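(* Let $d\geqslant 3$, $n\in\{2d,2d+1\}$, let $\ell$ be a prime power, let $\Delta$ be the dual polar graph on $[D_n(\ell)]$, fix a vertex $z$ of $\Delta$, and let $\Gamma=\mathrm{Alt}(n,\ell)$ be the alternating forms graph with vertex set $X=\Delta_n(z)$. Let $Y$ be a nontrivial descendent of $\Gamma$ (with respect to the standard $Q$-polynomial ordering) with width $w$. Then $n=2d$ and $Y$ takes one of the following forms: (i) $w=1$ and $Y=C(x,v):=\{x\}\cup\{y\in\Gamma(x):x\cap y\subseteq v\}$ for some $x\in X$ and some subspace $v$ of $x$ with $\dim v=n-1$; (ii) $w=d-1$ and $Y=I(u):=\{x\in X:u\subseteq x\}$ for some isotropic subspace $u$ of $[D_n(\ell)]$ with $\dim u=1$ and $z\cap u=0$.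
   Context: All graphs are finite, simple and undirected. Let $\Gamma$ be a connected graph with vertex set $X$, path-length distance $\partial$ and diameter $d$; $\Gamma(x)$ is the set of neighbours of $x$; let $A_i\in\mathbb{C}^{X\times X}$ be the adjacency matrix of the distance-$i$ graph ($A_0=I$). $\Gamma$ is distance-regular if there are integers $b_i,c_i$ such that whenever $\partial(x,y)=i$, $y$ has exactly $b_i$ (resp. $c_i$) neighbours at distance $i+1$ (resp. $i-1$) from $x$. Then the Bose--Mesner algebra $\langle A_0,\dots,A_d\rangle$ (complex span) is a commutative semisimple algebra with a basis of primitive idempotents $E_0=|X|^{-1}J,E_1,\dots,E_d$. $\Gamma$ is $Q$-polynomial with respect to the ordering $\{E_i\}_{i=0}^d$ if there are scalars $a_i^*,b_i^*,c_i^*$ with $b_d^*=c_0^*=0$, $b_{i-1}^*c_i^*\neq 0$ $(1\leqslant i\leqslant d)$ and $E_1\circ E_i=|X|^{-1}(b_{i-1}^*E_{i-1}+a_i^*E_i+c_{i+1}^*E_{i+1})$ $(0\leqslant i\leqslant d)$, where $\circ$ is the entrywise product, $E_{-1}=E_{d+1}=0$, $b_{-1}^*=c_{d+1}^*=0$. Write $|X|E_1=\sum_{i=0}^d\theta_i^*A_i$. For a nonempty $Y\subseteq X$ with characteristic vector $\hat Y$, the width is $w=\max\{i:\hat Y^{\mathsf T}A_i\hat Y\neq 0\}$ and the dual width is $w^*=\max\{i:\hat Y^{\mathsf T}E_i\hat Y\neq 0\}$. One always has $w+w^*\geqslant d$; $Y$ is a descendent of $\Gamma$ if $w+w^*=d$;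 it is trivial if moreover $w=0$ or $w=d$ (a singleton or $X$), nontrivial otherwise. Put $[i]_q=1+q+\dots+q^{i-1}$. $\Gamma$ has classical parameters $(d,q,\alpha,\beta)$ if $b_i=([d]_q-[i]_q)(\beta-\alpha[i]_q)$ and $c_i=[i]_q(1+\alpha[i-1]_q)$ for $0\leqslant i\leqslant d$. Then $\Gamma$ has a $Q$-polynomial ordering, called standard, for which $\theta_i^*=\xi^*[d-i]_q+\zeta^*$ for some scalars $\xi^*\neq 0$, $\zeta^*$. $[D_n(\ell)]$ is $\mathbb{F}_\ell^{2n}$ with a nondegenerate quadratic form of Witt index $n$; a subspace is isotropic if the quadratic form vanishes on it. The dual polar graph $\Delta$ has as vertices the maximal isotropic subspaces (dimension $n$), adjacent when their intersection has dimension $n-1$; $\Delta_n(z)$ is the set of vertices at distance $n$ from $z$ in $\Delta$ (i.e. meeting $z$ trivially). $\mathrm{Alt}(n,\ell)$ is the subgraph of the distance-$2$ graph of $\Delta$ induced on $\Delta_n(z)$ (so $x,y$ are adjacent iff $\dim x\cap y=n-2$). It is distance-regular with diameter $d$ and classical parameters $(d,\ell^2,\ell^2-1,\ell^m-1)$, where $m=2d-1$ if $n=2d$ and $m=2d+1$ if $n=2d+1$. *)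

theory Defs
  imports "HOL-Analysis.Analysis"
begin

text \<open>
  A graph is given by its vertex set \<open>X\<close> and its (symmetric, irreflexive) adjacency relation
  \<open>R\<close>, with \<open>R \<subseteq> X \<times> X\<close>. Path lengths are read off the relational powers \<open>R ^^ k\<close>; the distance
  is meaningful only between vertices joined by a path (all graphs below are connected).
\<close>

definition gdist :: "'v rel \<Rightarrow> 'v \<Rightarrow> 'v \<Rightarrow> nat" where
  "gdist R x y = (LEAST k. (x, y) \<in> R ^^ k)"

definition diam :: "'v set \<Rightarrow> 'v rel \<Rightarrow> nat" where
  "diam X R = Max {gdist R x y | x y. x \<in> X \<and> y \<in> X}"

definition nbrs :: "'v rel \<Rightarrow> 'v \<Rightarrow> 'v set" where
  "nbrs R x = {y. (x, y) \<in> R}"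

text \<open>
  Matrices in \<open>\<complex>\<^bsup>X\<times>X\<^esup>\<close> are represented by matrices indexed by the whole (finite) type of \<open>X\<close>
  whose entries outside \<open>X \<times> X\<close> vanish. This embedding preserves sums and the matrix product
  \<open>**\<close>; the identity of \<open>\<complex>\<^bsup>X\<times>X\<^esup>\<close> is \<open>dist_matrix X R 0\<close>, not \<open>mat 1\<close>. The entrywise product is
  the multiplication \<open>*\<close> that the library provides on vectors.
\<close>

definition smat :: "complex \<Rightarrow> complex^'v^'v \<Rightarrow> complex^('v::finite)^'v" where
  "smat c M = map_matrix (\<lambda>a. c * a) M"

definition dist_matrix :: "'v set \<Rightarrow> 'v rel \<Rightarrow> nat \<Rightarrow> complex^('v::finite)^'v" where
  "dist_matrix X R i = (\<chi> x y. if x \<in> X \<and> y \<in> X \<and> gdist R x y = i then 1 else 0)"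

definition all_ones :: "'v set \<Rightarrow> complex^('v::finite)^'v" where
  "all_ones X = (\<chi> x y. if x \<in> X \<and> y \<in> X then 1 else 0)"

definition bose_mesner :: "'v set \<Rightarrow> 'v rel \<Rightarrow> (complex^('v::finite)^'v) set" where
  "bose_mesner X R = {\<Sum>i\<le>diam X R. smat (c i) (dist_matrix X R i) | c. True}"

definition primitive_idempotent :: "(complex^('v::finite)^'v) set \<Rightarrow> complex^'v^'v \<Rightarrow> bool" where
  "primitive_idempotent A e \<longleftrightarrow> e \<in> A \<and> e \<noteq> 0 \<and> e ** e = e \<and>
     (\<forall>f\<in>A. \<forall>g\<in>A. f ** f = f \<and> g ** g = g \<and> f ** g = 0 \<and> g ** f = 0 \<and> e = f + g
        \<longrightarrow> f = 0 \<or> g = 0)"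

text \<open>Only the values \<open>E 0, \<dots>, E d\<close> with \<open>d = diam X R\<close> are relevant.\<close>

definition idempotent_ordering ::
    "'v set \<Rightarrow> 'v rel \<Rightarrow> (nat \<Rightarrow> complex^('v::finite)^'v) \<Rightarrow> bool" where
  "idempotent_ordering X R E \<longleftrightarrow>
     bij_betw E {0..diam X R} {e. primitive_idempotent (bose_mesner X R) e} \<and>
     E 0 = smat (1 / of_nat (card X)) (all_ones X)"

definition Q_polynomial ::
    "'v set \<Rightarrow> 'v rel \<Rightarrow> (nat \<Rightarrow> complex^('v::finite)^'v) \<Rightarrow> bool" where
  "Q_polynomial X R E \<longleftrightarrow> idempotent_ordering X R E \<and>
     (\<exists>a b c :: nat \<Rightarrow> complex. b (diam X R) = 0 \<and> c 0 = 0 \<and>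
        (\<forall>i\<in>{1..diam X R}. b (i - 1) * c i \<noteq> 0) \<and>
        (\<forall>i\<le>diam X R. E 1 * E i = smat (1 / of_nat (card X))
           ((if i = 0 then 0 else smat (b (i - 1)) (E (i - 1))) + smat (a i) (E i) +
            (if i = diam X R then 0 else smat (c (i + 1)) (E (i + 1))))))"

definition qint :: "complex \<Rightarrow> nat \<Rightarrow> complex" where
  "qint q i = (\<Sum>j<i. q ^ j)"

text \<open>
  The standard ordering for a graph with classical parameters \<open>(d, q, \<alpha>, \<beta>)\<close>; of these
  parameters only \<open>d = diam X R\<close> and \<open>q\<close> enter the form of the dual eigenvalues.
\<close>

definition standard_Q_polynomial ::
    "'v set \<Rightarrow> 'v rel \<Rightarrow> complex \<Rightarrow> (nat \<Rightarrow> complex^('v::finite)^'v) \<Rightarrow> bool" where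
  "standard_Q_polynomial X R q E \<longleftrightarrow> Q_polynomial X R E \<and>
     (\<exists>\<theta> \<xi> \<zeta>. smat (of_nat (card X)) (E 1) = (\<Sum>i\<le>diam X R. smat (\<theta> i) (dist_matrix X R i)) \<and>
        \<xi> \<noteq> 0 \<and> (\<forall>i\<le>diam X R. \<theta> i = \<xi> * qint q (diam X R - i) + \<zeta>))"

definition charvec :: "'v set \<Rightarrow> complex^('v::finite)" where
  "charvec Y = (\<chi> x. if x \<in> Y then 1 else 0)"

definition width :: "'v set \<Rightarrow> 'v rel \<Rightarrow> ('v::finite) set \<Rightarrow> nat" where
  "width X R Y = Max {i. i \<le> diam X R \<and>
     scalar_product (charvec Y) (dist_matrix X R i *v charvec Y) \<noteq> 0}"

definition dual_width ::
    "'v set \<Rightarrow> 'v rel \<Rightarrow> (nat \<Rightarrow> complex^('v::finite)^'v) \<Rightarrow> 'v set \<Rightarrow> nat" where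
  "dual_width X R E Y = Max {i. i \<le> diam X R \<and>
     scalar_product (charvec Y) (E i *v charvec Y) \<noteq> 0}"

definition descendent ::
    "'v set \<Rightarrow> 'v rel \<Rightarrow> (nat \<Rightarrow> complex^('v::finite)^'v) \<Rightarrow> 'v set \<Rightarrow> bool" where
  "descendent X R E Y \<longleftrightarrow> Y \<subseteq> X \<and> Y \<noteq> {} \<and> width X R Y + dual_width X R E Y = diam X R"

definition nontrivial_descendent ::
    "'v set \<Rightarrow> 'v rel \<Rightarrow> (nat \<Rightarrow> complex^('v::finite)^'v) \<Rightarrow> 'v set \<Rightarrow> bool" where
  "nontrivial_descendent X R E Y \<longleftrightarrow>
     descendent X R E Y \<and> width X R Y \<noteq> 0 \<and> width X R Y \<noteq> diam X R"

definition polar_form :: "('a::field^'m \<Rightarrow> 'a) \<Rightarrow> 'a^'m \<Rightarrow> 'a^'m \<Rightarrow> 'a" where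
  "polar_form Q x y = Q (x + y) - Q x - Q y"

definition quadratic_form :: "('a::field^'m \<Rightarrow> 'a) \<Rightarrow> bool" where
  "quadratic_form Q \<longleftrightarrow> (\<forall>c x. Q (c *s x) = c\<^sup>2 * Q x) \<and>
     (\<forall>x. Vector_Spaces.linear (*s) (*) (polar_form Q x))"

text \<open>In characteristic 2 nondegeneracy concerns \<open>Q\<close> itself, not only its polar form.\<close>

definition nondegenerate :: "('a::field^'m \<Rightarrow> 'a) \<Rightarrow> bool" where
  "nondegenerate Q \<longleftrightarrow> (\<forall>x. Q x = 0 \<and> (\<forall>y. polar_form Q x y = 0) \<longrightarrow> x = 0)"

definition isotropic :: "('a::field^'m \<Rightarrow> 'a) \<Rightarrow> ('a^'m) set \<Rightarrow> bool" where
  "isotropic Q U \<longleftrightarrow> vec.subspace U \<and> (\<forall>x\<in>U. Q x = 0)"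

definition witt_index :: "('a::field^'m \<Rightarrow> 'a) \<Rightarrow> nat" where
  "witt_index Q = Max {vec.dim U | U. isotropic Q U}"

definition maximal_isotropic :: "('a::field^'m \<Rightarrow> 'a) \<Rightarrow> ('a^'m) set \<Rightarrow> bool" where
  "maximal_isotropic Q U \<longleftrightarrow> isotropic Q U \<and> (\<forall>W. isotropic Q W \<and> U \<subseteq> W \<longrightarrow> W = U)"

text \<open>
  In the next definitions \<open>n\<close> is the Witt index of \<open>Q\<close>.
\<close>

definition dual_polar_vertices :: "('a::field^'m \<Rightarrow> 'a) \<Rightarrow> ('a^'m) set set" where
  "dual_polar_vertices Q = {U. maximal_isotropic Q U}"

definition dual_polar_adj :: "('a::field^'m \<Rightarrow> 'a) \<Rightarrow> nat \<Rightarrow> (('a^'m) set) rel" where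
  "dual_polar_adj Q n = {(x, y). x \<in> dual_polar_vertices Q \<and> y \<in> dual_polar_vertices Q \<and>
     vec.dim (x \<inter> y) = n - 1}"

definition Alt_vertices :: "('a::field^'m \<Rightarrow> 'a) \<Rightarrow> nat \<Rightarrow> ('a^'m) set \<Rightarrow> ('a^'m) set set" where
  "Alt_vertices Q n z = {x \<in> dual_polar_vertices Q. gdist (dual_polar_adj Q n) z x = n}"

definition Alt_adj :: "('a::field^'m \<Rightarrow> 'a) \<Rightarrow> nat \<Rightarrow> ('a^'m) set \<Rightarrow> (('a^'m) set) rel" where
  "Alt_adj Q n z = {(x, y). x \<in> Alt_vertices Q n z \<and> y \<in> Alt_vertices Q n z \<and>
     gdist (dual_polar_adj Q n) x y = 2}"

definition C_set ::
    "(('a::field^'m) set) rel \<Rightarrow> ('a^'m) set \<Rightarrow> ('a^'m) set \<Rightarrow> ('a^'m) set set" where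
  "C_set R x v = {x} \<union> {y \<in> nbrs R x. x \<inter> y \<subseteq> v}"

definition I_set :: "('a::field^'m) set set \<Rightarrow> ('a^'m) set \<Rightarrow> ('a^'m) set set" where
  "I_set X u = {x \<in> X. u \<subseteq> x}"

end

theory Submission
  imports Defs "HOL-Library.Function_Algebras"
begin

text \<open>
  Fix a vertex \<open>x0\<close> of \<open>Y\<close>. The polar form identifies \<open>z\<close> with the dual space of \<open>x0\<close>, so every vertex is
  the graph of a unique alternating form on \<open>x0\<close>, and the distance of two vertices is half the rank of
  the difference of their forms. Thus \<open>Y\<close> becomes a set of alternating forms containing \<open>0\<close>, with
  characteristic function \<open>f\<close>, and the characters of the additive group of forms are the bivectors
  \<open>\<Sum> a\<^sub>i \<and> b\<^sub>i\<close>.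

  The character sums of an idempotent \<open>E i\<close> take only the value \<open>0\<close> and one positive value. The dual
  eigenvalues are affine in the size \<open>m\<close> of the radical, so by the three-term recurrence \<open>E i\<close> is a
  polynomial in \<open>m\<close> of degree at most \<open>i\<close>, and the character sums of \<open>m ^ j\<close> vanish at bivectors with
  more than \<open>j\<close> summands, because some form kills \<open>j\<close> given vectors but not the bivector. By Parseval's
  identity, the Fourier transform of \<open>f\<close> then vanishes at all bivectors with more than \<open>d - w\<close> summands.

  If \<open>w = 1\<close>, then differences of forms have rank at most two, so either all forms vanish on a common
  hyperplane, or their radicals contain a common subspace of codimension three, which contradicts the
  vanishing of the Fourier transform. If \<open>w > 1\<close>, multiply \<open>f\<close> by the character of a bivector with
  \<open>d - w - 1\<close> summands and sum over the forms with given restriction to a complement \<open>U\<close> of dimension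
  \<open>2 * w + 2\<close> or \<open>2 * w + 3\<close>. The Fourier transform of the result lives on bivectors with one summand, i.e.
  on lines of the projective space. Any two of these lines meet, and they turn out to be precisely the
  lines through one point; odd dimension of \<open>U\<close> is impossible. For \<open>w = d - 1\<close> this is the second
  family. For smaller \<open>w\<close>, comparing the complements yields a symmetric relation on pairs of skew lines
  that cannot exist.
\<close>

subsection \<open>Alternating forms\<close>

text \<open>A twist by \<open>d - w - 1\<close> summands uses up all but one of the summands that
  the dual width permits, and it leaves a complement of dimension
  \<open>2 * d - 2 * (d - w - 1) = 2 * w + 2\<close>, the least even dimension in which rank at most
  \<open>2 * w\<close> forces singularity. That the two bounds fit together in this way is what
  \<open>w + w* = d\<close> provides. The price is that the twisted function is complex valued and
  no longer the characteristic function of a set, so counting is replaced by invariance: translation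
  by a form \<open>D\<close> fixes a function as soon as the characters in the support of its
  transform are trivial at \<open>D\<close>. The typical contradiction translates by a nonsingular
  \<open>D\<close>. That two lines in the support of the transform meet is shown by fixing the
  contraction of the forms with one vector, which lowers the dimension by two; in dimension four the
  classification of rank two cliques applies. Pairwise meeting lines pass through one point or lie
  in a plane, and a plane would permit translation by a nonsingular form that vanishes on
  it.\<close>

abbreviation sp :: "('a::field^'m) set \<Rightarrow> bool" where "sp \<equiv> vec.subspace"

section \<open>Linear algebra: complements, projections and functionals\<close>

lemma dim_sum_Int:
  fixes S T :: "('a::field^'m) set"
  assumes "sp S" "sp T"
  shows "vec.dim {x + y |x y. x \<in> S \<and> y \<in> T} + vec.dim (S \<inter> T) = vec.dim S + vec.dim T"
  using vec.dim_sums_Int[OF assms] by simp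

lemma in_span_insertE:
  fixes x :: "'a::field^'m"
  assumes "x \<in> vec.span (insert a S)"
  obtains c y where "y \<in> vec.span S" "x = c *s a + y"
proof -
  obtain k where "x - k *s a \<in> vec.span S" using assms vec.span_breakdown_eq by blast
  then show ?thesis using that[of "x - k *s a" k] by simp
qed

lemma in_span_insertI:
  fixes y :: "'a::field^'m"
  assumes "y \<in> vec.span S"
  shows "c *s a + y \<in> vec.span (insert a S)"
proof -
  have "y \<in> vec.span (insert a S)" using assms vec.span_mono[of S "insert a S"] by blast
  moreover have "c *s a \<in> vec.span (insert a S)" by (intro vec.span_scale vec.span_base) simp
  ultimately show ?thesis using vec.span_add by blast
qed

lemma span_eq_subspace: "sp S \<Longrightarrow> vec.span S = (S :: ('a::field^'m) set)"
  by (simp add: vec.span_eq_iff)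

text \<open>A subspace \<open>T\<close> of \<open>U\<close> that contains \<open>W\<close> and is
  maximal subject to \<open>S \<inter> T = {0}\<close> is a complement of \<open>S\<close>: a vector
  of \<open>U\<close> outside \<open>S + T\<close> could be adjoined to \<open>T\<close>.
  Prescribing \<open>W\<close> lets later complements pass through given lines.\<close>

lemma ex_complement:
  fixes S W U :: "('a::{field,finite}^'m::finite) set"
  assumes S: "sp S" and W: "sp W" and U: "sp U" and "S \<subseteq> U" "W \<subseteq> U" "S \<inter> W = {0}"
  obtains T where "sp T" "W \<subseteq> T" "T \<subseteq> U" "S \<inter> T = {0}"
    "\<And>x. x \<in> U \<Longrightarrow> \<exists>s\<in>S. \<exists>t\<in>T. x = s + t" "vec.dim T + vec.dim S = vec.dim U"
proof -
  let ?F = "{T. sp T \<and> W \<subseteq> T \<and> T \<subseteq> U \<and> S \<inter> T = {0}}"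
  have fin: "finite ?F" by simp
  have ne: "W \<in> ?F" using assms by auto
  have "\<exists>T\<in>?F. \<forall>T'\<in>?F. T \<subseteq> T' \<longrightarrow> T = T'"
  proof (rule finite_has_maximal[OF fin])
    show "?F \<noteq> {}" unfolding ex_in_conv[symmetric] using ne by (rule exI)
  qed
  then obtain T where T: "T \<in> ?F" and max: "\<forall>T'\<in>?F. T \<subseteq> T' \<longrightarrow> T = T'" by (elim bexE)
  have sT: "sp T" using T by simp
  have gen: "\<exists>s\<in>S. \<exists>t\<in>T. x = s + t" if x: "x \<in> U" for x
  proof (rule ccontr)
    assume neg: "\<not> ?thesis"
    let ?T' = "vec.span (insert x T)"
    have "S \<inter> ?T' \<subseteq> {0}"
    proof
      fix y assume y: "y \<in> S \<inter> ?T'"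
      then obtain c t where t: "t \<in> vec.span T" "y = c *s x + t" using in_span_insertE[of y x T] by blast
      have tT: "t \<in> T" using t(1) span_eq_subspace[OF sT] by simp
      show "y \<in> {0}"
      proof (cases "c = 0")
        case True
        then show ?thesis using t tT y T by auto
      next
        case False
        have "x = (1/c) *s y + (- (1/c)) *s t" using False t(2)
          by (simp add: vec.scale_right_distrib vec.scale_scale)
        moreover have "(1/c) *s y \<in> S" using y S by (simp add: vec.subspace_scale)
        moreover have "(- (1/c)) *s t \<in> T" using tT sT by (simp add: vec.subspace_scale vec.subspace_neg)
        ultimately show ?thesis using neg by blast
      qed
    qed
    moreover have "0 \<in> S \<inter> ?T'" using S by (simp add: vec.subspace_0 vec.span_zero)
    moreover have "T \<subseteq> ?T'" by (meson subset_insertI vec.span_superset subset_trans)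
    moreover have "?T' \<subseteq> U" using T x U by (intro vec.span_minimal) auto
    ultimately have "?T' \<in> ?F" using T by auto
    then have "T = ?T'" using bspec[OF max, of ?T'] \<open>T \<subseteq> ?T'\<close> by simp
    then have "x \<in> T" using vec.span_base[of x "insert x T"] by simp
    then have "x = 0 + x" "0 \<in> S" using S by (auto simp: vec.subspace_0)
    then show False using neg \<open>x \<in> T\<close> by blast
  qed
  have "{x + y |x y. x \<in> S \<and> y \<in> T} = U"
  proof
    show "{x + y |x y. x \<in> S \<and> y \<in> T} \<subseteq> U"
      using assms(4) T U by (auto intro: vec.subspace_add)
    show "U \<subseteq> {x + y |x y. x \<in> S \<and> y \<in> T}" using gen by blast
  qed
  then have "vec.dim T + vec.dim S = vec.dim U"
    using dim_sum_Int[OF S sT] T by simp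
  then show ?thesis using that T gen by blast
qed

text \<open>The projection onto \<open>S\<close> along a complement that contains \<open>W\<close>;
  its value is the unique \<open>s\<close> in \<open>S\<close> with \<open>x - s\<close> in the
  complement.\<close>

lemma ex_projection:
  fixes S W :: "('a::{field,finite}^'m::finite) set"
  assumes S: "sp S" and W: "sp W" and "S \<inter> W = {0}"
  obtains p where "\<And>x y. p (x + y) = p x + p y" "\<And>c x. p (c *s x) = c *s p x"
    "\<And>x. p x \<in> S" "\<And>x. x \<in> S \<Longrightarrow> p x = x" "\<And>x. x \<in> W \<Longrightarrow> p x = 0"
proof -
  obtain T where T: "sp T" "W \<subseteq> T" "S \<inter> T = {0}" and gen: "\<And>x. \<exists>s\<in>S. \<exists>t\<in>T. x = s + t"
    using ex_complement[OF S W vec.subspace_UNIV] assms(3) by (metis UNIV_I subset_UNIV)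
  have uniq: "s = s'" if "s \<in> S" "s' \<in> S" "x - s \<in> T" "x - s' \<in> T" for x s s'
  proof -
    have "s - s' \<in> S" using that S by (simp add: vec.subspace_diff)
    moreover have "(x - s') - (x - s) \<in> T" using that T(1) vec.subspace_diff by blast
    then have "s - s' \<in> T" by (simp add: algebra_simps)
    ultimately have "s - s' \<in> {0}" using T(3) by blast
    then show ?thesis by simp
  qed
  have ex: "\<exists>s. s \<in> S \<and> x - s \<in> T" for x using gen[of x] by (metis add_diff_cancel_left')
  define p where "p x = (SOME s. s \<in> S \<and> x - s \<in> T)" for x
  have p: "p x \<in> S" "x - p x \<in> T" for x using someI_ex[OF ex[of x]] by (auto simp: p_def)
  have pe: "p x = s" if "s \<in> S" "x - s \<in> T" for x s using uniq p that by blast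
  show ?thesis
  proof (rule that[of p])
    show "p (x + y) = p x + p y" for x y
    proof (rule pe)
      show "p x + p y \<in> S" using p S by (simp add: vec.subspace_add)
      have "(x - p x) + (y - p y) \<in> T" using p T(1) vec.subspace_add by blast
      then show "x + y - (p x + p y) \<in> T" by (simp add: algebra_simps)
    qed
    show "p (c *s x) = c *s p x" for c x
    proof (rule pe)
      show "c *s p x \<in> S" using p S by (simp add: vec.subspace_scale)
      have "c *s (x - p x) \<in> T" using p T(1) vec.subspace_scale by blast
      then show "c *s x - c *s p x \<in> T" by (simp add: vec.scale_right_diff_distrib)
    qed
    show "p x \<in> S" for x by (rule p)
    show "p x = x" if "x \<in> S" for x using pe[of x x] that T(1) by (simp add: vec.subspace_0)
    show "p x = 0" if "x \<in> W" for x using pe[of 0 x] that T S by (auto simp: vec.subspace_0)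
  qed
qed

lemma ex_functional:
  fixes S :: "('a::{field,finite}^'m::finite) set"
  assumes "sp S" "a \<notin> S"
  obtains h :: "'a^'m \<Rightarrow> 'a" where "\<And>x y. h (x + y) = h x + h y" "\<And>c x. h (c *s x) = c * h x"
    "h a = 1" "\<And>x. x \<in> S \<Longrightarrow> h x = 0"
proof -
  have a0: "a \<noteq> 0" using assms vec.subspace_0 by blast
  have "vec.span {a} \<inter> S = {0}"
  proof -
    have "x = 0" if "x \<in> vec.span {a}" "x \<in> S" for x
    proof -
      obtain c where c: "x = c *s a" using \<open>x \<in> vec.span {a}\<close> vec.span_breakdown_eq[of x a "{}"] by auto
      show ?thesis
      proof (rule ccontr)
        assume "x \<noteq> 0"
        then have "c \<noteq> 0" using c by auto
        then have "a = (1/c) *s x" using c by (simp add: vec.scale_scale)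
        then show False using assms that by (metis vec.subspace_scale)
      qed
    qed
    then show ?thesis using assms(1) vec.subspace_0 vec.span_zero by blast
  qed
  then obtain p where p: "\<And>x y. p (x + y) = p x + p y" "\<And>c x. p (c *s x) = c *s p x"
    "\<And>x. x \<in> vec.span {a} \<Longrightarrow> p x = x" "\<And>x. x \<in> S \<Longrightarrow> p x = 0"
    using ex_projection[OF vec.subspace_span assms(1)] by metis
  obtain i where i: "a $ i \<noteq> 0" using a0 by (metis vec_eq_iff zero_index)
  show ?thesis
    by (rule that[of "\<lambda>x. p x $ i / a $ i"])
      (use i in \<open>auto simp: p add_divide_distrib vec.span_base\<close>)
qed

text \<open>The condition \<open>B x x = 0\<close> is stronger than skew symmetry in characteristic
  2. A form on a subspace is represented by any form on the whole space that restricts to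
  it.\<close>

definition altf :: "('a::field^'m \<Rightarrow> 'a^'m \<Rightarrow> 'a) set" where
  "altf = {B. (\<forall>x y z. B (x + y) z = B x z + B y z) \<and> (\<forall>x y z. B z (x + y) = B z x + B z y) \<and>
     (\<forall>c x z. B (c *s x) z = c * B x z) \<and> (\<forall>c x z. B z (c *s x) = c * B z x) \<and> (\<forall>x. B x x = 0)}"

lemma altfD:
  assumes "B \<in> altf"
  shows "B (x + y) z = B x z + B y z" "B z (x + y) = B z x + B z y"
    "B (c *s x) z = c * B x z" "B z (c *s x) = c * B z x" "B x x = 0"
  using assms unfolding altf_def by auto

lemma altf_skew: assumes "B \<in> altf" shows "B x y = - B y x"
proof -
  have "B (x + y) (x + y) = 0" using altfD(5)[OF assms] .
  then show ?thesis using assms by (simp add: altfD eq_neg_iff_add_eq_0)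
qed

lemma altf_zero: assumes "B \<in> altf" shows "B 0 y = 0" "B x 0 = 0"
  using altfD(3)[OF assms, of 0 0 y] altfD(4)[OF assms, of x 0 0] by auto

lemma altf_minus: assumes "B \<in> altf" shows "B (- x) y = - B x y" "B x (- y) = - B x y"
    "B (x - y) z = B x z - B y z" "B z (x - y) = B z x - B z y"
proof -
  have n: "\<And>x y. B (- x) y = - B x y" "\<And>x y. B x (- y) = - B x y"
    using altfD(3)[OF assms, of "-1"] altfD(4)[OF assms, of _ "-1"]
    by (simp_all add: vec.scale_minus_left[symmetric])
  show "B (- x) y = - B x y" "B x (- y) = - B x y" by (rule n)+
  show "B (x - y) z = B x z - B y z" "B z (x - y) = B z x - B z y"
    using altfD(1)[OF assms, of x "-y" z] altfD(2)[OF assms, of z x "-y"] by (simp_all add: n)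
qed

lemmas altf_simps = altfD altf_zero altf_minus

lemma altf_0: "0 \<in> altf" by (simp add: altf_def)
lemma altf_add: "B \<in> altf \<Longrightarrow> D \<in> altf \<Longrightarrow> B + D \<in> altf" by (simp add: altf_def algebra_simps)
lemma altf_uminus: "B \<in> altf \<Longrightarrow> - B \<in> altf" by (simp add: altf_def)
lemma altf_diff: "B \<in> altf \<Longrightarrow> D \<in> altf \<Longrightarrow> B - D \<in> altf" by (simp add: altf_def algebra_simps)
lemma altf_scale: "B \<in> altf \<Longrightarrow> (\<lambda>x y. s * B x y) \<in> altf" by (simp add: altf_def algebra_simps)

definition eqon :: "('a::field^'m) set \<Rightarrow> ('a^'m \<Rightarrow> 'a^'m \<Rightarrow> 'a) \<Rightarrow> ('a^'m \<Rightarrow> 'a^'m \<Rightarrow> 'a) \<Rightarrow> bool" where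
  "eqon U B D \<longleftrightarrow> (\<forall>x\<in>U. \<forall>y\<in>U. B x y = D x y)"

definition nonsing :: "('a::field^'m) set \<Rightarrow> ('a^'m \<Rightarrow> 'a^'m \<Rightarrow> 'a) \<Rightarrow> bool" where
  "nonsing U D \<longleftrightarrow> (\<forall>x\<in>U. (\<forall>y\<in>U. D x y = 0) \<longrightarrow> x = 0)"

lemma nonsing_cong: "eqon U B D \<Longrightarrow> nonsing U B = nonsing U D"
  unfolding eqon_def nonsing_def by metis

text \<open>The orthogonal sum of \<open>B\<close> on \<open>S\<close> and \<open>C\<close> on
  \<open>T\<close>, pulled back along a projection onto \<open>S\<close> that kills \<open>T\<close>
  and one onto \<open>T\<close> that kills \<open>S\<close>, which makes it a form on the whole
  space.\<close>

lemma block_sum: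
  fixes S T :: "('a::{field,finite}^'m::finite) set"
  assumes S: "sp S" and T: "sp T" and ST: "S \<inter> T = {0}" and B: "B \<in> altf" and C: "C \<in> altf"
  obtains D where "D \<in> altf" "eqon S D B" "eqon T D C" "\<And>s t. s \<in> S \<Longrightarrow> t \<in> T \<Longrightarrow> D s t = 0"
    "nonsing S B \<Longrightarrow> nonsing T C \<Longrightarrow> nonsing {x + y |x y. x \<in> S \<and> y \<in> T} D"
proof -
  obtain p where p: "\<And>x y. p (x + y) = p x + p y" "\<And>c x. p (c *s x) = c *s p x"
    "\<And>x. x \<in> S \<Longrightarrow> p x = x" "\<And>x. x \<in> T \<Longrightarrow> p x = 0" using ex_projection[OF S T ST] by metis
  have TS: "T \<inter> S = {0}" using ST by blast
  obtain q where q: "\<And>x y. q (x + y) = q x + q y" "\<And>c x. q (c *s x) = c *s q x"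
    "\<And>x. x \<in> T \<Longrightarrow> q x = x" "\<And>x. x \<in> S \<Longrightarrow> q x = 0" using ex_projection[OF T S TS] by metis
  define D where "D = (\<lambda>x y. B (p x) (p y) + C (q x) (q y))"
  have D: "D \<in> altf" using B C unfolding altf_def D_def by (auto simp: p q algebra_simps)
  have DS: "eqon S D B" unfolding eqon_def D_def using C by (auto simp: p q altf_zero)
  have DT: "eqon T D C" unfolding eqon_def D_def using B by (auto simp: p q altf_zero)
  have DST: "D s t = 0" if "s \<in> S" "t \<in> T" for s t
    unfolding D_def using that B C by (auto simp: p q altf_zero)
  have "nonsing {x + y |x y. x \<in> S \<and> y \<in> T} D" if nS: "nonsing S B" and nT: "nonsing T C"
    unfolding nonsing_def
  proof (intro ballI impI)
    fix v assume "v \<in> {x + y |x y. x \<in> S \<and> y \<in> T}"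
      and z: "\<forall>y\<in>{x + y |x y. x \<in> S \<and> y \<in> T}. D v y = 0"
    then obtain s t where st: "v = s + t" "s \<in> S" "t \<in> T" by blast
    have "B s y = 0" if "y \<in> S" for y
    proof -
      have "y + 0 \<in> {x + y |x y. x \<in> S \<and> y \<in> T}" using that T vec.subspace_0 by blast
      then have "D v y = 0" using z by auto
      moreover have "D v y = D s y + D t y" using st altfD(1)[OF D] by simp
      moreover have "D t y = 0" using DST[OF that st(3)] altf_skew[OF D, of t y] by simp
      ultimately show ?thesis using DS that st unfolding eqon_def by simp
    qed
    then have "s = 0" using nS st unfolding nonsing_def by blast
    moreover have "C t y = 0" if "y \<in> T" for y
    proof -
      have "0 + y \<in> {x + y |x y. x \<in> S \<and> y \<in> T}" using that S vec.subspace_0 by blast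
      then have "D v y = 0" using z by auto
      then show ?thesis using DT that st altfD(1)[OF D, of s t y] DST[OF st(2) that] unfolding eqon_def by simp
    qed
    then have "t = 0" using nT st unfolding nonsing_def by blast
    ultimately show "v = 0" using st by simp
  qed
  then show ?thesis using that D DS DT DST by blast
qed

subsection \<open>Characters and bivectors\<close>

text \<open>Let \<open>H\<close> be maximal among the additive subgroups that avoid 1. Every element
  is congruent modulo \<open>H\<close> to an integer multiple of 1, and the integers in
  \<open>H\<close> are multiples of the characteristic \<open>p\<close>. So the quotient is cyclic
  of order \<open>p\<close> and carries the character that sends \<open>k\<close> to the
  \<open>k\<close>-th power of a primitive \<open>p\<close>-th root of unity.\<close>

lemma ex_additive_character:
  "\<exists>\<psi> :: 'a::{field,finite} \<Rightarrow> complex.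
     (\<forall>x y. \<psi> (x + y) = \<psi> x * \<psi> y) \<and> (\<forall>x. cmod (\<psi> x) = 1) \<and> (\<exists>x. \<psi> x \<noteq> 1)"
proof -
  let ?p = "CHAR('a)"
  have p0: "?p > 0" by (rule finite_imp_CHAR_pos) simp
  then have pp: "prime ?p" by (rule prime_CHAR_semidom)
  define G where "G = {H :: 'a set. 0 \<in> H \<and> (\<forall>x\<in>H. \<forall>y\<in>H. x - y \<in> H) \<and> 1 \<notin> H}"
  have fin: "finite G" by simp
  have "{0} \<in> G" by (simp add: G_def)
  then have ne: "G \<noteq> {}" by blast
  from finite_has_maximal[OF fin ne] obtain H
    where HG: "H \<in> G" and max: "\<forall>H'\<in>G. H \<subseteq> H' \<longrightarrow> H = H'" by (elim bexE)
  have H0: "0 \<in> H" and Hd: "\<And>x y. x \<in> H \<Longrightarrow> y \<in> H \<Longrightarrow> x - y \<in> H" and H1: "1 \<notin> H"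
    using HG by (auto simp: G_def)
  have Hm: "- x \<in> H" if "x \<in> H" for x using Hd[OF H0 that] by simp
  have Ha: "x + y \<in> H" if "x \<in> H" "y \<in> H" for x y using Hd[OF that(1) Hm[OF that(2)]] by simp
  have Hn: "of_nat k * x \<in> H" if "x \<in> H" for k x
    by (induction k) (auto simp: H0 Ha that distrib_right)
  have Hi: "of_int k * x \<in> H" if "x \<in> H" for k x
    using Hn[OF that] Hm by (cases k rule: int_cases2) auto
  have dvdH: "int ?p dvd k" if "of_int k \<in> H" for k
  proof (rule ccontr)
    assume "\<not> int ?p dvd k"
    then have "coprime (int ?p) k" using pp by (simp add: prime_imp_coprime)
    then obtain u v where uv: "u * k + v * int ?p = 1"
      using bezout_int[of k "int ?p"] by (metis coprime_iff_gcd_eq_1 gcd.commute)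
    have "(of_int (u * k + v * int ?p) :: 'a) = of_int u * of_int k" by simp
    then have "1 = (of_int u * of_int k :: 'a)" using uv by simp
    then show False using Hi[OF that, of u] H1 by simp
  qed
  \<comment> \<open>For \<open>x\<close> outside \<open>H\<close> the subgroup generated by
    \<open>H\<close> and \<open>x\<close> contains 1, say \<open>1 = h + j * x\<close>. Since 1 is
    not in \<open>H\<close>, \<open>j\<close> is prime to the characteristic, and an inverse
    \<open>u\<close> of \<open>j\<close> modulo it gives \<open>x - u\<close> in
    \<open>H\<close>.\<close>
  have ex: "\<exists>k::int. x - of_int k \<in> H" for x
  proof (cases "x \<in> H")
    case True
    then have "x - of_int 0 \<in> H" by simp
    then show ?thesis by blast
  next
    case False
    define H' where "H' = {h + of_int j * x | h j. h \<in> H}"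
    have sub: "H \<subseteq> H'"
    proof
      fix h assume "h \<in> H"
      then have "h + of_int 0 * x \<in> H'" unfolding H'_def by blast
      then show "h \<in> H'" by simp
    qed
    have "0 + of_int 1 * x \<in> H'" unfolding H'_def using H0 by blast
    then have "H \<noteq> H'" using False by auto
    then have "H' \<notin> G" using max sub by blast
    moreover have "0 \<in> H'" using sub H0 by blast
    moreover have "u - v \<in> H'" if uv: "u \<in> H'" "v \<in> H'" for u v
    proof -
      obtain h j h' j' where "u = h + of_int j * x" "v = h' + of_int j' * x" "h \<in> H" "h' \<in> H"
        using uv unfolding H'_def by blast
      then have "u - v = (h - h') + of_int (j - j') * x" "h - h' \<in> H"
        by (auto simp: algebra_simps Hd)
      then show ?thesis unfolding H'_def by blast
    qed
    ultimately have "1 \<in> H'" unfolding G_def by blast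
    then obtain h j where hj: "1 = h + of_int j * x" "h \<in> H" unfolding H'_def by blast
    have "\<not> int ?p dvd j"
    proof
      assume "int ?p dvd j"
      then have "(of_int j :: 'a) = 0" by (simp add: of_int_eq_0_iff_char_dvd)
      then show False using hj H1 by simp
    qed
    then have "coprime (int ?p) j" using pp by (simp add: prime_imp_coprime)
    then obtain u v where uv: "u * j + v * int ?p = 1"
      using bezout_int[of j "int ?p"] by (metis coprime_iff_gcd_eq_1 gcd.commute)
    have "(of_int (u * j + v * int ?p) :: 'a) = of_int u * of_int j" by simp
    then have uj: "(of_int u * of_int j :: 'a) = 1" using uv by simp
    have "x - of_int u = x - of_int u * (h + of_int j * x)" using hj by simp
    also have "\<dots> = x - of_int u * of_int j * x - of_int u * h" by (simp add: algebra_simps)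
    also have "\<dots> = - (of_int u * h)" using uj by simp
    also have "\<dots> \<in> H" using Hi[OF hj(2)] Hm by blast
    finally show ?thesis by blast
  qed
  define \<kappa> where "\<kappa> x = (SOME k::int. x - of_int k \<in> H)" for x
  have \<kappa>: "x - of_int (\<kappa> x) \<in> H" for x unfolding \<kappa>_def using someI_ex[OF ex[of x]] .
  have cisp: "cis (2 * pi * of_int k / real ?p) = cis (2 * pi * of_int k' / real ?p)"
    if "int ?p dvd k - k'" for k k'
  proof -
    obtain m where m: "k = k' + int ?p * m" using \<open>int ?p dvd k - k'\<close> by (metis add_diff_cancel_left' diff_add_cancel dvdE add.commute)
    have e: "2 * pi * of_int k / real ?p = 2 * pi * of_int k' / real ?p + 2 * pi * of_int m"
      using p0 by (simp add: m field_simps)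
    have "cis (2 * pi * of_int k / real ?p) = cis (2 * pi * of_int k' / real ?p) * cis (2 * pi * of_int m)"
      by (simp only: cis_mult e)
    also have "cis (2 * pi * of_int m) = 1" by (simp add: cis_multiple_2pi)
    finally show ?thesis by simp
  qed
  define \<psi> where "\<psi> x = cis (2 * pi * of_int (\<kappa> x) / real ?p)" for x
  have "\<psi> (x + y) = \<psi> x * \<psi> y" for x y
  proof -
    have "((x - of_int (\<kappa> x)) + (y - of_int (\<kappa> y))) - (x + y - of_int (\<kappa> (x + y))) \<in> H"
      by (intro Hd Ha \<kappa>)
    then have "of_int (\<kappa> (x + y) - (\<kappa> x + \<kappa> y)) \<in> H" by (simp add: algebra_simps)
    from cisp[OF dvdH[OF this]] show ?thesis
      unfolding \<psi>_def by (simp add: cis_mult add_divide_distrib[symmetric] algebra_simps)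
  qed
  moreover have "cmod (\<psi> x) = 1" for x by (simp add: \<psi>_def)
  moreover have "\<psi> 1 \<noteq> 1"
  proof
    assume "\<psi> 1 = 1"
    have "(1 - of_int (\<kappa> 1)) \<in> H" by (rule \<kappa>)
    then have "of_int (1 - \<kappa> 1) \<in> H" by simp
    from cisp[OF dvdH[OF this]] have "cis (2 * pi / real ?p) = 1"
      using \<open>\<psi> 1 = 1\<close> by (simp add: \<psi>_def)
    then have "cos (2 * pi / real ?p) = 1" by (simp add: complex_eq_iff)
    then obtain m :: int where m: "2 * pi / real ?p = of_int m * 2 * pi"
      using cos_one_2pi_int by auto
    then have "(2 * pi) * (1 / real ?p) = (2 * pi) * of_int m" by simp
    then have "1 / real ?p = of_int m" by (subst (asm) mult_left_cancel) auto
    then have "1 = of_int m * real ?p" using p0 by (simp add: field_simps)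
    then have "1 = m * int ?p" by (metis of_int_eq_1_iff of_int_mult of_int_of_nat_eq)
    then have "int ?p dvd 1" by (metis dvd_triv_right)
    then show False using pp by (simp add: prime_nat_iff)
  qed
  ultimately show ?thesis by blast
qed

definition addchar :: "'a::{field,finite} \<Rightarrow> complex" where
  "addchar = (SOME \<psi>. (\<forall>x y. \<psi> (x + y) = \<psi> x * \<psi> y) \<and> (\<forall>x. cmod (\<psi> x) = 1) \<and> (\<exists>x. \<psi> x \<noteq> 1))"

lemma addchar_add: "addchar (x + y) = addchar x * addchar y"
  and addchar_norm [simp]: "cmod (addchar x) = 1"
  and addchar_nontrivial: "\<exists>x :: 'a::{field,finite}. addchar x \<noteq> 1"
  using someI_ex[OF ex_additive_character] unfolding addchar_def[symmetric] by auto

lemma addchar_nz [simp]: "addchar x \<noteq> 0"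
  using addchar_norm[of x] by (metis norm_zero zero_neq_one)

lemma addchar_0 [simp]: "addchar 0 = 1"
  using addchar_add[of 0 0] by simp

lemma addchar_minus: "addchar (- x) = cnj (addchar x)"
proof -
  have "addchar x * addchar (- x) = 1" by (simp flip: addchar_add)
  moreover have "addchar x * cnj (addchar x) = 1" by (simp add: complex_norm_square[symmetric])
  ultimately show ?thesis by (metis addchar_nz mult_left_cancel)
qed

section \<open>Bivectors as lists of pairs of vectors\<close>

text \<open>The list \<open>[(a, b), \<dots>]\<close> stands for the bivector \<open>a \<and> b + \<dots>\<close>, of which only the functional \<open>B \<mapsto> ev B P\<close>
  on alternating forms matters; \<open>ind P\<close> says that the number of summands cannot be reduced.\<close>

fun sv :: "('v \<times> 'v) list \<Rightarrow> 'v set" where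
  "sv [] = {}"
| "sv ((a, b) # P) = insert a (insert b (sv P))"

fun ev :: "('v \<Rightarrow> 'v \<Rightarrow> 'a::comm_monoid_add) \<Rightarrow> ('v \<times> 'v) list \<Rightarrow> 'a" where
  "ev B [] = 0"
| "ev B ((a, b) # P) = B a b + ev B P"

definition ind :: "(('a::field^'m) \<times> ('a^'m)) list \<Rightarrow> bool" where
  "ind P \<longleftrightarrow> vec.dim (sv P) = 2 * length P"

lemma sv_append [simp]: "sv (P @ Q) = sv P \<union> sv Q"
  by (induction P rule: sv.induct) auto

lemma ev_append [simp]: "ev B (P @ Q) = ev B P + ev B Q"
  by (induction P rule: sv.induct) (auto simp: add.assoc)

lemma ev_add: "ev (B + D) P = ev B P + ev D P"
  by (induction P rule: sv.induct) (auto simp: algebra_simps)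

lemma ev_zero [simp]: "ev 0 P = 0"
  by (induction P rule: sv.induct) auto

lemma ev_uminus: "ev (- B) P = - ev (B :: 'v \<Rightarrow> 'v \<Rightarrow> 'a::ab_group_add) P"
  by (induction P rule: sv.induct) auto

lemma ev_diff: "ev (B - D) P = ev B P - ev (D :: 'v \<Rightarrow> 'v \<Rightarrow> 'a::ab_group_add) P"
  by (induction P rule: sv.induct) (auto simp: algebra_simps)

lemma ev_cong: "eqon U B D \<Longrightarrow> sv P \<subseteq> U \<Longrightarrow> ev B P = ev D P"
  by (induction P rule: sv.induct) (auto simp: eqon_def)

lemma finite_sv [simp]: "finite (sv P)"
  by (induction P rule: sv.induct) auto

lemma card_sv: "card (sv P) \<le> 2 * length P"
  by (induction P rule: sv.induct) (auto simp: card_insert_if)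

lemma dim_sv_le: "vec.dim (sv P) \<le> 2 * length P"
  using card_sv[of P] vec.dim_le_card[of "sv P" "sv P"] vec.span_superset[of "sv P"] by force

lemma ind_Nil [simp]: "ind []" by (simp add: ind_def)

lemma ind_Cons:
  "ind ((a, b) # P) \<longleftrightarrow> ind P \<and> a \<notin> vec.span (sv P) \<and> b \<notin> vec.span (insert a (sv P))"
proof -
  have "sv ((a, b) # P) = insert b (insert a (sv P))" by auto
  then show ?thesis unfolding ind_def using dim_sv_le[of P] by (auto simp: vec.dim_insert)
qed

lemma ind_append_commute: "ind (P @ Q) \<longleftrightarrow> ind (Q @ P)"
  by (simp add: ind_def Un_commute add.commute)

lemma ind_appendD: "ind (P @ Q) \<Longrightarrow> ind P" "ind (P @ Q) \<Longrightarrow> ind Q"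
proof -
  have *: "ind (P @ Q) \<Longrightarrow> ind Q" for P Q :: "(('a::field^'m) \<times> ('a^'m)) list"
    by (induction P rule: sv.induct) (auto simp: ind_Cons)
  show "ind (P @ Q) \<Longrightarrow> ind P" "ind (P @ Q) \<Longrightarrow> ind Q" using * ind_append_commute by blast+
qed

lemma span_Un_sum:
  "vec.span (S \<union> T) = {x + y |x y. x \<in> vec.span S \<and> y \<in> vec.span (T :: ('a::field^'m) set)}"
  by (rule vec.span_Un)

lemma dim_Un_disjoint:
  fixes S T :: "('a::field^'m) set"
  assumes "vec.span S \<inter> vec.span T = {0}"
  shows "vec.dim (S \<union> T) = vec.dim S + vec.dim T"
proof -
  have "vec.dim (S \<union> T) = vec.dim (vec.span (S \<union> T))" by simp
  also have "\<dots> = vec.dim {x + y |x y. x \<in> vec.span S \<and> y \<in> vec.span T}"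
    by (simp only: span_Un_sum)
  finally have "vec.dim (S \<union> T) = vec.dim {x + y |x y. x \<in> vec.span S \<and> y \<in> vec.span T}" .
  then show ?thesis using dim_sum_Int[of "vec.span S" "vec.span T"] assms by simp
qed

lemma ind_append:
  assumes "ind P" "ind Q" "vec.span (sv P) \<inter> vec.span (sv Q) = {0}"
  shows "ind (P @ Q)"
  using assms by (simp add: ind_def dim_Un_disjoint)

lemma ind_append_disjoint:
  fixes P Q :: "(('a::field^'m) \<times> ('a^'m)) list"
  assumes "ind (P @ Q)"
  shows "vec.span (sv P) \<inter> vec.span (sv Q) = {0}"
proof -
  have "vec.dim (sv P \<union> sv Q) = vec.dim (sv P) + vec.dim (sv Q)"
    using assms ind_appendD[OF assms] by (simp add: ind_def)
  moreover have "vec.dim (sv P \<union> sv Q) = vec.dim (vec.span (sv P \<union> sv Q))" by simp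
  moreover have "\<dots> = vec.dim {x + y |x y. x \<in> vec.span (sv P) \<and> y \<in> vec.span (sv Q)}"
    by (simp only: span_Un_sum)
  ultimately have "vec.dim (vec.span (sv P) \<inter> vec.span (sv Q)) = 0"
    using dim_sum_Int[OF vec.subspace_span vec.subspace_span, of "sv P" "sv Q", unfolded vec.dim_span]
    by linarith
  then have "vec.span (sv P) \<inter> vec.span (sv Q) \<subseteq> {0}" by (simp only: vec.dim_eq_0)
  moreover have "0 \<in> vec.span (sv P) \<inter> vec.span (sv Q)" by (simp add: vec.span_zero)
  ultimately show ?thesis by (intro subset_antisym) simp_all
qed

lemma in_span_sv_ConsE:
  assumes "y \<in> vec.span (sv ((a, b) # P))"
  obtains \<alpha> \<beta> y' where "y' \<in> vec.span (sv P)" "y = \<alpha> *s a + \<beta> *s b + y'"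
proof -
  have "y \<in> vec.span (insert a (insert b (sv P)))" using assms by simp
  then obtain \<alpha> z where z: "z \<in> vec.span (insert b (sv P))" "y = \<alpha> *s a + z"
    by (rule in_span_insertE)
  from z(1) obtain \<beta> y' where y': "y' \<in> vec.span (sv P)" "z = \<beta> *s b + y'"
    by (rule in_span_insertE)
  show ?thesis using that[OF y'(1), of \<alpha> \<beta>] z y' by (simp add: add.assoc)
qed

text \<open>Absorbs a summand \<open>v \<and> y\<close> with \<open>y\<close> in the span of the list, using
  \<open>(a + \<beta> v) \<and> (b - \<alpha> v) = a \<and> b + v \<and> (\<alpha> a + \<beta> b)\<close>.\<close>

lemma absorb:
  assumes "y \<in> vec.span (sv P)"
  shows "\<exists>P'. length P' = length P \<and> (\<forall>B\<in>altf. ev B P' = ev B P + B v y) \<and>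
    vec.span (insert v (sv P')) = vec.span (insert v (sv P))"
  using assms
proof (induction P arbitrary: y rule: sv.induct)
  case 1
  then show ?case by (auto simp: altf_simps)
next
  case (2 a b P)
  from 2(2) obtain \<alpha> \<beta> y'
    where y': "y' \<in> vec.span (sv P)" "y = \<alpha> *s a + \<beta> *s b + y'" by (rule in_span_sv_ConsE)
  from 2(1)[OF y'(1)] obtain P'
    where P': "length P' = length P" "\<And>B. B \<in> altf \<Longrightarrow> ev B P' = ev B P + B v y'"
      "vec.span (insert v (sv P')) = vec.span (insert v (sv P))" by blast
  let ?a = "\<beta> *s v + a" and ?b = "(- \<alpha>) *s v + b"
  have "ev B ((?a, ?b) # P') = ev B ((a, b) # P) + B v y" if B: "B \<in> altf" for B
    using altf_skew[OF B, of a v] by (simp add: y'(2) P'(2) altf_simps[OF B] algebra_simps B)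
  moreover have "vec.span (insert v (sv ((?a, ?b) # P'))) = vec.span (insert v (sv ((a, b) # P)))"
  proof -
    have sp_ins: "vec.span (insert v (insert (c *s v + x) S)) = vec.span (insert v (insert x S))"
      for c x and S :: "('a^'b) set"
    proof (rule vec.span_eq[THEN iffD2], intro conjI subsetI)
      fix z assume "z \<in> insert v (insert (c *s v + x) S)"
      then show "z \<in> vec.span (insert v (insert x S))"
        by (auto intro: vec.span_base in_span_insertI)
    next
      fix z assume z: "z \<in> insert v (insert x S)"
      have "x = (- c) *s v + (c *s v + x)" by (simp add: vec.scale_minus_left)
      also have "\<dots> \<in> vec.span (insert v (insert (c *s v + x) S))"
        by (rule in_span_insertI) (simp add: vec.span_base)
      finally show "z \<in> vec.span (insert v (insert (c *s v + x) S))"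
        using z by (auto intro: vec.span_base)
    qed
    have ins: "vec.span (insert x S) = vec.span (insert x T)" if "vec.span S = vec.span T" for x and S T :: "('a^'b) set"
      using that by (simp add: vec.span_insert)
    have "vec.span (insert v (sv ((?a, ?b) # P'))) = vec.span (insert v (insert a (insert ?b (sv P'))))"
      by (simp add: sp_ins)
    also have "\<dots> = vec.span (insert a (insert v (insert ?b (sv P'))))" by (simp add: insert_commute)
    also have "\<dots> = vec.span (insert a (insert v (insert b (sv P'))))" by (rule ins, rule sp_ins)
    also have "\<dots> = vec.span (insert a (insert b (insert v (sv P'))))" by (simp add: insert_commute)
    also have "\<dots> = vec.span (insert a (insert b (insert v (sv P))))" by (intro ins P')
    finally show ?thesis by (simp add: insert_commute)
  qed
  moreover have "length ((?a, ?b) # P') = length ((a, b) # P)" using P'(1) by simp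
  ultimately show ?case by blast
qed

text \<open>Absorption keeps the span of the list together with \<open>v\<close>, whose dimension
  \<open>2 * length P + 1\<close> is the largest possible for that length; hence the new list is
  again independent and \<open>v\<close> lies outside its span.\<close>

lemma absorb_ind:
  fixes P :: "(('a::field^'m) \<times> ('a^'m)) list"
  assumes "ind P" "v \<notin> vec.span (sv P)" "y \<in> vec.span (insert v (sv P))"
  obtains P' where "length P' = length P" "\<And>B. B \<in> altf \<Longrightarrow> ev B P' = ev B P + B v y"
    "vec.span (insert v (sv P')) = vec.span (insert v (sv P))" "ind P'" "v \<notin> vec.span (sv P')"
proof -
  from assms(3) obtain c y' where y': "y' \<in> vec.span (sv P)" "y = c *s v + y'"
    by (rule in_span_insertE)
  obtain P' where P': "length P' = length P" "\<And>B. B \<in> altf \<Longrightarrow> ev B P' = ev B P + B v y'"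
    "vec.span (insert v (sv P')) = vec.span (insert v (sv P))" using absorb[OF y'(1)] by blast
  have "vec.dim (insert v (sv P')) = vec.dim (insert v (sv P))" using P'(3) by (metis vec.dim_span)
  then have "vec.dim (insert v (sv P')) = 2 * length P + 1" using assms by (simp add: vec.dim_insert ind_def)
  then have "ind P' \<and> v \<notin> vec.span (sv P')" using dim_sv_le[of P'] P'(1)
    by (auto simp: vec.dim_insert ind_def split: if_splits)
  moreover have "ev B P' = ev B P + B v y" if "B \<in> altf" for B
    using P'(2)[OF that] y'(2) that by (simp add: altf_simps)
  ultimately show ?thesis using that P' by blast
qed

text \<open>Normalise the tail first. If the remaining pair depends on it, its summand can be
  written as \<open>v \<and> y\<close> with \<open>y\<close> in the span of the tail and is
  absorbed, which shortens the list; otherwise the pair is simply put back.\<close>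

lemma normal_form:
  fixes P :: "(('a::field^'m) \<times> ('a^'m)) list"
  assumes "sv P \<subseteq> U" "sp U"
  shows "\<exists>P'. ind P' \<and> sv P' \<subseteq> U \<and> length P' \<le> length P \<and> (\<forall>B\<in>altf. ev B P' = ev B P)"
  using assms(1)
proof (induction "length P" arbitrary: P rule: less_induct)
  case less
  show ?case
  proof (cases P)
    case Nil
    then show ?thesis by (intro exI[of _ "[]"]) auto
  next
    case (Cons ab P1)
    obtain a b where ab: "ab = (a, b)" by (cases ab)
    have abU: "a \<in> U" "b \<in> U" "sv P1 \<subseteq> U" using less(2) Cons ab by auto
    from less(1)[of P1] obtain Q where Q: "ind Q" "sv Q \<subseteq> U" "length Q \<le> length P1"
      "\<And>B. B \<in> altf \<Longrightarrow> ev B Q = ev B P1" using Cons abU by auto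
    have fin: ?thesis if v: "v \<in> U" and y: "y \<in> vec.span (sv Q)"
      and e: "\<And>B. B \<in> altf \<Longrightarrow> B v y = B a b" for v y
    proof -
      obtain Q' where Q': "length Q' = length Q" "\<And>B. B \<in> altf \<Longrightarrow> ev B Q' = ev B Q + B v y"
        "vec.span (insert v (sv Q')) = vec.span (insert v (sv Q))" using absorb[OF y] by blast
      have "sv Q' \<subseteq> vec.span (insert v (sv Q))"
        by (metis Q'(3) subset_insertI subset_trans vec.span_superset)
      also have "\<dots> \<subseteq> U" using v Q(2) assms(2) by (intro vec.span_minimal) auto
      finally have Q'U: "sv Q' \<subseteq> U" .
      have "length Q' < length P" using Q'(1) Q(3) Cons by simp
      then obtain R where R: "ind R" "sv R \<subseteq> U" "length R \<le> length Q'"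
        "\<And>B. B \<in> altf \<Longrightarrow> ev B R = ev B Q'" using less(1)[OF _ Q'U] by auto
      have "ev B R = ev B P" if "B \<in> altf" for B
        using R(4) Q'(2) Q(4) e that Cons ab by simp
      then show ?thesis using R \<open>length Q' < length P\<close> by (intro exI[of _ R]) auto
    qed
    show ?thesis
    proof (cases "a \<in> vec.span (sv Q)")
      case True
      then have "- a \<in> vec.span (sv Q)" by (rule vec.span_neg)
      then show ?thesis
        by (rule fin[OF abU(2)]) (metis altf_minus(2) altf_skew)
    next
      case False
      show ?thesis
      proof (cases "b \<in> vec.span (insert a (sv Q))")
        case True
        then obtain c y where "y \<in> vec.span (sv Q)" "b = c *s a + y" by (rule in_span_insertE)
        then show ?thesis by (intro fin[OF abU(1), of y]) (auto simp: altf_simps)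
      next
        case nb: False
        have "ind ((a, b) # Q)" using False nb Q(1) by (simp add: ind_Cons)
        then show ?thesis using Q abU Cons ab by (intro exI[of _ "(a, b) # Q"]) auto
      qed
    qed
  qed
qed

subsection \<open>Fourier transform on alternating forms\<close>

text \<open>Functions on the alternating forms of a subspace \<open>U\<close> are represented by functions on the forms
  of the whole space that depend only on the restriction to \<open>U\<close>.\<close>

definition dep :: "('a::field^'m) set \<Rightarrow> (('a^'m \<Rightarrow> 'a^'m \<Rightarrow> 'a) \<Rightarrow> complex) \<Rightarrow> bool" where
  "dep U f \<longleftrightarrow> (\<forall>B\<in>altf. \<forall>D\<in>altf. eqon U B D \<longrightarrow> f B = f D)"

definition FT :: "(('a::{field,finite}^'m::finite \<Rightarrow> 'a^'m \<Rightarrow> 'a) \<Rightarrow> complex) \<Rightarrow> (('a^'m) \<times> ('a^'m)) list \<Rightarrow> complex" where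
  "FT f P = (\<Sum>B\<in>altf. f B * addchar (ev B P))"

definition push :: "('a::{field,finite}^'m::finite) set \<Rightarrow> (('a^'m \<Rightarrow> 'a^'m \<Rightarrow> 'a) \<Rightarrow> complex) \<Rightarrow> ('a^'m \<Rightarrow> 'a^'m \<Rightarrow> 'a) \<Rightarrow> complex" where
  "push U f C = (\<Sum>B | B \<in> altf \<and> eqon U B C. f B)"

text \<open>The dual group of the alternating forms on \<open>U\<close>: lists that define the same
  functional are identified, and the value 0 off \<open>altf\<close> makes equal functionals equal
  as functions.\<close>

definition bivs :: "('a::{field,finite}^'m::finite) set \<Rightarrow> (('a^'m \<Rightarrow> 'a^'m \<Rightarrow> 'a) \<Rightarrow> 'a) set" where
  "bivs U = (\<lambda>P B. if B \<in> altf then ev B P else 0) ` {P. sv P \<subseteq> U}"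

lemma eqon_refl [simp]: "eqon U B B" by (simp add: eqon_def)
lemma eqon_sym: "eqon U B D \<longleftrightarrow> eqon U D B" by (auto simp: eqon_def)
lemma eqon_trans: "eqon U B C \<Longrightarrow> eqon U C D \<Longrightarrow> eqon U B D" by (simp add: eqon_def)
lemma eqon_subset: "eqon U B C \<Longrightarrow> V \<subseteq> U \<Longrightarrow> eqon V B C" unfolding eqon_def by blast
lemma eqon_diff: "eqon U (B - D) 0 \<longleftrightarrow> eqon U B (D :: 'a::field^'m \<Rightarrow> 'a^'m \<Rightarrow> 'a)" by (simp add: eqon_def)
lemma eqon_add: "eqon U B B' \<Longrightarrow> eqon U D D' \<Longrightarrow> eqon U (B + D) (B' + D')" by (simp add: eqon_def)

lemma sum_altf_shift:
  fixes f :: "('a::{field,finite}^'m::finite \<Rightarrow> 'a^'m \<Rightarrow> 'a) \<Rightarrow> complex"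
  assumes "D \<in> altf"
  shows "(\<Sum>B\<in>altf. f (B + D)) = (\<Sum>B\<in>altf. f B)"
  by (rule sum.reindex_bij_witness[of _ "\<lambda>B. B - D" "\<lambda>B. B + D"])
    (auto simp: assms altf_add altf_diff)

lemma FT_cong: "(\<And>B. B \<in> altf \<Longrightarrow> ev B P = ev B P') \<Longrightarrow> FT f P = FT f P'"
  by (simp add: FT_def)

lemma FT_shift:
  assumes "D \<in> altf"
  shows "FT (\<lambda>B. f (B + D)) P = addchar (- ev D P) * FT f P"
proof -
  have "FT (\<lambda>B. f (B + D)) P = (\<Sum>B\<in>altf. f (B + D) * (addchar (ev (B + D) P) * addchar (- ev D P)))"
    by (simp add: FT_def ev_add addchar_add[symmetric])
  also have "\<dots> = (\<Sum>B\<in>altf. f B * (addchar (ev B P) * addchar (- ev D P)))"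
    using sum_altf_shift[OF assms, of "\<lambda>B. f B * (addchar (ev B P) * addchar (- ev D P))"] .
  also have "\<dots> = addchar (- ev D P) * FT f P"
    by (simp add: FT_def sum_distrib_left mult_ac)
  finally show ?thesis .
qed

lemma bivs_nonempty: "bivs U \<noteq> {}"
proof -
  have "[] \<in> {P. sv P \<subseteq> U}" by simp
  then show ?thesis unfolding bivs_def by blast
qed

lemma card_bivs: "card (bivs U) \<noteq> 0" using bivs_nonempty by (simp add: card_eq_0_iff)

lemma ev_scale: "ev B (map (\<lambda>(a, b). (s *s a, b)) P) = s * ev B P" if "B \<in> altf"
  by (induction P rule: sv.induct) (auto simp: altf_simps[OF that] algebra_simps)

text \<open>Orthogonality of characters. If \<open>D\<close> does not vanish on \<open>U\<close>,
  some bivector takes at \<open>D\<close> a value with nontrivial character; translating the sum by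
  it multiplies the sum by that character value.\<close>

lemma sum_bivs:
  fixes D :: "'a::{field,finite}^'m::finite \<Rightarrow> 'a^'m \<Rightarrow> 'a"
  assumes D: "D \<in> altf" and U: "sp U"
  shows "(\<Sum>\<phi>\<in>bivs U. addchar (\<phi> D)) = (if eqon U D 0 then of_nat (card (bivs U)) else 0)"
proof (cases "eqon U D 0")
  case True
  have phiD: "\<phi> D = 0" if "\<phi> \<in> bivs U" for \<phi>
    using that ev_cong[OF True] D by (auto simp: bivs_def)
  have "(\<Sum>\<phi>\<in>bivs U. addchar (\<phi> D)) = (\<Sum>\<phi>\<in>bivs U. 1)"
  proof (rule sum.cong[OF refl])
    fix \<phi> assume "\<phi> \<in> bivs U"
    then have "\<phi> D = 0" by (rule phiD)
    then show "addchar (\<phi> D) = 1" by (simp only: addchar_0)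
  qed
  then show ?thesis using True by simp
next
  case False
  then obtain a b where ab: "a \<in> U" "b \<in> U" "D a b \<noteq> 0" by (auto simp: eqon_def)
  obtain s :: 'a where s: "addchar s \<noteq> 1" using addchar_nontrivial by blast
  define P where "P = [((s / D a b) *s a, b)]"
  have PU: "sv P \<subseteq> U" using ab U by (simp add: P_def vec.subspace_scale)
  have evP: "ev D P = s" using ab D by (simp add: P_def altf_simps)
  define \<phi>0 where "\<phi>0 = (\<lambda>B. if B \<in> altf then ev B P else 0)"
  define \<phi>1 where "\<phi>1 = (\<lambda>B. if B \<in> altf then ev B (map (\<lambda>(a, b). (- 1 *s a, b)) P) else 0)"
  have in0: "\<phi> + \<phi>0 \<in> bivs U" if \<phi>: "\<phi> \<in> bivs U" for \<phi>
  proof -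
    obtain Q where Q: "sv Q \<subseteq> U" "\<phi> = (\<lambda>B. if B \<in> altf then ev B Q else 0)"
      using \<phi> unfolding bivs_def by blast
    have "\<phi> + \<phi>0 = (\<lambda>B. if B \<in> altf then ev B (Q @ P) else 0)" by (auto simp: Q \<phi>0_def)
    moreover have "sv (Q @ P) \<subseteq> U" using Q PU by simp
    ultimately show ?thesis unfolding bivs_def by blast
  qed
  have in1: "\<phi> - \<phi>0 \<in> bivs U" if \<phi>: "\<phi> \<in> bivs U" for \<phi>
  proof -
    obtain Q where Q: "sv Q \<subseteq> U" "\<phi> = (\<lambda>B. if B \<in> altf then ev B Q else 0)"
      using \<phi> unfolding bivs_def by blast
    let ?P = "map (\<lambda>(a, b). (- 1 *s a, b)) P"
    have "\<phi> - \<phi>0 = (\<lambda>B. if B \<in> altf then ev B (Q @ ?P) else 0)"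
      by (auto simp: Q \<phi>0_def ev_scale fun_eq_iff P_def altf_simps)
    moreover have "sv (Q @ ?P) \<subseteq> U" using Q PU ab U by (simp add: P_def vec.subspace_scale vec.subspace_neg)
    ultimately show ?thesis unfolding bivs_def by blast
  qed
  have "(\<Sum>\<phi>\<in>bivs U. addchar (\<phi> D)) = (\<Sum>\<phi>\<in>bivs U. addchar ((\<phi> + \<phi>0) D))"
    by (rule sum.reindex_bij_witness[of _ "\<lambda>\<phi>. \<phi> + \<phi>0" "\<lambda>\<phi>. \<phi> - \<phi>0"])
      (auto simp: in0 in1)
  also have "\<dots> = addchar s * (\<Sum>\<phi>\<in>bivs U. addchar (\<phi> D))"
    using D by (simp add: \<phi>0_def addchar_add evP sum_distrib_left mult_ac)
  finally show ?thesis using s False by (metis mult_cancel_right1)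
qed

text \<open>Fourier inversion: multiply the transform by the conjugate character values at
  \<open>B0\<close> and sum over the dual group. Only forms that agree with \<open>B0\<close> on
  \<open>U\<close> survive, and there \<open>f\<close> is constant by \<open>dep\<close>.\<close>

lemma FT_inj:
  fixes f :: "('a::{field,finite}^'m::finite \<Rightarrow> 'a^'m \<Rightarrow> 'a) \<Rightarrow> complex"
  assumes f: "dep U f" and U: "sp U" and z: "\<And>P. sv P \<subseteq> U \<Longrightarrow> FT f P = 0" and B0: "B0 \<in> altf"
  shows "f B0 = 0"
proof -
  have "(\<Sum>B\<in>altf. f B * addchar (\<phi> (B - B0))) = 0" if \<phi>: "\<phi> \<in> bivs U" for \<phi>
  proof -
    obtain Q where Q: "sv Q \<subseteq> U" "\<phi> = (\<lambda>B. if B \<in> altf then ev B Q else 0)"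
      using \<phi> by (auto simp: bivs_def)
    have "(\<Sum>B\<in>altf. f B * addchar (\<phi> (B - B0))) = (\<Sum>B\<in>altf. f B * addchar (ev B Q)) * addchar (- ev B0 Q)"
      unfolding sum_distrib_right
    proof (rule sum.cong[OF refl])
      fix B :: "'a^'m \<Rightarrow> 'a^'m \<Rightarrow> 'a" assume "B \<in> altf"
      then have "\<phi> (B - B0) = ev B Q + (- ev B0 Q)" using altf_diff[OF _ B0] by (simp add: Q ev_diff)
      then show "f B * addchar (\<phi> (B - B0)) = f B * addchar (ev B Q) * addchar (- ev B0 Q)"
        by (simp only: addchar_add mult.assoc)
    qed
    then show ?thesis using z[OF Q(1)] by (simp add: FT_def)
  qed
  then have "0 = (\<Sum>\<phi>\<in>bivs U. \<Sum>B\<in>altf. f B * addchar (\<phi> (B - B0)))" by simp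
  also have "\<dots> = (\<Sum>B\<in>altf. f B * (\<Sum>\<phi>\<in>bivs U. addchar (\<phi> (B - B0))))"
    by (subst sum.swap) (simp add: sum_distrib_left)
  also have "\<dots> = (\<Sum>B\<in>altf. f B0 * of_nat (card (bivs U)) * (if eqon U B B0 then 1 else 0))"
  proof (rule sum.cong[OF refl])
    fix B :: "'a^'m \<Rightarrow> 'a^'m \<Rightarrow> 'a" assume B: "B \<in> altf"
    show "f B * (\<Sum>\<phi>\<in>bivs U. addchar (\<phi> (B - B0))) = f B0 * of_nat (card (bivs U)) * (if eqon U B B0 then 1 else 0)"
    proof (cases "eqon U B B0")
      case True
      then have "f B = f B0" using f B B0 unfolding dep_def by blast
      then show ?thesis using True by (simp add: sum_bivs[OF altf_diff[OF B B0] U] eqon_diff)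
    next
      case False
      then show ?thesis by (simp add: sum_bivs[OF altf_diff[OF B B0] U] eqon_diff)
    qed
  qed
  also have "\<dots> = f B0 * of_nat (card (bivs U)) * of_nat (card {B \<in> altf. eqon U B B0})"
    by (simp add: sum_distrib_left[symmetric] sum.If_cases Int_def)
  finally have "f B0 * of_nat (card (bivs U)) * of_nat (card {B \<in> altf. eqon U B B0}) = 0" by simp
  moreover have "card {B \<in> altf. eqon U B B0} \<noteq> 0" using B0 by (auto simp: card_eq_0_iff)
  ultimately show ?thesis using card_bivs[of U] by simp
qed

text \<open>Translation by \<open>D\<close> multiplies the coefficient at \<open>P\<close> by the
  conjugate of the character value at \<open>D\<close>. If that value is 1 wherever the coefficient
  is nonzero, \<open>f\<close> and its translate have the same transform on
  \<open>U\<close>.\<close>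

lemma FT_invariant:
  assumes f: "dep U f" and U: "sp U" and D: "D \<in> altf"
    and one: "\<And>P. sv P \<subseteq> U \<Longrightarrow> FT f P \<noteq> 0 \<Longrightarrow> addchar (ev D P) = 1" and B: "B \<in> altf"
  shows "f (B + D) = f B"
proof -
  let ?g = "\<lambda>B. f (B + D) - f B"
  have "?g B = 0"
  proof (rule FT_inj[OF _ U _ B])
    show "dep U ?g" using f D unfolding dep_def by (metis altf_add eqon_add eqon_refl)
    fix P assume P: "sv P \<subseteq> U"
    have "FT ?g P = FT (\<lambda>B. f (B + D)) P - FT f P"
      by (simp add: FT_def left_diff_distrib sum_subtractf)
    also have "\<dots> = (addchar (- ev D P) - 1) * FT f P" by (simp add: FT_shift[OF D] left_diff_distrib)
    finally show "FT ?g P = 0" using one[OF P] by (auto simp: addchar_minus)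
  qed
  then show ?thesis by simp
qed

lemma FT_constant:
  assumes f: "dep U f" and U: "sp U"
    and z: "\<And>P. ind P \<Longrightarrow> sv P \<subseteq> U \<Longrightarrow> P \<noteq> [] \<Longrightarrow> FT f P = 0" and B: "B \<in> altf"
  shows "f B = f 0"
proof -
  have "f (0 + B) = f 0"
  proof (rule FT_invariant[OF f U B _ altf_0])
    fix P assume P: "sv P \<subseteq> U" "FT f P \<noteq> 0"
    obtain Q where Q: "ind Q" "sv Q \<subseteq> U" "\<And>B. B \<in> altf \<Longrightarrow> ev B Q = ev B P"
      using normal_form[OF P(1) U] by blast
    have "FT f Q \<noteq> 0" using P(2) FT_cong[of Q P f] Q(3) by simp
    then have "Q = []" using z Q by blast
    then show "addchar (ev B P) = 1" using Q(3)[OF B] by simp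
  qed
  then show ?thesis by simp
qed

lemma dep_push: "dep U (push U f)"
  unfolding dep_def push_def
proof (intro ballI impI sum.cong refl)
  fix C D :: "'a^'b \<Rightarrow> 'a^'b \<Rightarrow> 'a" assume "eqon U C D"
  then have "eqon U B C \<longleftrightarrow> eqon U B D" for B using eqon_trans eqon_sym by blast
  then show "{B. B \<in> altf \<and> eqon U B C} = {B. B \<in> altf \<and> eqon U B D}" by simp
qed

lemma push_nz: "push U f C \<noteq> 0 \<Longrightarrow> \<exists>B\<in>altf. eqon U B C \<and> f B \<noteq> 0"
  unfolding push_def by (metis (mono_tags, lifting) mem_Collect_eq sum.neutral)

definition fibre :: "('a::{field,finite}^'m::finite) set \<Rightarrow> nat" where
  "fibre U = card {C :: 'a^'m \<Rightarrow> 'a^'m \<Rightarrow> 'a. C \<in> altf \<and> eqon U C 0}"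

lemma fibre_nz: "fibre U \<noteq> 0"
proof -
  have "0 \<in> {C. C \<in> altf \<and> eqon U C 0}" by (simp add: altf_0)
  then show ?thesis unfolding fibre_def by (subst card_eq_0_iff) auto
qed

lemma card_fibre:
  fixes B :: "'a::{field,finite}^'m::finite \<Rightarrow> 'a^'m \<Rightarrow> 'a"
  assumes "B \<in> altf"
  shows "card {C \<in> altf. eqon U B C} = fibre U"
  unfolding fibre_def
proof (rule bij_betw_same_card[of "\<lambda>C. C - B"], rule bij_betwI[where g = "\<lambda>C. C + B"])
  show "(\<lambda>C. C - B) \<in> {C \<in> altf. eqon U B C} \<rightarrow> {C \<in> altf. eqon U C 0}"
    using assms by (auto simp: altf_diff eqon_def)
  show "(\<lambda>C. C + B) \<in> {C \<in> altf. eqon U C 0} \<rightarrow> {C \<in> altf. eqon U B C}"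
    using assms by (auto simp: altf_add eqon_def)
qed auto

text \<open>Summing over the fibres of the restriction to \<open>U\<close> is dual to keeping only
  the characters given by bivectors of \<open>U\<close>, since these are constant on each fibre. The
  factor arises because \<open>push\<close> is again a function on forms of the whole space.\<close>

lemma FT_push:
  assumes "sv P \<subseteq> U"
  shows "FT (push U f) P = of_nat (fibre U) * FT f P"
proof -
  have "FT (push U f) P = (\<Sum>C\<in>altf. \<Sum>B\<in>altf. if eqon U B C then f B * addchar (ev C P) else 0)"
    by (auto simp: FT_def push_def sum_distrib_right sum.inter_filter[symmetric] intro!: sum.cong)
  also have "\<dots> = (\<Sum>C\<in>altf. \<Sum>B\<in>altf. if eqon U B C then f B * addchar (ev B P) else 0)"
    by (intro sum.cong refl) (auto dest: ev_cong[OF _ assms])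
  also have "\<dots> = (\<Sum>B\<in>altf. \<Sum>C\<in>altf. if eqon U B C then f B * addchar (ev B P) else 0)"
    by (rule sum.swap)
  also have "\<dots> = (\<Sum>B\<in>altf. of_nat (fibre U) * (f B * addchar (ev B P)))"
    by (intro sum.cong refl) (simp add: sum.If_cases Int_def card_fibre)
  finally show ?thesis by (simp add: FT_def sum_distrib_left)
qed

subsection \<open>Construction of forms\<close>

lemma ex_functional':
  fixes S :: "('a::{field,finite}^'m::finite) set"
  assumes "sp S" "a \<notin> S"
  shows "\<exists>h :: 'a^'m \<Rightarrow> 'a. (\<forall>x y. h (x + y) = h x + h y) \<and> (\<forall>c x. h (c *s x) = c * h x) \<and>
    h a = 1 \<and> (\<forall>x\<in>S. h x = 0)"
  by (rule ex_functional[OF assms]) blast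

text \<open>The form is \<open>s\<close> times the wedge of two functionals dual to \<open>a\<close>
  and \<open>b\<close> that vanish on \<open>sv P\<close>.\<close>

lemma ex_form_value:
  fixes a b :: "'a::{field,finite}^'m::finite"
  assumes "ind ((a, b) # P)"
  obtains D where "D \<in> altf" "D a b = s" "ev D P = 0"
proof -
  have na: "a \<notin> vec.span (insert b (sv P))"
  proof -
    have "ind ((b, a) # P)" using assms by (simp add: ind_def insert_commute)
    then show ?thesis by (simp add: ind_Cons)
  qed
  obtain h where h: "\<And>x y. h (x + y) = h x + h y" "\<And>c x. h (c *s x) = c * h x"
    "h a = 1" "\<And>x. x \<in> vec.span (insert b (sv P)) \<Longrightarrow> h x = 0"
    using ex_functional'[OF vec.subspace_span na] by blast
  have nb: "b \<notin> vec.span (insert a (sv P))" using assms by (simp add: ind_Cons)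
  obtain k where k: "\<And>x y. k (x + y) = k x + k y" "\<And>c x. k (c *s x) = c * k x"
    "k b = 1" "\<And>x. x \<in> vec.span (insert a (sv P)) \<Longrightarrow> k x = 0"
    using ex_functional'[OF vec.subspace_span nb] by blast
  define D where "D = (\<lambda>x y. s * (h x * k y - h y * k x))"
  have D: "D \<in> altf" by (simp add: altf_def D_def h k algebra_simps)
  have "h x = 0" if "x \<in> sv P" for x using that h(4) by (simp add: vec.span_base)
  then have "eqon (sv P) D 0" by (simp add: eqon_def D_def)
  then have "ev D P = 0" using ev_cong[of "sv P" D 0 P] by simp
  moreover have "h b = 0" "k a = 0" using h(4) k(4) by (auto simp: vec.span_base)
  ultimately show ?thesis using that[OF D] h(3) k(3) by (simp add: D_def)
qed

lemma nonsing_pair: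
  assumes "D \<in> altf" "D a b \<noteq> 0"
  shows "nonsing (vec.span {a, b}) D"
  unfolding nonsing_def
proof (intro ballI impI)
  fix x assume x: "x \<in> vec.span {a, b}" and z: "\<forall>y\<in>vec.span {a, b}. D x y = 0"
  from x have "x \<in> vec.span (insert a {b})" by simp
  then obtain c y where y: "y \<in> vec.span {b}" "x = c *s a + y" by (rule in_span_insertE)
  from y(1) obtain c' where c': "y = c' *s b" using vec.span_breakdown_eq[of y b "{}"] by auto
  have "D x a = 0" "D x b = 0" using z by (auto simp: vec.span_base)
  then show "x = 0" using assms altf_skew[OF assms(1), of b a]
    by (simp add: y c' altf_simps[OF assms(1)])
qed

text \<open>The pairs of the list span hyperbolic planes whose orthogonal sum is the required form.
  The first vectors of the pairs are mutually orthogonal, which later yields nonsingular forms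
  vanishing on a plane; \<open>s = 0\<close> encodes that no value at the head is
  prescribed.\<close>

lemma ind_nonsing:
  fixes P :: "(('a::{field,finite}^'m::finite) \<times> ('a^'m)) list"
  assumes "ind P"
  shows "\<exists>D\<in>altf. nonsing (vec.span (sv P)) D \<and> (\<forall>a\<in>fst ` set P. \<forall>b\<in>fst ` set P. D a b = 0) \<and>
    (s \<noteq> 0 \<longrightarrow> P \<noteq> [] \<longrightarrow> D (fst (hd P)) (snd (hd P)) = s)"
  using assms
proof (induction P arbitrary: s rule: sv.induct)
  case 1
  then show ?case by (auto simp: nonsing_def intro!: bexI[of _ 0] altf_0)
next
  case (2 a b P)
  define r where "r = (if s = 0 then 1 else s)"
  have r: "r \<noteq> 0" by (simp add: r_def)
  obtain D0 where D0: "D0 \<in> altf" "D0 a b = r" using ex_form_value[OF 2(2)] by metis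
  obtain D1 where D1: "D1 \<in> altf" "nonsing (vec.span (sv P)) D1" "\<forall>a\<in>fst ` set P. \<forall>b\<in>fst ` set P. D1 a b = 0"
    using 2(1)[of 0] 2(2) unfolding ind_Cons by blast
  have dis: "vec.span {a, b} \<inter> vec.span (sv P) = {0}"
    using ind_append_disjoint[of "[(a, b)]" P] 2(2) by simp
  from block_sum[OF vec.subspace_span vec.subspace_span dis D0(1) D1(1)] obtain D
    where D: "D \<in> altf" "eqon (vec.span {a, b}) D D0" "eqon (vec.span (sv P)) D D1"
     "\<And>s t. s \<in> vec.span {a, b} \<Longrightarrow> t \<in> vec.span (sv P) \<Longrightarrow> D s t = 0"
     "nonsing (vec.span {a, b}) D0 \<Longrightarrow> nonsing (vec.span (sv P)) D1 \<Longrightarrow>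
       nonsing {x + y |x y. x \<in> vec.span {a, b} \<and> y \<in> vec.span (sv P)} D" by blast
  have "nonsing {x + y |x y. x \<in> vec.span {a, b} \<and> y \<in> vec.span (sv P)} D"
    using D(5) D1(2) nonsing_pair[OF D0(1)] D0(2) r by simp
  then have "nonsing (vec.span ({a, b} \<union> sv P)) D" by (simp only: span_Un_sum)
  moreover have "{a, b} \<union> sv P = sv ((a, b) # P)" by auto
  ultimately have ns: "nonsing (vec.span (sv ((a, b) # P))) D" by simp
  have fstP: "x \<in> sv P" if "x \<in> fst ` set P" for x
    using that by (induction P rule: sv.induct) auto
  have "D x y = 0" if xy: "x \<in> fst ` set ((a, b) # P)" "y \<in> fst ` set ((a, b) # P)" for x y
  proof -
    have ab: "a \<in> vec.span {a, b}" by (simp add: vec.span_base)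
    have P: "z \<in> vec.span (sv P)" if "z \<in> fst ` set P" for z using fstP[OF that] by (rule vec.span_base)
    have "D a z = 0" if "z \<in> fst ` set P" for z using D(4)[OF ab P[OF that]] .
    moreover have "D z a = 0" if "z \<in> fst ` set P" for z
      using D(4)[OF ab P[OF that]] altf_skew[OF D(1), of z a] by simp
    moreover have "D z z' = 0" if "z \<in> fst ` set P" "z' \<in> fst ` set P" for z z'
    proof -
      have "D1 z z' = 0" using D1(3) that by blast
      then show ?thesis using D(3) P that unfolding eqon_def by simp
    qed
    moreover have "D a a = 0" using D(1) by (simp add: altf_simps)
    moreover have "x = a \<or> x \<in> fst ` set P" "y = a \<or> y \<in> fst ` set P" using xy by auto
    ultimately show ?thesis by blast
  qed
  moreover have "D a b = D0 a b" using D(2) unfolding eqon_def by (auto simp: vec.span_base)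
  ultimately show ?case using D(1) ns D0(2) r by (intro bexI[of _ D] conjI) (auto simp: r_def)
qed

lemma ind_extend:
  fixes P :: "(('a::{field,finite}^'m::finite) \<times> ('a^'m)) list"
  assumes "ind P" "sv P \<subseteq> U" "2 * (length P + k) \<le> vec.dim U"
  shows "\<exists>Q. ind (P @ Q) \<and> sv Q \<subseteq> U \<and> length Q = k"
  using assms(3)
proof (induction k)
  case 0
  then show ?case using assms by (intro exI[of _ "[]"]) simp
next
  case (Suc k)
  then obtain Q where Q: "ind (P @ Q)" "sv Q \<subseteq> U" "length Q = k" by auto
  have pick: "\<exists>x\<in>U. x \<notin> vec.span S" if "vec.dim S < vec.dim U" for S
  proof (rule ccontr)
    assume "\<not> ?thesis"
    then have "U \<subseteq> vec.span S" by blast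
    then show False using vec.dim_mono[of U S] that by simp
  qed
  have d: "vec.dim (sv (P @ Q)) = 2 * (length P + k)" using Q by (simp add: ind_def)
  obtain a where a: "a \<in> U" "a \<notin> vec.span (sv (P @ Q))" using pick[of "sv (P @ Q)"] d Suc(2) by auto
  have "vec.dim (insert a (sv (P @ Q))) = 2 * (length P + k) + 1" using a d by (simp add: vec.dim_insert)
  then obtain b where b: "b \<in> U" "b \<notin> vec.span (insert a (sv (P @ Q)))"
    using pick[of "insert a (sv (P @ Q))"] Suc(2) by auto
  have "ind ([(a, b)] @ P @ Q)" using a b Q by (simp add: ind_Cons)
  then have "ind (P @ (a, b) # Q)" by (simp add: ind_def insert_commute)
  then show ?case using a b Q by (intro exI[of _ "(a, b) # Q"]) auto
qed

lemma ind_span_eq: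
  fixes P :: "(('a::{field,finite}^'m::finite) \<times> ('a^'m)) list"
  assumes "ind P" "sv P \<subseteq> U" "sp U" "vec.dim U \<le> 2 * length P"
  shows "vec.span (sv P) = U"
proof (rule vec.subspace_dim_equal)
  show "vec.span (sv P) \<subseteq> U" using assms by (intro vec.span_minimal)
qed (use assms in \<open>auto simp: ind_def\<close>)

lemma ex_nonsing_extension:
  fixes P :: "(('a::{field,finite}^'m::finite) \<times> ('a^'m)) list"
  assumes "ind P" "sv P \<subseteq> U" "sp U" "even (vec.dim U)"
  shows "\<exists>D\<in>altf. nonsing U D \<and> (\<forall>a\<in>fst ` set P. \<forall>b\<in>fst ` set P. D a b = 0) \<and>
    (s \<noteq> 0 \<longrightarrow> P \<noteq> [] \<longrightarrow> D (fst (hd P)) (snd (hd P)) = s)"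
proof -
  have "vec.dim (sv P) \<le> vec.dim U" using assms by (intro vec.dim_subset)
  then have le: "2 * length P \<le> vec.dim U" using assms(1) by (simp add: ind_def)
  obtain j where j: "vec.dim U = 2 * j" using assms(4) by (rule evenE)
  define k where "k = j - length P"
  have k: "vec.dim U = 2 * (length P + k)" using le j by (simp add: k_def)
  then obtain Q where Q: "ind (P @ Q)" "sv Q \<subseteq> U" "length Q = k" using ind_extend[OF assms(1,2), of k] by auto
  have "vec.span (sv (P @ Q)) = U" by (rule ind_span_eq) (use Q assms k in auto)
  moreover obtain D where D: "D \<in> altf" "nonsing (vec.span (sv (P @ Q))) D"
    "\<forall>a\<in>fst ` set (P @ Q). \<forall>b\<in>fst ` set (P @ Q). D a b = 0"
    "s \<noteq> 0 \<longrightarrow> P @ Q \<noteq> [] \<longrightarrow> D (fst (hd (P @ Q))) (snd (hd (P @ Q))) = s"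
    using ind_nonsing[OF Q(1), of s] by blast
  moreover have "\<forall>a\<in>fst ` set P. \<forall>b\<in>fst ` set P. D a b = 0" using D(3) by auto
  moreover have "s \<noteq> 0 \<longrightarrow> P \<noteq> [] \<longrightarrow> D (fst (hd P)) (snd (hd P)) = s" using D(4) by auto
  ultimately show ?thesis by (intro bexI[of _ D]) auto
qed

lemma ex_nonsing:
  fixes U :: "('a::{field,finite}^'m::finite) set"
  assumes "sp U" "even (vec.dim U)"
  shows "\<exists>D\<in>altf. nonsing U D"
  using ex_nonsing_extension[of "[]" U] assms by auto

text \<open>Write \<open>s = \<alpha> a + \<beta> b + s'\<close> with \<open>s'\<close> in the span
  of the tail. If \<open>\<alpha>\<close> is nonzero and \<open>v = b / \<alpha>\<close>, then
  \<open>a \<and> b = s \<and> v + v \<and> s'\<close>, and the last summand is absorbed by the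
  tail. The inclusion of spans lets a dimension count show that independence is kept.\<close>

lemma extract_vector:
  fixes P :: "(('a::{field,finite}^'m::finite) \<times> ('a^'m)) list"
  assumes "s \<in> vec.span (sv P)" "s \<noteq> 0"
  shows "\<exists>t Q. length Q + 1 = length P \<and> (\<forall>B\<in>altf. ev B P = B s t + ev B Q) \<and>
    sv P \<subseteq> vec.span (sv ((s, t) # Q))"
  using assms
proof (induction P rule: sv.induct)
  case 1
  then show ?case by simp
next
  case (2 a b P)
  from 2(2) obtain \<alpha> \<beta> s' where s': "s' \<in> vec.span (sv P)" "s = \<alpha> *s a + \<beta> *s b + s'"
    by (rule in_span_sv_ConsE)
  have *: ?case if e: "\<And>B. B \<in> altf \<Longrightarrow> B a b = B s v + B v s'"
    and ab: "a \<in> vec.span {s, v, s'}" "b \<in> vec.span {s, v, s'}" for v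
  proof -
    from absorb[OF s'(1), of v] obtain Q where Q: "length Q = length P"
      "\<And>B. B \<in> altf \<Longrightarrow> ev B Q = ev B P + B v s'"
      "vec.span (insert v (sv Q)) = vec.span (insert v (sv P))" by blast
    have "ev B ((a, b) # P) = B s v + ev B Q" if "B \<in> altf" for B
      using e[OF that] Q(2)[OF that] by simp
    moreover have "sv ((a, b) # P) \<subseteq> vec.span (sv ((s, v) # Q))"
    proof -
      have "vec.span (insert v (sv Q)) \<subseteq> vec.span (sv ((s, v) # Q))" by (intro vec.span_mono) auto
      then have P: "vec.span (insert v (sv P)) \<subseteq> vec.span (sv ((s, v) # Q))" using Q(3) by simp
      moreover have "sv P \<subseteq> vec.span (insert v (sv P))"
        by (meson subset_insertI subset_trans vec.span_superset)
      moreover have "s' \<in> vec.span (insert v (sv P))" using s'(1) vec.span_mono[of "sv P" "insert v (sv P)"] by blast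
      moreover have "{s, v} \<subseteq> vec.span (sv ((s, v) # Q))" by (auto intro: vec.span_base)
      ultimately have "vec.span {s, v, s'} \<subseteq> vec.span (sv ((s, v) # Q))"
        by (intro vec.span_minimal) auto
      then show ?thesis using ab P \<open>sv P \<subseteq> vec.span (insert v (sv P))\<close> by auto
    qed
    ultimately show ?thesis using Q(1) by (intro exI[of _ v] exI[of _ Q]) auto
  qed
  have mem: "x *s s + y *s v + z *s s' \<in> vec.span {s, v, s'}" for x y z v
    by (intro vec.span_add vec.span_scale vec.span_base) auto
  consider "\<alpha> \<noteq> 0" | "\<alpha> = 0" "\<beta> \<noteq> 0" | "\<alpha> = 0" "\<beta> = 0" by blast
  then show ?case
  proof cases
    case 1
    let ?v = "(1 / \<alpha>) *s b"
    have a: "a = (1 / \<alpha>) *s s + (- \<beta>) *s ?v + (- 1 / \<alpha>) *s s'"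
      using 1 by (simp add: s'(2) vec.scale_right_distrib vec.scale_minus_left)
    have b: "b = 0 *s s + \<alpha> *s ?v + 0 *s s'" using 1 by simp
    show ?thesis
    proof (rule *[of ?v])
      show "B a b = B s ?v + B ?v s'" if B: "B \<in> altf" for B
        using 1 altf_skew[OF B, of b s'] by (simp add: s'(2) altf_simps[OF B] field_simps)
      show "a \<in> vec.span {s, ?v, s'}" by (subst a) (rule mem)
      show "b \<in> vec.span {s, ?v, s'}" by (subst b) (rule mem)
    qed
  next
    case 2
    let ?v = "(- 1 / \<beta>) *s a"
    have b: "b = (1 / \<beta>) *s s + 0 *s ?v + (- 1 / \<beta>) *s s'"
      using 2 by (simp add: s'(2) vec.scale_right_distrib vec.scale_minus_left)
    have a: "a = 0 *s s + (- \<beta>) *s ?v + 0 *s s'" using 2 by simp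
    show ?thesis
    proof (rule *[of ?v])
      show "B a b = B s ?v + B ?v s'" if B: "B \<in> altf" for B
        using 2 altf_skew[OF B, of b a] altf_skew[OF B, of s' a]
        by (simp add: s'(2) altf_simps[OF B] field_simps)
      show "a \<in> vec.span {s, ?v, s'}" by (subst a) (rule mem)
      show "b \<in> vec.span {s, ?v, s'}" by (subst b) (rule mem)
    qed
  next
    case 3
    then have "s \<in> vec.span (sv P)" using s' by simp
    then obtain t Q where Q: "length Q + 1 = length P" "\<And>B. B \<in> altf \<Longrightarrow> ev B P = B s t + ev B Q"
      "sv P \<subseteq> vec.span (sv ((s, t) # Q))" using 2 by blast
    have "vec.span (sv ((s, t) # Q)) \<subseteq> vec.span (sv ((s, t) # (a, b) # Q))"
      by (intro vec.span_mono) auto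
    moreover have "{a, b} \<subseteq> vec.span (sv ((s, t) # (a, b) # Q))" by (auto intro: vec.span_base)
    ultimately have "sv ((a, b) # P) \<subseteq> vec.span (sv ((s, t) # (a, b) # Q))" using Q(3) by auto
    then show ?thesis using Q by (intro exI[of _ t] exI[of _ "(a, b) # Q"]) (auto simp: algebra_simps)
  qed
qed

lemma dim_image_kill:
  fixes S :: "('a::{field,finite}^'m::finite) set"
  assumes S: "sp S" and s: "s \<in> S" "s \<noteq> 0"
    and p: "\<And>x y. p (x + y) = p x + p y" "\<And>c x. p (c *s x) = c *s p x" "p s = 0"
  shows "sp (p ` S) \<and> vec.dim (p ` S) < vec.dim S"
proof -
  have p0: "p 0 = 0" using p(2)[of 0 0] by simp
  have sub: "sp (p ` S)"
    unfolding vec.subspace_def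
  proof (intro conjI ballI allI)
    show "0 \<in> p ` S" using p0 S vec.subspace_0 by (metis image_eqI)
    show "x + y \<in> p ` S" if "x \<in> p ` S" "y \<in> p ` S" for x y
      using that S by (auto simp: p(1)[symmetric] vec.subspace_add)
    show "c *s x \<in> p ` S" if "x \<in> p ` S" for c x
      using that S by (auto simp: p(2)[symmetric] vec.subspace_scale)
  qed
  have sps: "sp (vec.span {s})" by simp
  have ss: "vec.span {s} \<subseteq> S" using S s by (intro vec.span_minimal) auto
  obtain T where T: "sp T" "T \<subseteq> S" "vec.span {s} \<inter> T = {0}"
    and gen: "\<And>x. x \<in> S \<Longrightarrow> \<exists>u\<in>vec.span {s}. \<exists>t\<in>T. x = u + t"
    and d: "vec.dim T + vec.dim (vec.span {s}) = vec.dim S"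
  proof (rule ex_complement[OF sps _ S ss])
    show "sp {0 :: 'a^'m}" by (simp add: vec.subspace_def)
    show "{0} \<subseteq> S" using S by (simp add: vec.subspace_0)
    show "vec.span {s} \<inter> {0} = {0}" by (auto simp: vec.span_zero)
  qed blast
  have "p u = 0" if "u \<in> vec.span {s}" for u
    using that vec.span_breakdown_eq[of u s "{}"] p(2,3) by auto
  then have "p x \<in> p ` T" if "x \<in> S" for x using gen[OF that] by (auto simp: p(1))
  then have im: "p ` S = p ` T" using T(2) by blast
  have "Vector_Spaces.linear (*s) (*s) p"
    by (simp add: Vector_Spaces.linear_iff p vec.vector_space_axioms)
  then have "vec.dim (p ` T) \<le> vec.dim T" by (rule vec.dim_image_le)
  moreover have "vec.dim (vec.span {s}) = 1" using s by simp
  ultimately show ?thesis using sub im d by simp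
qed

text \<open>Remove one nonzero \<open>s\<close> of \<open>S\<close> at the cost of at most one
  summand: if \<open>s\<close> lies in the span of \<open>P\<close>, rewrite the bivector as
  \<open>s \<and> t\<close> plus a shorter list \<open>Q\<close>, otherwise take
  \<open>Q = P\<close>. A projection that fixes the span of \<open>Q\<close> and kills
  \<open>s\<close> lowers the dimension of \<open>S\<close>; the form found for the image is pulled
  back along it.\<close>

lemma ex_killing_form:
  fixes P :: "(('a::{field,finite}^'m::finite) \<times> ('a^'m)) list"
  assumes "ind P" "sp S" "vec.dim S < length P"
  shows "\<exists>D\<in>altf. (\<forall>s\<in>S. \<forall>y. D s y = 0) \<and> ev D P = 1"
  using assms
proof (induction "vec.dim S" arbitrary: S P rule: less_induct)
  case less
  show ?case
  proof (cases "S \<subseteq> {0}")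
    case True
    obtain ab Q where "P = ab # Q" using less(4) by (cases P) auto
    then obtain a b where P: "P = (a, b) # Q" by (cases ab) auto
    have "ind ((a, b) # Q)" using less(2) P by simp
    then obtain D where "D \<in> altf" "D a b = 1" "ev D Q = 0" by (rule ex_form_value)
    then show ?thesis using True P by (intro bexI[of _ D]) (auto simp: altf_simps)
  next
    case False
    then obtain s where s: "s \<in> S" "s \<noteq> 0" by blast
    have *: "\<exists>D\<in>altf. (\<forall>s\<in>S. \<forall>y. D s y = 0) \<and> ev D Q = 1"
      if Q: "ind Q" "s \<notin> vec.span (sv Q)" "vec.dim S \<le> length Q" for Q
    proof -
      have sp1: "sp (vec.span {s})" by simp
      have dis: "vec.span (sv Q) \<inter> vec.span {s} = {0}"
      proof -
        have "x = 0" if x: "x \<in> vec.span (sv Q)" "x \<in> vec.span {s}" for x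
        proof -
          obtain c where c: "x = c *s s" using x(2) vec.span_breakdown_eq[of x s "{}"] by auto
          show ?thesis
          proof (cases "c = 0")
            case False
            then have "s = (1 / c) *s x" using c by simp
            then show ?thesis using Q(2) vec.span_scale[OF x(1), of "1 / c"] by simp
          qed (use c in simp)
        qed
        then show ?thesis using vec.span_zero by blast
      qed
      obtain p where p: "\<And>x y. p (x + y) = p x + p y" "\<And>c x. p (c *s x) = c *s p x"
        "\<And>x. x \<in> vec.span (sv Q) \<Longrightarrow> p x = x" "\<And>x. x \<in> vec.span {s} \<Longrightarrow> p x = 0"
        by (rule ex_projection[OF vec.subspace_span sp1 dis]) blast
      have ps: "p s = 0" using p(4) by (simp add: vec.span_base)
      have im: "sp (p ` S)" "vec.dim (p ` S) < vec.dim S" using dim_image_kill[OF less(3) s p(1,2) ps] by auto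
      have "vec.dim (p ` S) < length Q" using im(2) Q(3) by simp
      from less(1)[OF im(2) Q(1) im(1) this] obtain D
        where D: "D \<in> altf" "\<And>s y. s \<in> p ` S \<Longrightarrow> D s y = 0" "ev D Q = 1" by blast
      define D' where "D' = (\<lambda>x y. D (p x) (p y))"
      have "D' \<in> altf" using D(1) by (simp add: altf_def D'_def p)
      moreover have "eqon (vec.span (sv Q)) D' D" by (simp add: eqon_def D'_def p)
      then have "ev D' Q = 1" using ev_cong[of "vec.span (sv Q)" D' D Q] D(3) vec.span_superset[of "sv Q"] by simp
      moreover have "\<forall>s\<in>S. \<forall>y. D' s y = 0" using D(2) by (simp add: D'_def)
      ultimately show ?thesis by blast
    qed
    show ?thesis
    proof (cases "s \<in> vec.span (sv P)")
      case False
      then show ?thesis using * less by simp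
    next
      case True
      then obtain t Q where Q: "length Q + 1 = length P" "\<And>B. B \<in> altf \<Longrightarrow> ev B P = B s t + ev B Q"
        "sv P \<subseteq> vec.span (sv ((s, t) # Q))" using extract_vector s by blast
      have "vec.dim (sv P) \<le> vec.dim (sv ((s, t) # Q))" using Q(3) by (rule vec.dim_mono)
      then have "ind ((s, t) # Q)" using less(2) Q(1) dim_sv_le[of "(s, t) # Q"] by (simp add: ind_def)
      then have "ind Q" "s \<notin> vec.span (sv Q)" by (auto simp: ind_Cons)
      from *[OF this] obtain D where D: "D \<in> altf" "\<forall>s\<in>S. \<forall>y. D s y = 0" "ev D Q = 1"
        using Q(1) less(4) by auto
      then have "ev D P = 1" using Q(2)[OF D(1)] s by simp
      then show ?thesis using D by blast
    qed
  qed
qed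

section \<open>Hyperbolic planes and nonsingular completions\<close>

lemma nonsing_sum:
  assumes D: "D \<in> altf" and S: "nonsing S D" "0 \<in> S" and T: "nonsing T D" "0 \<in> T"
    and orth: "\<And>s t. s \<in> S \<Longrightarrow> t \<in> T \<Longrightarrow> D s t = 0"
  shows "nonsing {x + y |x y. x \<in> S \<and> y \<in> T} D"
  unfolding nonsing_def
proof (intro ballI impI)
  fix v assume "v \<in> {x + y |x y. x \<in> S \<and> y \<in> T}"
    and z: "\<forall>y\<in>{x + y |x y. x \<in> S \<and> y \<in> T}. D v y = 0"
  then obtain s t where st: "v = s + t" "s \<in> S" "t \<in> T" by blast
  have "D s y = 0" if "y \<in> S" for y
  proof -
    have "y + 0 \<in> {x + y |x y. x \<in> S \<and> y \<in> T}" using that T by blast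
    then have "D v y = 0" using z by auto
    moreover have "D t y = 0" using orth[OF that st(3)] altf_skew[OF D, of t y] by simp
    ultimately show ?thesis using st altfD(1)[OF D] by simp
  qed
  then have "s = 0" using S st unfolding nonsing_def by blast
  moreover have "D t y = 0" if "y \<in> T" for y
  proof -
    have "0 + y \<in> {x + y |x y. x \<in> S \<and> y \<in> T}" using that S by blast
    then have "D v y = 0" using z by auto
    then show ?thesis using altfD(1)[OF D, of s t y] st orth[OF st(2) that] by simp
  qed
  then have "t = 0" using T st unfolding nonsing_def by blast
  ultimately show "v = 0" using st by simp
qed

lemma hyperbolic_split:
  fixes U :: "('a::{field,finite}^'m::finite) set"
  assumes U: "sp U" and D: "D \<in> altf" and u: "u \<in> U" and e: "e \<in> U" "D u e \<noteq> 0"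
    and S_def: "S = vec.span {u, e}" and W_def: "W = {x \<in> U. D u x = 0 \<and> D e x = 0}"
  shows "sp W" "S \<inter> W = {0}" "{x + y |x y. x \<in> S \<and> y \<in> W} = U" "vec.dim W + 2 = vec.dim U"
    "\<And>s w. s \<in> S \<Longrightarrow> w \<in> W \<Longrightarrow> D s w = 0"
proof -
  have S: "sp S" by (simp add: S_def)
  have SU: "S \<subseteq> U" unfolding S_def by (intro vec.span_minimal) (use u e U in auto)
  show W: "sp W" unfolding W_def using U D by (auto simp: vec.subspace_def altf_simps)
  show SW: "S \<inter> W = {0}"
  proof -
    have "x = 0" if "x \<in> S" "x \<in> W" for x
    proof -
      have "D x y = 0" if "y \<in> S" for y
      proof -
        have y: "y \<in> vec.span {u, e}" using that by (simp add: S_def)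
        have sx: "sp {y. D x y = 0}" using D by (auto simp: vec.subspace_def altf_simps)
        have "{u, e} \<subseteq> {y. D x y = 0}"
          using \<open>x \<in> W\<close>[unfolded W_def] altf_skew[OF D, of x u] altf_skew[OF D, of x e] by simp
        then have "vec.span {u, e} \<subseteq> {y. D x y = 0}" using sx by (intro vec.span_minimal)
        then show ?thesis using y by blast
      qed
      then show ?thesis using nonsing_pair[OF D e(2)] \<open>x \<in> S\<close> unfolding nonsing_def S_def by blast
    qed
    moreover have "0 \<in> S \<inter> W" using S W vec.subspace_0 by blast
    ultimately show ?thesis by blast
  qed
  show gen: "{x + y |x y. x \<in> S \<and> y \<in> W} = U"
  proof
    show "{x + y |x y. x \<in> S \<and> y \<in> W} \<subseteq> U" using SU U unfolding W_def by (auto intro: vec.subspace_add)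
    show "U \<subseteq> {x + y |x y. x \<in> S \<and> y \<in> W}"
    proof
      fix x assume x: "x \<in> U"
      let ?s = "(D x e / D u e) *s u + (- D x u / D u e) *s e"
      have s: "?s \<in> S" unfolding S_def by (intro vec.span_add vec.span_scale vec.span_base) auto
      have "x - ?s \<in> W"
      proof -
        have "D u (x - ?s) = 0" "D e (x - ?s) = 0" using e altf_skew[OF D, of x u] altf_skew[OF D, of x e] altf_skew[OF D, of e u]
          by (simp_all add: altf_simps[OF D])
        moreover have "x - ?s \<in> U" using x s SU U by (meson subsetD vec.subspace_diff)
        ultimately show ?thesis by (simp add: W_def)
      qed
      moreover have "x = ?s + (x - ?s)" by simp
      ultimately show "x \<in> {x + y |x y. x \<in> S \<and> y \<in> W}" using s by blast
    qed
  qed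
  have "u \<noteq> 0" using e D by (auto simp: altf_simps)
  moreover have "e \<notin> vec.span {u}"
    using e D vec.span_breakdown_eq[of e u "{}"] by (auto simp: altf_simps)
  ultimately have "vec.dim S = 2" by (simp add: S_def vec.dim_insert insert_commute)
  moreover have "vec.dim U + vec.dim (S \<inter> W) = vec.dim S + vec.dim W"
    using dim_sum_Int[OF S W] gen by simp
  ultimately show "vec.dim W + 2 = vec.dim U" using SW by simp
  show "D s w = 0" if "s \<in> S" "w \<in> W" for s w
  proof -
    have "sp {y. D y w = 0}" using D by (auto simp: vec.subspace_def altf_simps)
    moreover have "{u, e} \<subseteq> {y. D y w = 0}" using that(2) by (simp add: W_def)
    ultimately have "vec.span {u, e} \<subseteq> {y. D y w = 0}" by (intro vec.span_minimal)
    then show ?thesis using that(1) S_def by blast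
  qed
qed

text \<open>Keep \<open>D\<close> on the hyperbolic plane of \<open>u\<close> and \<open>e\<close>
  and replace it by a nonsingular form on the orthogonal complement, which has even dimension. Both
  forms have the same contraction with \<open>u\<close>, so the correction has \<open>u\<close> in
  its radical on \<open>U\<close>.\<close>

lemma ex_nonsing_completion:
  fixes U :: "('a::{field,finite}^'m::finite) set"
  assumes U: "sp U" "even (vec.dim U)" and D: "D \<in> altf" and u: "u \<in> U" and e: "e \<in> U" "D u e \<noteq> 0"
  shows "\<exists>D'\<in>altf. (\<forall>y\<in>U. D' u y = 0) \<and> nonsing U (D + D')"
proof -
  define S where "S = vec.span {u, e}"
  define W where "W = {x \<in> U. D u x = 0 \<and> D e x = 0}"
  have S: "sp S" by (simp add: S_def)
  note hs = hyperbolic_split[OF U(1) D u e S_def W_def]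
  note W = hs(1) and SW = hs(2) and gen = hs(3)
  have "even (vec.dim W)" using U(2) hs(4)[symmetric] by simp
  then obtain C where C: "C \<in> altf" "nonsing W C" using ex_nonsing[OF W] by blast
  obtain F where F: "F \<in> altf" "eqon S F D" "eqon W F C" "\<And>s t. s \<in> S \<Longrightarrow> t \<in> W \<Longrightarrow> F s t = 0"
    "nonsing S D \<Longrightarrow> nonsing W C \<Longrightarrow> nonsing {x + y |x y. x \<in> S \<and> y \<in> W} F"
    by (rule block_sum[OF S W SW D C(1)]) blast
  have "nonsing U F" using F(5) C(2) nonsing_pair[OF D e(2)] gen by (simp add: S_def)
  moreover have "(F - D) u y = 0" if yU: "y \<in> U" for y
  proof -
    obtain s w where sw: "s \<in> S" "w \<in> W" "y = s + w" using gen yU by blast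
    have "u \<in> S" by (simp add: S_def vec.span_base)
    then have "F u s = D u s" "F u w = 0" "D u w = 0" using F(2,4) sw by (auto simp: eqon_def W_def)
    then show ?thesis by (simp add: sw altf_simps[OF F(1)] altf_simps[OF D])
  qed
  moreover have "D + (F - D) = F" by simp
  ultimately show ?thesis using F(1) D altf_diff by metis
qed

subsection \<open>Families of pairwise intersecting lines\<close>

definition isline :: "('a::field^'m) set \<Rightarrow> bool" where
  "isline J \<longleftrightarrow> sp J \<and> vec.dim J = 2"

definition ssum :: "('a::field^'m) set \<Rightarrow> ('a^'m) set \<Rightarrow> ('a^'m) set" where
  "ssum S T = {x + y |x y. x \<in> S \<and> y \<in> T}"

lemma sp_ssum: "sp S \<Longrightarrow> sp T \<Longrightarrow> sp (ssum S T)"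
  unfolding ssum_def by (rule vec.subspace_sums)

lemma ssum_upper:
  assumes "sp S" "sp T"
  shows "S \<subseteq> ssum S T" "T \<subseteq> ssum S T"
proof -
  have "0 \<in> S" "0 \<in> T" using assms by (auto simp: vec.subspace_0)
  then show "S \<subseteq> ssum S T" "T \<subseteq> ssum S T"
    unfolding ssum_def by (force, force)
qed

lemma ssum_least: "sp U \<Longrightarrow> S \<subseteq> U \<Longrightarrow> T \<subseteq> U \<Longrightarrow> ssum S T \<subseteq> U"
  unfolding ssum_def using vec.subspace_add by blast

lemma dim_ssum: "sp S \<Longrightarrow> sp T \<Longrightarrow> vec.dim (ssum S T) + vec.dim (S \<inter> T) = vec.dim S + vec.dim T"
  unfolding ssum_def by (rule dim_sum_Int)

lemma sp_Int: "sp S \<Longrightarrow> sp T \<Longrightarrow> sp (S \<inter> T)" by (rule vec.subspace_inter)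

lemma sp_eqI: "sp S \<Longrightarrow> sp T \<Longrightarrow> S \<subseteq> T \<Longrightarrow> vec.dim T \<le> vec.dim S \<Longrightarrow> S = T"
  by (rule vec.subspace_dim_equal)

lemma dim_0_iff: "sp S \<Longrightarrow> vec.dim S = 0 \<longleftrightarrow> S = {0}"
  using vec.subspace_0[of S] by (auto simp: subset_singleton_iff)

lemma islineD: "isline J \<Longrightarrow> sp J" "isline J \<Longrightarrow> vec.dim J = 2"
  by (auto simp: isline_def)

lemma isline_span:
  fixes a b :: "'a::{field,finite}^'m::finite"
  shows "isline (vec.span {a, b}) \<longleftrightarrow> ind [(a, b)]"
  by (simp add: isline_def ind_def)

lemma isline_basis:
  fixes J :: "('a::{field,finite}^'m::finite) set"
  assumes "isline J"
  obtains a b where "a \<in> J" "b \<in> J" "ind [(a, b)]" "J = vec.span {a, b}"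
proof -
  obtain Q where Q: "ind Q" "sv Q \<subseteq> J" "length Q = 1"
    using ind_extend[of "[]" J 1] assms by (auto simp: isline_def)
  obtain ab where ab: "Q = [ab]" using Q(3) by (cases Q) auto
  obtain a b where "ab = (a, b)" by (cases ab)
  then have "Q = [(a, b)]" using ab by simp
  moreover have "vec.span (sv Q) = J"
    using ind_span_eq[OF Q(1,2) islineD(1)[OF assms]] islineD(2)[OF assms] Q(3) by simp
  ultimately have "a \<in> J" "b \<in> J" "ind [(a, b)]" "J = vec.span {a, b}" using Q(1,2) by simp_all
  then show ?thesis by (rule that)
qed

lemma distinct_lines_Int:
  fixes J K :: "('a::{field,finite}^'m::finite) set"
  assumes J: "isline J" and K: "isline K" and ne: "J \<noteq> K" "J \<inter> K \<noteq> {0}"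
  shows "vec.dim (J \<inter> K) = 1"
proof -
  have s: "sp (J \<inter> K)" using islineD(1)[OF J] islineD(1)[OF K] by (rule sp_Int)
  have "vec.dim (J \<inter> K) \<noteq> 0" using ne(2) dim_0_iff[OF s] by blast
  moreover have "\<not> 2 \<le> vec.dim (J \<inter> K)"
  proof
    assume 2: "2 \<le> vec.dim (J \<inter> K)"
    have "J \<inter> K = J" by (rule sp_eqI[OF s islineD(1)[OF J]]) (use 2 islineD(2)[OF J] in auto)
    moreover have "J \<inter> K = K" by (rule sp_eqI[OF s islineD(1)[OF K]]) (use 2 islineD(2)[OF K] in auto)
    ultimately show False using ne by blast
  qed
  ultimately show ?thesis by linarith
qed

lemma line_in_plane:
  fixes J K L :: "('a::{field,finite}^'m::finite) set"
  assumes J: "isline J" and K: "isline K" and L: "isline L"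
    and JK: "J \<inter> K \<noteq> {0}" and JL: "J \<inter> L \<noteq> {0}" and KL: "J \<inter> K \<inter> L = {0}"
  shows "J \<subseteq> ssum K L"
proof -
  have s: "sp J" "sp K" "sp L" using J K L by (auto simp: isline_def)
  obtain p where p: "p \<in> J" "p \<in> K" "p \<noteq> 0" using JK s by (auto simp: vec.subspace_0)
  obtain q where q: "q \<in> J" "q \<in> L" "q \<noteq> 0" using JL s by (auto simp: vec.subspace_0)
  have "q \<notin> vec.span {p}"
  proof
    assume "q \<in> vec.span {p}"
    then have "q \<in> K" using p(2) s(2) vec.span_minimal[of "{p}" K] by auto
    then show False using q KL by auto
  qed
  then have "ind [(p, q)]" using p(3) by (simp add: ind_Cons)
  then have "vec.span (sv [(p, q)]) = J"
    by (rule ind_span_eq) (use p q s J in \<open>auto simp: isline_def\<close>)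
  moreover have "vec.span (sv [(p, q)]) \<subseteq> ssum K L"
    using p q ssum_upper[OF s(2,3)] by (intro vec.span_minimal sp_ssum s) auto
  ultimately show ?thesis by simp
qed

text \<open>Suppose neither alternative holds. Two of the lines, \<open>J0\<close> and
  \<open>J1\<close>, meet in \<open>u\<close> and span \<open>A\<close>; a line \<open>J3\<close>
  outside \<open>A\<close> must pass through \<open>u\<close>, and a line \<open>J4\<close> that
  misses \<open>u\<close> must lie in \<open>A\<close>. As \<open>J4\<close> also meets
  \<open>J0\<close> and \<open>J3\<close> in different points, it lies in \<open>J0 + J3\<close>,
  which meets \<open>A\<close> only in \<open>J0\<close>, so \<open>J4 = J0\<close> contains
  \<open>u\<close>.\<close>

lemma pairwise_meeting_lines:
  fixes F :: "('a::{field,finite}^'m::finite) set set"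
  assumes lines: "\<And>J. J \<in> F \<Longrightarrow> isline J" and meet: "\<And>J K. J \<in> F \<Longrightarrow> K \<in> F \<Longrightarrow> J \<inter> K \<noteq> {0}"
    and J0: "J0 \<in> F" and U: "sp U" "\<And>J. J \<in> F \<Longrightarrow> J \<subseteq> U"
  shows "(\<exists>u\<in>U. u \<noteq> 0 \<and> (\<forall>J\<in>F. u \<in> J)) \<or> (\<exists>A. sp A \<and> A \<subseteq> U \<and> vec.dim A = 3 \<and> (\<forall>J\<in>F. J \<subseteq> A))"
proof (cases "\<forall>J\<in>F. J = J0")
  case True
  have "J0 \<noteq> {0}" using meet[OF J0 J0] by simp
  moreover have "0 \<in> J0" using islineD(1)[OF lines[OF J0]] by (rule vec.subspace_0)
  ultimately obtain u where "u \<in> J0" "u \<noteq> 0" by blast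
  then show ?thesis using True U J0 by blast
next
  case False
  then obtain J1 where J1: "J1 \<in> F" "J1 \<noteq> J0" by blast
  note l0 = lines[OF J0] and l1 = lines[OF J1(1)]
  note s0 = islineD(1)[OF l0] and s1 = islineD(1)[OF l1]
  have d: "vec.dim (J0 \<inter> J1) = 1" using distinct_lines_Int[OF l0 l1] J1 meet J0 by blast
  define A where "A = ssum J0 J1"
  have A: "sp A" "vec.dim A = 3" "A \<subseteq> U" "J0 \<subseteq> A" "J1 \<subseteq> A"
    using dim_ssum[OF s0 s1] d islineD(2)[OF l0] islineD(2)[OF l1] sp_ssum[OF s0 s1]
      ssum_least[OF U(1), of J0 J1] U(2) J0 J1 ssum_upper[OF s0 s1] by (auto simp: A_def)
  have sI: "sp (J0 \<inter> J1)" using s0 s1 by (rule sp_Int)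
  obtain u where u: "u \<in> J0" "u \<in> J1" "u \<noteq> 0"
  proof -
    have "J0 \<inter> J1 \<noteq> {0}" using d dim_0_iff[OF sI] by simp
    then show ?thesis using that vec.subspace_0[OF sI] by blast
  qed
  have uI: "x \<in> vec.span {u}" if "x \<in> J0 \<inter> J1" for x
  proof -
    have "vec.span {u} \<subseteq> J0 \<inter> J1" using u by (intro vec.span_minimal sI) simp
    from sp_eqI[OF vec.subspace_span sI this] have "vec.span {u} = J0 \<inter> J1" using d u by simp
    then show ?thesis using that by simp
  qed
  show ?thesis
  proof (rule ccontr)
    assume neg: "\<not> ?thesis"
    then obtain J3 where J3: "J3 \<in> F" "\<not> J3 \<subseteq> A" using A by blast
    obtain J4 where J4: "J4 \<in> F" "u \<notin> J4" using neg u U J0 by blast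
    note l3 = lines[OF J3(1)] and l4 = lines[OF J4(1)]
    note s3 = islineD(1)[OF l3] and s4 = islineD(1)[OF l4]
    have triv: "J \<inter> J0 \<inter> J1 = {0}" if "u \<notin> J" "sp J" for J
    proof -
      have "x = 0" if x: "x \<in> J" "x \<in> J0" "x \<in> J1" for x
      proof (rule ccontr)
        assume "x \<noteq> 0"
        obtain c where c: "x = c *s u" using uI x vec.span_breakdown_eq[of x u "{}"] by auto
        then have "u = (1 / c) *s x" using \<open>x \<noteq> 0\<close> by (cases "c = 0") auto
        then show False using \<open>u \<notin> J\<close> x(1) \<open>sp J\<close> by (metis vec.subspace_scale)
      qed
      then show ?thesis using that s0 s1 by (auto simp: vec.subspace_0)
    qed
    have uJ3: "u \<in> J3"
    proof (rule ccontr)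
      assume "u \<notin> J3"
      then have "J3 \<subseteq> A" unfolding A_def
        using line_in_plane[OF l3 l0 l1] triv s3 meet J0 J1 J3 by blast
      then show False using J3 by blast
    qed
    have J4A: "J4 \<subseteq> A" unfolding A_def
      using line_in_plane[OF l4 l0 l1] triv[OF J4(2) s4] meet J0 J1 J4 by blast
    have d3: "vec.dim (J3 \<inter> A) < 2"
    proof (rule ccontr)
      assume "\<not> ?thesis"
      then have "J3 \<inter> A = J3" by (intro sp_eqI sp_Int s3 A) (use l3 in \<open>auto simp: isline_def\<close>)
      then show False using J3 by blast
    qed
    have J3A: "x \<in> J0" if x: "x \<in> J3" "x \<in> A" for x
    proof -
      have sJA: "sp (J3 \<inter> A)" using s3 A(1) by (rule sp_Int)
      have "u \<in> A" using u A by blast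
      then have "vec.span {u} \<subseteq> J3 \<inter> A" using uJ3 by (intro vec.span_minimal sJA) simp
      from sp_eqI[OF vec.subspace_span sJA this] have "vec.span {u} = J3 \<inter> A" using d3 u by simp
      then have "x \<in> vec.span {u}" using x by blast
      also have "\<dots> \<subseteq> J0" using u s0 by (intro vec.span_minimal) auto
      finally show ?thesis .
    qed
    have "J0 \<inter> J3 \<inter> J4 = {0}"
    proof -
      have "J0 \<inter> J3 = vec.span {u}"
      proof (rule sym, rule sp_eqI)
        show "vec.span {u} \<subseteq> J0 \<inter> J3" using u uJ3 s0 s3 by (intro vec.span_minimal sp_Int) auto
        show "vec.dim (J0 \<inter> J3) \<le> vec.dim (vec.span {u})"
          using distinct_lines_Int[OF l0 l3] J3 A(4) meet[OF J0 J3(1)] u by auto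
      qed (use s0 s3 in \<open>auto intro: sp_Int\<close>)
      moreover have "x = 0" if x: "x \<in> vec.span {u}" "x \<in> J4" for x
      proof (rule ccontr)
        assume "x \<noteq> 0"
        obtain c where c: "x = c *s u" using x(1) vec.span_breakdown_eq[of x u "{}"] by auto
        then have "u = (1 / c) *s x" using \<open>x \<noteq> 0\<close> by (cases "c = 0") auto
        then show False using J4(2) x(2) s4 by (metis vec.subspace_scale)
      qed
      ultimately show ?thesis using s4 by (auto simp: vec.subspace_0 vec.span_zero)
    qed
    then have "J4 \<subseteq> ssum J0 J3"
      using line_in_plane[OF l4 l0 l3] meet J0 J3 J4 by (simp add: Int_ac)
    then have "J4 \<subseteq> J0"
    proof (intro subsetI)
      fix x assume sub: "J4 \<subseteq> ssum J0 J3" and x: "x \<in> J4"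
      then obtain a c where ac: "x = a + c" "a \<in> J0" "c \<in> J3" unfolding ssum_def by blast
      have "c = x - a" using ac by simp
      then have "c \<in> A" using x J4A ac A by (metis subsetD vec.subspace_diff)
      then show "x \<in> J0" using ac J3A s0 by (simp add: vec.subspace_add)
    qed
    then have "J4 = J0" by (intro sp_eqI s4 s0) (use l4 l0 in \<open>auto simp: isline_def\<close>)
    then show False using J4 u by blast
  qed
qed

text \<open>Dual of \<open>pairwise_meeting_lines\<close>, proved on subspaces of codimension two:
  distinct ones span a hyperplane and meet in codimension three. A member outside
  \<open>r0 + r1\<close> contains \<open>r0 \<inter> r1\<close>, a member that does not contain it
  lies in \<open>r0 + r1\<close>, and having one of each forces the latter to equal
  \<open>r0\<close>.\<close>

lemma pairwise_codim2:
  fixes F :: "('a::{field,finite}^'m::finite) set set"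
  assumes F: "\<And>r. r \<in> F \<Longrightarrow> sp r" "\<And>r. r \<in> F \<Longrightarrow> r \<subseteq> U" "\<And>r. r \<in> F \<Longrightarrow> vec.dim r + 2 = vec.dim U"
    and meet: "\<And>r s. r \<in> F \<Longrightarrow> s \<in> F \<Longrightarrow> ssum r s \<noteq> U"
    and r0: "r0 \<in> F" and U: "sp U" and ne: "\<And>r. r \<in> F \<Longrightarrow> 3 \<le> vec.dim U"
  shows "(\<exists>A. sp A \<and> A \<subseteq> U \<and> vec.dim A + 1 = vec.dim U \<and> (\<forall>r\<in>F. r \<subseteq> A)) \<or>
    (\<exists>R. sp R \<and> R \<subseteq> U \<and> vec.dim R + 3 = vec.dim U \<and> (\<forall>r\<in>F. R \<subseteq> r))"
proof (cases "\<forall>r\<in>F. r = r0")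
  case True
  have "\<not> U \<subseteq> r0" using F(1,3)[OF r0] vec.dim_subset[of U r0] by auto
  then obtain x where x: "x \<in> U" "x \<notin> r0" by blast
  let ?A = "vec.span (insert x r0)"
  have "x \<notin> vec.span r0" unfolding span_eq_subspace[OF F(1)[OF r0]] by (rule x(2))
  then have "vec.dim ?A + 1 = vec.dim U" using F(3)[OF r0] by (simp add: vec.dim_insert)
  moreover have "?A \<subseteq> U" using x F(2)[OF r0] U by (intro vec.span_minimal) auto
  moreover have "r0 \<subseteq> ?A" by (meson subset_insertI subset_trans vec.span_superset)
  ultimately show ?thesis using True vec.subspace_span by blast
next
  case False
  then obtain r1 where r1: "r1 \<in> F" "r1 \<noteq> r0" by blast
  have hyper: "vec.dim (ssum r s) + 1 = vec.dim U" if "r \<in> F" "s \<in> F" "r \<noteq> s" for r s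
  proof -
    have rs: "sp r" "sp s" "vec.dim r + 2 = vec.dim U" "vec.dim s + 2 = vec.dim U" using F that by auto
    have "vec.dim (ssum r s) \<noteq> vec.dim U"
    proof
      assume "vec.dim (ssum r s) = vec.dim U"
      then have "ssum r s = U" by (intro sp_eqI sp_ssum ssum_least rs U) (use F that in auto)
      then show False using meet that by blast
    qed
    moreover have "vec.dim (ssum r s) \<le> vec.dim U" using F that U by (intro vec.dim_subset ssum_least) auto
    moreover have "vec.dim (ssum r s) \<noteq> vec.dim r"
    proof
      assume d: "vec.dim (ssum r s) = vec.dim r"
      then have "r = ssum r s" by (intro sp_eqI sp_ssum rs) (use ssum_upper[OF rs(1,2)] in auto)
      moreover have "s = ssum r s" by (intro sp_eqI sp_ssum rs) (use ssum_upper[OF rs(1,2)] d rs in auto)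
      ultimately show False using that by simp
    qed
    moreover have "vec.dim r \<le> vec.dim (ssum r s)" using ssum_upper[OF rs(1,2)] by (intro vec.dim_subset) auto
    ultimately show ?thesis using rs by linarith
  qed
  have codim3: "vec.dim (r \<inter> s) + 3 = vec.dim U" if "r \<in> F" "s \<in> F" "r \<noteq> s" for r s
    using dim_ssum[OF F(1)[OF that(1)] F(1)[OF that(2)]] hyper[OF that] F(3)[OF that(1)] F(3)[OF that(2)]
    by linarith
  \<comment> \<open>If \<open>x\<close> lies in \<open>r\<close> and \<open>s\<close> but not in
    \<open>t\<close>, then \<open>t\<close> and \<open>x\<close> span a hyperplane, which must equal
    both \<open>t + r\<close> and \<open>t + s\<close>, hence also \<open>r + s\<close>.\<close>
  have below: "t \<subseteq> ssum r s" if t: "t \<in> F" and rs: "r \<in> F" "s \<in> F" "r \<noteq> s" and n: "\<not> r \<inter> s \<subseteq> t" for r s t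
  proof -
    obtain x where x: "x \<in> r" "x \<in> s" "x \<notin> t" using n by blast
    have st: "sp r" "sp s" "sp t" "vec.span t = t" using F t rs span_eq_subspace by auto
    let ?H = "vec.span (insert x t)"
    have "x \<notin> vec.span t" unfolding st(4) by (rule x(3))
    then have dH: "vec.dim ?H + 1 = vec.dim U" using F(3)[OF t] by (simp add: vec.dim_insert)
    have "?H = ssum t q" if q: "q \<in> F" "x \<in> q" for q
    proof (rule sp_eqI)
      show "?H \<subseteq> ssum t q" using q ssum_upper[OF st(3) F(1)[OF q(1)]]
        by (intro vec.span_minimal sp_ssum st F(1) q) auto
      have "t \<noteq> q" using x q by blast
      then show "vec.dim (ssum t q) \<le> vec.dim ?H" using hyper[OF t q(1)] dH by simp
    qed (auto intro: sp_ssum st F(1) q)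
    then have "?H = ssum t r" "?H = ssum t s" using rs x by auto
    then have "r \<subseteq> ?H" "s \<subseteq> ?H" using ssum_upper[OF st(3,1)] ssum_upper[OF st(3,2)] by simp_all
    then have "ssum r s \<subseteq> ?H" by (intro ssum_least vec.subspace_span)
    then have "ssum r s = ?H" by (intro sp_eqI sp_ssum st) (use hyper[OF rs] dH in auto)
    moreover have "t \<subseteq> ?H" by (meson subset_insertI subset_trans vec.span_superset)
    ultimately show ?thesis by simp
  qed
  have n01: "r0 \<noteq> r1" using r1 by simp
  let ?A = "ssum r0 r1" and ?R = "r0 \<inter> r1"
  have s01: "sp r0" "sp r1" using F r0 r1 by auto
  show ?thesis
  proof (rule ccontr)
    assume neg: "\<not> ?thesis"
    have "sp ?A \<and> ?A \<subseteq> U \<and> vec.dim ?A + 1 = vec.dim U"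
      using hyper[OF r0 r1(1) n01] ssum_least[OF U F(2)[OF r0] F(2)[OF r1(1)]] sp_ssum[OF s01] by simp
    then obtain r3 where r3: "r3 \<in> F" "\<not> r3 \<subseteq> ?A" using neg by blast
    have "sp ?R \<and> ?R \<subseteq> U \<and> vec.dim ?R + 3 = vec.dim U"
      using codim3[OF r0 r1(1) n01] F(2)[OF r0] sp_Int[OF s01] by blast
    then obtain r4 where r4: "r4 \<in> F" "\<not> ?R \<subseteq> r4" using neg by blast
    have R3: "?R \<subseteq> r3" using below[OF r3(1) r0 r1(1) n01] r3(2) by blast
    have A4: "r4 \<subseteq> ?A" using below[OF r4(1) r0 r1(1) n01] r4(2) by blast
    have n03: "r0 \<noteq> r3" using r3(2) ssum_upper[OF s01] by blast
    have s3: "sp r3" using F r3 by auto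
    have "\<not> r0 \<inter> r3 \<subseteq> r4" using R3 r4(2) by blast
    then have B4: "r4 \<subseteq> ssum r0 r3" by (rule below[OF r4(1) r0 r3(1) n03])
    let ?I = "?A \<inter> ssum r0 r3"
    have sI: "sp ?I" by (intro sp_Int sp_ssum s01 s3)
    have "vec.dim ?I < vec.dim ?A"
    proof (rule ccontr)
      assume "\<not> ?thesis"
      then have "?I = ?A" by (intro sp_eqI sI sp_ssum s01) auto
      then have "?A \<subseteq> ssum r0 r3" by blast
      then have "?A = ssum r0 r3" by (intro sp_eqI sp_ssum s01 s3) (use hyper[OF r0 r1(1) n01] hyper[OF r0 r3(1) n03] in auto)
      then show False using r3(2) ssum_upper[OF s01(1) s3] by blast
    qed
    moreover have "r0 \<subseteq> ?I" using ssum_upper[OF s01] ssum_upper[OF s01(1) s3] by blast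
    ultimately have "r0 = ?I" by (intro sp_eqI s01 sI) (use hyper[OF r0 r1(1) n01] F(3)[OF r0] in auto)
    then have "r4 \<subseteq> r0" using A4 B4 by blast
    then have "r4 = r0" by (intro sp_eqI F(1) r4 r0) (use F(3)[OF r4(1)] F(3)[OF r0] in auto)
    then show False using r4 by blast
  qed
qed

subsection \<open>Radicals\<close>

definition rad :: "('a::field^'m) set \<Rightarrow> ('a^'m \<Rightarrow> 'a^'m \<Rightarrow> 'a) \<Rightarrow> ('a^'m) set" where
  "rad U D = {x \<in> U. \<forall>y\<in>U. D x y = 0}"

lemma sp_rad: "sp U \<Longrightarrow> D \<in> altf \<Longrightarrow> sp (rad U D)"
  by (auto simp: rad_def vec.subspace_def altf_simps)

lemma rad_subset: "rad U D \<subseteq> U" by (auto simp: rad_def)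

lemma nonsing_mod_rad:
  assumes D: "D \<in> altf" and M: "M \<inter> rad U D = {0}" "M \<subseteq> U"
    and gen: "\<And>x. x \<in> U \<Longrightarrow> \<exists>s\<in>rad U D. \<exists>t\<in>M. x = s + t"
  shows "nonsing M D"
  unfolding nonsing_def
proof (intro ballI impI)
  fix x assume x: "x \<in> M" "\<forall>y\<in>M. D x y = 0"
  have "D x y = 0" if y: "y \<in> U" for y
  proof -
    obtain s t where st: "s \<in> rad U D" "t \<in> M" "y = s + t" using gen[OF y] by blast
    have "D s x = 0" using st(1) x M(2) by (auto simp: rad_def)
    then show ?thesis using x st altf_skew[OF D, of x s] by (simp add: altf_simps[OF D])
  qed
  then have "x \<in> rad U D" using x M(2) by (auto simp: rad_def)
  then show "x = 0" using x M(1) by blast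
qed

text \<open>Equivalently, \<open>D\<close> has rank at most two on \<open>U\<close>.\<close>

definition noquad :: "('a::field^'m) set \<Rightarrow> ('a^'m \<Rightarrow> 'a^'m \<Rightarrow> 'a) \<Rightarrow> bool" where
  "noquad U D \<longleftrightarrow> (\<forall>M. sp M \<longrightarrow> M \<subseteq> U \<longrightarrow> vec.dim M = 4 \<longrightarrow> \<not> nonsing M D)"

text \<open>Split off a hyperbolic plane. A nonzero value of \<open>D\<close> on its orthogonal
  complement would give a second one, hence a nonsingular subspace of dimension four; so the
  complement is the radical.\<close>

lemma noquad_rad:
  fixes U :: "('a::{field,finite}^'m::finite) set"
  assumes U: "sp U" and D: "D \<in> altf" and nq: "noquad U D" and nz: "\<not> eqon U D 0"
  shows "vec.dim (rad U D) + 2 = vec.dim U"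
proof -
  obtain a b where ab: "a \<in> U" "b \<in> U" "D a b \<noteq> 0" using nz by (auto simp: eqon_def)
  define S where "S = vec.span {a, b}"
  define W where "W = {x \<in> U. D a x = 0 \<and> D b x = 0}"
  note hs = hyperbolic_split[OF U D ab S_def W_def]
  have nS: "nonsing S D" unfolding S_def by (rule nonsing_pair[OF D ab(3)])
  have dS: "vec.dim S = 2"
    using dim_sum_Int[of S W] hs by (simp add: S_def)
  have zW: "D c e = 0" if ce: "c \<in> W" "e \<in> W" for c e
  proof (rule ccontr)
    assume nz: "D c e \<noteq> 0"
    let ?T = "vec.span {c, e}"
    have TW: "?T \<subseteq> W" using ce hs(1) by (intro vec.span_minimal) auto
    have nT: "nonsing ?T D" by (rule nonsing_pair[OF D nz])
    have sS: "sp S" by (simp add: S_def)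
    have ns: "nonsing (ssum S ?T) D" unfolding ssum_def
      by (rule nonsing_sum[OF D nS _ nT]) (use TW hs(5) sS in \<open>auto simp: vec.span_zero vec.subspace_0\<close>)
    have "vec.dim ?T = 2"
    proof -
      have "c \<noteq> 0" using nz D by (auto simp: altf_simps)
      moreover have "e \<notin> vec.span {c}" using nz D vec.span_breakdown_eq[of e c "{}"] by (auto simp: altf_simps)
      ultimately have "ind [(c, e)]" by (simp add: ind_Cons)
      then show ?thesis by (simp add: ind_def)
    qed
    moreover have "S \<inter> ?T = {0}" using TW hs(2) sS by (auto simp: vec.subspace_0 vec.span_zero)
    ultimately have "vec.dim (ssum S ?T) = 4" using dim_ssum[OF sS vec.subspace_span, of "{c, e}"] dS by simp
    moreover have "ssum S ?T \<subseteq> U"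
    proof (rule ssum_least[OF U])
      show "S \<subseteq> U" unfolding S_def using ab U by (intro vec.span_minimal) auto
      show "?T \<subseteq> U" using TW by (auto simp: W_def)
    qed
    ultimately show False using nq ns sp_ssum[OF sS vec.subspace_span] unfolding noquad_def by blast
  qed
  have "rad U D = W"
  proof
    show "rad U D \<subseteq> W"
    proof
      fix x assume "x \<in> rad U D"
      then show "x \<in> W" using ab altf_skew[OF D, of a x] altf_skew[OF D, of b x] by (auto simp: rad_def W_def)
    qed
    show "W \<subseteq> rad U D"
    proof
      fix x assume x: "x \<in> W"
      have "D x y = 0" if y: "y \<in> U" for y
      proof -
        obtain s w where sw: "s \<in> S" "w \<in> W" "y = s + w" using hs(3) y by blast
        then show ?thesis using zW[OF x sw(2)] hs(5)[OF sw(1) x] altf_skew[OF D, of x s]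
          by (simp add: altf_simps[OF D])
      qed
      then show "x \<in> rad U D" using x by (auto simp: rad_def W_def)
    qed
  qed
  then show ?thesis using hs(4) by simp
qed

text \<open>If the two radicals spanned \<open>U\<close>, the radical of \<open>D - E\<close> would
  be their intersection, of codimension four, and \<open>D - E\<close> would be nonsingular on a
  complement of it.\<close>

lemma noquad_rads:
  fixes U :: "('a::{field,finite}^'m::finite) set"
  assumes U: "sp U" and D: "D \<in> altf" and E: "E \<in> altf" and nq: "noquad U (D - E)"
    and d: "vec.dim (rad U D) + 2 = vec.dim U" "vec.dim (rad U E) + 2 = vec.dim U"
  shows "ssum (rad U D) (rad U E) \<noteq> U"
proof
  assume eq: "ssum (rad U D) (rad U E) = U"
  note s = sp_rad[OF U D] sp_rad[OF U E]
  have DE: "D - E \<in> altf" using D E by (rule altf_diff)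
  have r: "rad U (D - E) = rad U D \<inter> rad U E"
  proof
    show "rad U D \<inter> rad U E \<subseteq> rad U (D - E)" by (auto simp: rad_def)
    show "rad U (D - E) \<subseteq> rad U D \<inter> rad U E"
    proof
      fix x assume x: "x \<in> rad U (D - E)"
      then have xU: "x \<in> U" and De: "\<And>y. y \<in> U \<Longrightarrow> D x y = E x y" by (auto simp: rad_def)
      have "D x y = 0" if y: "y \<in> U" for y
      proof -
        obtain p q where pq: "p \<in> rad U D" "q \<in> rad U E" "y = p + q" using eq y unfolding ssum_def by blast
        have "D x p = 0" using altf_skew[OF D, of x p] pq(1) xU by (simp add: rad_def)
        moreover have "D x q = E x q" using De pq(2) by (simp add: rad_def)
        moreover have "E x q = 0" using altf_skew[OF E, of x q] pq(2) xU by (simp add: rad_def)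
        ultimately show ?thesis by (simp add: pq altf_simps[OF D])
      qed
      then show "x \<in> rad U D \<inter> rad U E" using xU De by (auto simp: rad_def)
    qed
  qed
  have sz: "sp {0 :: 'a^'m}" by (simp add: vec.subspace_def)
  have "0 \<in> U" using U by (rule vec.subspace_0)
  have sR: "sp (rad U (D - E))" by (rule sp_rad[OF U DE])
  obtain M where M: "sp M" "M \<subseteq> U" "rad U (D - E) \<inter> M = {0}"
    "\<And>x. x \<in> U \<Longrightarrow> \<exists>s\<in>rad U (D - E). \<exists>t\<in>M. x = s + t" "vec.dim M + vec.dim (rad U (D - E)) = vec.dim U"
  proof (rule ex_complement[OF sR sz U rad_subset])
    show "{0} \<subseteq> U" using \<open>0 \<in> U\<close> by simp
    show "rad U (D - E) \<inter> {0} = {0}" using vec.subspace_0[OF sR] by auto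
  qed blast
  have "vec.dim M = 4" using dim_ssum[OF s] eq d M(5) r by simp
  moreover have "nonsing M (D - E)" by (rule nonsing_mod_rad[OF DE]) (use M in auto)
  ultimately show False using nq M unfolding noquad_def by blast
qed

text \<open>The radicals of the forms that are nonzero on \<open>U\<close> satisfy the hypotheses of
  \<open>pairwise_codim2\<close>. If they all lie in a hyperplane \<open>A\<close>, then every form
  vanishes on \<open>A\<close>: two vectors of \<open>A\<close> with nonzero value span a complement
  of the radical, and the sum of both would be all of \<open>U\<close> inside
  \<open>A\<close>.\<close>

lemma rank2_clique:
  fixes U :: "('a::{field,finite}^'m::finite) set"
  assumes U: "sp U" "3 \<le> vec.dim U" and Y: "Y \<subseteq> altf" "0 \<in> Y"
    and nq: "\<And>D E. D \<in> Y \<Longrightarrow> E \<in> Y \<Longrightarrow> noquad U (D - E)"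
  shows "(\<exists>A. sp A \<and> A \<subseteq> U \<and> vec.dim A + 1 = vec.dim U \<and> (\<forall>D\<in>Y. eqon A D 0)) \<or>
    (\<exists>R. sp R \<and> R \<subseteq> U \<and> vec.dim R + 3 = vec.dim U \<and> (\<forall>D\<in>Y. \<forall>x\<in>R. \<forall>y\<in>U. D x y = 0))"
proof -
  define Y' where "Y' = {D \<in> Y. \<not> eqon U D 0}"
  have nqD: "noquad U D" if "D \<in> Y" for D using nq[OF that Y(2)] by simp
  have dY: "vec.dim (rad U D) + 2 = vec.dim U" if "D \<in> Y'" for D
    using noquad_rad[OF U(1)] nqD that Y by (auto simp: Y'_def)
  have z: "D x y = 0" if "D \<in> Y" "D \<notin> Y'" "x \<in> U" "y \<in> U" for D x y
    using that by (auto simp: Y'_def eqon_def)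
  let ?F = "rad U ` Y'"
  have main: "(\<exists>A. sp A \<and> A \<subseteq> U \<and> vec.dim A + 1 = vec.dim U \<and> (\<forall>r\<in>?F. r \<subseteq> A)) \<or>
    (\<exists>R. sp R \<and> R \<subseteq> U \<and> vec.dim R + 3 = vec.dim U \<and> (\<forall>r\<in>?F. R \<subseteq> r))"
  proof (cases "Y' = {}")
    case True
    have "\<not> U \<subseteq> {0}" using U(2) vec.dim_eq_0[of U] by linarith
    then obtain x where x: "x \<in> U" "x \<noteq> 0" by blast
    have sx: "sp (vec.span {x})" by simp
    have sz: "sp {0 :: 'a^'m}" by (simp add: vec.subspace_def)
    obtain A where A: "sp A" "A \<subseteq> U" "vec.dim A + vec.dim (vec.span {x}) = vec.dim U"
    proof (rule ex_complement[OF sx sz U(1)])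
      show "vec.span {x} \<subseteq> U" using x U by (intro vec.span_minimal) auto
      show "{0} \<subseteq> U" using U by (simp add: vec.subspace_0)
      show "vec.span {x} \<inter> {0} = {0}" by (auto simp: vec.span_zero)
    qed blast
    have "vec.dim A + 1 = vec.dim U" using A(3) x by simp
    then show ?thesis using True A by blast
  next
    case False
    then obtain D0 where D0: "D0 \<in> Y'" by blast
    have Y'a: "D \<in> altf" if "D \<in> Y'" for D using that Y(1) by (auto simp: Y'_def)
    show ?thesis
    proof (rule pairwise_codim2[where ?r0.0 = "rad U D0"])
      show "ssum r s \<noteq> U" if rs: "r \<in> ?F" "s \<in> ?F" for r s
      proof -
        obtain D E where DE: "D \<in> Y'" "E \<in> Y'" "r = rad U D" "s = rad U E" using rs by blast
        show ?thesis unfolding DE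
          by (rule noquad_rads[OF U(1)]) (use DE dY Y'a nq in \<open>auto simp: Y'_def\<close>)
      qed
    qed (use D0 U dY sp_rad[OF U(1) Y'a] subsetD[OF rad_subset] in auto)
  qed
  then show ?thesis
  proof (elim disjE exE conjE)
    fix A assume A: "sp A" "A \<subseteq> U" "vec.dim A + 1 = vec.dim U" "\<forall>r\<in>?F. r \<subseteq> A"
    have "D x y = 0" if D: "D \<in> Y" and xy: "x \<in> A" "y \<in> A" for D x y
    proof (rule ccontr)
      assume nz: "D x y \<noteq> 0"
      have Da: "D \<in> altf" using D Y by blast
      have D': "D \<in> Y'" using z[OF D] nz xy A(2) by blast
      have sr: "sp (rad U D)" by (rule sp_rad[OF U(1) Da])
      let ?S = "vec.span {x, y}"
      have "?S \<inter> rad U D = {0}"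
      proof -
        have "v = 0" if v: "v \<in> ?S" "v \<in> rad U D" for v
        proof -
          have "?S \<subseteq> U" using xy A(2) U(1) by (intro vec.span_minimal) auto
          then have "\<forall>w\<in>?S. D v w = 0" using v(2) by (auto simp: rad_def)
          then show ?thesis using nonsing_pair[OF Da nz] v(1) unfolding nonsing_def by blast
        qed
        then show ?thesis using vec.subspace_0[OF sr] vec.span_zero by blast
      qed
      then have "vec.dim (ssum ?S (rad U D)) = vec.dim ?S + vec.dim (rad U D)"
        using dim_ssum[OF vec.subspace_span sr, of "{x, y}"] by simp
      moreover have "vec.dim ?S = 2"
      proof -
        have "x \<noteq> 0" using nz Da by (auto simp: altf_simps)
        moreover have "y \<notin> vec.span {x}" using nz Da vec.span_breakdown_eq[of y x "{}"] by (auto simp: altf_simps)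
        ultimately have "ind [(x, y)]" by (simp add: ind_Cons)
        then show ?thesis by (simp add: ind_def)
      qed
      moreover have "ssum ?S (rad U D) \<subseteq> A"
        using xy A D' by (intro ssum_least vec.span_minimal) auto
      then have "vec.dim (ssum ?S (rad U D)) \<le> vec.dim A" by (rule vec.dim_subset)
      ultimately show False using dY[OF D'] A(3) by simp
    qed
    then have "\<forall>D\<in>Y. eqon A D 0" by (simp add: eqon_def)
    then show ?thesis using A by blast
  next
    fix R assume R: "sp R" "R \<subseteq> U" "vec.dim R + 3 = vec.dim U" "\<forall>r\<in>?F. R \<subseteq> r"
    have "D x y = 0" if "D \<in> Y" "x \<in> R" "y \<in> U" for D x y
    proof (cases "D \<in> Y'")
      case True
      then have "x \<in> rad U D" using R(4) that by blast
      then show ?thesis using that by (simp add: rad_def)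
    next
      case False
      then show ?thesis using z that R(2) by blast
    qed
    then show ?thesis using R by blast
  qed
qed

text \<open>If the bivector \<open>Q\<close> takes the same value at all forms in the support,
  appending it changes the coefficient only by a phase; so a known zero or nonzero coefficient can
  be transferred.\<close>

lemma FT_absorb:
  assumes "\<And>B. B \<in> altf \<Longrightarrow> f B \<noteq> 0 \<Longrightarrow> ev B Q = c"
  shows "FT f (P @ Q) = addchar c * FT f P"
proof -
  have "f B * addchar (ev B (P @ Q)) = addchar c * (f B * addchar (ev B P))" if "B \<in> altf" for B
    using assms[OF that] by (cases "f B = 0") (auto simp: addchar_add)
  then show ?thesis unfolding FT_def sum_distrib_left by (intro sum.cong refl)
qed

subsection \<open>Fourier transforms supported on lines\<close>

definition deg1 :: "('a::{field,finite}^'m::finite) set \<Rightarrow> (('a^'m \<Rightarrow> 'a^'m \<Rightarrow> 'a) \<Rightarrow> complex) \<Rightarrow> bool" where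
  "deg1 U f \<longleftrightarrow> (\<forall>P. ind P \<longrightarrow> sv P \<subseteq> U \<longrightarrow> 2 \<le> length P \<longrightarrow> FT f P = 0)"

definition nodiff :: "('a::{field,finite}^'m::finite) set \<Rightarrow> (('a^'m \<Rightarrow> 'a^'m \<Rightarrow> 'a) \<Rightarrow> complex) \<Rightarrow> bool" where
  "nodiff U f \<longleftrightarrow> (\<forall>B\<in>altf. \<forall>D\<in>altf. f B \<noteq> 0 \<longrightarrow> f D \<noteq> 0 \<longrightarrow> \<not> nonsing U (B - D))"

text \<open>In dimension four a form of rank four is nonsingular, so the support, translated to
  contain 0, is a clique of rank two forms. By \<open>FT_absorb\<close>, a pair
  \<open>c \<and> d\<close> on which the clique vanishes cannot be independent of a line with
  nonzero coefficient, because \<open>deg1\<close> kills the sum. Hence all such lines lie in the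
  common hyperplane or pass through the common radical vector, and two skew lines can do
  neither.\<close>

lemma nodiff_base:
  fixes U :: "('a::{field,finite}^'m::finite) set"
  assumes U: "sp U" "vec.dim U = 4" and f: "deg1 U f" "nodiff U f"
    and P: "ind [(a, b), (a', b')]" "{a, b, a', b'} \<subseteq> U" "FT f [(a, b)] \<noteq> 0" "FT f [(a', b')] \<noteq> 0"
  shows False
proof -
  have "\<exists>B0\<in>altf. f B0 \<noteq> 0"
  proof (rule ccontr)
    assume "\<not> ?thesis"
    then have "FT f [(a, b)] = 0" by (simp add: FT_def)
    then show False using P by simp
  qed
  then obtain B0 where B0: "B0 \<in> altf" "f B0 \<noteq> 0" by blast
  define Y where "Y = {D \<in> altf. f (B0 + D) \<noteq> 0}"
  have Y: "Y \<subseteq> altf" "0 \<in> Y" using B0 by (auto simp: Y_def altf_0)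
  have nq: "noquad U (D - E)" if "D \<in> Y" "E \<in> Y" for D E
    unfolding noquad_def
  proof (intro allI impI)
    fix M assume M: "sp M" "M \<subseteq> U" "vec.dim M = 4"
    have "M = U" by (rule sp_eqI) (use M U in auto)
    moreover have "\<not> nonsing U ((B0 + D) - (B0 + E))"
      using that f(2) B0 altf_add unfolding nodiff_def Y_def by blast
    ultimately show "\<not> nonsing M (D - E)" by simp
  qed
  have fY: "B - B0 \<in> Y" if "B \<in> altf" "f B \<noteq> 0" for B using that B0 by (simp add: Y_def altf_diff)
  have swap: "ind [(q, p)] \<longleftrightarrow> ind [(p, q)]" for p q :: "'a^'m" by (simp add: ind_def insert_commute)
  have kill: "FT f [(p, q)] = 0"
    if Q: "ind [(p, q), (c, d)]" "{p, q, c, d} \<subseteq> U"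
      and e: "\<And>D. D \<in> Y \<Longrightarrow> D c d = 0" for p q c d
  proof -
    have "FT f ([(p, q)] @ [(c, d)]) = addchar (B0 c d) * FT f [(p, q)]"
    proof (rule FT_absorb)
      fix B assume "B \<in> altf" "f B \<noteq> 0"
      then show "ev B [(c, d)] = B0 c d" using e[OF fY] by simp
    qed
    moreover have "FT f [(p, q), (c, d)] = 0" using f(1) Q unfolding deg1_def by simp
    ultimately show ?thesis by simp
  qed
  have ind2: "ind [(a, b)]" "ind [(a', b')]"
    using ind_appendD[of "[(a, b)]" "[(a', b')]"] P(1) by auto
  have dis: "vec.span {a, b} \<inter> vec.span {a', b'} = {0}"
    using ind_append_disjoint[of "[(a, b)]" "[(a', b')]"] P(1) by simp
  have "(\<exists>A. sp A \<and> A \<subseteq> U \<and> vec.dim A + 1 = vec.dim U \<and> (\<forall>D\<in>Y. eqon A D 0)) \<or>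
    (\<exists>R. sp R \<and> R \<subseteq> U \<and> vec.dim R + 3 = vec.dim U \<and> (\<forall>D\<in>Y. \<forall>x\<in>R. \<forall>y\<in>U. D x y = 0))"
    by (rule rank2_clique[OF U(1) _ Y nq]) (use U in auto)
  then show False
  proof (elim disjE exE conjE)
    fix A assume A: "sp A" "A \<subseteq> U" "vec.dim A + 1 = vec.dim U" "\<forall>D\<in>Y. eqon A D 0"
    have inA: "vec.span {p, q} \<subseteq> A" if pq: "ind [(p, q)]" "{p, q} \<subseteq> U" "FT f [(p, q)] \<noteq> 0" for p q
    proof (rule ccontr)
      assume n: "\<not> vec.span {p, q} \<subseteq> A"
      let ?J = "vec.span {p, q}"
      have J: "isline ?J" using pq by (simp add: isline_span)
      have sI: "sp (?J \<inter> A)" using A(1) by (intro sp_Int) auto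
      have "vec.dim (?J \<inter> A) < 2"
      proof (rule ccontr)
        assume "\<not> ?thesis"
        then have "?J \<inter> A = ?J" by (intro sp_eqI sI) (use islineD[OF J] in auto)
        then show False using n by blast
      qed
      moreover have sz: "sp {0 :: 'a^'m}" by (simp add: vec.subspace_def)
      have "0 \<in> A" using A(1) by (rule vec.subspace_0)
      obtain T where T: "sp T" "T \<subseteq> A" "(?J \<inter> A) \<inter> T = {0}" "vec.dim T + vec.dim (?J \<inter> A) = vec.dim A"
      proof (rule ex_complement[OF sI sz A(1)])
        show "{0} \<subseteq> A" using \<open>0 \<in> A\<close> by simp
        show "?J \<inter> A \<inter> {0} = {0}" using \<open>0 \<in> A\<close> by (auto simp: vec.span_zero)
      qed blast+
      ultimately have "2 \<le> vec.dim T" using A(3) U(2) by linarith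
      then obtain Q where Q: "ind Q" "sv Q \<subseteq> T" "length Q = 1" using ind_extend[of "[]" T 1] by auto
      obtain cd where cd0: "Q = [cd]" using Q(3) by (cases Q) auto
      obtain c d where "cd = (c, d)" by (cases cd)
      then have cd: "Q = [(c, d)]" using cd0 by simp
      have "vec.span (sv Q) \<subseteq> T" using Q T by (intro vec.span_minimal)
      then have "vec.span (sv [(p, q)]) \<inter> vec.span (sv Q) = {0}"
        using T(2,3) by (auto simp: vec.span_zero)
      from ind_append[OF pq(1) Q(1) this] have "ind [(p, q), (c, d)]" by (simp add: cd)
      moreover have "c \<in> A" "d \<in> A" using Q T cd by auto
      ultimately have "FT f [(p, q)] = 0" using kill[of p q c d] A pq by (auto simp: eqon_def)
      then show False using pq by simp
    qed
    have "ssum (vec.span {a, b}) (vec.span {a', b'}) \<subseteq> A"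
      using inA[OF ind2(1)] inA[OF ind2(2)] P A(1) by (intro ssum_least) auto
    then have "vec.dim (ssum (vec.span {a, b}) (vec.span {a', b'})) \<le> vec.dim A" by (rule vec.dim_subset)
    moreover have "vec.dim (ssum (vec.span {a, b}) (vec.span {a', b'})) = 4"
      using dim_ssum[OF vec.subspace_span vec.subspace_span, of "{a, b}" "{a', b'}"] dis ind2 by (simp add: ind_def)
    ultimately show False using A(3) U(2) by simp
  next
    fix R assume R: "sp R" "R \<subseteq> U" "vec.dim R + 3 = vec.dim U" "\<forall>D\<in>Y. \<forall>x\<in>R. \<forall>y\<in>U. D x y = 0"
    have "R \<noteq> {0}" using R(3) U(2) dim_0_iff[OF R(1)] by auto
    then obtain u where u: "u \<in> R" "u \<noteq> 0" using vec.subspace_0[OF R(1)] by blast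
    have inJ: "u \<in> vec.span {p, q}" if pq: "ind [(p, q)]" "{p, q} \<subseteq> U" "FT f [(p, q)] \<noteq> 0" for p q
    proof (rule ccontr)
      assume n: "u \<notin> vec.span {p, q}"
      have "vec.dim (insert u {p, q}) = 3" using n pq(1) by (simp add: vec.dim_insert[of u "{p, q}"] ind_def)
      then have "\<not> U \<subseteq> vec.span (insert u {p, q})" using U(2) vec.dim_mono[of U "insert u {p, q}"] by auto
      then obtain y where y: "y \<in> U" "y \<notin> vec.span (insert u {p, q})" by blast
      have "ind [(u, y), (p, q)]" using n y pq(1) by (simp add: ind_Cons)
      then have "ind [(p, q), (u, y)]" using ind_append_commute[of "[(u, y)]" "[(p, q)]"] by simp
      then have "FT f [(p, q)] = 0" using kill[of p q u y] u y pq R by auto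
      then show False using pq by simp
    qed
    have "u \<in> vec.span {a, b} \<inter> vec.span {a', b'}" using inJ ind2 P by simp
    then show False using dis u by simp
  qed
qed

section \<open>Slicing along a vector: reduction of the dimension by two\<close>

definition slice :: "('a::{field,finite}^'m::finite) set \<Rightarrow> 'a^'m \<Rightarrow> ('a^'m \<Rightarrow> 'a) \<Rightarrow>
    (('a^'m \<Rightarrow> 'a^'m \<Rightarrow> 'a) \<Rightarrow> complex) \<Rightarrow> ('a^'m \<Rightarrow> 'a^'m \<Rightarrow> 'a) \<Rightarrow> complex" where
  "slice U v h f B = (if \<forall>y\<in>U. B v y = h y then f B else 0)"

lemma sum_addchar_linear:
  fixes U :: "('a::{field,finite}^'m::finite) set"
  assumes U: "sp U" and g: "\<And>x y. g (x + y) = g x + g y" "\<And>c x. g (c *s x) = c * g x"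
  shows "(\<Sum>y\<in>U. addchar (g y)) = (if \<forall>y\<in>U. g y = 0 then of_nat (card U) else 0)"
proof (cases "\<forall>y\<in>U. g y = 0")
  case True
  then show ?thesis by simp
next
  case False
  then obtain y where y: "y \<in> U" "g y \<noteq> 0" by blast
  obtain s :: 'a where s: "addchar s \<noteq> 1" using addchar_nontrivial by blast
  let ?y = "(s / g y) *s y"
  have yU: "?y \<in> U" using y U by (simp add: vec.subspace_scale)
  have gy: "g ?y = s" using y by (simp add: g)
  have "(\<Sum>y\<in>U. addchar (g y)) = (\<Sum>y\<in>U. addchar (g (y + ?y)))"
    by (rule sum.reindex_bij_witness[of _ "\<lambda>y. y + ?y" "\<lambda>y. y - ?y"])
      (auto intro: vec.subspace_add[OF U] vec.subspace_diff[OF U] yU)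
  also have "\<dots> = addchar s * (\<Sum>y\<in>U. addchar (g y))"
    by (simp add: g(1) gy addchar_add sum_distrib_left mult_ac)
  finally show ?thesis using s False by (metis mult_cancel_right1)
qed

text \<open>The indicator of the slice is the average over \<open>y\<close> in \<open>U\<close> of
  the characters of \<open>v \<and> y\<close> multiplied by the phase of \<open>- h y\<close>, by
  orthogonality on \<open>U\<close>.\<close>

lemma FT_slice:
  fixes U :: "('a::{field,finite}^'m::finite) set"
  assumes U: "sp U" and h: "\<And>x y. h (x + y) = h x + h y" "\<And>c x. h (c *s x) = c * h x"
  shows "of_nat (card U) * FT (slice U v h f) P = (\<Sum>y\<in>U. addchar (- h y) * FT f (P @ [(v, y)]))"
proof -
  have "(\<Sum>y\<in>U. addchar (- h y) * FT f (P @ [(v, y)])) =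
      (\<Sum>B\<in>altf. f B * addchar (ev B P) * (\<Sum>y\<in>U. addchar (B v y - h y)))"
    unfolding FT_def sum_distrib_left
    by (subst sum.swap) (simp add: addchar_add[symmetric] mult_ac add.assoc diff_conv_add_uminus del: add_uminus_conv_diff)
  also have "\<dots> = (\<Sum>B\<in>altf. of_nat (card U) * (slice U v h f B * addchar (ev B P)))"
  proof (rule sum.cong[OF refl])
    fix B :: "'a^'m \<Rightarrow> 'a^'m \<Rightarrow> 'a" assume B: "B \<in> altf"
    have "(\<Sum>y\<in>U. addchar (B v y - h y)) = (if \<forall>y\<in>U. B v y - h y = 0 then of_nat (card U) else 0)"
      by (rule sum_addchar_linear[OF U]) (simp_all add: altf_simps[OF B] h algebra_simps)
    then show "f B * addchar (ev B P) * (\<Sum>y\<in>U. addchar (B v y - h y)) =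
        of_nat (card U) * (slice U v h f B * addchar (ev B P))"
      by (auto simp: slice_def)
  qed
  finally show ?thesis by (simp add: FT_def sum_distrib_left)
qed

lemma ind_functional:
  fixes a b :: "'a::{field,finite}^'m::finite"
  assumes "ind ((a, b) # P)"
  shows "\<exists>h :: 'a^'m \<Rightarrow> 'a. (\<forall>x y. h (x + y) = h x + h y) \<and> (\<forall>c x. h (c *s x) = c * h x) \<and>
    h a = 1 \<and> h b = 0 \<and> (\<forall>x\<in>sv P. h x = 0)"
proof -
  have "ind ((b, a) # P)" using assms by (simp add: ind_def insert_commute)
  then have "a \<notin> vec.span (insert b (sv P))" by (simp add: ind_Cons)
  from ex_functional'[OF vec.subspace_span this] obtain h :: "'a^'m \<Rightarrow> 'a" where
    h: "\<forall>x y. h (x + y) = h x + h y" "\<forall>c x. h (c *s x) = c * h x" "h a = 1"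
    "\<forall>x\<in>vec.span (insert b (sv P)). h x = 0" by blast
  have "h x = 0" if "x \<in> insert b (sv P)" for x using h(4) vec.span_base[OF that] by blast
  then show ?thesis using h by blast
qed

lemma sum_addchar_mult:
  fixes t :: "'a::{field,finite}"
  shows "(\<Sum>s\<in>UNIV. addchar (s * t)) = (if t = 0 then of_nat CARD('a) else 0)"
proof (cases "t = 0")
  case False
  obtain r :: 'a where r: "addchar r \<noteq> 1" using addchar_nontrivial by blast
  have "(\<Sum>s\<in>UNIV. addchar (s * t)) = (\<Sum>s\<in>UNIV. addchar ((s + r / t) * t))"
    by (rule sum.reindex_bij_witness[of _ "\<lambda>s. s + r / t" "\<lambda>s. s - r / t"]) auto
  also have "\<dots> = addchar r * (\<Sum>s\<in>UNIV. addchar (s * t))"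
  proof -
    have e: "(s + r / t) * t = r + s * t" for s using False by (simp add: distrib_right)
    show ?thesis by (simp only: e addchar_add sum_distrib_left)
  qed
  finally show ?thesis using r False by (metis mult_cancel_right1)
qed simp

text \<open>Summing over all \<open>s\<close> and \<open>t\<close> filters out the \<open>y\<close>
  with \<open>g y = h y = 0\<close>, where \<open>G\<close> is the nonzero constant
  \<open>G0\<close>; so some choice of \<open>s\<close> and \<open>t\<close> gives a nonzero
  sum.\<close>

lemma ex_twist:
  fixes g h :: "'v \<Rightarrow> 'a::{field,finite}" and G :: "'v \<Rightarrow> complex"
  assumes S: "finite S" "z \<in> S" "g z = 0" "h z = 0" and G0: "G0 \<noteq> 0"
    and G: "\<And>y. y \<in> S \<Longrightarrow> g y = 0 \<Longrightarrow> h y = 0 \<Longrightarrow> G y = G0"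
  shows "\<exists>s t. (\<Sum>y\<in>S. addchar (- (s * g y + t * h y)) * G y) \<noteq> 0"
proof (rule ccontr)
  assume "\<not> ?thesis"
  then have "0 = (\<Sum>s\<in>UNIV. \<Sum>t\<in>UNIV. \<Sum>y\<in>S. addchar (- (s * g y + t * h y)) * G y)" by simp
  also have "\<dots> = (\<Sum>s\<in>UNIV. \<Sum>y\<in>S. \<Sum>t\<in>UNIV. addchar (- (s * g y + t * h y)) * G y)"
    by (subst (2) sum.swap) simp
  also have "\<dots> = (\<Sum>y\<in>S. \<Sum>s\<in>UNIV. \<Sum>t\<in>UNIV. addchar (- (s * g y + t * h y)) * G y)"
    by (rule sum.swap)
  also have "\<dots> = (\<Sum>y\<in>S. (\<Sum>s\<in>UNIV. addchar (s * - g y)) * (\<Sum>t\<in>UNIV. addchar (t * - h y)) * G y)"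
  proof -
    have e: "addchar (- (s * g y + t * h y)) = addchar (s * - g y) * addchar (t * - h y)" for s t y
      by (simp add: addchar_add[symmetric])
    have "(\<Sum>s\<in>UNIV. \<Sum>t\<in>UNIV. addchar (- (s * g y + t * h y)) * G y) =
        (\<Sum>s\<in>UNIV. addchar (s * - g y)) * (\<Sum>t\<in>UNIV. addchar (t * - h y)) * G y" for y
      unfolding e sum_product by (simp only: sum_distrib_right)
    then show ?thesis by (simp only:)
  qed
  also have "\<dots> = (\<Sum>y\<in>S. if g y = 0 \<and> h y = 0 then of_nat CARD('a) * of_nat CARD('a) * G0 else 0)"
  proof (rule sum.cong[OF refl])
    fix y assume y: "y \<in> S"
    show "(\<Sum>s\<in>UNIV. addchar (s * - g y)) * (\<Sum>t\<in>UNIV. addchar (t * - h y)) * G y =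
        (if g y = 0 \<and> h y = 0 then of_nat CARD('a) * of_nat CARD('a) * G0 else 0)"
      unfolding sum_addchar_mult using G[OF y] by auto
  qed
  also have "\<dots> = of_nat (card {y \<in> S. g y = 0 \<and> h y = 0}) * (of_nat CARD('a) * of_nat CARD('a) * G0)"
    using S by (simp add: sum.If_cases Int_def)
  finally show False using S G0 by (auto simp: card_eq_0_iff)
qed

lemma nonsing_uminus: "nonsing U (- D) \<longleftrightarrow> nonsing U (D :: 'a::field^'m \<Rightarrow> 'a^'m \<Rightarrow> 'a)"
  by (simp add: nonsing_def)

context
  fixes U U' :: "('a::{field,finite}^'m::finite) set" and v e :: "'a^'m" and g :: "'a^'m \<Rightarrow> 'a"
    and f :: "('a^'m \<Rightarrow> 'a^'m \<Rightarrow> 'a) \<Rightarrow> complex"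
  assumes U: "sp U" and U': "sp U'" "U' \<subseteq> U" and v: "v \<in> U" "v \<notin> U'" and e: "e \<in> U"
    and gen: "\<And>x. x \<in> U \<Longrightarrow> \<exists>\<alpha> \<beta> x'. x' \<in> U' \<and> x = \<alpha> *s v + \<beta> *s e + x'"
    and g: "\<And>x y. g (x + y) = g x + g y" "\<And>c x. g (c *s x) = c * g x" "g v = 0" "g e = 1"
      "\<And>x. x \<in> U' \<Longrightarrow> g x = 0"
    and f: "deg1 U f" "nodiff U f"
begin

text \<open>If \<open>y\<close> depends on \<open>v\<close> and \<open>P\<close>, the summand
  \<open>v \<and> y\<close> is absorbed without changing the length; otherwise the list grows.
  Either way at least two summands remain, as \<open>deg1\<close> requires.\<close>

lemma slice_long:
  assumes P: "ind P" "sv P \<subseteq> U'" "2 \<le> length P" and y: "y \<in> U"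
  shows "FT f (P @ [(v, y)]) = 0"
proof -
  have sP: "vec.span (sv P) \<subseteq> U'" using P U' by (intro vec.span_minimal)
  then have vP: "v \<notin> vec.span (sv P)" using v by blast
  show ?thesis
  proof (cases "y \<in> vec.span (insert v (sv P))")
    case True
    from absorb_ind[OF P(1) vP True] obtain P' where P': "length P' = length P"
      "\<And>B. B \<in> altf \<Longrightarrow> ev B P' = ev B P + B v y"
      "vec.span (insert v (sv P')) = vec.span (insert v (sv P))" "ind P'" by metis
    have "sv P' \<subseteq> vec.span (insert v (sv P'))" by (meson subset_insertI subset_trans vec.span_superset)
    also have "\<dots> \<subseteq> U" unfolding P'(3) using v P U U' by (intro vec.span_minimal) auto
    finally have "FT f P' = 0" using f(1) P' P unfolding deg1_def by simp
    moreover have "FT f (P @ [(v, y)]) = FT f P'" by (rule FT_cong) (simp add: P')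
    ultimately show ?thesis by simp
  next
    case False
    then have "ind ([(v, y)] @ P)" using P vP by (simp add: ind_Cons)
    then have "ind (P @ [(v, y)])" using ind_append_commute by blast
    moreover have "sv (P @ [(v, y)]) \<subseteq> U" using P U' v y by auto
    ultimately show ?thesis using f(1) P unfolding deg1_def by simp
  qed
qed

lemma slice_short:
  assumes P: "ind [(p, q)]" "p \<in> U'" "q \<in> U'" and y: "y \<in> U" "y \<notin> vec.span {v, p, q}"
  shows "FT f ([(p, q)] @ [(v, y)]) = 0"
proof -
  have "vec.span {p, q} \<subseteq> U'" using P U' by (intro vec.span_minimal) auto
  then have "v \<notin> vec.span {p, q}" using v by blast
  then have "ind ([(v, y)] @ [(p, q)])" using P y by (simp add: ind_Cons)
  then have "ind ([(p, q)] @ [(v, y)])" using ind_append_commute by blast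
  moreover have "{p, q, v, y} \<subseteq> U" using P U' v y by auto
  ultimately show ?thesis using f(1) unfolding deg1_def by simp
qed

text \<open>The contractions of \<open>B\<close> and \<open>D\<close> with \<open>v\<close> differ
  by \<open>g\<close>, which is 1 at \<open>e\<close> and 0 at \<open>v\<close> and on
  \<open>U'\<close>. So \<open>v\<close> and \<open>e\<close> pair nontrivially under
  \<open>B - D\<close>, and nonsingularity on \<open>U'\<close> would extend to
  \<open>U\<close>.\<close>

lemma slice_cross:
  assumes B: "B \<in> altf" "f B \<noteq> 0" "\<And>y. y \<in> U \<Longrightarrow> B v y = h y"
    and D: "D \<in> altf" "f D \<noteq> 0" "\<And>y. y \<in> U \<Longrightarrow> D v y = h y + g y"
  shows "\<not> nonsing U' (B - D)"
proof
  assume ns: "nonsing U' (B - D)"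
  let ?E = "B - D"
  have E: "?E \<in> altf" using B D by (simp add: altf_diff)
  have Ev: "?E v y = - g y" if "y \<in> U" for y using B(3) D(3) that by simp
  have "nonsing U ?E"
    unfolding nonsing_def
  proof (intro ballI impI)
    fix x assume x: "x \<in> U" "\<forall>y\<in>U. ?E x y = 0"
    obtain \<alpha> \<beta> x' where x': "x' \<in> U'" "x = \<alpha> *s v + \<beta> *s e + x'" using gen[OF x(1)] by blast
    have "?E v x = 0" using x v altf_skew[OF E, of v x] by simp
    then have "\<beta> = 0" using Ev[OF x(1)] x' by (simp add: g)
    then have xx: "x = \<alpha> *s v + x'" using x' by simp
    have "?E x' y = 0" if y: "y \<in> U'" for y
    proof -
      have "0 = ?E x y" using x y U' by auto
      also have "\<dots> = \<alpha> * ?E v y + ?E x' y" by (simp only: xx altf_simps(1,3)[OF E])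
      also have "?E v y = 0" using Ev[of y] y U' g(5) by auto
      finally show ?thesis by simp
    qed
    then have x'0: "x' = 0" using ns x'(1) unfolding nonsing_def by blast
    have "0 = ?E x e" using x e by auto
    also have "\<dots> = \<alpha> * ?E v e" by (simp only: xx x'0 add_0_right altf_simps(3)[OF E])
    also have "?E v e = - 1" using Ev[OF e] g(4) by simp
    finally show "x = 0" using xx x'0 by simp
  qed
  then show False using f(2) B D unfolding nodiff_def by blast
qed

text \<open>Compare the slices at \<open>h\<close> and \<open>h + g\<close>. Their transforms differ
  at most at the empty bivector, so the two functions differ by a constant \<open>\<delta>\<close>,
  while \<open>slice_cross\<close> forbids nonsingular differences between their supports. For
  \<open>\<delta> = 0\<close> this is \<open>nodiff\<close>. For nonzero \<open>\<delta>\<close> it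
  makes \<open>F0\<close> invariant under all nonsingular forms, and such a form with a prescribed
  nontrivial value at a line removes the coefficient of that line.\<close>

lemma slice_step:
  assumes h: "\<And>x y. h (x + y) = h x + h y" "\<And>c x. h (c *s x) = c * h x"
    and F0: "F0 = push U' (slice U v h f)"
    and even: "even (vec.dim U')"
  shows "deg1 U' F0"
    "nodiff U' F0 \<or> (\<forall>a b. a \<in> U' \<longrightarrow> b \<in> U' \<longrightarrow> ind [(a, b)] \<longrightarrow> FT F0 [(a, b)] = 0)"
proof -
  have cU: "of_nat (card U) \<noteq> (0 :: complex)" using v by auto
  define k where "k c y = h y + c * g y" for c y
  have k: "k c (x + y) = k c x + k c y" "k c (r *s x) = r * k c x" for c x y r
    by (simp_all add: k_def h g algebra_simps)
  have k0: "k 0 = h" "k 1 = (\<lambda>y. h y + g y)" by (simp_all add: k_def fun_eq_iff)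
  define F where "F c = push U' (slice U v (k c) f)" for c
  have F0F: "F0 = F 0" using F0 by (simp add: F_def k0)
  have FTF: "FT (F c) P = of_nat (fibre U') / of_nat (card U) * (\<Sum>y\<in>U. addchar (- k c y) * FT f (P @ [(v, y)]))"
    if "sv P \<subseteq> U'" for c P
    using FT_slice[OF U k(1)[of c] k(2)[of c], where v = v and f = f and P = P] FT_push[OF that] cU by (simp add: F_def field_simps)
  have d1: "FT (F c) P = 0" if "ind P" "sv P \<subseteq> U'" "2 \<le> length P" for c P
    using slice_long[OF that] FTF[OF that(2)] by simp
  show "deg1 U' F0" unfolding deg1_def F0F using d1 by blast
  define \<delta> where "\<delta> = F 0 0 - F 1 0"
  have diff: "F 0 B - F 1 B = \<delta>" if B: "B \<in> altf" for B
    unfolding \<delta>_def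
  proof (rule FT_constant[OF _ U'(1) _ B])
    show "dep U' (\<lambda>B. F 0 B - F 1 B)"
      using dep_push[of U'] unfolding F_def dep_def by metis
    fix P :: "(('a^'m) \<times> ('a^'m)) list" assume P: "ind P" "sv P \<subseteq> U'" "P \<noteq> []"
    have "FT (F 0) P = FT (F 1) P"
    proof (cases "2 \<le> length P")
      case True
      then show ?thesis using d1 P by simp
    next
      case False
      then obtain pq where "P = [pq]" using P(3) by (cases P; cases "tl P") auto
      then obtain p q where pq: "P = [(p, q)]" by (cases pq) auto
      \<comment> \<open>Where \<open>g y = 0\<close> the phases agree; elsewhere \<open>y\<close> is
        outside the span of \<open>v\<close>, \<open>p\<close>, \<open>q\<close>, and the
        coefficient vanishes by \<open>slice_short\<close>.\<close>
      have "addchar (- k 0 y) * FT f (P @ [(v, y)]) = addchar (- k 1 y) * FT f (P @ [(v, y)])" if y: "y \<in> U" for y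
      proof (cases "g y = 0")
        case False
        have "sp {x. g x = 0}" using g(2)[of 0 0] by (auto simp: vec.subspace_def g)
        then have "vec.span {v, p, q} \<subseteq> {x. g x = 0}"
          using P pq g by (intro vec.span_minimal) auto
        then have "y \<notin> vec.span {v, p, q}" using False by blast
        then show ?thesis using slice_short[OF _ _ _ y] P pq by simp
      qed (simp add: k_def)
      then have "(\<Sum>y\<in>U. addchar (- k 0 y) * FT f (P @ [(v, y)])) = (\<Sum>y\<in>U. addchar (- k 1 y) * FT f (P @ [(v, y)]))"
        by (rule sum.cong[OF refl])
      then show ?thesis by (simp only: FTF[OF P(2)])
    qed
    then show "FT (\<lambda>B. F 0 B - F 1 B) P = 0" by (simp add: FT_def left_diff_distrib sum_subtractf)
  qed
  have cross: "\<not> nonsing U' (B - D)" if BD: "B \<in> altf" "D \<in> altf" "F 0 B \<noteq> 0" "F 1 D \<noteq> 0" for B D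
  proof -
    obtain B1 where B1: "B1 \<in> altf" "eqon U' B1 B" "slice U v (k 0) f B1 \<noteq> 0"
      using push_nz BD(3) unfolding F_def by blast
    obtain D1 where D1: "D1 \<in> altf" "eqon U' D1 D" "slice U v (k 1) f D1 \<noteq> 0"
      using push_nz BD(4) unfolding F_def by blast
    have "\<not> nonsing U' (B1 - D1)"
      by (rule slice_cross[where h = h]) (use B1 D1 in \<open>auto simp: slice_def k0 split: if_splits\<close>)
    moreover have "eqon U' (B1 - D1) (B - D)" using B1(2) D1(2) by (simp add: eqon_def)
    ultimately show ?thesis using nonsing_cong by blast
  qed
  show "nodiff U' F0 \<or> (\<forall>a b. a \<in> U' \<longrightarrow> b \<in> U' \<longrightarrow> ind [(a, b)] \<longrightarrow> FT F0 [(a, b)] = 0)"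
  proof (cases "\<delta> = 0")
    case True
    then have "F 1 B = F 0 B" if "B \<in> altf" for B using diff[OF that] by simp
    then have "nodiff U' F0" unfolding nodiff_def F0F using cross by metis
    then show ?thesis by blast
  next
    case False
    have val: "F 0 C = \<delta> \<and> F 0 (C + D) = \<delta>" if C: "C \<in> altf" "F 0 C \<noteq> 0" and D: "D \<in> altf" "nonsing U' D" for C D
    proof -
      have CD: "C + D \<in> altf" using C D by (simp add: altf_add)
      have "nonsing U' (C - (C + D))" using D(2) nonsing_uminus[of U' D] by simp
      then have "F 1 (C + D) = 0" using cross[OF C(1) CD C(2)] by blast
      then have 1: "F 0 (C + D) = \<delta>" using diff[OF CD] by simp
      have "F 1 C = 0" using cross[OF CD C(1)] 1 False D(2) by auto
      then show ?thesis using 1 diff[OF C(1)] by simp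
    qed
    have inv: "F 0 (C + D) = F 0 C" if C: "C \<in> altf" and D: "D \<in> altf" "nonsing U' D" for C D
    proof (cases "F 0 C = 0")
      case True
      show ?thesis
      proof (rule ccontr)
        assume n: "F 0 (C + D) \<noteq> F 0 C"
        have "F 0 ((C + D) + (- D)) = \<delta>"
          using val[of "C + D" "- D"] n True C D by (simp add: altf_add altf_uminus nonsing_uminus)
        then show False using True False by simp
      qed
    next
      case False
      then show ?thesis using val[OF C False D] by simp
    qed
    have "FT F0 [(a, b)] = 0" if ab: "a \<in> U'" "b \<in> U'" "ind [(a, b)]" for a b
    proof -
      obtain s :: 'a where s: "addchar s \<noteq> 1" using addchar_nontrivial by blast
      then have s0: "s \<noteq> 0" by auto
      obtain D where D: "D \<in> altf" "nonsing U' D" "D a b = s"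
        using ex_nonsing_extension[OF ab(3) _ U'(1) even, of s] ab s0 by auto
      have "FT F0 [(a, b)] = FT (\<lambda>B. F0 (B + D)) [(a, b)]"
        unfolding FT_def F0F using inv D by (intro sum.cong) auto
      also have "\<dots> = cnj (addchar s) * FT F0 [(a, b)]" using FT_shift[OF D(1)] D(3) by (simp add: addchar_minus)
      finally have "(1 - cnj (addchar s)) * FT F0 [(a, b)] = 0" by (simp add: left_diff_distrib)
      moreover have "cnj (addchar s) \<noteq> 1" using s by (metis complex_cnj_cnj complex_cnj_one)
      ultimately show ?thesis by simp
    qed
    then show ?thesis by blast
  qed
qed

end

text \<open>Choose \<open>v\<close>, \<open>e\<close> independent of both lines and slice along
  \<open>v\<close> down to a complement \<open>U'\<close> of \<open>span {v, e}\<close> through the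
  two lines. The functional \<open>h\<close> must be chosen so that neither coefficient is lost;
  then \<open>slice_step\<close> leaves only its first alternative, and induction applies.\<close>

lemma nodiff_step:
  fixes U :: "('a::{field,finite}^'m::finite) set"
  assumes U: "sp U" "vec.dim U = 2 * Suc k" "2 \<le> k" and f: "deg1 U f" "nodiff U f"
    and P: "ind [(a, b), (a', b')]" "{a, b, a', b'} \<subseteq> U" "FT f [(a, b)] \<noteq> 0" "FT f [(a', b')] \<noteq> 0"
    and IH: "\<And>U f. sp (U :: ('a^'m) set) \<Longrightarrow> vec.dim U = 2 * k \<Longrightarrow> deg1 U f \<Longrightarrow> nodiff U f \<Longrightarrow>
       {a, b, a', b'} \<subseteq> U \<Longrightarrow> FT f [(a, b)] \<noteq> 0 \<Longrightarrow> FT f [(a', b')] \<noteq> 0 \<Longrightarrow> False"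
  shows False
proof -
  let ?L = "[(a, b), (a', b')]"
  obtain Q where Q: "ind (?L @ Q)" "sv Q \<subseteq> U" "length Q = 1"
    using ind_extend[OF P(1), of U 1] P(2) U by auto
  obtain ve where ve0: "Q = [ve]" using Q(3) by (cases Q) auto
  obtain v e where "ve = (v, e)" by (cases ve)
  then have ve: "Q = [(v, e)]" using ve0 by simp
  have vU: "v \<in> U" "e \<in> U" using Q ve by auto
  let ?S = "vec.span {v, e}" and ?W = "vec.span (sv ?L)"
  have dis: "?S \<inter> ?W = {0}" using ind_append_disjoint[OF Q(1)] ve by auto
  have dS: "vec.dim ?S = 2" using ind_appendD(2)[OF Q(1)] ve by (simp add: ind_def)
  obtain U' where U': "sp U'" "?W \<subseteq> U'" "U' \<subseteq> U" "?S \<inter> U' = {0}"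
    "\<And>x. x \<in> U \<Longrightarrow> \<exists>s\<in>?S. \<exists>t\<in>U'. x = s + t" "vec.dim U' + vec.dim ?S = vec.dim U"
  proof (rule ex_complement[OF vec.subspace_span vec.subspace_span U(1)])
    show "vec.span {v, e} \<subseteq> U" using vU U by (intro vec.span_minimal) auto
    show "?W \<subseteq> U" using P(2) U by (intro vec.span_minimal) auto
    show "?S \<inter> ?W = {0}" by (rule dis)
  qed blast
  have dU': "vec.dim U' = 2 * k" using U'(6) dS U(2) by simp
  have inU': "{a, b, a', b'} \<subseteq> U'" using U'(2) by (auto intro: vec.span_base)
  have vS: "v \<in> ?S" "e \<in> ?S" by (auto intro: vec.span_base)
  have ive: "ind [(v, e)]" using ind_appendD(2)[OF Q(1)] ve by simp
  then have v0: "v \<noteq> 0" "e \<notin> vec.span {v}" by (auto simp: ind_Cons)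
  have vU': "v \<notin> U'" using vS v0 U'(4) by blast
  have eU': "e \<notin> vec.span (insert v U')"
  proof
    assume "e \<in> vec.span (insert v U')"
    then obtain c y where y: "y \<in> vec.span U'" "e = c *s v + y" by (rule in_span_insertE)
    have "y \<in> U'" using y(1) unfolding span_eq_subspace[OF U'(1)] .
    moreover have "y = e - c *s v" using y by simp
    then have "y \<in> ?S" using vS by (simp add: vec.span_diff vec.span_scale)
    ultimately have "y = 0" using U'(4) by blast
    then show False using y v0 by (simp add: vec.span_base vec.span_scale)
  qed
  from ex_functional'[OF vec.subspace_span eU'] obtain g :: "'a^'m \<Rightarrow> 'a" where g:
    "\<And>x y. g (x + y) = g x + g y" "\<And>c x. g (c *s x) = c * g x" "g e = 1"
    "\<And>x. x \<in> vec.span (insert v U') \<Longrightarrow> g x = 0" by blast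
  have gv: "g v = 0" "\<And>x. x \<in> U' \<Longrightarrow> g x = 0" using g(4) by (auto simp: vec.span_base)
  have gen: "\<exists>\<alpha> \<beta> x'. x' \<in> U' \<and> x = \<alpha> *s v + \<beta> *s e + x'" if "x \<in> U" for x
  proof -
    obtain s t where st: "s \<in> ?S" "t \<in> U'" "x = s + t" using U'(5)[OF \<open>x \<in> U\<close>] by blast
    obtain \<alpha> y where y: "y \<in> vec.span {e}" "s = \<alpha> *s v + y" using st(1) by (rule in_span_insertE)
    obtain \<beta> where "y = \<beta> *s e" using y(1) vec.span_breakdown_eq[of y e "{}"] by auto
    then show ?thesis using st y by blast
  qed
  note ctx = U(1) U'(1) U'(3) vU(1) vU' vU(2) gen g(1,2) gv(1) g(3) gv(2) f
  let ?K = "\<lambda>p q y. FT f ([(p, q)] @ [(v, y)])"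
  \<comment> \<open>After slicing, the coefficient at \<open>p \<and> q\<close> is a sum over the
    span of \<open>v\<close>, \<open>p\<close>, \<open>q\<close> only. By \<open>ex_twist\<close>
    some functional that vanishes at \<open>v\<close> and on the other line makes this sum
    nonzero.\<close>
  have pencil: "\<exists>h. (\<forall>x y. h (x + y) = h x + h y) \<and> (\<forall>c x. h (c *s x) = c * h x) \<and>
      (\<forall>x\<in>{v, p', q'}. h x = 0) \<and> (\<Sum>y\<in>vec.span {v, p, q}. addchar (- h y) * ?K p q y) \<noteq> 0"
    if pq: "ind [(p, q), (p', q'), (v, e)]" "FT f [(p, q)] \<noteq> 0" for p q p' q'
  proof -
    obtain hp :: "'a^'m \<Rightarrow> 'a" where hp: "\<And>x y. hp (x + y) = hp x + hp y" "\<And>c x. hp (c *s x) = c * hp x"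
      "hp p = 1" "hp q = 0" "\<And>x. x \<in> {p', q', v, e} \<Longrightarrow> hp x = 0" using ind_functional[OF pq(1)] by auto
    have iq: "ind ((q, p) # [(p', q'), (v, e)])" using pq(1) by (simp add: ind_def insert_commute)
    obtain hq :: "'a^'m \<Rightarrow> 'a" where hq: "\<And>x y. hq (x + y) = hq x + hq y" "\<And>c x. hq (c *s x) = c * hq x"
      "hq q = 1" "hq p = 0" "\<And>x. x \<in> {p', q', v, e} \<Longrightarrow> hq x = 0" using ind_functional[OF iq] by auto
    have "?K p q y = FT f [(p, q)]" if y: "y \<in> vec.span {v, p, q}" "hp y = 0" "hq y = 0" for y
    proof -
      obtain c y1 where y1: "y1 \<in> vec.span {p, q}" "y = c *s v + y1" using y(1) by (rule in_span_insertE)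
      obtain d y2 where y2: "y2 \<in> vec.span {q}" "y1 = d *s p + y2" using y1(1) by (rule in_span_insertE)
      obtain d' where y3: "y2 = d' *s q" using y2(1) vec.span_breakdown_eq[of y2 q "{}"] by auto
      have "d = 0" using y(2) by (simp add: y1 y2 y3 hp)
      moreover have "d' = 0" using y(3) by (simp add: y1 y2 y3 hq)
      ultimately have "y = c *s v" using y1 y2 y3 by simp
      then show ?thesis by (intro FT_cong) (simp add: altf_simps)
    qed
    then obtain s t where st: "(\<Sum>y\<in>vec.span {v, p, q}. addchar (- (s * hp y + t * hq y)) * ?K p q y) \<noteq> 0"
      using ex_twist[of "vec.span {v, p, q}" v hp hq "FT f [(p, q)]" "?K p q"] hp(5)[of v] hq(5)[of v] pq(2)
      by (auto simp: vec.span_base)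
    show ?thesis
      by (rule exI[of _ "\<lambda>y. s * hp y + t * hq y"]) (use st hp hq in \<open>auto simp: algebra_simps\<close>)
  qed
  have i1: "ind [(a, b), (a', b'), (v, e)]" using Q(1) ve by simp
  have "ind ([(a, b)] @ [(a', b'), (v, e)])" using i1 by simp
  then have i2: "ind [(a', b'), (a, b), (v, e)]" by (simp add: ind_def insert_commute)
  obtain h1 where h1: "\<And>x y. h1 (x + y) = h1 x + h1 y" "\<And>c x. h1 (c *s x) = c * h1 x"
    "\<forall>x\<in>{v, a', b'}. h1 x = 0" "(\<Sum>y\<in>vec.span {v, a, b}. addchar (- h1 y) * ?K a b y) \<noteq> 0"
    using pencil[OF i1 P(3)] by blast
  obtain h2 where h2: "\<And>x y. h2 (x + y) = h2 x + h2 y" "\<And>c x. h2 (c *s x) = c * h2 x"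
    "\<forall>x\<in>{v, a, b}. h2 x = 0" "(\<Sum>y\<in>vec.span {v, a', b'}. addchar (- h2 y) * ?K a' b' y) \<noteq> 0"
    using pencil[OF i2 P(4)] by blast
  \<comment> \<open>Each of the two sums sees only one of \<open>h1\<close> and \<open>h2\<close>,
    because the other one vanishes on its range.\<close>
  define h where "h y = h1 y + h2 y" for y
  have h: "h (x + y) = h x + h y" "h (c *s x) = c * h x" for x y c by (simp_all add: h_def h1 h2 algebra_simps)
  have vanish: "r y = 0" if "\<And>x y. r (x + y) = r x + r y" "\<And>c x. r (c *s x) = c * r x" "\<forall>x\<in>T. r x = 0"
    "y \<in> vec.span T" for r :: "'a^'m \<Rightarrow> 'a" and T y
  proof -
    have "sp {x. r x = 0}" using that(2)[of 0 0] by (auto simp: vec.subspace_def that(1,2))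
    then have "vec.span T \<subseteq> {x. r x = 0}" using that(3) by (intro vec.span_minimal) auto
    then show ?thesis using that(4) by blast
  qed
  define F0 where "F0 = push U' (slice U v h f)"
  have FTnz: "FT F0 [(p, q)] \<noteq> 0" if pq: "ind [(p, q)]" "p \<in> U'" "q \<in> U'"
    and hh: "\<And>y. y \<in> vec.span {v, p, q} \<Longrightarrow> h y = r y"
    and nz: "(\<Sum>y\<in>vec.span {v, p, q}. addchar (- r y) * ?K p q y) \<noteq> 0" for p q r
  proof -
    have "(\<Sum>y\<in>U. addchar (- h y) * ?K p q y) = (\<Sum>y\<in>vec.span {v, p, q}. addchar (- h y) * ?K p q y)"
    proof (rule sum.mono_neutral_right)
      show "vec.span {v, p, q} \<subseteq> U" using vU pq U' U by (intro vec.span_minimal) auto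
      show "\<forall>y\<in>U - vec.span {v, p, q}. addchar (- h y) * ?K p q y = 0"
        using slice_short[OF ctx pq] by simp
    qed simp
    also have "\<dots> = (\<Sum>y\<in>vec.span {v, p, q}. addchar (- r y) * ?K p q y)"
      by (intro sum.cong refl) (simp add: hh)
    finally have "of_nat (card U) * FT (slice U v h f) [(p, q)] \<noteq> 0"
      using nz FT_slice[OF U(1) h, where P = "[(p, q)]" and v = v and f = f] by simp
    then show ?thesis using FT_push[of "[(p, q)]" U' "slice U v h f"] pq fibre_nz[of U'] by (simp add: F0_def)
  qed
  have ab: "ind [(a, b)]" "ind [(a', b')]"
    using ind_appendD[of "[(a, b)]" "[(a', b')]"] P(1) by auto
  have n1: "FT F0 [(a, b)] \<noteq> 0"
    by (rule FTnz[OF ab(1), of h1]) (use inU' h1(4) vanish[OF h2(1,2,3)] in \<open>auto simp: h_def\<close>)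
  have n2: "FT F0 [(a', b')] \<noteq> 0"
    by (rule FTnz[OF ab(2), of h2]) (use inU' h2(4) vanish[OF h1(1,2,3)] in \<open>auto simp: h_def\<close>)
  have "even (vec.dim U')" using dU' by simp
  from slice_step[OF ctx h F0_def this] have "deg1 U' F0" "nodiff U' F0"
    using n1 ab(1) inU' by auto
  from IH[OF U'(1) dU' this inU' n1 n2] show False .
qed

lemma nodiff_meet:
  fixes U :: "('a::{field,finite}^'m::finite) set"
  assumes "2 \<le> k" "sp U" "vec.dim U = 2 * k" "deg1 U f" "nodiff U f"
    and "ind [(a, b), (a', b')]" "{a, b, a', b'} \<subseteq> U" "FT f [(a, b)] \<noteq> 0" "FT f [(a', b')] \<noteq> 0"
  shows False
  using assms
proof (induction k arbitrary: U f rule: dec_induct)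
  case base
  then show ?case using nodiff_base[of U f a b a' b'] by simp
next
  case (step k)
  show ?case
    by (rule nodiff_step[OF step(4,5) _ step(6-11)]) (use step(1) step(3)[OF _ _ _ _ step(8)] in auto)
qed

text \<open>A line determines its bivector only up to a scalar; a nonzero coefficient at one of the
  multiples puts the line into the set.\<close>

definition FTlines :: "('a::{field,finite}^'m::finite) set \<Rightarrow> (('a^'m \<Rightarrow> 'a^'m \<Rightarrow> 'a) \<Rightarrow> complex) \<Rightarrow> ('a^'m) set set" where
  "FTlines U f = {vec.span {a, b} | a b. ind [(a, b)] \<and> a \<in> U \<and> b \<in> U \<and> FT f [(a, b)] \<noteq> 0}"

lemma FTlines_dichotomy:
  fixes U :: "('a::{field,finite}^'m::finite) set"
  assumes U: "sp U" "1 \<le> vec.dim U"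
    and meet: "\<And>a b a' b'. ind [(a, b), (a', b')] \<Longrightarrow> {a, b, a', b'} \<subseteq> U \<Longrightarrow> FT f [(a, b)] \<noteq> 0 \<Longrightarrow>
      FT f [(a', b')] \<noteq> 0 \<Longrightarrow> False"
  shows "(\<exists>u\<in>U. u \<noteq> 0 \<and> (\<forall>J\<in>FTlines U f. u \<in> J)) \<or>
    (\<exists>A. sp A \<and> A \<subseteq> U \<and> vec.dim A = 3 \<and> (\<forall>J\<in>FTlines U f. J \<subseteq> A))"
proof (cases "FTlines U f = {}")
  case True
  have "\<not> U \<subseteq> {0}" using U(2) vec.dim_eq_0[of U] by linarith
  then show ?thesis using True by blast
next
  case False
  then obtain J0 where J0: "J0 \<in> FTlines U f" by blast
  show ?thesis
  proof (rule pairwise_meeting_lines[OF _ _ J0 U(1)])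
    show "isline J" if "J \<in> FTlines U f" for J using that by (auto simp: FTlines_def isline_span)
    show "J \<subseteq> U" if J: "J \<in> FTlines U f" for J
    proof -
      obtain a b where "J = vec.span {a, b}" "a \<in> U" "b \<in> U" using J unfolding FTlines_def by blast
      then show ?thesis using vec.span_minimal[of "{a, b}" U] U(1) by simp
    qed
    show "J \<inter> K \<noteq> {0}" if J: "J \<in> FTlines U f" and K: "K \<in> FTlines U f" for J K
    proof
      assume JK: "J \<inter> K = {0}"
      obtain a b where ab: "J = vec.span {a, b}" "ind [(a, b)]" "a \<in> U" "b \<in> U" "FT f [(a, b)] \<noteq> 0"
        using J unfolding FTlines_def by blast
      obtain a' b' where ab': "K = vec.span {a', b'}" "ind [(a', b')]" "a' \<in> U" "b' \<in> U" "FT f [(a', b')] \<noteq> 0"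
        using K unfolding FTlines_def by blast
      have "ind ([(a, b)] @ [(a', b')])" by (rule ind_append) (use ab ab' JK in auto)
      then show False using meet[of a b a' b'] ab ab' by simp
    qed
  qed
qed

section \<open>Invariance under translations and the shape of the support\<close>

lemma deg1_invariant:
  fixes U :: "('a::{field,finite}^'m::finite) set"
  assumes f: "dep U f" "deg1 U f" and U: "sp U" and D: "D \<in> altf" and B: "B \<in> altf"
    and z: "\<And>a b. ind [(a, b)] \<Longrightarrow> a \<in> U \<Longrightarrow> b \<in> U \<Longrightarrow> FT f [(a, b)] \<noteq> 0 \<Longrightarrow> D a b = 0"
  shows "f (B + D) = f B"
proof (rule FT_invariant[OF f(1) U D _ B])
  fix P assume P: "sv P \<subseteq> U" "FT f P \<noteq> 0"
  obtain Q where Q: "ind Q" "sv Q \<subseteq> U" "\<And>B. B \<in> altf \<Longrightarrow> ev B Q = ev B P"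
    using normal_form[OF P(1) U] by blast
  have FQ: "FT f Q \<noteq> 0" using P(2) FT_cong[of Q P f] Q(3) by simp
  then have "length Q < 2" using f(2) Q unfolding deg1_def by (meson not_le)
  have "ev D Q = 0"
  proof (cases Q)
    case (Cons pq R)
    then have "R = []" using \<open>length Q < 2\<close> by simp
    then obtain p q where "Q = [(p, q)]" using Cons by (cases pq) auto
    then show ?thesis using z[of p q] Q FQ by simp
  qed simp
  then show "addchar (ev D P) = 1" using Q(3)[OF D] by simp
qed

lemma star_invariant:
  fixes U :: "('a::{field,finite}^'m::finite) set"
  assumes f: "dep U f" "deg1 U f" and U: "sp U" and D: "D \<in> altf" and B: "B \<in> altf"
    and u: "u \<noteq> 0" "\<forall>J\<in>FTlines U f. u \<in> J" and Du: "\<And>y. y \<in> U \<Longrightarrow> D u y = 0"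
  shows "f (B + D) = f B"
proof (rule deg1_invariant[OF f U D B])
  fix a b assume ab: "ind [(a, b)]" "a \<in> U" "b \<in> U" "FT f [(a, b)] \<noteq> 0"
  then have "vec.span {a, b} \<in> FTlines U f" unfolding FTlines_def by blast
  then have "u \<in> vec.span {a, b}" using u(2) by blast
  then obtain \<alpha> y where y: "y \<in> vec.span {b}" "u = \<alpha> *s a + y" by (rule in_span_insertE)
  obtain \<beta> where \<beta>: "y = \<beta> *s b" using y(1) vec.span_breakdown_eq[of y b "{}"] by auto
  have "\<alpha> \<noteq> 0 \<or> \<beta> \<noteq> 0" using y \<beta> u(1) by auto
  moreover have "\<alpha> * D a b = 0" using Du[OF ab(3)] by (simp add: y \<beta> altf_simps[OF D])
  moreover have "\<beta> * D a b = 0" using Du[OF ab(2)] altf_skew[OF D, of b a] by (simp add: y \<beta> altf_simps[OF D])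
  ultimately show "D a b = 0" by auto
qed

lemma plane_invariant:
  fixes U :: "('a::{field,finite}^'m::finite) set"
  assumes f: "dep U f" "deg1 U f" and U: "sp U" and D: "D \<in> altf" and B: "B \<in> altf"
    and A: "\<forall>J\<in>FTlines U f. J \<subseteq> A" and DA: "eqon A D 0"
  shows "f (B + D) = f B"
proof (rule deg1_invariant[OF f U D B])
  fix a b assume ab: "ind [(a, b)]" "a \<in> U" "b \<in> U" "FT f [(a, b)] \<noteq> 0"
  then have "vec.span {a, b} \<in> FTlines U f" unfolding FTlines_def by blast
  then have "vec.span {a, b} \<subseteq> A" using A by blast
  then have "a \<in> A" "b \<in> A" by (auto intro: vec.span_base)
  then show "D a b = 0" using DA by (simp add: eqon_def)
qed

lemma ex_triple:
  fixes A :: "('a::{field,finite}^'m::finite) set"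
  assumes "sp A" "3 \<le> vec.dim A"
  obtains a b c where "{a, b, c} \<subseteq> A" "vec.dim {a, b, c} = 3"
proof -
  obtain Q where Q: "ind Q" "sv Q \<subseteq> A" "length Q = 1" using ind_extend[of "[]" A 1] assms by auto
  obtain ab where ab0: "Q = [ab]" using Q(3) by (cases Q) auto
  obtain a b where "ab = (a, b)" by (cases ab)
  then have ab: "Q = [(a, b)]" using ab0 by simp
  have d: "vec.dim {a, b} = 2" using Q ab by (simp add: ind_def)
  then have "\<not> A \<subseteq> vec.span {a, b}" using assms vec.dim_mono[of A "{a, b}"] by auto
  then obtain c where c: "c \<in> A" "c \<notin> vec.span {a, b}" by blast
  have "vec.dim (insert c {a, b}) = 3" using c d by (simp add: vec.dim_insert[of c "{a, b}"])
  then show ?thesis using that[of c a b] Q ab c by simp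
qed

text \<open>Pair a basis of \<open>A\<close> with three independent vectors of a complement. The
  vectors of \<open>A\<close> then come first in the pairs of a hyperbolic basis, and
  \<open>ex_nonsing_extension\<close> makes them mutually orthogonal; dimension at least six
  provides the room.\<close>

lemma ex_nonsing_isotropic_plane:
  fixes U :: "('a::{field,finite}^'m::finite) set"
  assumes U: "sp U" "even (vec.dim U)" "6 \<le> vec.dim U" and A: "sp A" "A \<subseteq> U" "vec.dim A = 3"
  shows "\<exists>D\<in>altf. nonsing U D \<and> eqon A D 0"
proof -
  obtain a1 a2 a3 where a: "{a1, a2, a3} \<subseteq> A" "vec.dim {a1, a2, a3} = 3" using ex_triple[OF A(1)] A(3) by auto
  have sz: "sp {0 :: 'a^'m}" by (simp add: vec.subspace_def)
  obtain T where T: "sp T" "T \<subseteq> U" "A \<inter> T = {0}" "vec.dim T + vec.dim A = vec.dim U"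
  proof (rule ex_complement[OF A(1) sz U(1) A(2)])
    show "{0} \<subseteq> U" using U(1) by (simp add: vec.subspace_0)
    show "A \<inter> {0} = {0}" using A(1) by (simp add: vec.subspace_0)
  qed blast
  obtain c1 c2 c3 where c: "{c1, c2, c3} \<subseteq> T" "vec.dim {c1, c2, c3} = 3"
    using ex_triple[OF T(1)] T(4) A(3) U(3) by auto
  have spA: "vec.span {a1, a2, a3} = A"
    by (rule sp_eqI[OF vec.subspace_span A(1) vec.span_minimal[OF a(1) A(1)]]) (simp add: a(2) A(3))
  have spT: "vec.span {c1, c2, c3} \<subseteq> T" using c T by (intro vec.span_minimal)
  let ?P = "[(a1, c1), (a2, c2), (a3, c3)]"
  have "vec.dim ({a1, a2, a3} \<union> {c1, c2, c3}) = 6"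
    by (subst dim_Un_disjoint) (use a c spA spT T(3) in \<open>auto simp: vec.span_zero\<close>)
  moreover have "sv ?P = {a1, a2, a3} \<union> {c1, c2, c3}" by auto
  ultimately have "ind ?P" by (simp add: ind_def)
  moreover have "sv ?P \<subseteq> U" using a c A T by auto
  ultimately obtain D where D: "D \<in> altf" "nonsing U D" "\<forall>a\<in>fst ` set ?P. \<forall>b\<in>fst ` set ?P. D a b = 0"
    using ex_nonsing_extension[of ?P U 0] U by blast
  have D0: "D x y = 0" if xy: "x \<in> {a1, a2, a3}" "y \<in> {a1, a2, a3}" for x y using D(3) xy by auto
  have D1: "D x y = 0" if x: "x \<in> {a1, a2, a3}" and y: "y \<in> A" for x y
  proof -
    have "sp {y. D x y = 0}" using D(1) by (auto simp: vec.subspace_def altf_simps)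
    then have "vec.span {a1, a2, a3} \<subseteq> {y. D x y = 0}" using D0[OF x] by (intro vec.span_minimal) auto
    then show ?thesis using y spA by blast
  qed
  have "D x y = 0" if xy: "x \<in> A" "y \<in> A" for x y
  proof -
    have "sp {x. D x y = 0}" using D(1) by (auto simp: vec.subspace_def altf_simps)
    then have "vec.span {a1, a2, a3} \<subseteq> {x. D x y = 0}" using D1[OF _ xy(2)] by (intro vec.span_minimal) auto
    then show ?thesis using xy spA by blast
  qed
  then have "eqon A D 0" by (simp add: eqon_def)
  then show ?thesis using D by blast
qed

lemma ex_hyperplane:
  fixes U :: "('a::{field,finite}^'m::finite) set"
  assumes U: "sp U" and W: "sp W" "W \<subseteq> U" and x: "x \<in> U" "x \<notin> W"
  obtains M where "sp M" "W \<subseteq> M" "M \<subseteq> U" "x \<notin> M" "vec.dim M + 1 = vec.dim U"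
proof -
  have x0: "x \<noteq> 0" using x W vec.subspace_0 by blast
  have dis: "vec.span {x} \<inter> W = {0}"
  proof -
    have "y = 0" if y: "y \<in> vec.span {x}" "y \<in> W" for y
    proof (rule ccontr)
      assume "y \<noteq> 0"
      obtain c where c: "y = c *s x" using y(1) vec.span_breakdown_eq[of y x "{}"] by auto
      then have "x = (1 / c) *s y" using \<open>y \<noteq> 0\<close> by (cases "c = 0") auto
      then show False using x(2) y(2) W(1) by (metis vec.subspace_scale)
    qed
    then show ?thesis using W(1) by (auto simp: vec.span_zero vec.subspace_0)
  qed
  have sx: "vec.span {x} \<subseteq> U" using x U by (intro vec.span_minimal) auto
  obtain M where M: "sp M" "W \<subseteq> M" "M \<subseteq> U" "vec.span {x} \<inter> M = {0}" "vec.dim M + vec.dim (vec.span {x}) = vec.dim U"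
    by (rule ex_complement[OF vec.subspace_span W(1) U sx W(2) dis]) blast
  have "x \<notin> M" using M(4) x0 vec.span_base[of x "{x}"] by auto
  then show ?thesis using that M x0 by simp
qed

text \<open>If all lines lay in a plane, translating \<open>B0\<close> by a nonsingular form that
  vanishes on it would contradict \<open>nodiff\<close>. So they share a point \<open>u\<close>, and
  \<open>f\<close> depends only on the contraction with \<open>u\<close>. A form whose contraction
  differs from that of \<open>B0\<close> can be changed, with the contraction kept, until it differs
  from \<open>B0\<close> by a nonsingular form; there \<open>f\<close> vanishes.\<close>

lemma nodiff_pencil:
  fixes U :: "('a::{field,finite}^'m::finite) set"
  assumes U: "sp U" "vec.dim U = 2 * k" "3 \<le> k" and f: "dep U f" "deg1 U f" "nodiff U f"
    and B0: "B0 \<in> altf" "f B0 \<noteq> 0"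
  shows "\<exists>u\<in>U. u \<noteq> 0 \<and> (\<forall>B\<in>altf. f B = (if \<forall>y\<in>U. B u y = B0 u y then f B0 else 0))"
proof -
  have "(\<exists>u\<in>U. u \<noteq> 0 \<and> (\<forall>J\<in>FTlines U f. u \<in> J)) \<or>
    (\<exists>A. sp A \<and> A \<subseteq> U \<and> vec.dim A = 3 \<and> (\<forall>J\<in>FTlines U f. J \<subseteq> A))"
  proof (rule FTlines_dichotomy[OF U(1)])
    show False if "ind [(a, b), (a', b')]" "{a, b, a', b'} \<subseteq> U" "FT f [(a, b)] \<noteq> 0" "FT f [(a', b')] \<noteq> 0" for a b a' b'
      by (rule nodiff_meet[OF _ U(1,2) f(2,3) that]) (use U in simp)
  qed (use U in simp)
  then show ?thesis
  proof (elim disjE exE conjE bexE)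
    fix A assume A: "sp A" "A \<subseteq> U" "vec.dim A = 3" "\<forall>J\<in>FTlines U f. J \<subseteq> A"
    obtain D where D: "D \<in> altf" "nonsing U D" "eqon A D 0" using ex_nonsing_isotropic_plane[OF U(1) _ _ A(1-3)] U by auto
    have "f (B0 + D) = f B0" by (rule plane_invariant[OF f(1,2) U(1) D(1) B0(1) A(4) D(3)])
    then have "\<not> nonsing U (B0 + D - B0)" using f(3) B0 altf_add[OF B0(1) D(1)] unfolding nodiff_def by metis
    then show ?thesis using D(2) by simp
  next
    fix u assume u: "u \<in> U" "u \<noteq> 0" "\<forall>J\<in>FTlines U f. u \<in> J"
    have "f B = (if \<forall>y\<in>U. B u y = B0 u y then f B0 else 0)" if B: "B \<in> altf" for B
    proof (cases "\<forall>y\<in>U. B u y = B0 u y")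
      case True
      have "f (B0 + (B - B0)) = f B0"
        by (rule star_invariant[OF f(1,2) U(1) altf_diff[OF B B0(1)] B0(1) u(2,3)]) (use True in simp)
      then show ?thesis using True by simp
    next
      case False
      then obtain e where e: "e \<in> U" "(B - B0) u e \<noteq> 0" by auto
      have "even (vec.dim U)" using U(2) by simp
      from ex_nonsing_completion[OF U(1) this altf_diff[OF B B0(1)] u(1) e] obtain D'
        where D': "D' \<in> altf" "\<forall>y\<in>U. D' u y = 0" "nonsing U (B - B0 + D')" by blast
      have "f (B + D') = f B"
        by (rule star_invariant[OF f(1,2) U(1) D'(1) B u(2,3)]) (use D' in simp)
      moreover have "B + D' - B0 = B - B0 + D'" by (simp add: algebra_simps)
      ultimately have "f B = 0" using f(3) B0 altf_add[OF B D'(1)] D'(3) unfolding nodiff_def by metis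
      then show ?thesis unfolding if_not_P[OF False] .
    qed
    then show ?thesis using u by blast
  qed
qed

text \<open>All forms on a space of odd dimension are singular, so the hypothesis concerns
  hyperplanes \<open>M\<close>. Two skew lines lie in a hyperplane, where \<open>nodiff_meet\<close>
  applies after \<open>push\<close>. A common plane is put inside \<open>M\<close>, while a common
  point is kept outside \<open>M\<close>: a form with \<open>u\<close> in its radical can still be
  nonsingular on \<open>M\<close>, and translating by it gives the contradiction.\<close>

lemma nodiff_odd:
  fixes U :: "('a::{field,finite}^'m::finite) set"
  assumes U: "sp U" "vec.dim U = 2 * k + 1" "3 \<le> k" and f: "dep U f" "deg1 U f"
    and nd: "\<And>M. sp M \<Longrightarrow> M \<subseteq> U \<Longrightarrow> vec.dim M = 2 * k \<Longrightarrow> nodiff M f"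
    and B0: "B0 \<in> altf" "f B0 \<noteq> 0"
  shows False
proof -
  have hyp: "\<exists>M. sp M \<and> W \<subseteq> M \<and> M \<subseteq> U \<and> vec.dim M = 2 * k" if W: "sp W" "W \<subseteq> U" "vec.dim W < vec.dim U" for W
  proof -
    have "\<not> U \<subseteq> W" using W(3) vec.dim_subset[of U W] by auto
    then obtain x where "x \<in> U" "x \<notin> W" by blast
    from ex_hyperplane[OF U(1) W(1,2) this] show ?thesis using U(2) by (metis add_right_cancel)
  qed
  have contra: False if M: "sp M" "M \<subseteq> U" "vec.dim M = 2 * k" and D: "D \<in> altf" "nonsing M D" "f (B0 + D) = f B0" for M D
  proof -
    have "\<not> nonsing M (B0 + D - B0)" using nd[OF M] B0 altf_add[OF B0(1) D(1)] D(3) unfolding nodiff_def by metis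
    then show ?thesis using D(2) by simp
  qed
  have "(\<exists>u\<in>U. u \<noteq> 0 \<and> (\<forall>J\<in>FTlines U f. u \<in> J)) \<or>
    (\<exists>A. sp A \<and> A \<subseteq> U \<and> vec.dim A = 3 \<and> (\<forall>J\<in>FTlines U f. J \<subseteq> A))"
  proof (rule FTlines_dichotomy[OF U(1)])
    show False if ab: "ind [(a, b), (a', b')]" "{a, b, a', b'} \<subseteq> U" "FT f [(a, b)] \<noteq> 0" "FT f [(a', b')] \<noteq> 0" for a b a' b'
    proof -
      let ?W = "vec.span {a, b, a', b'}"
      have "vec.dim ?W = 4" using ab(1) by (simp add: ind_def)
      then have dW: "vec.dim ?W < vec.dim U" using U by simp
      have WU: "?W \<subseteq> U" using ab(2) U(1) by (intro vec.span_minimal)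
      obtain M where M: "sp M" "?W \<subseteq> M" "M \<subseteq> U" "vec.dim M = 2 * k"
        using hyp[OF vec.subspace_span WU dW] by blast
      have inM: "{a, b, a', b'} \<subseteq> M" by (rule subset_trans[OF vec.span_superset M(2)])
      have "deg1 M (push M f)" unfolding deg1_def
      proof (intro allI impI)
        fix P assume P: "ind P" "sv P \<subseteq> M" "2 \<le> length P"
        have "FT f P = 0" using f(2) P M(3) unfolding deg1_def by blast
        then show "FT (push M f) P = 0" using FT_push[OF P(2)] by simp
      qed
      moreover have "nodiff M (push M f)" unfolding nodiff_def
      proof (intro ballI impI)
        fix B D assume nz: "push M f B \<noteq> 0" "push M f D \<noteq> 0"
        obtain B1 where B1: "B1 \<in> altf" "eqon M B1 B" "f B1 \<noteq> 0" using push_nz[OF nz(1)] by blast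
        obtain D1 where D1: "D1 \<in> altf" "eqon M D1 D" "f D1 \<noteq> 0" using push_nz[OF nz(2)] by blast
        have "\<not> nonsing M (B1 - D1)"
          using nd[OF M(1,3,4)] B1 D1 unfolding nodiff_def by blast
        moreover have "eqon M (B1 - D1) (B - D)" using B1(2) D1(2) by (simp add: eqon_def)
        ultimately show "\<not> nonsing M (B - D)" using nonsing_cong by blast
      qed
      moreover have "FT (push M f) [(a, b)] \<noteq> 0" "FT (push M f) [(a', b')] \<noteq> 0"
        using FT_push[of "[(a, b)]" M f] FT_push[of "[(a', b')]" M f] inM ab fibre_nz[of M] by auto
      ultimately show False using nodiff_meet[OF _ M(1,4) _ _ ab(1) inM] U by simp
    qed
  qed (use U in simp)
  then show False
  proof (elim disjE exE conjE bexE)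
    fix A assume A: "sp A" "A \<subseteq> U" "vec.dim A = 3" "\<forall>J\<in>FTlines U f. J \<subseteq> A"
    obtain M where M: "sp M" "A \<subseteq> M" "M \<subseteq> U" "vec.dim M = 2 * k" using hyp[OF A(1,2)] A(3) U by auto
    obtain D where D: "D \<in> altf" "nonsing M D" "eqon A D 0"
      using ex_nonsing_isotropic_plane[OF M(1) _ _ A(1) M(2) A(3)] U M(4) by auto
    have "f (B0 + D) = f B0" by (rule plane_invariant[OF f U(1) D(1) B0(1) A(4) D(3)])
    then show False by (rule contra[OF M(1,3,4) D(1,2)])
  next
    fix u assume u: "u \<in> U" "u \<noteq> 0" "\<forall>J\<in>FTlines U f. u \<in> J"
    have sz: "sp {0 :: 'a^'m}" by (simp add: vec.subspace_def)
    have "0 \<in> U" using U(1) by (rule vec.subspace_0)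
    obtain M where M: "sp M" "M \<subseteq> U" "u \<notin> M" "vec.dim M + 1 = vec.dim U"
      by (rule ex_hyperplane[OF U(1) sz _ u(1)]) (use u \<open>0 \<in> U\<close> in auto)
    have dM: "vec.dim M = 2 * k" using M(4) U(2) by simp
    obtain C where C: "C \<in> altf" "nonsing M C" using ex_nonsing[OF M(1)] dM by auto
    have dis: "vec.span {u} \<inter> M = {0}"
    proof -
      have "y = 0" if y: "y \<in> vec.span {u}" "y \<in> M" for y
      proof (rule ccontr)
        assume "y \<noteq> 0"
        obtain c where c: "y = c *s u" using y(1) vec.span_breakdown_eq[of y u "{}"] by auto
        then have "u = (1 / c) *s y" using \<open>y \<noteq> 0\<close> by (cases "c = 0") auto
        then show False using M(1,3) y(2) by (metis vec.subspace_scale)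
      qed
      then show ?thesis using M(1) by (auto simp: vec.span_zero vec.subspace_0)
    qed
    obtain D where D: "D \<in> altf" "eqon (vec.span {u}) D 0" "eqon M D C"
      "\<And>s t. s \<in> vec.span {u} \<Longrightarrow> t \<in> M \<Longrightarrow> D s t = 0"
      by (rule block_sum[OF vec.subspace_span M(1) dis altf_0 C(1)]) blast
    have uu: "u \<in> vec.span {u}" by (simp add: vec.span_base)
    have "vec.span {u} \<subseteq> U" using u U by (intro vec.span_minimal) auto
    then have "ssum (vec.span {u}) M = U"
      by (intro sp_eqI sp_ssum ssum_least U(1) M(1,2) vec.subspace_span)
        (use dim_ssum[OF vec.subspace_span M(1), of "{u}"] dis u M(4) in auto)
    have "D u y = 0" if y: "y \<in> U" for y
    proof -
      obtain s t where st: "s \<in> vec.span {u}" "t \<in> M" "y = s + t"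
        using y \<open>ssum (vec.span {u}) M = U\<close> unfolding ssum_def by blast
      have "D u s = 0" using D(2) st(1) uu by (simp add: eqon_def)
      then show ?thesis using D(4)[OF uu st(2)] st by (simp add: altf_simps[OF D(1)])
    qed
    then have "f (B0 + D) = f B0" by (intro star_invariant[OF f U(1) D(1) B0(1) u(2,3)])
    moreover have "nonsing M D" using C(2) D(3) nonsing_cong by blast
    ultimately show False using contra[OF M(1,2) dM D(1)] by blast
  qed
qed

subsection \<open>A relation between skew lines\<close>

lemma two_subspaces_not_cover:
  fixes A B U :: "('a::field^'m) set"
  assumes "sp A" "sp B" "sp U" "\<not> U \<subseteq> A" "\<not> U \<subseteq> B"
  shows "\<exists>x\<in>U. x \<notin> A \<and> x \<notin> B"
proof -
  obtain x y where xy: "x \<in> U" "x \<notin> A" "y \<in> U" "y \<notin> B" using assms by blast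
  show ?thesis
  proof (cases "x \<notin> B \<or> y \<notin> A")
    case True
    then show ?thesis using xy by blast
  next
    case False
    have "x + y \<notin> A" using vec.subspace_diff[OF assms(1), of "x + y" y] False xy by auto
    moreover have "x + y \<notin> B" using vec.subspace_diff[OF assms(2), of "x + y" x] False xy by auto
    ultimately show ?thesis using xy vec.subspace_add[OF assms(3)] by blast
  qed
qed

lemma span_pair_disjoint:
  fixes L :: "('a::field^'m) set"
  assumes L: "sp L" and x: "x \<notin> L" and y: "y \<notin> vec.span (insert x L)"
  shows "L \<inter> vec.span {x, y} = {0}" "ind [(x, y)]"
proof -
  have sL: "vec.span L = L" using L by (rule span_eq_subspace)
  have "z = 0" if z: "z \<in> L" "z \<in> vec.span {x, y}" for z
  proof -
    obtain \<alpha> z1 where z1: "z1 \<in> vec.span {y}" "z = \<alpha> *s x + z1" using z(2) by (rule in_span_insertE)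
    obtain \<beta> where b: "z1 = \<beta> *s y" using z1(1) vec.span_breakdown_eq[of z1 y "{}"] by auto
    have "\<beta> = 0"
    proof (rule ccontr)
      assume nz: "\<beta> \<noteq> 0"
      have "y = (- \<alpha> / \<beta>) *s x + (1 / \<beta>) *s z"
        using nz by (simp add: z1 b vec.scale_right_distrib vec.scale_minus_left)
      moreover have "(1 / \<beta>) *s z \<in> vec.span L" using z(1) by (intro vec.span_scale vec.span_base)
      ultimately have "y \<in> vec.span (insert x L)" using in_span_insertI[of "(1 / \<beta>) *s z" L "- \<alpha> / \<beta>" x] by simp
      then show False using y by blast
    qed
    moreover have "\<alpha> = 0"
    proof (rule ccontr)
      assume nz: "\<alpha> \<noteq> 0"
      then have "x = (1 / \<alpha>) *s z" using \<open>\<beta> = 0\<close> by (simp add: z1 b)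
      then show False using x vec.subspace_scale[OF L z(1), of "1 / \<alpha>"] by simp
    qed
    ultimately show ?thesis using z1 b by simp
  qed
  then show "L \<inter> vec.span {x, y} = {0}" using vec.subspace_0[OF L] vec.span_zero by blast
  have "x \<noteq> 0" using x vec.subspace_0[OF L] by blast
  moreover have "y \<notin> vec.span {x}" using y vec.span_mono[of "{x}" "insert x L"] by auto
  ultimately show "ind [(x, y)]" by (simp add: ind_Cons)
qed

lemma common_complement:
  fixes J :: "('a::{field,finite}^'m::finite) set"
  assumes J: "sp J" "vec.dim J = 4" and L: "isline L" "L \<subseteq> J" and K: "isline K" "K \<subseteq> J"
  obtains M where "isline M" "M \<subseteq> J" "L \<inter> M = {0}" "K \<inter> M = {0}" "ssum L M = J" "ssum K M = J"
proof -
  have sLK: "sp L" "sp K" "vec.dim L = 2" "vec.dim K = 2" using L K by (auto simp: isline_def)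
  have nc: "\<not> J \<subseteq> S" if "vec.dim S < 4" for S using vec.dim_subset[of J S] J(2) that by auto
  obtain x where x: "x \<in> J" "x \<notin> L" "x \<notin> K"
    using two_subspaces_not_cover[OF sLK(1,2) J(1)] nc sLK by auto
  have d3: "vec.dim (vec.span (insert x S)) < 4" if S: "vec.dim S = 2" for S
    using S by (simp add: vec.dim_insert)
  have "\<exists>y\<in>J. y \<notin> vec.span (insert x L) \<and> y \<notin> vec.span (insert x K)"
    by (rule two_subspaces_not_cover[OF vec.subspace_span vec.subspace_span J(1) nc nc]) (use d3 sLK in auto)
  then obtain y where y: "y \<in> J" "y \<notin> vec.span (insert x L)" "y \<notin> vec.span (insert x K)" by blast
  let ?M = "vec.span {x, y}"
  have M: "isline ?M" using span_pair_disjoint(2)[OF sLK(1) x(2) y(2)] by (simp add: isline_span)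
  have MJ: "?M \<subseteq> J" using x y J by (intro vec.span_minimal) auto
  have LM: "L \<inter> ?M = {0}" by (rule span_pair_disjoint(1)[OF sLK(1) x(2) y(2)])
  have KM: "K \<inter> ?M = {0}" by (rule span_pair_disjoint(1)[OF sLK(2) x(3) y(3)])
  have "ssum S ?M = J" if S: "isline S" "S \<subseteq> J" "S \<inter> ?M = {0}" for S
    using dim_ssum[OF islineD(1)[OF S(1)] islineD(1)[OF M]] S islineD(2)[OF S(1)] islineD(2)[OF M] J
    by (intro sp_eqI sp_ssum ssum_least islineD(1)[OF S(1)] islineD(1)[OF M] MJ) auto
  then have "ssum L ?M = J" "ssum K ?M = J" using L K LM KM by simp_all
  then show ?thesis by (rule that[OF M MJ LM KM])
qed

lemma ex_line:
  fixes V :: "('a::{field,finite}^'m::finite) set"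
  assumes "sp V" "2 \<le> vec.dim V"
  obtains l where "isline l" "l \<subseteq> V"
proof -
  obtain Q where Q: "ind Q" "sv Q \<subseteq> V" "length Q = 1" using ind_extend[of "[]" V 1] assms by auto
  have "isline (vec.span (sv Q))" using Q by (simp add: isline_def ind_def)
  moreover have "vec.span (sv Q) \<subseteq> V" using Q assms by (intro vec.span_minimal)
  ultimately show ?thesis by (rule that)
qed

lemma ssum_commute: "ssum S T = ssum T (S :: ('a::field^'m) set)"
proof -
  have *: "ssum S T \<subseteq> ssum T S" for S T :: "('a^'m) set"
  proof
    fix v assume "v \<in> ssum S T"
    then obtain x y where "x \<in> S" "y \<in> T" "v = y + x" unfolding ssum_def by (auto simp: add.commute)
    then show "v \<in> ssum T S" unfolding ssum_def by blast
  qed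
  show ?thesis by (intro subset_antisym *)
qed

text \<open>Abstracts nonvanishing of the transform at \<open>L + K + P\<close> with
  \<open>P\<close> fixed. Assumption \<open>star\<close> says that inside each complement of
  \<open>L\<close> the related lines are exactly those through one point; the point may a priori
  depend on the complement.\<close>

locale line_relation =
  fixes V :: "('a::{field,finite}^'m::finite) set" and R :: "('a^'m) set \<Rightarrow> ('a^'m) set \<Rightarrow> bool"
  assumes V: "sp V" "6 \<le> vec.dim V"
    and sym: "R L K \<Longrightarrow> R K L"
    and lines: "R L K \<Longrightarrow> isline L" "R L K \<Longrightarrow> L \<subseteq> V" "R L K \<Longrightarrow> L \<inter> K = {0}"
    and star: "R L K \<Longrightarrow> sp U \<Longrightarrow> U \<subseteq> V \<Longrightarrow> L \<inter> U = {0} \<Longrightarrow> vec.dim U + 2 = vec.dim V \<Longrightarrow>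
      \<exists>u\<in>U. u \<noteq> 0 \<and> (\<forall>M. isline M \<longrightarrow> M \<subseteq> U \<longrightarrow> (R L M \<longleftrightarrow> u \<in> M))"
begin

text \<open>In the quotient of \<open>V\<close> by \<open>L\<close>, the plane \<open>N\<close> is
  the single point through which the images of all related lines pass.\<close>

definition vertex :: "('a^'m) set \<Rightarrow> ('a^'m) set \<Rightarrow> bool" where
  "vertex L N \<longleftrightarrow> isline L \<and> L \<subseteq> V \<and> sp N \<and> vec.dim N = 3 \<and> L \<subseteq> N \<and> N \<subseteq> V \<and>
     (\<forall>K. isline K \<longrightarrow> K \<subseteq> V \<longrightarrow> L \<inter> K = {0} \<longrightarrow> (R L K \<longleftrightarrow> N \<subseteq> ssum L K))"

lemma complement_through:
  assumes L: "isline L" "L \<subseteq> V" and W: "sp W" "W \<subseteq> V" "L \<inter> W = {0}"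
  obtains U where "sp U" "W \<subseteq> U" "U \<subseteq> V" "L \<inter> U = {0}" "vec.dim U + 2 = vec.dim V" "ssum L U = V"
proof -
  obtain U where U: "sp U" "W \<subseteq> U" "U \<subseteq> V" "L \<inter> U = {0}" "vec.dim U + vec.dim L = vec.dim V"
    by (rule ex_complement[OF islineD(1)[OF L(1)] W(1) V(1) L(2) W(2,3)]) blast
  have "ssum L U = V"
    using dim_ssum[OF islineD(1)[OF L(1)] U(1)] U L
    by (intro sp_eqI sp_ssum ssum_least V U islineD(1)[OF L(1)]) auto
  then show ?thesis using that U islineD(2)[OF L(1)] by simp
qed

text \<open>Let \<open>u0\<close> be the point for one complement and \<open>N\<close> the span of
  \<open>u0\<close> and \<open>L\<close>. If a related \<open>K\<close> avoided \<open>N\<close>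
  modulo \<open>L\<close>, a line \<open>M\<close> through \<open>u0\<close> could be chosen such
  that some complement of \<open>L\<close> contains both \<open>K\<close> and \<open>M\<close>; its
  point would lie on two disjoint lines. Conversely, for \<open>K\<close> with
  \<open>N \<subseteq> L + K\<close>, the point \<open>u\<close> of a complement through
  \<open>K\<close> lies in \<open>N\<close>, hence on \<open>K\<close>.\<close>

lemma ex_vertex:
  assumes R0: "R L K0"
  shows "\<exists>N. vertex L N"
proof -
  have L: "isline L" "L \<subseteq> V" using lines R0 by auto
  note sL = islineD(1)[OF L(1)]
  have K0: "sp K0" "K0 \<subseteq> V" "L \<inter> K0 = {0}" using lines[OF sym[OF R0]] lines(3)[OF R0] islineD by auto
  obtain U0 where U0: "sp U0" "U0 \<subseteq> V" "L \<inter> U0 = {0}" "vec.dim U0 + 2 = vec.dim V" "ssum L U0 = V"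
    by (rule complement_through[OF L K0]) blast
  obtain u0 where u0: "u0 \<in> U0" "u0 \<noteq> 0" "\<And>M. isline M \<Longrightarrow> M \<subseteq> U0 \<Longrightarrow> R L M \<longleftrightarrow> u0 \<in> M"
    using star[OF R0 U0(1-4)] by blast
  have u0L: "u0 \<notin> L" using u0 U0 by blast
  define N where "N = vec.span (insert u0 L)"
  have NV: "N \<subseteq> V" unfolding N_def using L u0(1) U0(2) V(1) by (intro vec.span_minimal) auto
  have N: "sp N" "L \<subseteq> N" "u0 \<in> N" "N \<subseteq> V"
    using NV by (auto simp: N_def vec.span_base)
  have "u0 \<notin> vec.span L" using u0L unfolding span_eq_subspace[OF sL] .
  then have dN: "vec.dim N = 3" using islineD(2)[OF L(1)] by (simp add: N_def vec.dim_insert)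
  have NJ: "N \<subseteq> ssum L K \<longleftrightarrow> u0 \<in> ssum L K" if K: "isline K" for K
  proof
    assume "u0 \<in> ssum L K"
    then show "N \<subseteq> ssum L K" unfolding N_def using ssum_upper[OF sL islineD(1)[OF K]]
      by (intro vec.span_minimal sp_ssum sL islineD(1)[OF K]) auto
  qed (use N in blast)
  have fwd: "N \<subseteq> ssum L K" if K: "isline K" "K \<subseteq> V" "L \<inter> K = {0}" "R L K" for K
  proof (rule ccontr)
    assume "\<not> ?thesis"
    then have nu: "u0 \<notin> ssum L K" using NJ[OF K(1)] by blast
    note sK = islineD(1)[OF K(1)]
    let ?J = "ssum L K"
    have sJ: "sp ?J" by (rule sp_ssum[OF sL sK])
    have dJ: "vec.dim ?J = 4" using dim_ssum[OF sL sK] K islineD(2)[OF K(1)] islineD(2)[OF L(1)] by simp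
    have "\<not> U0 \<subseteq> vec.span (insert u0 ?J)"
    proof
      assume "U0 \<subseteq> vec.span (insert u0 ?J)"
      moreover have "L \<subseteq> vec.span (insert u0 ?J)"
        using ssum_upper(1)[OF sL sK] vec.span_superset[of "insert u0 ?J"] by blast
      ultimately have "V \<subseteq> vec.span (insert u0 ?J)" using ssum_least[OF vec.subspace_span] U0(5) by metis
      then have "vec.dim V \<le> vec.dim (insert u0 ?J)" by (rule vec.dim_mono)
      also have "\<dots> \<le> 5" using dJ by (simp add: vec.dim_insert)
      finally show False using V by simp
    qed
    then obtain y where y: "y \<in> U0" "y \<notin> vec.span (insert u0 ?J)" by blast
    let ?M = "vec.span {u0, y}"
    note dis = span_pair_disjoint[OF sJ nu y(2)]
    have M: "isline ?M" using dis(2) by (simp add: isline_span)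
    have MU: "?M \<subseteq> U0" using u0 y U0 by (intro vec.span_minimal) auto
    have "u0 \<in> ?M" by (simp add: vec.span_base)
    then have RM: "R L ?M" using u0(3)[OF M MU] by simp
    note sM = islineD(1)[OF M]
    let ?W = "ssum K ?M"
    have sW: "sp ?W" by (rule sp_ssum[OF sK sM])
    have KM: "K \<inter> ?M = {0}" using dis(1) ssum_upper(2)[OF sL sK] sK sM by (auto simp: vec.subspace_0)
    have dW: "vec.dim ?W = 4" using dim_ssum[OF sK sM] KM islineD(2)[OF K(1)] islineD(2)[OF M] by simp
    have "ssum ?J ?M \<subseteq> ssum L ?W"
    proof (rule ssum_least[OF sp_ssum[OF sL sW]], rule ssum_least[OF sp_ssum[OF sL sW]])
      show "L \<subseteq> ssum L ?W" by (rule ssum_upper(1)[OF sL sW])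
      show "K \<subseteq> ssum L ?W" using ssum_upper(2)[OF sL sW] ssum_upper(1)[OF sK sM] by blast
      show "?M \<subseteq> ssum L ?W" using ssum_upper(2)[OF sL sW] ssum_upper(2)[OF sK sM] by blast
    qed
    then have "vec.dim (ssum ?J ?M) \<le> vec.dim (ssum L ?W)" by (rule vec.dim_subset)
    moreover have "vec.dim (ssum ?J ?M) = 6" using dim_ssum[OF sJ sM] dis(1) dJ islineD(2)[OF M] by simp
    moreover note dim_ssum[OF sL sW] dW islineD(2)[OF L(1)]
    ultimately have "vec.dim (L \<inter> ?W) = 0" by linarith
    then have LW: "L \<inter> ?W = {0}" using dim_0_iff[OF sp_Int[OF sL sW]] by blast
    have WV: "?W \<subseteq> V" using K(2) MU U0(2) by (intro ssum_least V) auto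
    obtain U where U: "sp U" "?W \<subseteq> U" "U \<subseteq> V" "L \<inter> U = {0}" "vec.dim U + 2 = vec.dim V"
      by (rule complement_through[OF L sW WV LW]) blast
    obtain u where u: "u \<noteq> 0" "\<And>M. isline M \<Longrightarrow> M \<subseteq> U \<Longrightarrow> R L M \<longleftrightarrow> u \<in> M" using star[OF R0 U(1,3-5)] by blast
    have "u \<in> K" using u(2)[OF K(1)] K(4) ssum_upper(1)[OF sK sM] U(2) by blast
    moreover have "u \<in> ?M" using u(2)[OF M] RM ssum_upper(2)[OF sK sM] U(2) by blast
    ultimately show False using KM u(1) by blast
  qed
  have bwd: "R L K" if K: "isline K" "K \<subseteq> V" "L \<inter> K = {0}" "N \<subseteq> ssum L K" for K
  proof -
    note sK = islineD(1)[OF K(1)]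
    obtain U where U: "sp U" "K \<subseteq> U" "U \<subseteq> V" "L \<inter> U = {0}" "vec.dim U + 2 = vec.dim V"
      by (rule complement_through[OF L sK K(2,3)]) blast
    obtain u where u: "u \<in> U" "u \<noteq> 0" "\<And>M. isline M \<Longrightarrow> M \<subseteq> U \<Longrightarrow> R L M \<longleftrightarrow> u \<in> M" using star[OF R0 U(1,3-5)] by blast
    have "\<not> U \<subseteq> vec.span {u}" using vec.dim_mono[of U "{u}"] V U(5) by (auto split: if_splits)
    then obtain y1 where y1: "y1 \<in> U" "y1 \<notin> vec.span {u}" by blast
    have d2: "vec.dim (insert y1 {u}) = 2" using y1 u(2) by (simp add: vec.dim_insert[of y1 "{u}"])
    have "\<not> U \<subseteq> vec.span (insert y1 {u})" using vec.dim_mono[of U "insert y1 {u}"] V U(5) d2 by auto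
    then obtain y2 where y2: "y2 \<in> U" "y2 \<notin> vec.span (insert y1 {u})" by blast
    have y2u: "y2 \<notin> vec.span {u}" using y2(2) vec.span_mono[of "{u}" "insert y1 {u}"] by auto
    \<comment> \<open>Every line through \<open>u\<close> in \<open>U\<close> is related to
      \<open>L\<close>, so modulo \<open>L\<close> it contains \<open>u0\<close>. Two different such
      lines determine the same representative of \<open>u0\<close> in \<open>U\<close>, which is
      therefore a multiple of \<open>u\<close>.\<close>
    have rep: "\<exists>l x. l \<in> L \<and> x \<in> vec.span {u, y} \<and> u0 = l + x" if y: "y \<in> U" "y \<notin> vec.span {u}" for y
    proof -
      let ?M = "vec.span {u, y}"
      have "ind [(u, y)]" using u(2) y(2) by (simp add: ind_Cons)
      then have M: "isline ?M" by (simp add: isline_span)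
      have MU: "?M \<subseteq> U" using u y U by (intro vec.span_minimal) auto
      have "R L ?M" using u(3)[OF M MU] by (simp add: vec.span_base)
      moreover have LM: "L \<inter> ?M = {0}" using MU U(4) vec.subspace_0[OF sL] vec.span_zero by blast
      moreover have "?M \<subseteq> V" using MU U(3) by blast
      ultimately have "N \<subseteq> ssum L ?M" using fwd[OF M] by simp
      then show ?thesis using N(3) unfolding ssum_def by blast
    qed
    obtain l1 x1 where x1: "l1 \<in> L" "x1 \<in> vec.span {u, y1}" "u0 = l1 + x1" using rep[OF y1] by blast
    obtain l2 x2 where x2: "l2 \<in> L" "x2 \<in> vec.span {u, y2}" "u0 = l2 + x2" using rep[OF y2(1) y2u] by blast
    have inU: "vec.span {u, y1} \<subseteq> U" "vec.span {u, y2} \<subseteq> U"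
      using u(1) y1(1) y2(1) U(1) by (simp_all add: vec.span_minimal)
    have "l1 - l2 = x2 - x1" using x1(3) x2(3) by (simp add: algebra_simps)
    moreover have "l1 - l2 \<in> L" using x1 x2 sL by (simp add: vec.subspace_diff)
    moreover have "x2 - x1 \<in> U" using x1(2) x2(2) inU U(1) by (meson subsetD vec.subspace_diff)
    ultimately have "x2 - x1 = 0" using U(4) by (metis IntI singletonD)
    then have x12: "x1 \<in> vec.span {u, y2}" using x2 by simp
    obtain \<alpha> z where z: "z \<in> vec.span {u}" "x1 = \<alpha> *s y2 + z"
      using x12 by (metis in_span_insertE insert_commute)
    have "\<alpha> = 0"
    proof (rule ccontr)
      assume a: "\<alpha> \<noteq> 0"
      have "z \<in> vec.span (insert y1 {u})" using z(1) vec.span_mono[of "{u}" "insert y1 {u}"] by auto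
      moreover have "x1 \<in> vec.span (insert y1 {u})" using x1(2) by (simp add: insert_commute)
      ultimately have "(1 / \<alpha>) *s (x1 - z) \<in> vec.span (insert y1 {u})" by (intro vec.span_scale vec.span_diff)
      moreover have "(1 / \<alpha>) *s (x1 - z) = y2" using a z(2) by simp
      ultimately show False using y2(2) by simp
    qed
    then have x1u: "x1 \<in> vec.span {u}" using z by simp
    obtain c where c: "x1 = c *s u" using x1u vec.span_breakdown_eq[of x1 u "{}"] by auto
    have "c \<noteq> 0" using c x1 u0L by auto
    then have "u = (1 / c) *s (u0 - l1)" using x1(3) c by simp
    moreover have "u0 - l1 \<in> N" using N x1(1) by (meson subsetD vec.subspace_diff)
    ultimately have "u \<in> N" using N(1) vec.subspace_scale by metis
    then obtain l p where lp: "l \<in> L" "p \<in> K" "u = l + p" using K(4) unfolding ssum_def by blast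
    have "u - p \<in> U" using u(1) lp(2) U(1,2) by (meson subsetD vec.subspace_diff)
    moreover have "u - p = l" using lp(3) by simp
    ultimately have "l = 0" using lp(1) U(4) by blast
    then have "u \<in> K" using lp by simp
    then show ?thesis using u(3)[OF K(1) U(2)] by simp
  qed
  have iff: "R L K \<longleftrightarrow> N \<subseteq> ssum L K" if K: "isline K" "K \<subseteq> V" "L \<inter> K = {0}" for K
    using fwd[OF K] bwd[OF K] by (rule iffI)
  have "vertex L N" unfolding vertex_def
    by (intro conjI allI impI L N(1) dN N(2) N(4)) (rule iff)
  then show ?thesis by blast
qed

lemma vertexD:
  assumes "vertex L N"
  shows "isline L" "L \<subseteq> V" "sp N" "vec.dim N = 3" "L \<subseteq> N" "N \<subseteq> V"
    "\<And>K. isline K \<Longrightarrow> K \<subseteq> V \<Longrightarrow> L \<inter> K = {0} \<Longrightarrow> R L K \<longleftrightarrow> N \<subseteq> ssum L K"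
  using assms unfolding vertex_def by blast+

text \<open>Choose a line \<open>M\<close> of \<open>J\<close> skew to \<open>L\<close> and
  \<open>K\<close>. As \<open>L + M = J\<close> contains \<open>N\<close>, \<open>M\<close> is
  related to \<open>L\<close>; by symmetry the plane of \<open>M\<close> lies in
  \<open>J = M + L = M + K\<close>, so \<open>M\<close> is related to \<open>K\<close>, and symmetry
  again puts the plane of \<open>K\<close> into \<open>J\<close>.\<close>

lemma vertex_in_solid:
  assumes N: "vertex L N" and J: "sp J" "vec.dim J = 4" "N \<subseteq> J" "J \<subseteq> V" and K: "isline K" "K \<subseteq> J"
  shows "\<exists>N'. vertex K N'" "vertex K N' \<Longrightarrow> N' \<subseteq> J"
proof -
  have L: "isline L" "L \<subseteq> J" using vertexD[OF N] J by auto
  obtain M where M: "isline M" "M \<subseteq> J" "L \<inter> M = {0}" "K \<inter> M = {0}" "ssum L M = J" "ssum K M = J"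
    by (rule common_complement[OF J(1,2) L K]) blast
  have MV: "M \<subseteq> V" and KV: "K \<subseteq> V" using M K J by auto
  have "R L M" using vertexD(7)[OF N M(1) MV M(3)] J(3) M(5) by simp
  then have RML: "R M L" by (rule sym)
  then obtain N2 where N2: "vertex M N2" using ex_vertex by blast
  have "M \<inter> L = {0}" "M \<inter> K = {0}" using M by auto
  have "N2 \<subseteq> J" using vertexD(7)[OF N2 vertexD(1,2)[OF N] \<open>M \<inter> L = {0}\<close>] RML M(5) ssum_commute by metis
  then have "R M K" using vertexD(7)[OF N2 K(1) KV \<open>M \<inter> K = {0}\<close>] M(6) ssum_commute by metis
  then have RKM: "R K M" by (rule sym)
  then show "\<exists>N'. vertex K N'" by (rule ex_vertex)
  show "N' \<subseteq> J" if N': "vertex K N'"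
    using vertexD(7)[OF N' M(1) MV M(4)] RKM M(6) by simp
qed

lemma solid:
  assumes N: "sp N" "vec.dim N = 3" "N \<subseteq> V" and z: "z \<in> V" "z \<notin> N"
  shows "vec.dim (vec.span (insert z N)) = 4" "N \<subseteq> vec.span (insert z N)" "vec.span (insert z N) \<subseteq> V"
proof -
  have "z \<notin> vec.span N" using z(2) unfolding span_eq_subspace[OF N(1)] .
  then show "vec.dim (vec.span (insert z N)) = 4" using N by (simp add: vec.dim_insert)
  show "N \<subseteq> vec.span (insert z N)" using vec.span_superset[of "insert z N"] by blast
  show "vec.span (insert z N) \<subseteq> V" using z N V by (intro vec.span_minimal) auto
qed

text \<open>Two different solids through \<open>N\<close> intersect in \<open>N\<close>, and both
  contain the plane of \<open>K\<close>.\<close>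

lemma vertex_same:
  assumes N: "vertex L N" and K: "isline K" "K \<subseteq> N"
  shows "vertex K N' \<Longrightarrow> N' = N" "\<exists>N'. vertex K N'"
proof -
  note nd = vertexD[OF N]
  have "\<not> V \<subseteq> N" using vec.dim_subset[of V N] V nd(4) by auto
  then obtain z where z: "z \<in> V" "z \<notin> N" by blast
  note J = solid[OF nd(3,4,6) z]
  let ?J = "vec.span (insert z N)"
  have "\<not> V \<subseteq> ?J" using vec.dim_subset[of V ?J] V J(1) by auto
  then obtain z' where z': "z' \<in> V" "z' \<notin> ?J" by blast
  then have z'N: "z' \<notin> N" using J(2) by blast
  note J' = solid[OF nd(3,4,6) z'(1) z'N]
  let ?J' = "vec.span (insert z' N)"
  have z'J': "z' \<in> ?J'" by (simp add: vec.span_base)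
  show "\<exists>N'. vertex K N'" using vertex_in_solid(1)[OF N vec.subspace_span J K(1)] K J by blast
  assume N': "vertex K N'"
  have "N' \<subseteq> ?J" using vertex_in_solid(2)[OF N vec.subspace_span J K(1) _ N'] K J by blast
  moreover have "N' \<subseteq> ?J'" using vertex_in_solid(2)[OF N vec.subspace_span J' K(1) _ N'] K J' by blast
  moreover have "N = ?J \<inter> ?J'"
  proof (rule sp_eqI)
    show "vec.dim (?J \<inter> ?J') \<le> vec.dim N"
    proof (rule ccontr)
      assume n: "\<not> ?thesis"
      have "?J \<inter> ?J' = ?J'" by (rule sp_eqI) (use n nd(4) J'(1) in \<open>auto intro: sp_Int\<close>)
      then show False using z' z'J' by blast
    qed
  qed (use nd J J' in \<open>auto intro: sp_Int\<close>)
  ultimately have "N' \<subseteq> N" by blast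
  then show "N' = N" by (intro sp_eqI vertexD(3)[OF N'] nd) (use vertexD(4)[OF N'] nd in auto)
qed

text \<open>In a solid through \<open>N\<close>, a line through a point of \<open>N\<close> that
  leaves \<open>N\<close> has its own plane \<open>N1\<close> in the solid. The planes
  \<open>N\<close> and \<open>N1\<close> share a line, and the plane of that line equals both of
  them, although \<open>N1\<close> is not contained in \<open>N\<close>.\<close>

lemma no_relation: "\<not> R L K"
proof
  assume "R L K"
  then obtain N where N: "vertex L N" using ex_vertex by blast
  note nd = vertexD[OF N]
  have "\<not> V \<subseteq> N" using vec.dim_subset[of V N] V nd(4) by auto
  then obtain z where z: "z \<in> V" "z \<notin> N" by blast
  note J = solid[OF nd(3,4,6) z]
  let ?J = "vec.span (insert z N)"
  have "N \<noteq> {0}" using nd by auto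
  then obtain u where u: "u \<in> N" "u \<noteq> 0" using vec.subspace_0[OF nd(3)] by blast
  have "z \<notin> vec.span {u}" using z u vec.span_minimal[of "{u}" N] nd by auto
  then have "ind [(u, z)]" using u by (simp add: ind_Cons)
  then have M: "isline (vec.span {u, z})" by (simp add: isline_span)
  have zJ: "z \<in> ?J" by (simp add: vec.span_base)
  have MJ: "vec.span {u, z} \<subseteq> ?J" using u J zJ by (intro vec.span_minimal) auto
  obtain N1 where N1: "vertex (vec.span {u, z}) N1" using vertex_in_solid(1)[OF N vec.subspace_span J M MJ] by blast
  note nd1 = vertexD[OF N1]
  have N1J: "N1 \<subseteq> ?J" by (rule vertex_in_solid(2)[OF N vec.subspace_span J M MJ N1])
  have "ssum N N1 \<subseteq> ?J" using J N1J by (intro ssum_least) auto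
  then have "vec.dim (ssum N N1) \<le> 4" using J(1) vec.dim_subset by metis
  then have "2 \<le> vec.dim (N \<inter> N1)" using dim_ssum[OF nd(3) nd1(3)] nd nd1 by simp
  then obtain l where l: "isline l" "l \<subseteq> N \<inter> N1" by (rule ex_line[OF sp_Int[OF nd(3) nd1(3)]])
  obtain N2 where N2: "vertex l N2" using vertex_same(2)[OF N l(1)] l by blast
  have "N2 = N" using vertex_same(1)[OF N l(1) _ N2] l by blast
  moreover have "N2 = N1" using vertex_same(1)[OF N1 l(1) _ N2] l by blast
  moreover have "z \<in> N1" using nd1(5) vec.span_base[of z "{u, z}"] by auto
  ultimately show False using z by simp
qed

end

section \<open>The transform of a pencil\<close>

lemma FT_nzD: "FT f P \<noteq> 0 \<Longrightarrow> \<exists>B\<in>altf. f B \<noteq> 0"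
  unfolding FT_def by (metis (no_types, lifting) mult_zero_left sum.neutral)

text \<open>For \<open>u\<close> on the line of \<open>p\<close> and \<open>q\<close> all forms in
  the support agree at \<open>p \<and> q\<close>, so the coefficient is a phase times the total sum.
  Otherwise a form with \<open>u\<close> in its radical and a nontrivial value at
  \<open>p \<and> q\<close> leaves \<open>f\<close> invariant and kills the coefficient.\<close>

lemma pencil_FT:
  fixes U :: "('a::{field,finite}^'m::finite) set"
  assumes U: "sp U" and u: "u \<in> U" "u \<noteq> 0" and B0: "B0 \<in> altf" "f B0 \<noteq> 0"
    and f: "\<And>B. B \<in> altf \<Longrightarrow> f B = (if \<forall>y\<in>U. B u y = B0 u y then f B0 else 0)"
  shows "FT f [] \<noteq> 0"
    "ind [(p, q)] \<Longrightarrow> p \<in> U \<Longrightarrow> q \<in> U \<Longrightarrow> FT f [(p, q)] \<noteq> 0 \<longleftrightarrow> u \<in> vec.span {p, q}"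
proof -
  let ?Z = "{B \<in> altf. \<forall>y\<in>U. B u y = B0 u y}"
  have "FT f [] = (\<Sum>B\<in>altf. if \<forall>y\<in>U. B u y = B0 u y then f B0 else 0)"
    unfolding FT_def by (intro sum.cong refl) (simp add: f)
  also have "\<dots> = of_nat (card ?Z) * f B0" by (simp add: sum.If_cases Int_def)
  finally have F0: "FT f [] = of_nat (card ?Z) * f B0" .
  have "B0 \<in> ?Z" using B0 by simp
  then have "card ?Z \<noteq> 0" by (subst card_eq_0_iff) auto
  then show n0: "FT f [] \<noteq> 0" using F0 B0 by simp
  assume pq: "ind [(p, q)]" "p \<in> U" "q \<in> U"
  show "FT f [(p, q)] \<noteq> 0 \<longleftrightarrow> u \<in> vec.span {p, q}"
  proof
    assume "u \<in> vec.span {p, q}"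
    then obtain \<alpha> y where y: "y \<in> vec.span {q}" "u = \<alpha> *s p + y" by (rule in_span_insertE)
    obtain \<beta> where \<beta>: "y = \<beta> *s q" using y(1) vec.span_breakdown_eq[of y q "{}"] by auto
    have "B p q = B0 p q" if B: "B \<in> altf" "f B \<noteq> 0" for B
    proof -
      have e: "\<And>y. y \<in> U \<Longrightarrow> B u y = B0 u y" using f[OF B(1)] B(2) by (auto split: if_splits)
      have "\<alpha> * B p q = \<alpha> * B0 p q" using e[OF pq(3)] by (simp add: y \<beta> altf_simps[OF B(1)] altf_simps[OF B0(1)])
      moreover have "\<beta> * B p q = \<beta> * B0 p q" using e[OF pq(2)] altf_skew[OF B(1), of q p] altf_skew[OF B0(1), of q p]
        by (simp add: y \<beta> altf_simps[OF B(1)] altf_simps[OF B0(1)])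
      moreover have "\<alpha> \<noteq> 0 \<or> \<beta> \<noteq> 0" using u y \<beta> by auto
      ultimately show ?thesis by auto
    qed
    then have "FT f ([] @ [(p, q)]) = addchar (B0 p q) * FT f []" by (intro FT_absorb) simp
    then show "FT f [(p, q)] \<noteq> 0" using n0 by simp
  next
    assume nz: "FT f [(p, q)] \<noteq> 0"
    show "u \<in> vec.span {p, q}"
    proof (rule ccontr)
      assume nu: "u \<notin> vec.span {p, q}"
      have pq0: "p \<noteq> 0" "q \<notin> vec.span {p}" using pq(1) by (auto simp: ind_Cons)
      have "ind [(q, p)]" using pq(1) by (simp add: ind_def insert_commute)
      then have qp0: "p \<notin> vec.span {q}" by (simp add: ind_Cons)
      have np: "p \<notin> vec.span {u, q}" using vec.in_span_insert[of p u "{q}"] qp0 nu by auto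
      obtain g :: "'a^'m \<Rightarrow> 'a" where g: "\<And>x y. g (x + y) = g x + g y" "\<And>c x. g (c *s x) = c * g x"
        "g p = 1" "\<And>x. x \<in> vec.span {u, q} \<Longrightarrow> g x = 0" using ex_functional'[OF vec.subspace_span np] by blast
      have nq: "q \<notin> vec.span {u, p}" using vec.in_span_insert[of q u "{p}"] pq0 nu by (auto simp: insert_commute)
      obtain h :: "'a^'m \<Rightarrow> 'a" where h: "\<And>x y. h (x + y) = h x + h y" "\<And>c x. h (c *s x) = c * h x"
        "h q = 1" "\<And>x. x \<in> vec.span {u, p} \<Longrightarrow> h x = 0" using ex_functional'[OF vec.subspace_span nq] by blast
      have v: "g u = 0" "g q = 0" "h u = 0" "h p = 0" using g(4) h(4) by (auto simp: vec.span_base)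
      obtain s :: 'a where s: "addchar s \<noteq> 1" using addchar_nontrivial by blast
      define D where "D = (\<lambda>x y. s * (g x * h y - g y * h x))"
      have D: "D \<in> altf" by (simp add: altf_def D_def g(1,2) h(1,2) algebra_simps)
      have Du: "D u y = 0" for y by (simp add: D_def v)
      have Dpq: "D p q = s" by (simp add: D_def v g h)
      have "f (B + D) = f B" if "B \<in> altf" for B using f[OF that] f[OF altf_add[OF that D]] Du by simp
      then have "FT f [(p, q)] = FT (\<lambda>B. f (B + D)) [(p, q)]" unfolding FT_def by (intro sum.cong) auto
      also have "\<dots> = cnj (addchar s) * FT f [(p, q)]" using FT_shift[OF D] Dpq by (simp add: addchar_minus)
      finally have "(1 - cnj (addchar s)) * FT f [(p, q)] = 0" by (simp add: left_diff_distrib)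
      moreover have "cnj (addchar s) \<noteq> 1" using s by (metis complex_cnj_cnj complex_cnj_one)
      ultimately show False using nz by simp
    qed
  qed
qed

subsection \<open>Descendents as sets of forms\<close>

text \<open>Having no nonsingular difference on subspaces of dimension \<open>2 * w + 2\<close> amounts to differences of
  rank at most \<open>2 * w\<close>.\<close>

locale descendant_forms =
  fixes V :: "('a::{field,finite}^'m::finite) set" and f :: "('a^'m \<Rightarrow> 'a^'m \<Rightarrow> 'a) \<Rightarrow> complex"
    and d w :: nat
  assumes V: "sp V" "vec.dim V = 2 * d \<or> vec.dim V = 2 * d + 1" and d: "3 \<le> d" "0 < w" "w < d"
    and f: "dep V f" "\<And>B. f B = 0 \<or> f B = 1" "f 0 = 1"
    and width: "\<And>B D M. B \<in> altf \<Longrightarrow> D \<in> altf \<Longrightarrow> f B \<noteq> 0 \<Longrightarrow> f D \<noteq> 0 \<Longrightarrow> sp M \<Longrightarrow> M \<subseteq> V \<Longrightarrow>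
      vec.dim M = 2 * w + 2 \<Longrightarrow> \<not> nonsing M (B - D)"
    and dual: "\<And>P. ind P \<Longrightarrow> sv P \<subseteq> V \<Longrightarrow> d - w < length P \<Longrightarrow> FT f P = 0"
begin

lemma FT_Nil: "FT f [] \<noteq> 0"
proof -
  have "FT f [] = (\<Sum>B\<in>altf. if f B = 1 then 1 else 0)"
    unfolding FT_def
  proof (intro sum.cong refl)
    show "f B * addchar (ev B []) = (if f B = 1 then 1 else 0)" for B
      using f(2)[of B] by auto
  qed
  also have "\<dots> = of_nat (card {B \<in> altf. f B = 1})" by (simp add: sum.If_cases Int_def)
  finally have "FT f [] = of_nat (card {B \<in> altf. f B = 1})" .
  moreover have "0 \<in> {B \<in> altf. f B = 1}" using f(3) altf_0 by simp
  then have "card {B \<in> altf. f B = 1} \<noteq> 0" by (subst card_eq_0_iff) auto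
  ultimately show ?thesis by simp
qed

lemma dimV: "2 * d \<le> vec.dim V" "vec.dim V \<le> 2 * d + 1" using V(2) by auto

definition twist :: "('a^'m) set \<Rightarrow> (('a^'m) \<times> ('a^'m)) list \<Rightarrow> ('a^'m \<Rightarrow> 'a^'m \<Rightarrow> 'a) \<Rightarrow> complex" where
  "twist U P = push U (\<lambda>B. f B * addchar (ev B P))"

lemma FT_twist: "sv Q \<subseteq> U \<Longrightarrow> FT (twist U P) Q = of_nat (fibre U) * FT f (P @ Q)"
  unfolding twist_def by (subst FT_push) (simp_all add: FT_def addchar_add mult.assoc)

lemma FT_twist_nz: "sv Q \<subseteq> U \<Longrightarrow> FT (twist U P) Q \<noteq> 0 \<longleftrightarrow> FT f (P @ Q) \<noteq> 0"
  using FT_twist[of Q U P] fibre_nz[of U] by simp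

lemma dep_twist: "dep U (twist U P)"
  unfolding twist_def by (rule dep_push)

lemma twist_nz: "twist U P B \<noteq> 0 \<Longrightarrow> \<exists>B'\<in>altf. eqon U B' B \<and> f B' \<noteq> 0"
  unfolding twist_def by (drule push_nz) auto

lemma nodiff_twist:
  assumes M: "sp M" "M \<subseteq> U" "M \<subseteq> V" "vec.dim M = 2 * w + 2"
  shows "nodiff M (twist U P)"
  unfolding nodiff_def
proof (intro ballI impI)
  fix B D assume nz: "twist U P B \<noteq> 0" "twist U P D \<noteq> 0"
  obtain B' where B': "B' \<in> altf" "eqon U B' B" "f B' \<noteq> 0" using twist_nz[OF nz(1)] by blast
  obtain D' where D': "D' \<in> altf" "eqon U D' D" "f D' \<noteq> 0" using twist_nz[OF nz(2)] by blast
  have "\<not> nonsing M (B' - D')" using width B' D' M by blast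
  moreover have "eqon M (B' - D') (B - D)"
    using eqon_subset[OF B'(2) M(2)] eqon_subset[OF D'(2) M(2)] by (simp add: eqon_def)
  ultimately show "\<not> nonsing M (B - D)" using nonsing_cong by blast
qed

text \<open>Take a bivector \<open>P\<close> with nonzero coefficient and the greatest number
  \<open>t\<close> of summands. Twisted by \<open>P\<close>, \<open>f\<close> becomes a nonzero
  constant on the forms of a complement of dimension \<open>dim V - 2 * t\<close>. If
  \<open>t < d - w\<close>, that complement has room for a form that is nonsingular on dimension
  \<open>2 * w + 2\<close>, and it agrees there with a member of the set, against the width.\<close>

lemma ex_top: "\<exists>P. ind P \<and> sv P \<subseteq> V \<and> length P = d - w \<and> FT f P \<noteq> 0"
proof -
  let ?G = "\<lambda>t. \<exists>P. ind P \<and> sv P \<subseteq> V \<and> length P = t \<and> FT f P \<noteq> 0"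
  have G0: "?G 0" using FT_Nil by (intro exI[of _ "[]"]) simp
  have bound: "t \<le> d - w" if "?G t" for t using dual that by (meson not_le)
  define t where "t = Greatest ?G"
  have t1: "?G t" unfolding t_def
  proof (rule GreatestI_nat[where P = ?G])
    show "?G 0" by (rule G0)
    show "y \<le> d - w" if "?G y" for y by (rule bound[OF that])
  qed
  have t2: "s \<le> t" if "?G s" for s unfolding t_def
  proof (rule Greatest_le_nat[where P = ?G])
    show "?G s" by (rule that)
    show "y \<le> d - w" if "?G y" for y by (rule bound[OF that])
  qed
  note t = t1 t2
  show ?thesis
  proof (cases "t = d - w")
    case True
    then show ?thesis using t(1) by blast
  next
    case False
    then have lt: "t < d - w" using bound[OF t(1)] by simp
    obtain P where P: "ind P" "sv P \<subseteq> V" "length P = t" "FT f P \<noteq> 0" using t(1) by blast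
    let ?J = "vec.span (sv P)"
    have JV: "?J \<subseteq> V" using P V by (intro vec.span_minimal)
    have sz: "sp {0 :: 'a^'m}" by (simp add: vec.subspace_def)
    have zV: "{0} \<subseteq> V" using V by (simp add: vec.subspace_0)
    have Jz: "?J \<inter> {0} = {0}" by (auto simp: vec.span_zero)
    obtain M where M: "sp M" "M \<subseteq> V" "?J \<inter> M = {0}" "vec.dim M + vec.dim ?J = vec.dim V"
      by (rule ex_complement[OF vec.subspace_span sz V(1) JV zV Jz]) blast
    have dM: "2 * (length ([] :: (('a^'m) \<times> ('a^'m)) list) + (w + 1)) \<le> vec.dim M"
      using M(4) P(1,3) lt dimV by (simp add: ind_def)
    obtain Q where Q: "ind Q" "sv Q \<subseteq> M" "length Q = w + 1"
      using ind_extend[OF ind_Nil _ dM] by auto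
    let ?M' = "vec.span (sv Q)"
    have M': "?M' \<subseteq> M" using Q M by (intro vec.span_minimal)
    obtain C where C: "C \<in> altf" "nonsing ?M' C" using ind_nonsing[OF Q(1), of 0] by blast
    let ?g = "twist M P"
    have const: "?g B = ?g 0" if "B \<in> altf" for B
    proof (rule FT_constant[OF dep_twist M(1) _ that])
      fix S assume S: "ind S" "sv S \<subseteq> M" "S \<noteq> []"
      have "vec.span (sv S) \<subseteq> M" using S M by (intro vec.span_minimal)
      then have "?J \<inter> vec.span (sv S) = {0}" using M(3) by (auto simp: vec.span_zero)
      then have "ind (P @ S)" by (rule ind_append[OF P(1) S(1)])
      moreover have "sv (P @ S) \<subseteq> V" using P S M by auto
      moreover have "\<not> length (P @ S) \<le> t" using P S by simp
      ultimately have "FT f (P @ S) = 0" using t(2)[of "length (P @ S)"] by blast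
      then show "FT ?g S = 0" using FT_twist[OF S(2)] by simp
    qed
    have "FT ?g [] \<noteq> 0" using FT_twist_nz[of "[]" M P] P(4) by simp
    then obtain B where "B \<in> altf" "?g B \<noteq> 0" using FT_nzD by blast
    then have "?g C \<noteq> 0" using const C(1) by metis
    then obtain B' where B': "B' \<in> altf" "eqon M B' C" "f B' \<noteq> 0" using twist_nz by blast
    have "\<not> nonsing ?M' (B' - 0)"
      by (rule width) (use B' f(3) altf_0 M' M Q in \<open>auto simp: ind_def\<close>)
    moreover have "eqon ?M' B' C" using B'(2) M' by (rule eqon_subset)
    ultimately show ?thesis using C(2) nonsing_cong by auto
  qed
qed

lemma deg1_twist:
  assumes P: "ind P" "sv P \<subseteq> V" "length P + 1 = d - w" and U: "sp U" "U \<subseteq> V" "vec.span (sv P) \<inter> U = {0}"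
  shows "deg1 U (twist U P)"
  unfolding deg1_def
proof (intro allI impI)
  fix Q assume Q: "ind Q" "sv Q \<subseteq> U" "2 \<le> length Q"
  have "vec.span (sv Q) \<subseteq> U" using Q U by (intro vec.span_minimal)
  then have "vec.span (sv P) \<inter> vec.span (sv Q) = {0}" using U(3) by (auto simp: vec.span_zero)
  then have "ind (P @ Q)" by (rule ind_append[OF P(1) Q(1)])
  moreover have "sv (P @ Q) \<subseteq> V" using P Q U by auto
  ultimately have "FT f (P @ Q) = 0" by (intro dual) (use P Q in auto)
  then show "FT (twist U P) Q = 0" using FT_twist[OF Q(2)] by simp
qed

lemma split_complement:
  assumes P: "ind (Q @ P)" "sv (Q @ P) \<subseteq> V"
  obtains U where "sp U" "sv Q \<subseteq> U" "U \<subseteq> V" "vec.span (sv P) \<inter> U = {0}" "vec.dim U + 2 * length P = vec.dim V"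
proof -
  have JV: "vec.span (sv P) \<subseteq> V" "vec.span (sv Q) \<subseteq> V" using P(2) V(1) by (simp_all add: vec.span_minimal)
  have dis: "vec.span (sv P) \<inter> vec.span (sv Q) = {0}" using ind_append_disjoint[OF P(1)] by blast
  obtain U where U: "sp U" "vec.span (sv Q) \<subseteq> U" "U \<subseteq> V" "vec.span (sv P) \<inter> U = {0}"
    "vec.dim U + vec.dim (vec.span (sv P)) = vec.dim V"
    by (rule ex_complement[OF vec.subspace_span vec.subspace_span V(1) JV dis]) blast
  have "sv Q \<subseteq> U" using U(2) vec.span_superset by (rule subset_trans[rotated])
  then show ?thesis using that U ind_appendD(2)[OF P(1)] by (simp add: ind_def)
qed

text \<open>Otherwise the complement left by the twist has dimension \<open>2 * (w + 1) + 1\<close>,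
  against \<open>nodiff_odd\<close>, which asks for \<open>3 \<le> w + 1\<close>.\<close>

lemma even_dim:
  assumes "2 \<le> w"
  shows "vec.dim V = 2 * d"
proof (rule ccontr)
  assume "\<not> ?thesis"
  then have dV: "vec.dim V = 2 * d + 1" using V(2) by simp
  obtain P0 where P0: "ind P0" "sv P0 \<subseteq> V" "length P0 = d - w" "FT f P0 \<noteq> 0" using ex_top by blast
  obtain ab P where "P0 = ab # P" using P0(3) d by (cases P0) auto
  then obtain a b where P: "P0 = [(a, b)] @ P" by (cases ab) auto
  obtain U where U: "sp U" "sv [(a, b)] \<subseteq> U" "U \<subseteq> V" "vec.span (sv P) \<inter> U = {0}"
    "vec.dim U + 2 * length P = vec.dim V" using split_complement[of "[(a, b)]" P] P0 P by auto
  have iP: "ind P" using ind_appendD(2)[of "[(a, b)]" P] P0 P by simp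
  have dU: "vec.dim U = 2 * (w + 1) + 1" using U(5) dV P0(3) P d by simp
  have d1: "deg1 U (twist U P)" by (rule deg1_twist) (use iP P0 P U in auto)
  have nd: "nodiff M (twist U P)" if "sp M" "M \<subseteq> U" "vec.dim M = 2 * (w + 1)" for M
    by (rule nodiff_twist) (use that U in auto)
  have "FT f (P @ [(a, b)]) = FT f P0" by (rule FT_cong) (simp add: P add.commute)
  then have "FT (twist U P) [(a, b)] \<noteq> 0" using FT_twist_nz[OF U(2)] P0(4) by simp
  then obtain B where B: "B \<in> altf" "twist U P B \<noteq> 0" using FT_nzD by blast
  show False by (rule nodiff_odd[OF U(1) dU _ dep_twist d1 nd B]) (use assms in simp)
qed

text \<open>For \<open>w = d - 1\<close> both bounds hold for \<open>f\<close> on \<open>V\<close>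
  without a twist, and \<open>B0 = 0\<close> is a member of the set.\<close>

lemma dual_width_one:
  assumes "2 \<le> w" "w = d - 1"
  shows "\<exists>u\<in>V. u \<noteq> 0 \<and> (\<forall>B\<in>altf. f B \<noteq> 0 \<longleftrightarrow> (\<forall>y\<in>V. B u y = 0))"
proof -
  have dV: "vec.dim V = 2 * d" by (rule even_dim[OF assms(1)])
  have "deg1 V f" unfolding deg1_def using dual assms d by simp
  moreover have "nodiff V f" unfolding nodiff_def
  proof (intro ballI impI)
    fix B D assume "B \<in> altf" "D \<in> altf" "f B \<noteq> 0" "f D \<noteq> 0"
    then show "\<not> nonsing V (B - D)" by (rule width) (use V dV assms in auto)
  qed
  ultimately obtain u where u: "u \<in> V" "u \<noteq> 0" "\<And>B. B \<in> altf \<Longrightarrow> f B = (if \<forall>y\<in>V. B u y = 0 u y then f 0 else 0)"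
    using nodiff_pencil[OF V(1) dV d(1) f(1) _ _ altf_0] f(3) by auto
  then have "f B \<noteq> 0 \<longleftrightarrow> (\<forall>y\<in>V. B u y = 0)" if "B \<in> altf" for B using u(3)[OF that] f(3) by auto
  then show ?thesis using u by blast
qed

text \<open>Split a bivector of maximal length into two lines and a remainder \<open>P\<close> of
  \<open>d - w - 2\<close> summands. On a complement \<open>W\<close> of \<open>P\<close>,
  nonvanishing of the coefficient at \<open>a \<and> b + p \<and> q + P\<close> is symmetric in the
  two lines, and for a fixed first line \<open>nodiff_pencil\<close> and \<open>pencil_FT\<close>
  give the star property on every complement in \<open>W\<close>. So it yields a
  \<open>line_relation\<close>.\<close>

lemma middle_false:
  assumes w: "2 \<le> w" "w \<le> d - 2"
  shows False
proof -
  have dV: "vec.dim V = 2 * d" by (rule even_dim[OF w(1)])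
  obtain P0 where P0: "ind P0" "sv P0 \<subseteq> V" "length P0 = d - w" "FT f P0 \<noteq> 0" using ex_top by blast
  obtain ab cd P where "P0 = ab # cd # P" using P0(3) d w by (cases P0; cases "tl P0") auto
  then obtain a0 b0 c0 d0 where P: "P0 = [(a0, b0), (c0, d0)] @ P" by (cases ab; cases cd) auto
  obtain W where W: "sp W" "sv [(a0, b0), (c0, d0)] \<subseteq> W" "W \<subseteq> V" "vec.span (sv P) \<inter> W = {0}"
    "vec.dim W + 2 * length P = vec.dim V" using split_complement[of "[(a0, b0), (c0, d0)]" P] P0 P by auto
  have iP: "ind P" "sv P \<subseteq> V" "length P + 2 = d - w"
    using ind_appendD(2)[of "[(a0, b0), (c0, d0)]" P] P0 P by simp_all
  have dW: "vec.dim W = 2 * w + 4" using W(5) dV iP(3) d by simp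
  define S where "S a b p q \<longleftrightarrow> FT f ((a, b) # (p, q) # P) \<noteq> 0" for a b p q
  have S_sym: "S a b p q \<longleftrightarrow> S p q a b" for a b p q
    unfolding S_def by (subst FT_cong[of "(a, b) # (p, q) # P" "(p, q) # (a, b) # P"]) (simp_all add: algebra_simps)
  have struct: "\<exists>u\<in>U. u \<noteq> 0 \<and> (\<forall>p q. ind [(p, q)] \<longrightarrow> p \<in> U \<longrightarrow> q \<in> U \<longrightarrow> (S a b p q \<longleftrightarrow> u \<in> vec.span {p, q}))"
    if ab: "ind [(a, b)]" "a \<in> W" "b \<in> W" and U: "sp U" "U \<subseteq> W" "vec.span {a, b} \<inter> U = {0}" "vec.dim U + 2 = vec.dim W"
      and ex: "S a b p0 q0" "p0 \<in> W" "q0 \<in> W" "ind [(p0, q0)]" "vec.span {a, b} \<inter> vec.span {p0, q0} = {0}" for a b U p0 q0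
  proof -
    let ?P = "(a, b) # P"
    have disj: "vec.span (sv P) \<inter> vec.span {a, b} = {0}"
      using W(4) vec.span_minimal[of "{a, b}" W] ab W(1) by (auto simp: vec.span_zero)
    have iP': "ind ?P" using ind_append[of "[(a, b)]" P] ab iP disj by (simp add: Int_commute)
    have sP': "sv ?P \<subseteq> V" using ab W iP by auto
    have main: "\<exists>u\<in>U. u \<noteq> 0 \<and> FT (twist U ?P) [] \<noteq> 0 \<and>
        (\<forall>p q. ind [(p, q)] \<longrightarrow> p \<in> U \<longrightarrow> q \<in> U \<longrightarrow> (FT (twist U ?P) [(p, q)] \<noteq> 0 \<longleftrightarrow> u \<in> vec.span {p, q}))"
      if U: "sp U" "U \<subseteq> W" "vec.span {a, b} \<inter> U = {0}" "vec.dim U + 2 = vec.dim W" and nz: "\<exists>Q. FT (twist U ?P) Q \<noteq> 0" for U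
    proof -
      have dU: "vec.dim U = 2 * (w + 1)" using U(4) dW by simp
      have dis: "vec.span (sv ?P) \<inter> U = {0}"
      proof -
        have "x = 0" if x: "x \<in> vec.span (sv ?P)" "x \<in> U" for x
        proof -
          have "sv ?P = {a, b} \<union> sv P" by auto
          then have "x \<in> vec.span ({a, b} \<union> sv P)" using x(1) by simp
          then obtain y z where yz: "x = y + z" "y \<in> vec.span {a, b}" "z \<in> vec.span (sv P)"
            unfolding span_Un_sum by blast
          have "vec.span {a, b} \<subseteq> W" using ab W(1) by (intro vec.span_minimal) auto
          then have "x - y \<in> W" using x(2) U(2) yz(2) W(1) by (meson subsetD vec.subspace_diff)
          moreover have "x - y = z" using yz(1) by simp
          ultimately have "z = 0" using yz(3) W(4) by blast
          then show ?thesis using yz x(2) U(3) by auto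
        qed
        then show ?thesis using U(1) by (auto simp: vec.span_zero vec.subspace_0)
      qed
      have d1: "deg1 U (twist U ?P)" by (rule deg1_twist[OF iP' sP' _ U(1) _ dis]) (use iP U W in auto)
      have nd: "nodiff U (twist U ?P)" by (rule nodiff_twist) (use U W dU in auto)
      obtain B where B: "B \<in> altf" "twist U ?P B \<noteq> 0" using nz FT_nzD by blast
      have "3 \<le> w + 1" using w by simp
      from nodiff_pencil[OF U(1) dU this dep_twist d1 nd B] obtain u where u: "u \<in> U" "u \<noteq> 0"
        "\<And>D. D \<in> altf \<Longrightarrow> twist U ?P D = (if \<forall>y\<in>U. D u y = B u y then twist U ?P B else 0)" by blast
      from pencil_FT[OF U(1) u(1,2) B u(3)] show ?thesis using u(1,2) by blast
    qed
    let ?M0 = "vec.span {p0, q0}" and ?J = "vec.span {a, b}"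
    have J: "?J \<subseteq> W" "?M0 \<subseteq> W" using ab(2,3) ex(2,3) W(1) by (simp_all add: vec.span_minimal)
    \<comment> \<open>A complement through the second line serves to show that the coefficient at
      \<open>a \<and> b + P\<close> is nonzero; that fact involves no complement and carries over to
      the given \<open>U\<close>.\<close>
    obtain U0 where U0: "sp U0" "?M0 \<subseteq> U0" "U0 \<subseteq> W" "?J \<inter> U0 = {0}" "vec.dim U0 + vec.dim ?J = vec.dim W"
      by (rule ex_complement[OF vec.subspace_span vec.subspace_span W(1) J ex(5)]) blast
    have dJ: "vec.dim ?J = 2" using ab(1) by (simp add: ind_def)
    have pq0: "sv [(p0, q0)] \<subseteq> U0" using U0(2) by (auto intro: vec.span_base)
    have "FT f (?P @ [(p0, q0)]) = FT f ((a, b) # (p0, q0) # P)" by (rule FT_cong) (simp add: algebra_simps)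
    then have "FT (twist U0 ?P) [(p0, q0)] \<noteq> 0" using FT_twist_nz[OF pq0] ex(1) unfolding S_def by simp
    then have "FT (twist U0 ?P) [] \<noteq> 0" using main[OF U0(1,3,4)] U0(5) dJ by auto
    then have "FT f ?P \<noteq> 0" using FT_twist_nz[of "[]" U0 ?P] by simp
    then have "FT (twist U ?P) [] \<noteq> 0" using FT_twist_nz[of "[]" U ?P] by simp
    then obtain u where u: "u \<in> U" "u \<noteq> 0" "\<And>p q. ind [(p, q)] \<Longrightarrow> p \<in> U \<Longrightarrow> q \<in> U \<Longrightarrow>
        FT (twist U ?P) [(p, q)] \<noteq> 0 \<longleftrightarrow> u \<in> vec.span {p, q}" using main[OF U] by blast
    have "S a b p q \<longleftrightarrow> u \<in> vec.span {p, q}" if pq: "ind [(p, q)]" "p \<in> U" "q \<in> U" for p q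
    proof -
      have "FT f (?P @ [(p, q)]) = FT f ((a, b) # (p, q) # P)" by (rule FT_cong) (simp add: algebra_simps)
      then show ?thesis using u(3)[OF pq] FT_twist_nz[of "[(p, q)]" U ?P] pq unfolding S_def by simp
    qed
    then show ?thesis using u by blast
  qed
  \<comment> \<open>The bases are quantified because \<open>S\<close> refers to bivectors and a line
    fixes its bivector only up to a scalar.\<close>
  define R where "R L K \<longleftrightarrow> isline L \<and> isline K \<and> L \<subseteq> W \<and> K \<subseteq> W \<and> L \<inter> K = {0} \<and>
    (\<exists>a b p q. L = vec.span {a, b} \<and> K = vec.span {p, q} \<and> S a b p q)" for L K
  have RI: "R L K" if "isline L" "isline K" "L \<subseteq> W" "K \<subseteq> W" "L \<inter> K = {0}" "L = vec.span {a, b}"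
    "K = vec.span {p, q}" "S a b p q" for L K a b p q
    unfolding R_def by (intro conjI that(1-5) exI[of _ a] exI[of _ b] exI[of _ p] exI[of _ q] that(6-8))
  have R_sym: "R K L" if LK: "R L K" for L K
  proof -
    from LK obtain a b p q where *: "L = vec.span {a, b}" "K = vec.span {p, q}" "S a b p q" unfolding R_def by blast
    have "K \<inter> L = {0}" using LK unfolding R_def by (simp add: Int_commute)
    moreover have "S p q a b" using *(3) by (subst S_sym)
    moreover have "isline L" "isline K" "L \<subseteq> W" "K \<subseteq> W" using LK by (simp_all add: R_def)
    ultimately show ?thesis by (intro RI[OF _ _ _ _ _ *(2,1)])
  qed
  have in_span: "x \<in> vec.span {x, y}" "y \<in> vec.span {x, y}" for x y :: "'a^'m" by (auto simp: vec.span_base)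
  interpret line_relation W R
  proof
    show "sp W" by (rule W(1))
    show "6 \<le> vec.dim W" using dW w by simp
    show "R K L" if "R L K" for L K using R_sym that .
    show "isline L" "L \<subseteq> W" "L \<inter> K = {0}" if "R L K" for L K using that unfolding R_def by auto
    fix L K U assume LK: "R L K" and U: "sp U" "U \<subseteq> W" "L \<inter> U = {0}" "vec.dim U + 2 = vec.dim W"
    obtain a b p0 q0 where ab: "L = vec.span {a, b}" "K = vec.span {p0, q0}" "S a b p0 q0"
      and LK': "isline L" "isline K" "L \<subseteq> W" "K \<subseteq> W" "L \<inter> K = {0}" using LK unfolding R_def by blast
    have iab: "ind [(a, b)]" "a \<in> W" "b \<in> W" "ind [(p0, q0)]" "p0 \<in> W" "q0 \<in> W"
    proof -
      show "ind [(a, b)]" "ind [(p0, q0)]" using LK'(1,2) ab(1,2) by (simp_all add: isline_span)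
      show "a \<in> W" "b \<in> W" using LK'(3) ab(1) in_span(1)[of a b] in_span(2)[of b a] by (simp_all add: subset_iff)
      show "p0 \<in> W" "q0 \<in> W" using LK'(4) ab(2) in_span(1)[of p0 q0] in_span(2)[of q0 p0] by (simp_all add: subset_iff)
    qed
    obtain u where u: "u \<in> U" "u \<noteq> 0" "\<And>p q. ind [(p, q)] \<Longrightarrow> p \<in> U \<Longrightarrow> q \<in> U \<Longrightarrow> S a b p q \<longleftrightarrow> u \<in> vec.span {p, q}"
      using struct[OF iab(1-3) U(1,2) _ U(4) ab(3) iab(5,6,4)] U(3) LK'(5) ab by auto
    have "R L M \<longleftrightarrow> u \<in> M" if M: "isline M" "M \<subseteq> U" for M
    proof
      assume "u \<in> M"
      obtain p q where pq: "p \<in> M" "q \<in> M" "ind [(p, q)]" "M = vec.span {p, q}" using isline_basis[OF M(1)] .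
      have "S a b p q" using u(3)[OF pq(3)] pq M \<open>u \<in> M\<close> by blast
      moreover have "L \<inter> M = {0}"
        using U(3) M(2) vec.subspace_0[OF islineD(1)[OF M(1)]] vec.subspace_0[OF islineD(1)[OF LK'(1)]] by blast
      moreover have "M \<subseteq> W" using M(2) U(2) by blast
      ultimately show "R L M" by (intro RI[OF LK'(1) M(1) LK'(3) _ _ ab(1) pq(4)])
    next
      assume RLM: "R L M"
      obtain a1 b1 p q where pq: "L = vec.span {a1, b1}" "M = vec.span {p, q}" "S a1 b1 p q" and LM: "L \<inter> M = {0}"
        using RLM unfolding R_def by blast
      have MW: "M \<subseteq> W" using M U by blast
      have i: "ind [(p, q)]" "p \<in> W" "q \<in> W" "ind [(a1, b1)]" "a1 \<in> W" "b1 \<in> W" "p \<in> U" "q \<in> U"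
      proof -
        show "ind [(p, q)]" "ind [(a1, b1)]" using LK'(1) M(1) pq(1,2) by (simp_all add: isline_span)
        show "p \<in> W" "q \<in> W" using MW pq(2) in_span(1)[of p q] in_span(2)[of q p] by (simp_all add: subset_iff)
        show "p \<in> U" "q \<in> U" using M(2) pq(2) in_span(1)[of p q] in_span(2)[of q p] by (simp_all add: subset_iff)
        show "a1 \<in> W" "b1 \<in> W" using LK'(3) pq(1) in_span(1)[of a1 b1] in_span(2)[of b1 a1] by (simp_all add: subset_iff)
      qed
      have ML0: "M \<inter> L = {0}" using LM by blast
      \<comment> \<open>The basis \<open>a1\<close>, \<open>b1\<close> of \<open>L\<close> may
        differ from \<open>a\<close>, \<open>b\<close>. With \<open>M\<close> as the first line and
        a complement of \<open>M\<close> through \<open>L\<close>, the criterion of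
        \<open>struct\<close> depends only on the line spanned by the second pair, which allows the
        change of basis.\<close>
      obtain U1 where U1: "sp U1" "L \<subseteq> U1" "U1 \<subseteq> W" "M \<inter> U1 = {0}" "vec.dim U1 + vec.dim M = vec.dim W"
        by (rule ex_complement[OF islineD(1)[OF M(1)] islineD(1)[OF LK'(1)] W(1) MW LK'(3) ML0]) blast
      have "vec.dim U1 + 2 = vec.dim W" using U1(5) islineD(2)[OF M(1)] by simp
      moreover have "S p q a1 b1" using pq(3) S_sym by blast
      moreover have "vec.span {p, q} \<inter> vec.span {a1, b1} = {0}" using ML0 pq by simp
      ultimately obtain u1 where u1: "\<And>x y. ind [(x, y)] \<Longrightarrow> x \<in> U1 \<Longrightarrow> y \<in> U1 \<Longrightarrow> S p q x y \<longleftrightarrow> u1 \<in> vec.span {x, y}"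
        using struct[OF i(1-3) U1(1,3) _ _ _ i(5,6,4)] U1(4) pq(2) by auto
      have "a1 \<in> U1" "b1 \<in> U1" "a \<in> U1" "b \<in> U1"
        using U1(2) pq(1) ab(1) in_span(1)[of a1 b1] in_span(2)[of b1 a1] in_span(1)[of a b] in_span(2)[of b a] by (simp_all add: subset_iff)
      then have "S p q a b" using u1[OF i(4)] u1[OF iab(1)] \<open>S p q a1 b1\<close> pq(1) ab(1) by simp
      then have "S a b p q" using S_sym by blast
      then show "u \<in> M" using u(3)[OF i(1,7,8)] pq(2) by simp
    qed
    then show "\<exists>u\<in>U. u \<noteq> 0 \<and> (\<forall>M. isline M \<longrightarrow> M \<subseteq> U \<longrightarrow> (R L M \<longleftrightarrow> u \<in> M))" using u by blast
  qed
  have i0: "ind [(a0, b0), (c0, d0)]" using ind_appendD(1)[of "[(a0, b0), (c0, d0)]" P] P0 P by simp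
  have i1: "ind [(a0, b0)]" "ind [(c0, d0)]" using ind_appendD[of "[(a0, b0)]" "[(c0, d0)]"] i0 by auto
  have "vec.span {a0, b0} \<inter> vec.span {c0, d0} = {0}" using ind_append_disjoint[of "[(a0, b0)]" "[(c0, d0)]"] i0 by simp
  moreover have "S a0 b0 c0 d0" using P0(4) P unfolding S_def by simp
  moreover have "vec.span {a0, b0} \<subseteq> W" "vec.span {c0, d0} \<subseteq> W" using W(1,2) by (simp_all add: vec.span_minimal)
  ultimately have "R (vec.span {a0, b0}) (vec.span {c0, d0})"
    using i1 by (intro RI[OF _ _ _ _ _ refl refl]) (simp_all add: isline_span)
  then show False using no_relation by blast
qed

end

section \<open>The case of width one\<close>

lemma hyperplane_decomposition:
  fixes V :: "('a::{field,finite}^'m::finite) set"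
  assumes V: "sp V" and A: "sp A" "A \<subseteq> V" "vec.dim A + 1 = vec.dim V" and e: "e \<in> V" "e \<notin> A"
    and P: "sv P \<subseteq> V"
  shows "\<exists>a\<in>A. \<exists>Q. sv Q \<subseteq> A \<and> (\<forall>B\<in>altf. ev B P = B a e + ev B Q)"
proof -
  have sA: "vec.span A = A" by (rule span_eq_subspace[OF A(1)])
  have "e \<notin> vec.span A" using e(2) unfolding sA .
  then have "vec.dim (vec.span (insert e A)) = vec.dim V" using A(3) by (simp add: vec.dim_insert)
  moreover have "vec.span (insert e A) \<subseteq> V" using A e V by (intro vec.span_minimal) auto
  ultimately have VA: "vec.span (insert e A) = V" by (intro sp_eqI V vec.subspace_span) auto
  have dec: "\<exists>c y. y \<in> A \<and> x = c *s e + y" if "x \<in> V" for x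
  proof -
    have "x \<in> vec.span (insert e A)" using that VA by simp
    then obtain c y where "y \<in> vec.span A" "x = c *s e + y" by (rule in_span_insertE)
    then show ?thesis using sA by blast
  qed
  show ?thesis using P
  proof (induction P rule: sv.induct)
    case 1
    have "0 \<in> A" using A(1) by (rule vec.subspace_0)
    then show ?case by (intro bexI[of _ 0] exI[of _ "[]"]) (auto simp: altf_simps)
  next
    case (2 p q P)
    then obtain a Q where aQ: "a \<in> A" "sv Q \<subseteq> A" "\<And>B. B \<in> altf \<Longrightarrow> ev B P = B a e + ev B Q" by auto
    obtain c p' where p': "p' \<in> A" "p = c *s e + p'" using dec[of p] 2(2) by auto
    obtain c' q' where q': "q' \<in> A" "q = c' *s e + q'" using dec[of q] 2(2) by auto
    \<comment> \<open>The identity used is \<open>(c e + p') \<and> (c' e + q') = (c' p' - c q')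
      \<and> e + p' \<and> q'\<close>.\<close>
    let ?a = "c' *s p' - c *s q' + a"
    have "?a \<in> A" using A(1) p' q' aQ by (intro vec.subspace_add vec.subspace_diff vec.subspace_scale)
    moreover have "ev B ((p, q) # P) = B ?a e + ev B ((p', q') # Q)" if B: "B \<in> altf" for B
      using aQ(3)[OF B] altf_skew[OF B, of e q'] by (simp add: p' q' altf_simps[OF B] algebra_simps)
    moreover have "sv ((p', q') # Q) \<subseteq> A" using p' q' aQ by simp
    ultimately show ?case by blast
  qed
qed

lemma simple_complement:
  fixes S U :: "('a::{field,finite}^'m::finite) set"
  assumes S: "sp S" and U: "sp U" "S \<subseteq> U"
  obtains T where "sp T" "T \<subseteq> U" "S \<inter> T = {0}" "vec.dim T + vec.dim S = vec.dim U"
proof -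
  have sz: "sp {0 :: 'a^'m}" by (simp add: vec.subspace_def)
  have z: "{0} \<subseteq> U" "S \<inter> {0} = {0}" using S U by (auto simp: vec.subspace_0)
  show ?thesis by (rule ex_complement[OF S sz U(1) U(2) z]) (rule that)
qed

context descendant_forms
begin

text \<open>A bivector with \<open>d\<close> summands, three of the form \<open>r \<and> t\<close>
  with \<open>r\<close> in \<open>R\<close> and the rest inside \<open>R\<close>, vanishes at every
  member of the set, so its coefficient equals the nonzero total \<open>FT f []\<close>; but
  \<open>d\<close> exceeds the dual bound \<open>d - w\<close>. There is room for the
  \<open>d - 3\<close> further pairs because \<open>R\<close> has codimension three.\<close>

lemma clique_plane_false:
  assumes R: "sp R" "R \<subseteq> V" "vec.dim R + 3 = vec.dim V"
    and kill: "\<And>B x y. B \<in> altf \<Longrightarrow> f B \<noteq> 0 \<Longrightarrow> x \<in> R \<Longrightarrow> y \<in> V \<Longrightarrow> B x y = 0"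
  shows False
proof -
  have dR: "2 * d \<le> vec.dim R + 3" "3 \<le> vec.dim R" using R(3) dimV d by auto
  obtain r1 r2 r3 where r: "{r1, r2, r3} \<subseteq> R" "vec.dim {r1, r2, r3} = 3" by (rule ex_triple[OF R(1) dR(2)])
  obtain T where T: "sp T" "T \<subseteq> V" "R \<inter> T = {0}" "vec.dim T + vec.dim R = vec.dim V"
    by (rule simple_complement[OF R(1) V(1) R(2)])
  have "3 \<le> vec.dim T" using T(4) R(3) by simp
  then obtain t1 t2 t3 where t: "{t1, t2, t3} \<subseteq> T" "vec.dim {t1, t2, t3} = 3" by (rule ex_triple[OF T(1)])
  let ?S = "vec.span {r1, r2, r3}" and ?T = "vec.span {t1, t2, t3}"
  have sub: "?S \<subseteq> R" "?T \<subseteq> T" using r t R T by (simp_all add: vec.span_minimal)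
  obtain R' where R': "sp R'" "R' \<subseteq> R" "?S \<inter> R' = {0}" "vec.dim R' + vec.dim ?S = vec.dim R"
    by (rule simple_complement[OF vec.subspace_span R(1) sub(1)])
  have "vec.dim R' + 3 = vec.dim R" using R'(4) r(2) by simp
  then have dR': "2 * (length ([] :: (('a^'m) \<times> ('a^'m)) list) + (d - 3)) \<le> vec.dim R'" using dR by simp
  obtain Q where Q: "ind Q" "sv Q \<subseteq> R'" "length Q = d - 3" using ind_extend[OF ind_Nil _ dR'] by auto
  let ?P = "[(r1, t1), (r2, t2), (r3, t3)]"
  have dis: "?S \<inter> ?T = {0}" using sub T(3) by (auto simp: vec.span_zero)
  have svP: "sv ?P = {r1, r2, r3} \<union> {t1, t2, t3}" by auto
  have iP: "ind ?P" using dim_Un_disjoint[OF dis] r(2) t(2) by (simp only: ind_def svP) simp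
  have sQ: "vec.span (sv Q) \<subseteq> R'" using Q R' by (intro vec.span_minimal)
  have "vec.span (sv ?P) \<inter> vec.span (sv Q) = {0}"
  proof -
    have "x = 0" if x: "x \<in> vec.span (sv ?P)" "x \<in> vec.span (sv Q)" for x
    proof -
      obtain y z where yz: "x = y + z" "y \<in> ?S" "z \<in> ?T" using x(1) unfolding svP span_Un_sum by blast
      have xR: "x \<in> R'" "x \<in> R" using x(2) sQ R'(2) by auto
      have "x - y \<in> R" using xR yz(2) sub(1) R(1) by (meson subsetD vec.subspace_diff)
      moreover have "x - y = z" using yz(1) by simp
      ultimately have "z = 0" using yz(3) sub(2) T(3) by blast
      then show ?thesis using yz xR(1) R'(3) by auto
    qed
    then show ?thesis using vec.span_zero by blast
  qed
  then have iPQ: "ind (?P @ Q)" by (rule ind_append[OF iP Q(1)])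
  have sPQ: "sv (?P @ Q) \<subseteq> V" using r t Q R R' T by auto
  have evQ: "ev B Q = 0" if B: "B \<in> altf" "f B \<noteq> 0" for B
  proof -
    have "eqon R' B 0" using kill[OF B] R'(2) R(2) by (auto simp: eqon_def)
    then show ?thesis using ev_cong[of R' B 0 Q] Q(2) by simp
  qed
  have "FT f ([] @ (?P @ Q)) = addchar (0 :: 'a) * FT f []"
  proof (rule FT_absorb)
    fix B assume B: "B \<in> altf" "f B \<noteq> 0"
    have "B r1 t1 = 0" "B r2 t2 = 0" "B r3 t3 = 0" using kill[OF B] r t T(2) by auto
    then show "ev B (?P @ Q) = 0" using evQ[OF B] by simp
  qed
  moreover have "FT f (?P @ Q) = 0" by (rule dual[OF iPQ sPQ]) (use Q d in simp)
  ultimately show False using FT_Nil by simp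
qed

text \<open>Bivectors inside \<open>A\<close> may be added freely, since the members vanish on
  \<open>A\<close>. If \<open>dim V\<close> were odd, \<open>A\<close> would hold \<open>d\<close>
  independent pairs, with coefficient \<open>FT f []\<close>. For \<open>dim V = 2 * d\<close>, a
  bivector with nonzero coefficient must lie inside \<open>A\<close>: otherwise its part inside
  \<open>A\<close> can be exchanged so that \<open>d\<close> independent summands arise. Hence the
  characters in the support of the transform are trivial at every form vanishing on
  \<open>A\<close>.\<close>

lemma clique_star:
  assumes w: "w = 1" and A: "sp A" "A \<subseteq> V" "vec.dim A + 1 = vec.dim V"
    and kill: "\<And>B. B \<in> altf \<Longrightarrow> f B \<noteq> 0 \<Longrightarrow> eqon A B 0"
  shows "vec.dim V = 2 * d" "B \<in> altf \<Longrightarrow> eqon A B 0 \<Longrightarrow> f B \<noteq> 0"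
proof -
  have abs: "FT f (P @ Q) = FT f P" if "sv Q \<subseteq> A" for P Q
  proof -
    have "FT f (P @ Q) = addchar (0 :: 'a) * FT f P"
      by (rule FT_absorb) (use ev_cong[OF kill that] in simp)
    then show ?thesis by simp
  qed
  show dV: "vec.dim V = 2 * d"
  proof (rule ccontr)
    assume "\<not> ?thesis"
    then have dA: "2 * (length ([] :: (('a^'m) \<times> ('a^'m)) list) + d) \<le> vec.dim A" using V(2) A(3) by simp
    obtain Q where Q: "ind Q" "sv Q \<subseteq> A" "length Q = d" using ind_extend[OF ind_Nil _ dA] by auto
    have "FT f Q = 0" by (rule dual) (use Q A w d in auto)
    then show False using abs[OF Q(2), of "[]"] FT_Nil by simp
  qed
  assume B: "B \<in> altf" "eqon A B 0"
  have "\<not> V \<subseteq> A" using vec.dim_subset[of V A] A(3) by auto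
  then obtain e where e: "e \<in> V" "e \<notin> A" by blast
  have "f (0 + B) = f 0"
  proof (rule FT_invariant[OF f(1) V(1) B(1) _ altf_0])
    fix P assume P: "sv P \<subseteq> V" "FT f P \<noteq> 0"
    obtain a Q where aQ: "a \<in> A" "sv Q \<subseteq> A" "\<And>B. B \<in> altf \<Longrightarrow> ev B P = B a e + ev B Q"
      using hyperplane_decomposition[OF V(1) A e P(1)] by blast
    have "a = 0"
    proof (rule ccontr)
      assume a0: "a \<noteq> 0"
      have sa: "vec.span {a} \<subseteq> A" using aQ(1) A(1) by (intro vec.span_minimal) auto
      obtain A' where A': "sp A'" "A' \<subseteq> A" "vec.span {a} \<inter> A' = {0}" "vec.dim A' + vec.dim (vec.span {a}) = vec.dim A"
        by (rule simple_complement[OF vec.subspace_span A(1) sa])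
      have "vec.dim A' + 1 = vec.dim A" using A'(4) a0 by simp
      then have dA': "2 * (length ([] :: (('a^'m) \<times> ('a^'m)) list) + (d - 1)) \<le> vec.dim A'" using A(3) dV by simp
      obtain Q0 where Q0: "ind Q0" "sv Q0 \<subseteq> A'" "length Q0 = d - 1" using ind_extend[OF ind_Nil _ dA'] by auto
      have na: "a \<notin> A'" using A'(3) a0 vec.span_base[of a "{a}"] by auto
      have "vec.span (insert a A') \<subseteq> A" using aQ(1) A'(2) A(1) by (intro vec.span_minimal) auto
      then have ne: "e \<notin> vec.span (insert a A')" using e by blast
      note sd = span_pair_disjoint[OF A'(1) na ne]
      have "vec.span (sv Q0) \<subseteq> A'" using Q0 A' by (intro vec.span_minimal)
      then have "vec.span (sv [(a, e)]) \<inter> vec.span (sv Q0) = {0}" using sd(1) by (auto simp: vec.span_zero)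
      then have i: "ind ([(a, e)] @ Q0)" by (rule ind_append[OF sd(2) Q0(1)])
      \<comment> \<open>Appending \<open>?N\<close> cancels the part of \<open>P\<close> inside
        \<open>A\<close>, and \<open>Q0\<close> completes \<open>a \<and> e\<close> to
        \<open>d\<close> independent summands.\<close>
      let ?N = "map (\<lambda>(x, y). (- 1 *s x, y)) Q"
      have sN: "sv ?N \<subseteq> A" using aQ(2)
      proof (induction Q rule: sv.induct)
        case (2 x y Q)
        then show ?case using A(1) by (simp add: vec.subspace_neg)
      qed simp
      have sNQ: "sv (?N @ Q0) \<subseteq> A" using sN Q0(2) A'(2) by auto
      have "FT f P = FT f (P @ (?N @ Q0))" using abs[OF sNQ] by simp
      also have "\<dots> = FT f ([(a, e)] @ Q0)"
      proof (rule FT_cong)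
        fix C :: "'a^'m \<Rightarrow> 'a^'m \<Rightarrow> 'a" assume C: "C \<in> altf"
        have "ev C ?N = - ev C Q" using ev_scale[OF C, of "- 1" Q] by simp
        then show "ev C (P @ (?N @ Q0)) = ev C ([(a, e)] @ Q0)" using aQ(3)[OF C] by (simp only: ev_append) simp
      qed
      also have "\<dots> = 0" by (rule dual[OF i]) (use Q0 A' A aQ e d w in auto)
      finally show False using P(2) by simp
    qed
    then have "ev B P = 0" using aQ(3)[OF B(1)] ev_cong[OF B(2) aQ(2)] B(1) by (simp add: altf_simps)
    then show "addchar (ev B P) = 1" by simp
  qed
  then show "f B \<noteq> 0" using f(3) by simp
qed

lemma width_one:
  assumes w: "w = 1"
  shows "vec.dim V = 2 * d \<and> (\<exists>A. sp A \<and> A \<subseteq> V \<and> vec.dim A + 1 = vec.dim V \<and>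
    (\<forall>B\<in>altf. f B \<noteq> 0 \<longleftrightarrow> eqon A B 0))"
proof -
  define Y where "Y = {B \<in> altf. f B \<noteq> 0}"
  have Y: "Y \<subseteq> altf" "0 \<in> Y" using f(3) by (auto simp: Y_def altf_0)
  have nq: "noquad V (D - E)" if "D \<in> Y" "E \<in> Y" for D E
    unfolding noquad_def
  proof (intro allI impI)
    fix M assume "sp M" "M \<subseteq> V" "vec.dim M = 4"
    then show "\<not> nonsing M (D - E)" by (intro width) (use that w in \<open>auto simp: Y_def\<close>)
  qed
  have "(\<exists>A. sp A \<and> A \<subseteq> V \<and> vec.dim A + 1 = vec.dim V \<and> (\<forall>D\<in>Y. eqon A D 0)) \<or>
    (\<exists>R. sp R \<and> R \<subseteq> V \<and> vec.dim R + 3 = vec.dim V \<and> (\<forall>D\<in>Y. \<forall>x\<in>R. \<forall>y\<in>V. D x y = 0))"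
    by (rule rank2_clique[OF V(1) _ Y nq]) (use dimV d in auto)
  then show ?thesis
  proof (elim disjE exE conjE)
    fix A assume A: "sp A" "A \<subseteq> V" "vec.dim A + 1 = vec.dim V" "\<forall>D\<in>Y. eqon A D 0"
    have kill: "eqon A B 0" if "B \<in> altf" "f B \<noteq> 0" for B using A(4) that by (simp add: Y_def)
    note cs = clique_star[OF w A(1-3) kill]
    show ?thesis using cs A(1-3) kill by blast
  next
    fix R assume R: "sp R" "R \<subseteq> V" "vec.dim R + 3 = vec.dim V" "\<forall>D\<in>Y. \<forall>x\<in>R. \<forall>y\<in>V. D x y = 0"
    have False by (rule clique_plane_false[OF R(1-3)]) (use R(4) in \<open>auto simp: Y_def\<close>)
    then show ?thesis ..
  qed
qed

theorem classification:
  "vec.dim V = 2 * d \<and>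
    (w = 1 \<and> (\<exists>A. sp A \<and> A \<subseteq> V \<and> vec.dim A + 1 = vec.dim V \<and> (\<forall>B\<in>altf. f B \<noteq> 0 \<longleftrightarrow> eqon A B 0)) \<or>
     w = d - 1 \<and> (\<exists>u\<in>V. u \<noteq> 0 \<and> (\<forall>B\<in>altf. f B \<noteq> 0 \<longleftrightarrow> (\<forall>y\<in>V. B u y = 0))))"
proof (cases "w = 1")
  case True
  then show ?thesis using width_one by blast
next
  case False
  then have w: "2 \<le> w" using d by simp
  have "\<not> w \<le> d - 2" using middle_false[OF w] by blast
  then have "w = d - 1" using d by linarith
  then show ?thesis using even_dim[OF w] dual_width_one[OF w] by blast
qed

end

subsection \<open>Distances\<close>

text \<open>The bound \<open>tri\<close> gives the lower estimate along any path;
  \<open>step\<close> and \<open>tri\<close> together give a neighbour at which \<open>D\<close>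
  drops by exactly one, hence a path of length \<open>D x z\<close>.\<close>

lemma gdist_eqI:
  fixes D :: "'v \<Rightarrow> 'v \<Rightarrow> nat"
  assumes R: "\<And>x y. (x, y) \<in> R \<Longrightarrow> x \<in> X \<and> y \<in> X"
    and D0: "\<And>x y. x \<in> X \<Longrightarrow> y \<in> X \<Longrightarrow> D x y = 0 \<longleftrightarrow> x = y"
    and tri: "\<And>x y z. (x, y) \<in> R \<Longrightarrow> z \<in> X \<Longrightarrow> D x z \<le> D y z + 1"
    and step: "\<And>x z. x \<in> X \<Longrightarrow> z \<in> X \<Longrightarrow> D x z \<noteq> 0 \<Longrightarrow> \<exists>y. (x, y) \<in> R \<and> D y z < D x z"
    and xz: "x \<in> X" "z \<in> X"
  shows "gdist R x z = D x z"
proof -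
  have lower: "D x z \<le> k" if "(x, z) \<in> R ^^ k" "x \<in> X" for k x
    using that
  proof (induction k arbitrary: x)
    case 0
    then show ?case using D0 xz by auto
  next
    case (Suc k)
    then obtain y where "(x, y) \<in> R" "(y, z) \<in> R ^^ k" by (meson relpow_Suc_D2)
    then show ?case using Suc(1) tri[of x y z] R[of x y] xz by fastforce
  qed
  have path: "(x, z) \<in> R ^^ (D x z)" if "x \<in> X" for x
    using that
  proof (induction "D x z" arbitrary: x)
    case 0
    then have "D x z = 0" "x = z" using D0 xz by auto
    then show ?case by simp
  next
    case (Suc k)
    obtain y where y: "(x, y) \<in> R" "D y z < D x z" using step[OF Suc(3) xz(2)] Suc(2) by auto
    have "D x z \<le> D y z + 1" using tri[OF y(1) xz(2)] .
    then have "k = D y z" using Suc(2) y(2) by simp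
    then have "(y, z) \<in> R ^^ k" using Suc(1) R y(1) by blast
    then have "(x, z) \<in> R ^^ Suc k" by (rule relpow_Suc_I2[OF y(1)])
    then show ?case using Suc(2) by simp
  qed
  show ?thesis unfolding gdist_def
    by (rule Least_equality) (use path lower xz in auto)
qed

lemma dim_kernel:
  fixes W :: "('a::{field,finite}^'m::finite) set"
  assumes W: "sp W" and h: "\<And>x y. h (x + y) = h x + h y" "\<And>c x. h (c *s x) = c * (h x :: 'a)"
  shows "sp {x \<in> W. h x = 0}" "vec.dim W \<le> vec.dim {x \<in> W. h x = 0} + 1"
proof -
  have h0: "h 0 = 0" using h(2)[of 0 0] by simp
  let ?K = "{x \<in> W. h x = 0}"
  show K: "sp ?K" using W h0 by (auto simp: vec.subspace_def h)
  show "vec.dim W \<le> vec.dim ?K + 1"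
  proof (cases "W = ?K")
    case False
    then obtain e where e: "e \<in> W" "h e \<noteq> 0" by blast
    have "W \<subseteq> vec.span (insert e ?K)"
    proof
      fix x assume x: "x \<in> W"
      let ?k = "x - (h x / h e) *s e"
      have "h ?k + h ((h x / h e) *s e) = h x" by (subst h(1)[symmetric]) simp
      then have "h ?k = 0" using e by (simp add: h)
      moreover have "?k \<in> W" using x e W by (intro vec.subspace_diff vec.subspace_scale)
      ultimately have "?k \<in> vec.span ?K" by (intro vec.span_base) simp
      then have "(h x / h e) *s e + ?k \<in> vec.span (insert e ?K)" by (rule in_span_insertI)
      then show "x \<in> vec.span (insert e ?K)" by simp
    qed
    then have "vec.dim W \<le> vec.dim (insert e ?K)" by (rule vec.dim_mono)
    also have "\<dots> \<le> vec.dim ?K + 1" by (simp add: vec.dim_insert)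
    finally show ?thesis .
  qed simp
qed

lemma dim_Int_ge:
  fixes S T U :: "('a::{field,finite}^'m::finite) set"
  assumes "sp S" "sp T" "sp U" "S \<subseteq> U" "T \<subseteq> U"
  shows "vec.dim S + vec.dim T \<le> vec.dim (S \<inter> T) + vec.dim U"
proof -
  have "vec.dim (ssum S T) \<le> vec.dim U" using assms by (intro vec.dim_subset ssum_least)
  then show ?thesis using dim_ssum[OF assms(1,2)] by linarith
qed

subsection \<open>The dual polar graph\<close>

locale polar_space =
  fixes Q :: "'a::{field,finite}^'m::finite \<Rightarrow> 'a" and n :: nat
  assumes quad: "quadratic_form Q" and nondeg: "nondegenerate Q" and witt: "witt_index Q = n"
    and card_m: "CARD('m) = 2 * n" and n2: "2 \<le> n"
begin

abbreviation "bf \<equiv> polar_form Q"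

lemma Q_scale: "Q (c *s x) = c\<^sup>2 * Q x"
  using quad unfolding quadratic_form_def by blast

lemma bf_sym: "bf x y = bf y x"
  by (simp add: polar_form_def add.commute)

lemma bf_add: "bf x (y + y') = bf x y + bf x y'" "bf (y + y') x = bf y x + bf y' x"
  and bf_scale: "bf x (c *s y) = c * bf x y" "bf (c *s y) x = c * bf y x"
proof -
  have "Vector_Spaces.linear (*s) (*) (bf x)" for x using quad unfolding quadratic_form_def by blast
  then have "bf x (y + y') = bf x y + bf x y'" "bf x (c *s y) = c * bf x y" for x y y' c
    unfolding Vector_Spaces.linear_iff by blast+
  then show "bf x (y + y') = bf x y + bf x y'" "bf (y + y') x = bf y x + bf y' x"
    "bf x (c *s y) = c * bf x y" "bf (c *s y) x = c * bf y x"
    using bf_sym by metis+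
qed

lemma bf_0: "bf x 0 = 0" "bf 0 x = 0"
  using bf_scale(1)[where c = 0 and y = 0 and x = x] bf_scale(2)[where c = 0 and y = 0 and x = x] by auto

lemma bf_diff: "bf x (y - y') = bf x y - bf x y'" "bf (y - y') x = bf y x - bf y' x"
  using bf_add(1)[of x "y - y'" y'] bf_add(2)[of "y - y'" y' x] by (simp_all add: algebra_simps)

lemma Q_add: "Q (x + y) = Q x + Q y + bf x y"
  by (simp add: polar_form_def)

lemma isotropicD: "isotropic Q U \<Longrightarrow> sp U" "isotropic Q U \<Longrightarrow> x \<in> U \<Longrightarrow> Q x = 0"
  "isotropic Q U \<Longrightarrow> x \<in> U \<Longrightarrow> y \<in> U \<Longrightarrow> bf x y = 0"
  unfolding isotropic_def polar_form_def by (auto simp: vec.subspace_add)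

lemma witt_set: "finite {vec.dim U | U. isotropic Q U}" "{vec.dim U | U. isotropic Q U} \<noteq> {}"
proof -
  have "vec.dim U \<le> 2 * n" for U :: "('a^'m) set"
    using vec.dim_subset_UNIV[of U] card_m by (simp add: vec.dimension_def card_cart_basis)
  then have "{vec.dim U | U. isotropic Q U} \<subseteq> {..2 * n}" by auto
  then show "finite {vec.dim U | U. isotropic Q U}" by (rule finite_subset) simp
  have "isotropic Q {0}" using Q_scale[of 0 0] by (simp add: isotropic_def vec.subspace_def)
  then show "{vec.dim U | U. isotropic Q U} \<noteq> {}" by blast
qed

lemma isotropic_dim_le: "isotropic Q U \<Longrightarrow> vec.dim U \<le> n"
  using Max_ge[OF witt_set(1)] witt unfolding witt_index_def by blast

lemma ex_isotropic_n: "\<exists>U. isotropic Q U \<and> vec.dim U = n"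
  using Max_in[OF witt_set] witt unfolding witt_index_def by auto

text \<open>The functional \<open>bf p\<close> cuts \<open>W\<close> down by at most one dimension,
  and adjoining \<open>p\<close> gives an isotropic subspace again; as \<open>n\<close> is the
  greatest isotropic dimension, the loss is exactly one. This exchange shows that maximal isotropic
  subspaces have dimension \<open>n\<close> and constructs geodesics.\<close>

lemma flip:
  assumes W: "isotropic Q W" "vec.dim W = n" and p: "Q p = 0" "p \<notin> W"
    and K_def: "K = {x \<in> W. bf p x = 0}" and W'_def: "W' = vec.span (insert p K)"
  shows "isotropic Q W'" "vec.dim W' = n" "vec.dim K = n - 1" "W \<inter> W' = K" "p \<in> W'" "K \<subseteq> W'"
proof -
  note sW = isotropicD(1)[OF W(1)]
  have K: "sp K" "n \<le> vec.dim K + 1"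
    using dim_kernel[where h = "bf p", OF sW bf_add(1) bf_scale(1)] W(2) by (simp_all add: K_def)
  have sK: "vec.span K = K" by (rule span_eq_subspace[OF K(1)])
  have rep: "\<exists>c k. k \<in> K \<and> x = c *s p + k" if "x \<in> W'" for x
  proof -
    have "x \<in> vec.span (insert p K)" using that W'_def by simp
    then obtain c k where "k \<in> vec.span K" "x = c *s p + k" by (rule in_span_insertE)
    then show ?thesis using sK by blast
  qed
  show iso: "isotropic Q W'"
    unfolding isotropic_def
  proof (intro conjI ballI)
    show "sp W'" by (simp add: W'_def)
    fix x assume "x \<in> W'"
    then obtain c k where k: "k \<in> K" "x = c *s p + k" using rep by blast
    have "Q k = 0" "bf p k = 0" using k(1) isotropicD(2)[OF W(1)] by (auto simp: K_def)
    then show "Q x = 0" by (simp add: k(2) Q_add Q_scale p bf_scale)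
  qed
  have "p \<notin> vec.span K" unfolding sK using p(2) by (simp add: K_def)
  then have "vec.dim W' = vec.dim K + 1" by (simp add: W'_def vec.dim_insert)
  then show d: "vec.dim W' = n" "vec.dim K = n - 1" using isotropic_dim_le[OF iso] K(2) by auto
  show pK: "p \<in> W'" "K \<subseteq> W'" using vec.span_superset[of "insert p K"] by (auto simp: W'_def)
  show "W \<inter> W' = K"
  proof
    show "K \<subseteq> W \<inter> W'" using pK by (auto simp: K_def)
    show "W \<inter> W' \<subseteq> K"
    proof
      fix x assume x: "x \<in> W \<inter> W'"
      then obtain c k where k: "k \<in> K" "x = c *s p + k" using rep by blast
      have "c = 0"
      proof (rule ccontr)
        assume c: "c \<noteq> 0"
        have "x - k \<in> W" using x k(1) sW by (intro vec.subspace_diff) (auto simp: K_def)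
        then have "(1 / c) *s (x - k) \<in> W" by (rule vec.subspace_scale[OF sW])
        then show False using c p(2) by (simp add: k(2))
      qed
      then show "x \<in> K" using k by simp
    qed
  qed
qed

text \<open>Among the isotropic subspaces of dimension \<open>n\<close> take \<open>W\<close> with
  the largest intersection with \<open>U\<close>. If \<open>p\<close> in \<open>U\<close> were
  outside \<open>W\<close>, \<open>flip\<close> would keep \<open>W \<inter> U\<close> and add
  \<open>p\<close>.\<close>

lemma maximal_isotropic_iff: "maximal_isotropic Q U \<longleftrightarrow> isotropic Q U \<and> vec.dim U = n"
proof
  assume U: "isotropic Q U \<and> vec.dim U = n"
  have "W = U" if W: "isotropic Q W" "U \<subseteq> W" for W
    using sp_eqI[OF isotropicD(1) isotropicD(1)[OF W(1)] W(2)] U isotropic_dim_le[OF W(1)] by auto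
  then show "maximal_isotropic Q U" using U unfolding maximal_isotropic_def by blast
next
  assume U: "maximal_isotropic Q U"
  then have iU: "isotropic Q U" by (simp add: maximal_isotropic_def)
  let ?P = "\<lambda>W. isotropic Q W \<and> vec.dim W = n"
  obtain W0 where "?P W0" using ex_isotropic_n by blast
  then obtain W where W: "?P W" "\<And>W'. ?P W' \<Longrightarrow> vec.dim (W' \<inter> U) \<le> vec.dim (W \<inter> U)"
    using ex_has_greatest_nat[of ?P W0 "\<lambda>W. vec.dim (W \<inter> U)" "CARD('m) + 1"]
    by (metis (no_types, lifting) U Suc_eq_plus1 iU isotropic_dim_le le_imp_less_Suc vec.dim_subset inf_le2 le_trans card_m mult_2 le_add1)
  have "U \<subseteq> W"
  proof (rule ccontr)
    assume "\<not> U \<subseteq> W"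
    then obtain p where p: "p \<in> U" "p \<notin> W" by blast
    define K where "K = {x \<in> W. bf p x = 0}"
    define W' where "W' = vec.span (insert p K)"
    have Qp: "Q p = 0" using isotropicD(2)[OF iU p(1)] .
    note fl = flip[OF conjunct1[OF W(1)] conjunct2[OF W(1)] Qp p(2) K_def W'_def]
    have WU: "W \<inter> U \<subseteq> K" using isotropicD(3)[OF iU p(1)] by (auto simp: K_def)
    have sI: "sp (W \<inter> U)" "sp (W' \<inter> U)" using isotropicD(1) W(1) iU fl(1) by (auto intro: sp_Int)
    have "insert p (W \<inter> U) \<subseteq> W' \<inter> U" using WU fl(5,6) p by auto
    then have "vec.dim (insert p (W \<inter> U)) \<le> vec.dim (W' \<inter> U)" by (rule vec.dim_subset)
    moreover have "p \<notin> vec.span (W \<inter> U)" unfolding span_eq_subspace[OF sI(1)] using p by blast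
    then have "vec.dim (insert p (W \<inter> U)) = vec.dim (W \<inter> U) + 1" by (simp add: vec.dim_insert)
    ultimately show False using W(2)[of W'] fl(1,2) by simp
  qed
  then have "W = U" using U W(1) unfolding maximal_isotropic_def by blast
  then show "isotropic Q U \<and> vec.dim U = n" using W(1) by simp
qed

lemma vertex_iff: "x \<in> dual_polar_vertices Q \<longleftrightarrow> isotropic Q x \<and> vec.dim x = n"
  by (simp add: dual_polar_vertices_def maximal_isotropic_iff)

lemma vertexD':
  assumes "x \<in> dual_polar_vertices Q"
  shows "sp x" "vec.dim x = n" "isotropic Q x"
  using assms isotropicD(1) by (auto simp: vertex_iff)

lemma triangle:
  assumes "x \<in> dual_polar_vertices Q" "y \<in> dual_polar_vertices Q" "z \<in> dual_polar_vertices Q"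
  shows "vec.dim (x \<inter> y) + vec.dim (y \<inter> z) \<le> vec.dim (x \<inter> z) + n"
proof -
  note s = vertexD'(1)[OF assms(1)] vertexD'(1)[OF assms(2)] vertexD'(1)[OF assms(3)]
  have "vec.dim (x \<inter> y) + vec.dim (y \<inter> z) \<le> vec.dim ((x \<inter> y) \<inter> (y \<inter> z)) + vec.dim y"
    by (rule dim_Int_ge) (use s in \<open>auto intro: sp_Int\<close>)
  also have "vec.dim ((x \<inter> y) \<inter> (y \<inter> z)) \<le> vec.dim (x \<inter> z)" by (rule vec.dim_subset) auto
  finally show ?thesis using vertexD'(2)[OF assms(2)] by simp
qed

lemma dim_Int_vertex_le:
  assumes "x \<in> dual_polar_vertices Q"
  shows "vec.dim (x \<inter> y) \<le> n"
  using vec.dim_subset[of "x \<inter> y" x] vertexD'(2)[OF assms] by auto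

lemma eq_vertex:
  assumes x: "x \<in> dual_polar_vertices Q" and y: "y \<in> dual_polar_vertices Q" and d: "n \<le> vec.dim (x \<inter> y)"
  shows "x = y"
proof -
  have s: "sp (x \<inter> y)" by (rule sp_Int[OF vertexD'(1)[OF x] vertexD'(1)[OF y]])
  have "x \<inter> y = x" by (rule sp_eqI[OF s vertexD'(1)[OF x]]) (use d vertexD'(2)[OF x] in auto)
  moreover have "x \<inter> y = y" by (rule sp_eqI[OF s vertexD'(1)[OF y]]) (use d vertexD'(2)[OF y] in auto)
  ultimately show ?thesis by simp
qed

lemma gdist_dual_polar:
  assumes "x \<in> dual_polar_vertices Q" "y \<in> dual_polar_vertices Q"
  shows "gdist (dual_polar_adj Q n) x y = n - vec.dim (x \<inter> y)"
proof (rule gdist_eqI[where X = "dual_polar_vertices Q" and D = "\<lambda>x y. n - vec.dim (x \<inter> y)"])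
  show "x \<in> dual_polar_vertices Q \<and> y \<in> dual_polar_vertices Q" if "(x, y) \<in> dual_polar_adj Q n" for x y
    using that by (simp add: dual_polar_adj_def)
  show "n - vec.dim (x \<inter> y) = 0 \<longleftrightarrow> x = y" if "x \<in> dual_polar_vertices Q" "y \<in> dual_polar_vertices Q" for x y
    using eq_vertex[OF that] vertexD'(2)[OF that(1)] by auto
  show "n - vec.dim (x \<inter> z) \<le> n - vec.dim (y \<inter> z) + 1" if "(x, y) \<in> dual_polar_adj Q n" "z \<in> dual_polar_vertices Q" for x y z
    using triangle[of x y z] that n2 by (simp add: dual_polar_adj_def)
  show "\<exists>y. (x, y) \<in> dual_polar_adj Q n \<and> n - vec.dim (y \<inter> z) < n - vec.dim (x \<inter> z)"
    if x: "x \<in> dual_polar_vertices Q" and z: "z \<in> dual_polar_vertices Q" and nz: "n - vec.dim (x \<inter> z) \<noteq> 0" for x z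
  proof -
    have "\<not> z \<subseteq> x"
    proof
      assume "z \<subseteq> x"
      then have "x \<inter> z = z" by blast
      then show False using nz vertexD'(2)[OF z] by simp
    qed
    \<comment> \<open>The neighbour is the flip of \<open>x\<close> at \<open>p\<close>: it keeps
      \<open>x \<inter> z\<close>, which is orthogonal to \<open>p\<close>, and gains
      \<open>p\<close> itself.\<close>
    then obtain p where p: "p \<in> z" "p \<notin> x" by blast
    define K where "K = {y \<in> x. bf p y = 0}"
    define y where "y = vec.span (insert p K)"
    have Qp: "Q p = 0" using isotropicD(2)[OF vertexD'(3)[OF z] p(1)] .
    note fl = flip[OF vertexD'(3,2)[OF x] Qp p(2) K_def y_def]
    have xz: "x \<inter> z \<subseteq> K" using isotropicD(3)[OF vertexD'(3)[OF z] p(1)] by (auto simp: K_def)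
    have sI: "sp (x \<inter> z)" by (rule sp_Int[OF vertexD'(1)[OF x] vertexD'(1)[OF z]])
    have "insert p (x \<inter> z) \<subseteq> y \<inter> z" using xz fl(5,6) p by auto
    then have "vec.dim (insert p (x \<inter> z)) \<le> vec.dim (y \<inter> z)" by (rule vec.dim_subset)
    moreover have "p \<notin> vec.span (x \<inter> z)" unfolding span_eq_subspace[OF sI] using p by blast
    then have "vec.dim (insert p (x \<inter> z)) = vec.dim (x \<inter> z) + 1" by (simp add: vec.dim_insert)
    ultimately have "n - vec.dim (y \<inter> z) < n - vec.dim (x \<inter> z)" using nz by simp
    moreover have "(x, y) \<in> dual_polar_adj Q n" using x fl by (simp add: dual_polar_adj_def vertex_iff)
    ultimately show ?thesis by blast
  qed
qed (use assms in auto)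

lemma Alt_vertices_iff:
  assumes "z \<in> dual_polar_vertices Q"
  shows "x \<in> Alt_vertices Q n z \<longleftrightarrow> x \<in> dual_polar_vertices Q \<and> x \<inter> z = {0}"
proof -
  have "gdist (dual_polar_adj Q n) z x = n \<longleftrightarrow> x \<inter> z = {0}" if x: "x \<in> dual_polar_vertices Q"
  proof -
    have s: "sp (x \<inter> z)" by (rule sp_Int[OF vertexD'(1)[OF x] vertexD'(1)[OF assms]])
    have "gdist (dual_polar_adj Q n) z x = n \<longleftrightarrow> vec.dim (x \<inter> z) = 0"
    proof -
      have 1: "gdist (dual_polar_adj Q n) z x = n - vec.dim (x \<inter> z)"
        using gdist_dual_polar[OF assms x] by (simp add: Int_commute)
      have 2: "vec.dim (x \<inter> z) \<le> n" by (rule dim_Int_vertex_le[OF x])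
      show ?thesis unfolding 1 using 2 n2 by arith
    qed
    then show ?thesis using dim_0_iff[OF s] by simp
  qed
  then show ?thesis by (auto simp: Alt_vertices_def)
qed

lemma Alt_adj_iff:
  assumes "z \<in> dual_polar_vertices Q"
  shows "(x, y) \<in> Alt_adj Q n z \<longleftrightarrow> x \<in> Alt_vertices Q n z \<and> y \<in> Alt_vertices Q n z \<and> vec.dim (x \<inter> y) + 2 = n"
proof -
  have "gdist (dual_polar_adj Q n) x y = 2 \<longleftrightarrow> vec.dim (x \<inter> y) + 2 = n"
    if "x \<in> dual_polar_vertices Q" "y \<in> dual_polar_vertices Q"
    using gdist_dual_polar[OF that] n2 by auto
  then show ?thesis using Alt_vertices_iff[OF assms] by (auto simp: Alt_adj_def)
qed

end

subsection \<open>The graph of alternating forms\<close>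

text \<open>A hyperbolic plane can be split off without changing the radical.\<close>

lemma rad_parity:
  fixes U :: "('a::{field,finite}^'m::finite) set"
  assumes "sp U" "D \<in> altf"
  shows "\<exists>k. vec.dim U = vec.dim (rad U D) + 2 * k"
  using assms
proof (induction "vec.dim U" arbitrary: U rule: less_induct)
  case less
  note U = less(2) and D = less(3)
  show ?case
  proof (cases "eqon U D 0")
    case True
    then have "rad U D = U" by (auto simp: rad_def eqon_def)
    then show ?thesis by (intro exI[of _ 0]) simp
  next
    case False
    then obtain a b where ab: "a \<in> U" "b \<in> U" "D a b \<noteq> 0" by (auto simp: eqon_def)
    define S where "S = vec.span {a, b}"
    define W where "W = {x \<in> U. D a x = 0 \<and> D b x = 0}"
    note hs = hyperbolic_split[OF U D ab S_def W_def]
    have "rad U D = rad W D"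
    proof
      show "rad U D \<subseteq> rad W D"
      proof
        fix x assume x: "x \<in> rad U D"
        then have "D x a = 0" "D x b = 0" using ab by (simp_all add: rad_def)
        then have "D a x = 0" "D b x = 0" using altf_skew[OF D, of a x] altf_skew[OF D, of b x] by simp_all
        then show "x \<in> rad W D" using x unfolding rad_def W_def by blast
      qed
      show "rad W D \<subseteq> rad U D"
      proof
        fix x assume x: "x \<in> rad W D"
        have "D x y = 0" if y: "y \<in> U" for y
        proof -
          obtain s w where sw: "s \<in> S" "w \<in> W" "y = s + w" using hs(3) y by blast
          have "D x s = 0" using hs(5)[OF sw(1), of x] x altf_skew[OF D, of x s] by (simp add: rad_def)
          then show ?thesis using x sw by (simp add: rad_def altf_simps[OF D])
        qed
        then show "x \<in> rad U D" using x by (auto simp: rad_def W_def)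
      qed
    qed
    moreover obtain k where "vec.dim W = vec.dim (rad W D) + 2 * k" using less(1)[OF _ hs(1) D] hs(4) by auto
    ultimately show ?thesis using hs(4) by (intro exI[of _ "k + 1"]) simp
  qed
qed

locale alt_graph = polar_space Q n for Q :: "'a::{field,finite}^'m::finite \<Rightarrow> 'a" and n +
  fixes z x0 :: "('a^'m) set"
  assumes z: "z \<in> dual_polar_vertices Q" and x0: "x0 \<in> Alt_vertices Q n z"
begin

abbreviation "X \<equiv> Alt_vertices Q n z"

lemma XD: assumes "x \<in> X" shows "x \<in> dual_polar_vertices Q" "x \<inter> z = {0}" "sp x" "vec.dim x = n" "isotropic Q x"
  using assms Alt_vertices_iff[OF z] vertexD' by blast+

lemma zD: "sp z" "vec.dim z = n" "isotropic Q z"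
  using vertexD'[OF z] by blast+

lemma X_sum: assumes "x \<in> X" shows "ssum x z = UNIV"
proof (rule sp_eqI)
  have "vec.dim (ssum x z) = 2 * n" using dim_ssum[OF XD(3)[OF assms] zD(1)] XD[OF assms] zD by simp
  moreover have "vec.dim (UNIV :: ('a^'m) set) = 2 * n" using card_m by (simp add: card_cart_basis)
  ultimately show "vec.dim (UNIV :: ('a^'m) set) \<le> vec.dim (ssum x z)" by simp
qed (auto intro: sp_ssum XD(3)[OF assms] zD)

lemma X_decomp: assumes "x \<in> X" obtains a \<zeta> where "a \<in> x" "\<zeta> \<in> z" "v = a + \<zeta>"
proof -
  have "v \<in> ssum x z" using X_sum[OF assms] by simp
  then show ?thesis using that unfolding ssum_def by blast
qed

lemma X_decomp_unique:
  assumes "x \<in> X" "a \<in> x" "a' \<in> x" "\<zeta> \<in> z" "\<zeta>' \<in> z" "a + \<zeta> = a' + \<zeta>'"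
  shows "a = a'" "\<zeta> = \<zeta>'"
proof -
  have "a - a' = \<zeta>' - \<zeta>" using assms(6) by (simp add: algebra_simps)
  moreover have "a - a' \<in> x" "\<zeta>' - \<zeta> \<in> z" using assms XD(3)[OF assms(1)] zD(1) by (auto intro: vec.subspace_diff)
  ultimately have "a - a' \<in> x \<inter> z" by simp
  then show "a = a'" using XD(2)[OF assms(1)] by simp
  then show "\<zeta> = \<zeta>'" using assms(6) by simp
qed

lemma pairing_z: assumes "\<zeta> \<in> z" "\<And>b. b \<in> x0 \<Longrightarrow> bf \<zeta> b = 0" shows "\<zeta> = 0"
proof -
  have "bf \<zeta> v = 0" for v
  proof -
    obtain a \<zeta>' where v: "a \<in> x0" "\<zeta>' \<in> z" "v = a + \<zeta>'" by (rule X_decomp[OF x0])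
    then show ?thesis using assms isotropicD(3)[OF zD(3) assms(1) v(2)] by (simp add: bf_add)
  qed
  then show ?thesis using nondeg isotropicD(2)[OF zD(3) assms(1)] unfolding nondegenerate_def by blast
qed

lemma pairing_x0: assumes "b \<in> x0" "\<And>\<zeta>. \<zeta> \<in> z \<Longrightarrow> bf \<zeta> b = 0" shows "b = 0"
proof -
  have "bf b v = 0" for v
  proof -
    obtain a \<zeta>' where v: "a \<in> x0" "\<zeta>' \<in> z" "v = a + \<zeta>'" by (rule X_decomp[OF x0])
    then show ?thesis using assms isotropicD(3)[OF XD(5)[OF x0] assms(1) v(1)] bf_sym[of b] by (simp add: bf_add)
  qed
  then show ?thesis using nondeg isotropicD(2)[OF XD(5)[OF x0] assms(1)] unfolding nondegenerate_def by blast
qed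

text \<open>Counting with the additive character, the number \<open>N\<close> of solutions \<open>\<zeta>\<close> satisfies
  \<open>card x0 * N = card z\<close>.\<close>

lemma ex_dual_vector:
  assumes h: "\<And>x y. h (x + y) = h x + h y" "\<And>c x. h (c *s x) = c * (h x :: 'a)"
  shows "\<exists>\<zeta>\<in>z. \<forall>b\<in>x0. bf \<zeta> b = h b"
proof (rule ccontr)
  assume neg: "\<not> ?thesis"
  have h0: "h 0 = 0" using h(2)[of 0 0] by simp
  have "(\<Sum>\<zeta>\<in>z. \<Sum>b\<in>x0. addchar (bf \<zeta> b - h b)) = (\<Sum>\<zeta>\<in>z. 0 :: complex)"
  proof (rule sum.cong[OF refl])
    fix \<zeta> assume \<zeta>: "\<zeta> \<in> z"
    have "(\<Sum>b\<in>x0. addchar (bf \<zeta> b - h b)) = (if \<forall>b\<in>x0. bf \<zeta> b - h b = 0 then of_nat (card x0) else 0)"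
      by (rule sum_addchar_linear[OF XD(3)[OF x0]]) (simp_all add: bf_add bf_scale h algebra_simps)
    then show "(\<Sum>b\<in>x0. addchar (bf \<zeta> b - h b)) = 0" using neg \<zeta> by auto
  qed
  then have "0 = (\<Sum>\<zeta>\<in>z. \<Sum>b\<in>x0. addchar (bf \<zeta> b - h b))" by simp
  also have "\<dots> = (\<Sum>b\<in>x0. \<Sum>\<zeta>\<in>z. addchar (bf \<zeta> b - h b))" by (rule sum.swap)
  also have "\<dots> = (\<Sum>b\<in>x0. if b = 0 then of_nat (card z) else 0)"
  proof (rule sum.cong[OF refl])
    fix b assume b: "b \<in> x0"
    have "(\<Sum>\<zeta>\<in>z. addchar (bf \<zeta> b - h b)) = (\<Sum>\<zeta>\<in>z. addchar (bf \<zeta> b)) * addchar (- h b)"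
      unfolding sum_distrib_right by (intro sum.cong refl) (simp add: addchar_add[symmetric])
    also have "(\<Sum>\<zeta>\<in>z. addchar (bf \<zeta> b)) = (if \<forall>\<zeta>\<in>z. bf \<zeta> b = 0 then of_nat (card z) else 0)"
      by (rule sum_addchar_linear[OF zD(1)]) (simp_all add: bf_add bf_scale)
    also have "(\<forall>\<zeta>\<in>z. bf \<zeta> b = 0) \<longleftrightarrow> b = 0" using pairing_x0[OF b] bf_0 by auto
    finally show "(\<Sum>\<zeta>\<in>z. addchar (bf \<zeta> b - h b)) = (if b = 0 then of_nat (card z) else 0)"
      by (simp add: h0)
  qed
  also have "\<dots> = of_nat (card z)" using vec.subspace_0[OF XD(3)[OF x0]] by simp
  finally have "card z = 0" by simp
  then show False using vec.subspace_0[OF zD(1)] by auto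
qed

text \<open>The vertex that is the graph of the map \<open>x0 \<rightarrow> z\<close> induced by the form \<open>B\<close>, where the polar
  form identifies \<open>z\<close> with the dual space of \<open>x0\<close>.\<close>

definition gr :: "('a^'m \<Rightarrow> 'a^'m \<Rightarrow> 'a) \<Rightarrow> ('a^'m) set" where
  "gr B = {a + \<zeta> | a \<zeta>. a \<in> x0 \<and> \<zeta> \<in> z \<and> (\<forall>b\<in>x0. bf \<zeta> b = B a b)}"

lemma gr_iff:
  assumes "a \<in> x0" "\<zeta> \<in> z"
  shows "a + \<zeta> \<in> gr B \<longleftrightarrow> (\<forall>b\<in>x0. bf \<zeta> b = B a b)"
  using X_decomp_unique[OF x0 assms(1) _ assms(2)] assms unfolding gr_def by blast

lemma ex_gr: assumes "B \<in> altf" shows "\<exists>\<zeta>\<in>z. \<forall>b\<in>x0. bf \<zeta> b = B a b"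
  by (rule ex_dual_vector) (simp_all add: altf_simps[OF assms])

lemma gr_sp: assumes B: "B \<in> altf" shows "sp (gr B)"
  unfolding vec.subspace_def
proof (intro conjI ballI allI)
  have "0 \<in> x0" "0 \<in> z" using vec.subspace_0 XD(3)[OF x0] zD(1) by blast+
  then show "0 \<in> gr B" using gr_iff[of 0 0 B] by (simp add: bf_0 altf_zero[OF B])
next
  fix u v assume "u \<in> gr B" "v \<in> gr B"
  then obtain a \<zeta> a' \<zeta>' where uv: "u = a + \<zeta>" "a \<in> x0" "\<zeta> \<in> z" "\<forall>b\<in>x0. bf \<zeta> b = B a b"
    "v = a' + \<zeta>'" "a' \<in> x0" "\<zeta>' \<in> z" "\<forall>b\<in>x0. bf \<zeta>' b = B a' b" unfolding gr_def by blast
  have "u + v = (a + a') + (\<zeta> + \<zeta>')" using uv by (simp add: algebra_simps)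
  moreover have "a + a' \<in> x0" "\<zeta> + \<zeta>' \<in> z" using uv XD(3)[OF x0] zD(1) by (auto intro: vec.subspace_add)
  moreover have "\<forall>b\<in>x0. bf (\<zeta> + \<zeta>') b = B (a + a') b" using uv by (simp add: bf_add altf_simps[OF B])
  ultimately show "u + v \<in> gr B" using gr_iff[of "a + a'" "\<zeta> + \<zeta>'" B] by metis
next
  fix c v assume "v \<in> gr B"
  then obtain a \<zeta> where v: "v = a + \<zeta>" "a \<in> x0" "\<zeta> \<in> z" "\<forall>b\<in>x0. bf \<zeta> b = B a b" unfolding gr_def by blast
  have "c *s v = c *s a + c *s \<zeta>" using v by (simp add: vec.scale_right_distrib)
  moreover have "c *s a \<in> x0" "c *s \<zeta> \<in> z" using v XD(3)[OF x0] zD(1) by (auto intro: vec.subspace_scale)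
  moreover have "\<forall>b\<in>x0. bf (c *s \<zeta>) b = B (c *s a) b" using v by (simp add: bf_scale altf_simps[OF B])
  ultimately show "c *s v \<in> gr B" using gr_iff[of "c *s a" "c *s \<zeta>" B] by metis
qed

text \<open>Isotropy is \<open>Q (a + \<zeta>) = bf \<zeta> a = B a a = 0\<close>; the dimension
  follows because \<open>gr B\<close> meets \<open>z\<close> trivially and together with
  \<open>z\<close> spans the space.\<close>

lemma gr_X: assumes B: "B \<in> altf" shows "gr B \<in> X"
proof -
  have iso: "isotropic Q (gr B)"
    unfolding isotropic_def
  proof (intro conjI ballI gr_sp B)
    fix v assume "v \<in> gr B"
    then obtain a \<zeta> where v: "v = a + \<zeta>" "a \<in> x0" "\<zeta> \<in> z" "\<forall>b\<in>x0. bf \<zeta> b = B a b" unfolding gr_def by blast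
    have "bf a \<zeta> = B a a" using v bf_sym[of a \<zeta>] by simp
    then show "Q v = 0" using v isotropicD(2)[OF XD(5)[OF x0] v(2)] isotropicD(2)[OF zD(3) v(3)]
      by (simp add: Q_add altf_simps[OF B])
  qed
  have int: "gr B \<inter> z = {0}"
  proof -
    have "v = 0" if v: "v \<in> gr B" "v \<in> z" for v
    proof -
      obtain a \<zeta> where a: "v = a + \<zeta>" "a \<in> x0" "\<zeta> \<in> z" "\<forall>b\<in>x0. bf \<zeta> b = B a b" using v(1) unfolding gr_def by blast
      have "0 + v = a + \<zeta>" using a(1) by simp
      then have "0 = a" "v = \<zeta>" using X_decomp_unique[OF x0 vec.subspace_0[OF XD(3)[OF x0]] a(2) v(2) a(3)] by blast+
      then have "\<zeta> = 0" using pairing_z[OF a(3)] a(4) by (simp add: altf_zero[OF B])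
      then show ?thesis using \<open>v = \<zeta>\<close> by simp
    qed
    then show ?thesis using vec.subspace_0[OF gr_sp[OF B]] vec.subspace_0[OF zD(1)] by blast
  qed
  have "UNIV \<subseteq> ssum (gr B) z"
  proof
    fix v
    obtain a \<zeta> where v: "a \<in> x0" "\<zeta> \<in> z" "v = a + \<zeta>" by (rule X_decomp[OF x0])
    obtain \<zeta>' where z': "\<zeta>' \<in> z" "\<forall>b\<in>x0. bf \<zeta>' b = B a b" using ex_gr[OF B] by blast
    have "a + \<zeta>' \<in> gr B" using gr_iff[OF v(1) z'(1)] z'(2) by simp
    moreover have "\<zeta> - \<zeta>' \<in> z" using v z' zD(1) by (simp add: vec.subspace_diff)
    moreover have "v = (a + \<zeta>') + (\<zeta> - \<zeta>')" using v by simp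
    ultimately show "v \<in> ssum (gr B) z" unfolding ssum_def by blast
  qed
  then have "ssum (gr B) z = UNIV" by blast
  then have "vec.dim (gr B) + n = 2 * n"
    using dim_ssum[OF gr_sp[OF B] zD(1)] int zD(2) card_m by (simp add: card_cart_basis)
  then show ?thesis using Alt_vertices_iff[OF z] vertex_iff iso int by simp
qed

text \<open>Modulo \<open>z\<close>, a point \<open>a + \<zeta>\<close> of the intersection becomes
  \<open>a\<close>, and some such point lies in both graphs exactly when \<open>B\<close> and
  \<open>D\<close> have the same contraction with \<open>a\<close> on \<open>x0\<close>. So the
  intersection and the radical have equal sums with \<open>z\<close>, which both meet
  trivially.\<close>

lemma dim_gr_Int:
  assumes B: "B \<in> altf" and D: "D \<in> altf"
  shows "vec.dim (gr B \<inter> gr D) = vec.dim (rad x0 (B - D))"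
proof -
  let ?r = "rad x0 (B - D)"
  note s = sp_Int[OF gr_sp[OF B] gr_sp[OF D]]
  have sr: "sp ?r" by (rule sp_rad[OF XD(3)[OF x0] altf_diff[OF B D]])
  have "ssum (gr B \<inter> gr D) z = ssum ?r z"
  proof
    show "ssum (gr B \<inter> gr D) z \<subseteq> ssum ?r z"
    proof (rule ssum_least[OF sp_ssum[OF sr zD(1)]])
      show "gr B \<inter> gr D \<subseteq> ssum ?r z"
      proof
        fix v assume v: "v \<in> gr B \<inter> gr D"
        then obtain a \<zeta> where a: "v = a + \<zeta>" "a \<in> x0" "\<zeta> \<in> z" "\<forall>b\<in>x0. bf \<zeta> b = B a b" unfolding gr_def by blast
        have "\<forall>b\<in>x0. bf \<zeta> b = D a b" using gr_iff[OF a(2,3), of D] v a(1) by simp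
        then have "a \<in> ?r" using a by (simp add: rad_def)
        then show "v \<in> ssum ?r z" using a unfolding ssum_def by blast
      qed
    qed (rule ssum_upper[OF sr zD(1)])
    show "ssum ?r z \<subseteq> ssum (gr B \<inter> gr D) z"
    proof (rule ssum_least[OF sp_ssum[OF s zD(1)]])
      show "?r \<subseteq> ssum (gr B \<inter> gr D) z"
      proof
        fix a assume a: "a \<in> ?r"
        then have a0: "a \<in> x0" "\<And>b. b \<in> x0 \<Longrightarrow> B a b = D a b" by (auto simp: rad_def)
        obtain \<zeta> where \<zeta>: "\<zeta> \<in> z" "\<forall>b\<in>x0. bf \<zeta> b = B a b" using ex_gr[OF B] by blast
        have "a + \<zeta> \<in> gr B \<inter> gr D" using gr_iff[OF a0(1) \<zeta>(1)] \<zeta>(2) a0(2) by simp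
        moreover have "- \<zeta> \<in> z" using \<zeta> zD(1) by (simp add: vec.subspace_neg)
        moreover have "a = (a + \<zeta>) + (- \<zeta>)" by simp
        ultimately show "a \<in> ssum (gr B \<inter> gr D) z" unfolding ssum_def by blast
      qed
    qed (rule ssum_upper[OF s zD(1)])
  qed
  moreover have "(gr B \<inter> gr D) \<inter> z = {0}"
    using XD(2)[OF gr_X[OF B]] vec.subspace_0[OF gr_sp[OF D]] by blast
  moreover have "?r \<inter> z = {0}"
    using XD(2)[OF x0] vec.subspace_0[OF sr] rad_subset[of x0 "B - D"] vec.subspace_0[OF zD(1)] by blast
  ultimately show ?thesis using dim_ssum[OF s zD(1)] dim_ssum[OF sr zD(1)] by simp
qed

lemma gr_eq_iff:
  assumes B: "B \<in> altf" and D: "D \<in> altf"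
  shows "gr B = gr D \<longleftrightarrow> eqon x0 B D"
proof
  assume BD: "eqon x0 B D"
  have "(\<forall>b\<in>x0. bf \<zeta> b = B a b) \<longleftrightarrow> (\<forall>b\<in>x0. bf \<zeta> b = D a b)" if "a \<in> x0" for a \<zeta>
    using BD that unfolding eqon_def by (intro ball_cong refl) simp
  then show "gr B = gr D" unfolding gr_def by blast
next
  assume "gr B = gr D"
  then have "vec.dim (rad x0 (B - D)) = n" using dim_gr_Int[OF B D] XD(4)[OF gr_X[OF D]] by simp
  then have "rad x0 (B - D) = x0"
    by (intro sp_eqI sp_rad XD(3)[OF x0] altf_diff B D rad_subset) (simp add: XD(4)[OF x0])
  then show "eqon x0 B D" by (auto simp: rad_def eqon_def)
qed

lemma gr_0: "gr 0 = x0"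
proof (rule sp_eqI[OF gr_sp[OF altf_0] XD(3)[OF x0]])
  show "gr 0 \<subseteq> x0"
  proof
    fix v assume "v \<in> gr 0"
    then obtain a \<zeta> where a: "v = a + \<zeta>" "a \<in> x0" "\<zeta> \<in> z" "\<forall>b\<in>x0. bf \<zeta> b = 0" unfolding gr_def by auto
    then show "v \<in> x0" using pairing_z[OF a(3)] by simp
  qed
  show "vec.dim x0 \<le> vec.dim (gr 0)" using XD(4)[OF x0] XD(4)[OF gr_X[OF altf_0]] by simp
qed

text \<open>Both \<open>x0\<close> and \<open>x\<close> are complements of \<open>z\<close>, so
  \<open>x\<close> is the graph of \<open>a \<mapsto> r a - a\<close> with values in
  \<open>z\<close>, where \<open>r\<close> projects onto \<open>x\<close> along \<open>z\<close>.
  That the resulting form is alternating comes from the vanishing of \<open>Q\<close> at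
  \<open>r a\<close>.\<close>

lemma gr_surj: assumes x: "x \<in> X" shows "\<exists>B\<in>altf. gr B = x"
proof -
  obtain p where p: "\<And>u v. p (u + v) = p u + p v" "\<And>c u. p (c *s u) = c *s p u"
    "\<And>u. p u \<in> x0" "\<And>u. u \<in> x0 \<Longrightarrow> p u = u"
    by (rule ex_projection[OF XD(3)[OF x0] zD(1) XD(2)[OF x0]]) blast
  obtain r where r: "\<And>u v. r (u + v) = r u + r v" "\<And>c u. r (c *s u) = c *s r u"
    "\<And>u. r u \<in> x" "\<And>u. u \<in> x \<Longrightarrow> r u = u" "\<And>u. u \<in> z \<Longrightarrow> r u = 0"
    by (rule ex_projection[OF XD(3)[OF x] zD(1) XD(2)[OF x]]) blast
  have rz: "r u - u \<in> z" for u
  proof -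
    obtain a \<zeta> where u: "a \<in> x" "\<zeta> \<in> z" "u = a + \<zeta>" by (rule X_decomp[OF x])
    then have "r u - u = - \<zeta>" by (simp add: r)
    then show ?thesis using u zD(1) by (simp add: vec.subspace_neg)
  qed
  define B where "B = (\<lambda>u v. bf (r (p u) - p u) (p v))"
  have alt: "bf (r a - a) a = 0" if a: "a \<in> x0" for a
  proof -
    have "Q (a + (r a - a)) = Q a + Q (r a - a) + bf a (r a - a)" by (rule Q_add)
    moreover have "Q (a + (r a - a)) = 0" using isotropicD(2)[OF XD(5)[OF x] r(3)] by simp
    moreover have "Q a = 0" using isotropicD(2)[OF XD(5)[OF x0] a] .
    moreover have "Q (r a - a) = 0" using isotropicD(2)[OF zD(3) rz] .
    ultimately show ?thesis using bf_sym[of a] by simp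
  qed
  have B: "B \<in> altf"
    unfolding altf_def B_def using alt p(3) by (auto simp: p r bf_add bf_diff bf_scale algebra_simps)
  have "gr B \<subseteq> x"
  proof
    fix v assume "v \<in> gr B"
    then obtain a \<zeta> where a: "v = a + \<zeta>" "a \<in> x0" "\<zeta> \<in> z" "\<forall>b\<in>x0. bf \<zeta> b = B a b" unfolding gr_def by blast
    have "\<zeta> - (r a - a) = 0"
    proof (rule pairing_z)
      show "\<zeta> - (r a - a) \<in> z" using a rz zD(1) by (simp add: vec.subspace_diff)
      show "bf (\<zeta> - (r a - a)) b = 0" if "b \<in> x0" for b using a that by (simp add: bf_diff B_def p)
    qed
    then have "v = r a" using a by simp
    then show "v \<in> x" using r(3) by simp
  qed
  then have "gr B = x" by (intro sp_eqI gr_sp B XD(3)[OF x]) (simp_all add: XD(4)[OF x] XD(4)[OF gr_X[OF B]])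
  then show ?thesis using B by blast
qed

text \<open>Half the rank of \<open>D\<close> on \<open>x0\<close>; the division is exact by
  \<open>rad_parity\<close>.\<close>

definition rho :: "('a^'m \<Rightarrow> 'a^'m \<Rightarrow> 'a) \<Rightarrow> nat" where
  "rho D = (n - vec.dim (rad x0 D)) div 2"

lemma dim_rad: assumes "D \<in> altf" shows "vec.dim (rad x0 D) + 2 * rho D = n"
  using rad_parity[OF XD(3)[OF x0] assms] XD(4)[OF x0] unfolding rho_def by auto

lemma gdist_Alt:
  assumes "x \<in> X" "y \<in> X"
  shows "gdist (Alt_adj Q n z) x y = (n - vec.dim (x \<inter> y)) div 2"
proof (rule gdist_eqI[where X = X and D = "\<lambda>x y. (n - vec.dim (x \<inter> y)) div 2"])
  show "x \<in> X \<and> y \<in> X" if "(x, y) \<in> Alt_adj Q n z" for x y using that Alt_adj_iff[OF z] by simp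
  show "(n - vec.dim (x \<inter> y)) div 2 = 0 \<longleftrightarrow> x = y" if xy: "x \<in> X" "y \<in> X" for x y
  proof
    obtain B where B: "B \<in> altf" "gr B = x" using gr_surj[OF xy(1)] by blast
    obtain D where D: "D \<in> altf" "gr D = y" using gr_surj[OF xy(2)] by blast
    have d: "vec.dim (x \<inter> y) + 2 * rho (B - D) = n"
      using dim_gr_Int[OF B(1) D(1)] B D dim_rad[OF altf_diff[OF B(1) D(1)]] by simp
    assume "(n - vec.dim (x \<inter> y)) div 2 = 0"
    then have "n \<le> vec.dim (x \<inter> y)" using d by presburger
    then show "x = y" using eq_vertex XD(1) xy by blast
  qed (use XD(4)[OF xy(1)] in simp)
  show "(n - vec.dim (x \<inter> w)) div 2 \<le> (n - vec.dim (y \<inter> w)) div 2 + 1" if "(x, y) \<in> Alt_adj Q n z" "w \<in> X" for x y w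
  proof -
    have xy: "x \<in> X" "y \<in> X" "vec.dim (x \<inter> y) + 2 = n" using that(1) Alt_adj_iff[OF z] by blast+
    have "vec.dim (x \<inter> y) + vec.dim (y \<inter> w) \<le> vec.dim (x \<inter> w) + n"
      by (rule triangle[OF XD(1)[OF xy(1)] XD(1)[OF xy(2)] XD(1)[OF that(2)]])
    then have "n - vec.dim (x \<inter> w) \<le> (n - vec.dim (y \<inter> w)) + 2" using xy(3) by linarith
    then have "(n - vec.dim (x \<inter> w)) div 2 \<le> ((n - vec.dim (y \<inter> w)) + 2) div 2" by (rule div_le_mono)
    then show ?thesis by simp
  qed
  show "\<exists>y. (x, y) \<in> Alt_adj Q n z \<and> (n - vec.dim (y \<inter> w)) div 2 < (n - vec.dim (x \<inter> w)) div 2"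
    if x: "x \<in> X" and w: "w \<in> X" and nz: "(n - vec.dim (x \<inter> w)) div 2 \<noteq> 0" for x w
  proof -
    note sx0 = XD(3)[OF x0]
    obtain B where B: "B \<in> altf" "gr B = x" using gr_surj[OF x] by blast
    obtain C where C: "C \<in> altf" "gr C = w" using gr_surj[OF w] by blast
    define E where "E = B - C"
    have E: "E \<in> altf" using B C by (simp add: E_def altf_diff)
    have dE: "vec.dim (x \<inter> w) = vec.dim (rad x0 E)" using dim_gr_Int[OF B(1) C(1)] B C by (simp add: E_def)
    have "\<not> eqon x0 E 0"
    proof
      assume "eqon x0 E 0"
      then have "rad x0 E = x0" by (auto simp: rad_def eqon_def)
      then show False using nz dE XD(4)[OF x0] by simp
    qed
    then obtain a b where ab: "a \<in> x0" "b \<in> x0" "E a b \<noteq> 0" by (auto simp: eqon_def)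
    define S where "S = vec.span {a, b}"
    define W where "W = {v \<in> x0. E a v = 0 \<and> E b v = 0}"
    note hs = hyperbolic_split[OF sx0 E ab S_def W_def]
    have ba: "E b a = - E a b" by (rule altf_skew[OF E])
    \<comment> \<open>\<open>F\<close> has rank two and the same contractions with \<open>a\<close>
      and \<open>b\<close> as \<open>E\<close>, so the radical of \<open>E - F\<close> gains
      \<open>a\<close> and \<open>b\<close>. The vertex of \<open>B - F\<close> is therefore a
      neighbour of \<open>x\<close> that is closer to \<open>w\<close>.\<close>
    define F where "F = (\<lambda>u v. (E a u * E b v - E a v * E b u) / E a b)"
    have F: "F \<in> altf" by (simp add: altf_def F_def altf_simps[OF E] algebra_simps add_divide_distrib diff_divide_distrib)
    have Fa: "F a v = E a v" "F b v = E b v" for v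
      using ab(3) by (simp_all add: F_def altf_simps[OF E] ba)
    have EF: "E - F \<in> altf" by (rule altf_diff[OF E F])
    have radF: "rad x0 F = W"
    proof
      show "W \<subseteq> rad x0 F" by (auto simp: W_def rad_def F_def)
      show "rad x0 F \<subseteq> W"
      proof
        fix v assume v: "v \<in> rad x0 F"
        then have "F a v = 0" "F b v = 0" using ab altf_skew[OF F, of a v] altf_skew[OF F, of b v] by (auto simp: rad_def)
        then show "v \<in> W" using v Fa by (simp add: W_def rad_def)
      qed
    qed
    let ?y = "gr (B - F)"
    have BF: "B - F \<in> altf" by (rule altf_diff[OF B(1) F])
    have adj: "(x, ?y) \<in> Alt_adj Q n z"
      using dim_gr_Int[OF B(1) BF] B(2) radF hs(4) XD(4)[OF x0] Alt_adj_iff[OF z] x gr_X[OF BF] by simp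
    have rE: "rad x0 E \<subseteq> rad x0 (E - F)"
    proof
      fix v assume v: "v \<in> rad x0 E"
      then have "E a v = 0" "E b v = 0" using ab altf_skew[OF E, of a v] altf_skew[OF E, of b v] by (auto simp: rad_def)
      then show "v \<in> rad x0 (E - F)" using v by (simp add: rad_def F_def)
    qed
    have Sr: "S \<subseteq> rad x0 (E - F)"
      unfolding S_def by (intro vec.span_minimal sp_rad sx0 EF) (use ab Fa in \<open>auto simp: rad_def\<close>)
    have dis: "S \<inter> rad x0 E = {0}"
    proof -
      have "v = 0" if v: "v \<in> S" "v \<in> rad x0 E" for v
      proof -
        have "S \<subseteq> x0" unfolding S_def using ab sx0 by (intro vec.span_minimal) auto
        then have "\<forall>y\<in>S. E v y = 0" using v(2) by (auto simp: rad_def)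
        then show ?thesis using nonsing_pair[OF E ab(3)] v(1) unfolding nonsing_def S_def by blast
      qed
      moreover have "0 \<in> S" by (simp add: S_def vec.span_zero)
      ultimately show ?thesis using vec.subspace_0[OF sp_rad[OF sx0 E]] by blast
    qed
    have sS: "sp S" by (simp add: S_def)
    have dS: "vec.dim S = 2" using dim_sum_Int[OF sS hs(1)] hs by simp
    have "ssum S (rad x0 E) \<subseteq> rad x0 (E - F)" by (rule ssum_least[OF sp_rad[OF sx0 EF] Sr rE])
    then have "vec.dim (ssum S (rad x0 E)) \<le> vec.dim (rad x0 (E - F))" by (rule vec.dim_subset)
    then have "vec.dim (rad x0 E) + 2 \<le> vec.dim (rad x0 (E - F))"
      using dim_ssum[OF sS sp_rad[OF sx0 E]] dis dS by simp
    moreover have "vec.dim (?y \<inter> w) = vec.dim (rad x0 (E - F))"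
      using dim_gr_Int[OF BF C(1)] C(2) by (simp add: E_def algebra_simps)
    ultimately have "(n - vec.dim (?y \<inter> w)) div 2 < (n - vec.dim (x \<inter> w)) div 2" using dE nz by linarith
    then show ?thesis using adj by blast
  qed
qed (use assms in auto)

lemma gdist_gr:
  assumes "B \<in> altf" "D \<in> altf"
  shows "gdist (Alt_adj Q n z) (gr B) (gr D) = rho (B - D)"
  using gdist_Alt[OF gr_X[OF assms(1)] gr_X[OF assms(2)]] dim_gr_Int[OF assms] by (simp add: rho_def)

lemma rho_le: "rho D \<le> n div 2" by (simp add: rho_def div_le_mono)

lemma ex_rho:
  assumes "k \<le> n div 2"
  shows "\<exists>D\<in>altf. k \<le> rho D"
proof -
  note sx0 = XD(3)[OF x0]
  have "2 * (length ([] :: (('a^'m) \<times> ('a^'m)) list) + k) \<le> vec.dim x0" using assms XD(4)[OF x0] by simp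
  from ind_extend[OF ind_Nil _ this] obtain P where P: "ind P" "sv P \<subseteq> x0" "length P = k" by auto
  obtain D where D: "D \<in> altf" "nonsing (vec.span (sv P)) D" using ind_nonsing[OF P(1), of 0] by blast
  let ?M = "vec.span (sv P)"
  have M: "?M \<subseteq> x0" using P sx0 by (intro vec.span_minimal)
  have "v = 0" if v: "v \<in> ?M" "v \<in> rad x0 D" for v
    using D(2) v M unfolding nonsing_def rad_def by blast
  then have dis: "?M \<inter> rad x0 D = {0}" using vec.span_zero vec.subspace_0[OF sp_rad[OF sx0 D(1)]] by blast
  have "vec.dim (ssum ?M (rad x0 D)) \<le> vec.dim x0" using M rad_subset sx0 by (intro vec.dim_subset ssum_least)
  then have "2 * k + vec.dim (rad x0 D) \<le> n"
    using dim_ssum[OF vec.subspace_span sp_rad[OF sx0 D(1)], of "sv P"] dis P XD(4)[OF x0] by (simp add: ind_def)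
  then show ?thesis using D(1) by (intro bexI[of _ D]) (simp_all add: rho_def)
qed

lemma diam_Alt: "diam X (Alt_adj Q n z) = n div 2"
  unfolding diam_def
proof (rule Max_eqI)
  let ?G = "{gdist (Alt_adj Q n z) x y | x y. x \<in> X \<and> y \<in> X}"
  have le: "g \<le> n div 2" if "g \<in> ?G" for g
  proof -
    obtain x y where "x \<in> X" "y \<in> X" "g = gdist (Alt_adj Q n z) x y" using \<open>g \<in> ?G\<close> by blast
    then show ?thesis using gdist_Alt by (simp add: div_le_mono)
  qed
  then show "g \<le> n div 2" if "g \<in> ?G" for g using that by blast
  have "?G \<subseteq> {..n div 2}" using le by blast
  then show "finite ?G" by (rule finite_subset) simp
  obtain D where D: "D \<in> altf" "n div 2 \<le> rho D" using ex_rho[of "n div 2"] by auto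
  then have "gdist (Alt_adj Q n z) (gr D) (gr 0) = n div 2"
    using gdist_gr[OF D(1) altf_0] rho_le[of D] by simp
  then show "n div 2 \<in> ?G" using gr_X[OF D(1)] gr_X[OF altf_0] by (metis (mono_tags, lifting) mem_Collect_eq)
qed

end

subsection \<open>Character sums of the idempotents\<close>

lemma card_span_independent:
  fixes B :: "('a::{field,finite}^'m::finite) set"
  assumes "finite B" "vec.independent B"
  shows "card (vec.span B) = CARD('a) ^ card B"
  using assms
proof (induction B)
  case empty
  then show ?case by simp
next
  case (insert b B)
  then have b: "b \<notin> vec.span B" and B: "vec.independent B" by (simp_all add: vec.independent_insert)
  have "bij_betw (\<lambda>(c, x). c *s b + x) (UNIV \<times> vec.span B) (vec.span (insert b B))"
    unfolding bij_betw_def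
  proof
    show "inj_on (\<lambda>(c, x). c *s b + x) (UNIV \<times> vec.span B)"
    proof (rule inj_onI, clarify)
      fix c x c' x' assume xs: "x \<in> vec.span B" "x' \<in> vec.span B" and eq: "c *s b + x = c' *s b + x'"
      have "(c - c') *s b = x' - x" using eq by (simp add: vec.scale_left_diff_distrib algebra_simps)
      then have m: "(c - c') *s b \<in> vec.span B" using vec.span_diff[OF xs(2,1)] by simp
      have "c = c'"
      proof (rule ccontr)
        assume "c \<noteq> c'"
        then have "(1 / (c - c')) *s ((c - c') *s b) = b" by (simp only: vec.scale_scale) simp
        then show False using vec.span_scale[OF m, of "1 / (c - c')"] b by simp
      qed
      then show "c = c' \<and> x = x'" using eq by simp
    qed
    show "(\<lambda>(c, x). c *s b + x) ` (UNIV \<times> vec.span B) = vec.span (insert b B)"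
    proof
      show "(\<lambda>(c, x). c *s b + x) ` (UNIV \<times> vec.span B) \<subseteq> vec.span (insert b B)"
        by (auto intro: in_span_insertI)
      show "vec.span (insert b B) \<subseteq> (\<lambda>(c, x). c *s b + x) ` (UNIV \<times> vec.span B)"
      proof
        fix v assume "v \<in> vec.span (insert b B)"
        then obtain c x where "x \<in> vec.span B" "v = c *s b + x" by (rule in_span_insertE)
        then show "v \<in> (\<lambda>(c, x). c *s b + x) ` (UNIV \<times> vec.span B)" by (intro image_eqI[of _ _ "(c, x)"]) auto
      qed
    qed
  qed
  then have "card (vec.span (insert b B)) = CARD('a) * card (vec.span B)"
    by (simp add: bij_betw_same_card[symmetric] card_cartesian_product)
  then show ?case using insert B by simp
qed

lemma card_sp:
  fixes U :: "('a::{field,finite}^'m::finite) set"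
  assumes "sp U"
  shows "card U = CARD('a) ^ vec.dim U"
proof -
  obtain B where B: "B \<subseteq> U" "vec.independent B" "U \<subseteq> vec.span B" "card B = vec.dim U"
    by (rule vec.basis_exists)
  have "vec.span B = U" using B assms by (intro subset_antisym vec.span_minimal) auto
  then show ?thesis using card_span_independent[OF _ B(2)] B(4) by simp
qed

lemma FT_convolution:
  "FT f P * FT g P = FT (\<lambda>C. \<Sum>B\<in>altf. f B * g (C - B)) P"
proof -
  have "FT (\<lambda>C. \<Sum>B\<in>altf. f B * g (C - B)) P = (\<Sum>B\<in>altf. \<Sum>C\<in>altf. f B * (g (C + - B) * addchar (ev C P)))"
    unfolding FT_def by (subst sum.swap) (simp add: sum_distrib_right mult.assoc)
  also have "\<dots> = (\<Sum>B\<in>altf. f B * FT (\<lambda>C. g (C + - B)) P)"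
    by (simp add: FT_def sum_distrib_left)
  also have "\<dots> = (\<Sum>B\<in>altf. f B * (addchar (ev B P) * FT g P))"
  proof (intro sum.cong refl)
    fix B :: "'a^'b \<Rightarrow> 'a^'b \<Rightarrow> 'a" assume B: "B \<in> altf"
    show "f B * FT (\<lambda>C. g (C + - B)) P = f B * (addchar (ev B P) * FT g P)"
      by (simp only: FT_shift[OF altf_uminus[OF B]] ev_uminus minus_minus)
  qed
  finally show ?thesis by (simp add: FT_def sum_distrib_right mult.assoc)
qed

lemma FT_lin:
  "FT (\<lambda>B. f B + g B) P = FT f P + FT g P" "FT (\<lambda>B. c * f B) P = c * FT f P"
  by (simp_all add: FT_def sum.distrib sum_distrib_left algebra_simps)

lemma FT_eq_0_invariant:
  assumes "D \<in> altf" "ev D P = 1" "\<And>c B. B \<in> altf \<Longrightarrow> f (B + (\<lambda>x y. c * D x y)) = f B"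
  shows "FT f P = 0"
proof -
  obtain c :: 'a where c: "addchar c \<noteq> 1" using addchar_nontrivial by blast
  let ?D = "\<lambda>x y. (- c) * D x y"
  have D: "?D \<in> altf" by (rule altf_scale[OF assms(1)])
  have "ev ?D P = (- c) * ev D P" by (induction P rule: sv.induct) (simp_all add: algebra_simps)
  then have "FT (\<lambda>B. f (B + ?D)) P = addchar c * FT f P" using FT_shift[OF D, of f P] assms(2) by simp
  moreover have "FT (\<lambda>B. f (B + ?D)) P = FT f P" unfolding FT_def by (intro sum.cong refl) (simp only: assms(3))
  ultimately have "(addchar c - 1) * FT f P = 0" by (simp add: algebra_simps)
  then show ?thesis using c by simp
qed

text \<open>\<open>card (rad U D) ^ j\<close> counts the \<open>j\<close>-tuples in the radical, and for each tuple the condition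
  of lying in the radical of \<open>D\<close> is invariant under a form that vanishes on it.\<close>

lemma FT_card_rad_power:
  assumes P: "ind P" and j: "j < length P"
  shows "FT (\<lambda>D. of_nat (card (rad U D) ^ j)) P = 0"
proof -
  let ?T = "{t. set t \<subseteq> U \<and> length t = j}"
  let ?g = "\<lambda>t D. if \<forall>s\<in>set t. \<forall>y\<in>U. D s y = 0 then 1 else (0 :: complex)"
  have fT: "finite ?T" by (rule finite_lists_length_eq) simp
  have "of_nat (card (rad U D) ^ j) = (\<Sum>t\<in>?T. ?g t D)" for D :: "'a^'b \<Rightarrow> 'a^'b \<Rightarrow> 'a"
  proof -
    have "?T \<inter> {t. \<forall>s\<in>set t. \<forall>y\<in>U. D s y = 0} = {t. set t \<subseteq> rad U D \<and> length t = j}"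
      by (auto simp: rad_def)
    then have "(\<Sum>t\<in>?T. ?g t D) = of_nat (card {t. set t \<subseteq> rad U D \<and> length t = j})"
      using fT by (simp add: sum.If_cases)
    also have "card {t. set t \<subseteq> rad U D \<and> length t = j} = card (rad U D) ^ j"
      by (rule card_lists_length_eq) simp
    finally show ?thesis by simp
  qed
  then have "FT (\<lambda>D. of_nat (card (rad U D) ^ j)) P = (\<Sum>t\<in>?T. FT (?g t) P)"
    unfolding FT_def by (subst sum.swap) (simp add: sum_distrib_right)
  also have "\<dots> = 0"
  proof (rule sum.neutral, rule ballI)
    fix t assume t: "t \<in> ?T"
    have "vec.dim (vec.span (set t)) \<le> card (set t)" by (simp add: vec.dim_le_card')
    also have "\<dots> < length P" using t j card_length[of t] by simp
    finally obtain D where D: "D \<in> altf" "\<forall>s\<in>vec.span (set t). \<forall>y. D s y = 0" "ev D P = 1"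
      using ex_killing_form[OF P vec.subspace_span] by blast
    have Dt: "D s y = 0" if "s \<in> set t" for s y using D(2) vec.span_base[OF that] by blast
    show "FT (?g t) P = 0"
      by (rule FT_eq_0_invariant[OF D(1,3)]) (simp add: Dt)
  qed
  finally show ?thesis .
qed

lemma sum_product3:
  fixes h :: "'k \<Rightarrow> 'c::semiring_0"
  shows "sum f I * sum g J * sum h K = (\<Sum>i\<in>I. \<Sum>j\<in>J. \<Sum>k\<in>K. f i * g j * h k)"
  unfolding sum_product[of f I g J]
  unfolding sum_distrib_right[where r = "sum h K"]
  unfolding sum_distrib_left ..

lemma smat_nth [simp]: "smat c M $ x $ y = c * M $ x $ y"
  by (simp add: smat_def map_matrix_def)

section \<open>Idempotents as functions of the rank\<close>

context alt_graph
begin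

abbreviation "R \<equiv> Alt_adj Q n z"

lemma rho_cong: "eqon x0 B D \<Longrightarrow> rho B = rho D"
  by (simp add: rho_def rad_def eqon_def cong: conj_cong ball_cong)

lemma rho_uminus: "rho (- D) = rho D"
  by (simp add: rho_def rad_def)

lemma rho_diff_commute: "rho (B - D) = rho (D - B)"
  using rho_uminus[of "B - D"] by simp

lemma rho_eq_0: assumes "D \<in> altf" shows "rho D = 0 \<longleftrightarrow> eqon x0 D 0"
proof
  assume "rho D = 0"
  then have "vec.dim (rad x0 D) = n" using dim_rad[OF assms] by simp
  then have "rad x0 D = x0"
    by (intro sp_eqI sp_rad XD(3)[OF x0] assms rad_subset) (simp add: XD(4)[OF x0])
  then show "eqon x0 D 0" by (auto simp: rad_def eqon_def)
next
  assume "eqon x0 D 0"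
  then have "rad x0 D = x0" by (auto simp: rad_def eqon_def)
  then show "rho D = 0" by (simp add: rho_def XD(4)[OF x0])
qed

lemma sum_X:
  fixes F :: "('a^'m) set \<Rightarrow> complex"
  shows "(\<Sum>B\<in>altf. F (gr B)) = of_nat (fibre x0) * (\<Sum>y\<in>X. F y)"
proof -
  have im: "gr ` altf = X" using gr_X gr_surj by blast
  have "(\<Sum>B\<in>altf. F (gr B)) = (\<Sum>y\<in>gr ` altf. \<Sum>B | B \<in> altf \<and> gr B = y. F (gr B))"
    by (rule sum.image_gen) simp
  also have "\<dots> = (\<Sum>y\<in>X. of_nat (fibre x0) * F y)"
    unfolding im
  proof (intro sum.cong refl)
    fix y assume "y \<in> X"
    then obtain D where D: "D \<in> altf" "gr D = y" using gr_surj by blast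
    have "{B. B \<in> altf \<and> gr B = y} = {B \<in> altf. eqon x0 D B}"
      using gr_eq_iff[OF _ D(1)] D(2) eqon_sym by blast
    then have "card {B. B \<in> altf \<and> gr B = y} = fibre x0" using card_fibre[OF D(1)] by simp
    then show "(\<Sum>B | B \<in> altf \<and> gr B = y. F (gr B)) = of_nat (fibre x0) * F y" by simp
  qed
  finally show ?thesis by (simp add: sum_distrib_left)
qed

definition has_coeffs :: "complex^(('a^'m) set)^(('a^'m) set) \<Rightarrow> (nat \<Rightarrow> complex) \<Rightarrow> bool" where
  "has_coeffs M c \<longleftrightarrow> (\<forall>x y. M $ x $ y = (if x \<in> X \<and> y \<in> X then c (gdist R x y) else 0))"

lemma has_coeffs_sum:
  "has_coeffs (\<Sum>i\<le>diam X R. smat (c i) (dist_matrix X R i)) c"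
proof -
  have "gdist R x y \<le> diam X R" if "x \<in> X" "y \<in> X" for x y
    using gdist_Alt[OF that] by (simp add: diam_Alt div_le_mono)
  then show ?thesis by (auto simp: has_coeffs_def dist_matrix_def sum.delta' if_distrib cong: if_cong)
qed

lemma bose_mesner_coeffs: "M \<in> bose_mesner X R \<Longrightarrow> \<exists>c. has_coeffs M c"
  unfolding bose_mesner_def using has_coeffs_sum by blast

lemma coeffs_gr:
  assumes "has_coeffs M c" "B \<in> altf" "D \<in> altf"
  shows "M $ gr B $ gr D = c (rho (B - D))"
  using assms gr_X gdist_gr by (simp add: has_coeffs_def)

text \<open>The matrix product is convolution on forms, in which every vertex occurs
  \<open>fibre x0\<close> times; hence the character sums of an idempotent are 0 or
  \<open>fibre x0\<close>.\<close>

lemma idempotent_FT: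
  assumes c: "has_coeffs M c" and M: "M ** M = M"
  shows "FT (c \<circ> rho) P * FT (c \<circ> rho) P = of_nat (fibre x0) * FT (c \<circ> rho) P"
proof -
  have "(\<Sum>B\<in>altf. c (rho B) * c (rho (C - B))) = of_nat (fibre x0) * c (rho C)" if C: "C \<in> altf" for C
  proof -
    have "(\<Sum>B\<in>altf. c (rho B) * c (rho (C - B))) = (\<Sum>B\<in>altf. M $ gr C $ gr B * M $ gr B $ gr 0)"
      by (intro sum.cong refl) (simp add: coeffs_gr[OF c] C altf_0)
    also have "\<dots> = of_nat (fibre x0) * (\<Sum>y\<in>X. M $ gr C $ y * M $ y $ gr 0)" by (rule sum_X)
    also have "(\<Sum>y\<in>X. M $ gr C $ y * M $ y $ gr 0) = (\<Sum>y\<in>UNIV. M $ gr C $ y * M $ y $ gr 0)"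
      by (rule sum.mono_neutral_left) (use c in \<open>auto simp: has_coeffs_def\<close>)
    also have "\<dots> = (M ** M) $ gr C $ gr 0" by (simp add: matrix_matrix_mult_def)
    also have "\<dots> = c (rho C)" using coeffs_gr[OF c C altf_0] by (simp add: M)
    finally show ?thesis .
  qed
  then show ?thesis unfolding FT_convolution comp_def
    by (simp add: FT_def sum_distrib_left mult.assoc)
qed

text \<open>Expanding the quadratic form of \<open>Y\<close> in characters gives, up to a positive
  factor, the sum of the squared moduli of the coefficients of \<open>f\<close> weighted by the
  character sums of \<open>M\<close>. The weights are nonnegative by \<open>idempotent_FT\<close>,
  so every term of the zero sum vanishes.\<close>

lemma idempotent_FT_vanish:
  assumes c: "has_coeffs M c" and M: "M ** M = M" and Y: "Y \<subseteq> X"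
    and zero: "scalar_product (charvec Y) (M *v charvec Y) = 0"
    and f_def: "f = (\<lambda>B. if gr B \<in> Y then 1 else 0)"
    and P: "sv P \<subseteq> x0" "FT (c \<circ> rho) P \<noteq> 0"
  shows "FT f P = 0"
proof -
  let ?N = "of_nat (fibre x0) :: complex"
  let ?b = "of_nat (card (bivs x0)) :: complex"
  define F where "F = (\<lambda>g (\<phi> :: ('a^'m \<Rightarrow> 'a^'m \<Rightarrow> 'a) \<Rightarrow> 'a). \<Sum>B\<in>altf. g B * addchar (\<phi> B))"
  have FFT: "\<exists>P. sv P \<subseteq> x0 \<and> (\<forall>B\<in>altf. \<phi> B = ev B P)" if "\<phi> \<in> bivs x0" for \<phi>
    using that unfolding bivs_def by auto
  have FFT': "F g \<phi> = FT g P" if "\<forall>B\<in>altf. \<phi> B = ev B P" for g \<phi> P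
    using that by (simp add: F_def FT_def)
  have quad: "(\<Sum>B\<in>altf. \<Sum>D\<in>altf. f B * c (rho (B - D)) * f D) = 0"
  proof -
    have "(\<Sum>B\<in>altf. \<Sum>D\<in>altf. f B * c (rho (B - D)) * f D) =
        (\<Sum>B\<in>altf. \<Sum>D\<in>altf. charvec Y $ gr B * (M $ gr B $ gr D * charvec Y $ gr D))"
      by (intro sum.cong refl) (simp add: coeffs_gr[OF c] f_def charvec_def)
    also have "\<dots> = (\<Sum>B\<in>altf. ?N * (\<Sum>y\<in>X. charvec Y $ gr B * (M $ gr B $ y * charvec Y $ y)))"
      by (intro sum.cong refl sum_X)
    also have "\<dots> = ?N * (\<Sum>x\<in>X. ?N * (\<Sum>y\<in>X. charvec Y $ x * (M $ x $ y * charvec Y $ y)))"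
      by (rule sum_X)
    also have "(\<Sum>x\<in>X. ?N * (\<Sum>y\<in>X. charvec Y $ x * (M $ x $ y * charvec Y $ y))) =
        ?N * (\<Sum>x\<in>X. charvec Y $ x * (\<Sum>y\<in>X. M $ x $ y * charvec Y $ y))"
      by (simp add: sum_distrib_left)
    also have "(\<Sum>x\<in>X. charvec Y $ x * (\<Sum>y\<in>X. M $ x $ y * charvec Y $ y)) =
        (\<Sum>x\<in>UNIV. charvec Y $ x * (\<Sum>y\<in>UNIV. M $ x $ y * charvec Y $ y))"
    proof (rule sum.mono_neutral_cong_left)
      show "charvec Y $ x * (\<Sum>y\<in>X. M $ x $ y * charvec Y $ y) = charvec Y $ x * (\<Sum>y\<in>UNIV. M $ x $ y * charvec Y $ y)" for x
        by (intro arg_cong2[where f = "(*)"] refl sum.mono_neutral_left) (use Y in \<open>auto simp: charvec_def\<close>)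
    qed (use Y in \<open>auto simp: charvec_def\<close>)
    also have "\<dots> = 0" using zero by (simp add: scalar_product_def matrix_vector_mult_def)
    finally show ?thesis by (simp only: mult_zero_right)
  qed
  have "(\<Sum>\<phi>\<in>bivs x0. F f \<phi> * F (c \<circ> rho) \<phi> * cnj (F f \<phi>)) =
      (\<Sum>\<phi>\<in>bivs x0. \<Sum>B\<in>altf. \<Sum>D\<in>altf. \<Sum>C\<in>altf. f B * f D * c (rho C) * addchar (\<phi> (B + C - D)))"
  proof (intro sum.cong refl)
    fix \<phi> assume "\<phi> \<in> bivs x0"
    then obtain P where P: "\<forall>B\<in>altf. \<phi> B = ev B P" using FFT by blast
    have cf: "cnj (f D) = f D" for D by (simp add: f_def)
    have "F f \<phi> * F (c \<circ> rho) \<phi> * cnj (F f \<phi>) =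
      (\<Sum>B\<in>altf. f B * addchar (\<phi> B)) * (\<Sum>D\<in>altf. f D * addchar (- \<phi> D)) * (\<Sum>C\<in>altf. c (rho C) * addchar (\<phi> C))"
      by (simp add: F_def addchar_minus cf mult_ac)
    also have "\<dots> = (\<Sum>B\<in>altf. \<Sum>D\<in>altf. \<Sum>C\<in>altf. (f B * addchar (\<phi> B)) * (f D * addchar (- \<phi> D)) * (c (rho C) * addchar (\<phi> C)))"
      by (rule sum_product3)
    also have "\<dots> = (\<Sum>B\<in>altf. \<Sum>D\<in>altf. \<Sum>C\<in>altf. f B * f D * c (rho C) * addchar (\<phi> (B + C - D)))"
    proof (intro sum.cong refl)
      fix B D C :: "'a^'m \<Rightarrow> 'a^'m \<Rightarrow> 'a" assume m: "B \<in> altf" "D \<in> altf" "C \<in> altf"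
      have m': "B + C - D \<in> altf" using m by (simp add: altf_add altf_diff)
      have "\<phi> (B + C - D) = \<phi> B + \<phi> C + - \<phi> D"
        using P m m' by (simp add: ev_add ev_diff)
      then have "addchar (\<phi> (B + C - D)) = addchar (\<phi> B) * addchar (\<phi> C) * addchar (- \<phi> D)" by (simp only: addchar_add)
      then show "(f B * addchar (\<phi> B)) * (f D * addchar (- \<phi> D)) * (c (rho C) * addchar (\<phi> C)) =
          f B * f D * c (rho C) * addchar (\<phi> (B + C - D))" by (simp only: mult_ac)
    qed
    finally show "F f \<phi> * F (c \<circ> rho) \<phi> * cnj (F f \<phi>) =
        (\<Sum>B\<in>altf. \<Sum>D\<in>altf. \<Sum>C\<in>altf. f B * f D * c (rho C) * addchar (\<phi> (B + C - D)))" .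
  qed
  also have "\<dots> = (\<Sum>B\<in>altf. \<Sum>D\<in>altf. \<Sum>C\<in>altf. \<Sum>\<phi>\<in>bivs x0. f B * f D * c (rho C) * addchar (\<phi> (B + C - D)))"
    by (subst sum.swap, intro sum.cong refl, subst sum.swap, intro sum.cong refl, rule sum.swap)
  also have "\<dots> = (\<Sum>B\<in>altf. \<Sum>D\<in>altf. (?N * ?b) * (f B * c (rho (B - D)) * f D))"
  proof (intro sum.cong refl)
    fix B D :: "'a^'m \<Rightarrow> 'a^'m \<Rightarrow> 'a" assume m: "B \<in> altf" "D \<in> altf"
    have "(\<Sum>C\<in>altf. \<Sum>\<phi>\<in>bivs x0. f B * f D * c (rho C) * addchar (\<phi> (B + C - D))) =
        (\<Sum>C\<in>altf. if eqon x0 (D - B) C then f B * f D * c (rho (B - D)) * ?b else 0)"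
    proof (intro sum.cong refl)
      fix C :: "'a^'m \<Rightarrow> 'a^'m \<Rightarrow> 'a" assume C: "C \<in> altf"
      have BCD: "B + C - D \<in> altf" using m C by (simp add: altf_add altf_diff)
      \<comment> \<open>Orthogonality of the characters forces \<open>C = D - B\<close> on
        \<open>x0\<close>, which turns the triple sum back into the quadratic form.\<close>
      have e: "eqon x0 (B + C - D) 0 \<longleftrightarrow> eqon x0 (D - B) C" by (auto simp: eqon_def algebra_simps)
      have "(\<Sum>\<phi>\<in>bivs x0. f B * f D * c (rho C) * addchar (\<phi> (B + C - D))) =
          f B * f D * c (rho C) * (if eqon x0 (D - B) C then ?b else 0)"
        by (simp only: sum_distrib_left[symmetric] sum_bivs[OF BCD XD(3)[OF x0]] e)
      also have "\<dots> = (if eqon x0 (D - B) C then f B * f D * c (rho (B - D)) * ?b else 0)"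
        using rho_cong[of "D - B" C] rho_diff_commute[of B D] by auto
      finally show "(\<Sum>\<phi>\<in>bivs x0. f B * f D * c (rho C) * addchar (\<phi> (B + C - D))) =
          (if eqon x0 (D - B) C then f B * f D * c (rho (B - D)) * ?b else 0)" .
    qed
    also have "\<dots> = of_nat (card {C \<in> altf. eqon x0 (D - B) C}) * (f B * f D * c (rho (B - D)) * ?b)"
      by (simp add: sum.If_cases Int_def)
    also have "\<dots> = (?N * ?b) * (f B * c (rho (B - D)) * f D)"
      by (simp only: card_fibre[OF altf_diff[OF m(2,1)]] mult_ac)
    finally show "(\<Sum>C\<in>altf. \<Sum>\<phi>\<in>bivs x0. f B * f D * c (rho C) * addchar (\<phi> (B + C - D))) =
      (?N * ?b) * (f B * c (rho (B - D)) * f D)" .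
  qed
  also have "\<dots> = (?N * ?b) * (\<Sum>B\<in>altf. \<Sum>D\<in>altf. f B * c (rho (B - D)) * f D)"
    by (simp only: sum_distrib_left)
  finally have sum0: "(\<Sum>\<phi>\<in>bivs x0. F f \<phi> * F (c \<circ> rho) \<phi> * cnj (F f \<phi>)) = 0" using quad by simp
  define G where "G = (\<lambda>\<phi>. if F (c \<circ> rho) \<phi> = 0 then 0 else real (fibre x0) * (cmod (F f \<phi>))\<^sup>2)"
  have G: "F f \<phi> * F (c \<circ> rho) \<phi> * cnj (F f \<phi>) = complex_of_real (G \<phi>)" if \<phi>: "\<phi> \<in> bivs x0" for \<phi>
  proof -
    obtain P where P: "\<forall>B\<in>altf. \<phi> B = ev B P" using FFT[OF \<phi>] by blast
    have "F (c \<circ> rho) \<phi> = 0 \<or> F (c \<circ> rho) \<phi> = ?N"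
      using idempotent_FT[OF c M, of P] FFT'[OF P, of "c \<circ> rho"] by auto
    then show ?thesis
      using complex_norm_square[of "F f \<phi>"] by (auto simp: G_def mult_ac)
  qed
  have "complex_of_real (\<Sum>\<phi>\<in>bivs x0. G \<phi>) = 0" using sum0 by (simp add: G)
  then have "(\<Sum>\<phi>\<in>bivs x0. G \<phi>) = 0" by (simp only: of_real_eq_0_iff)
  moreover have "G \<phi> \<ge> 0" for \<phi> by (simp add: G_def)
  ultimately have G0: "G \<phi> = 0" if "\<phi> \<in> bivs x0" for \<phi> using sum_nonneg_eq_0_iff[of "bivs x0" G] that by simp
  let ?\<phi> = "\<lambda>B. if B \<in> altf then ev B P else 0"
  have "?\<phi> \<in> bivs x0" using P(1) unfolding bivs_def by blast
  then have "G ?\<phi> = 0" by (rule G0)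
  moreover have "F g ?\<phi> = FT g P" for g by (rule FFT') simp
  ultimately show ?thesis using P(2) fibre_nz[of x0] by (simp add: G_def)
qed

lemma idempotent_coeffs:
  assumes E: "idempotent_ordering X R E" and i: "i \<le> diam X R"
  shows "\<exists>c. has_coeffs (E i) c" "E i ** E i = E i"
proof -
  have "E i \<in> {e. primitive_idempotent (bose_mesner X R) e}"
    using E i unfolding idempotent_ordering_def bij_betw_def by (metis atLeastAtMost_iff imageI le0)
  then show "\<exists>c. has_coeffs (E i) c" "E i ** E i = E i"
    using bose_mesner_coeffs by (auto simp: primitive_idempotent_def)
qed

text \<open>The size of the radical on \<open>x0\<close> of a form of rank
  \<open>2 * r\<close>.\<close>

definition radnum :: "nat \<Rightarrow> complex" where
  "radnum r = of_nat (CARD('a) ^ (n - 2 * r))"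

lemma card_a: "2 \<le> CARD('a)"
  using card_mono[of UNIV "{0, 1 :: 'a}"] by simp

lemma radnum_rho: "D \<in> altf \<Longrightarrow> radnum (rho D) = of_nat (card (rad x0 D))"
  using card_sp[OF sp_rad[OF XD(3)[OF x0]], of D] dim_rad[of D]
  by (simp add: radnum_def) (metis add_diff_cancel_right')

lemma radnum_inj:
  assumes "1 \<le> r" "r \<le> n div 2"
  shows "radnum 0 \<noteq> radnum r"
proof -
  have "CARD('a) ^ (n - 2 * r) < CARD('a) ^ n"
    using assms card_a by (intro power_strict_increasing) auto
  then show ?thesis unfolding radnum_def of_nat_eq_iff by simp
qed

text \<open>With \<open>q\<close> the square of the field size,
  \<open>q ^ k = (q - 1) * qint q k + 1\<close>; the factor \<open>CARD('a) ^ (n mod 2)\<close> is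
  the size of the radical at maximal rank.\<close>

lemma radnum_affine:
  assumes "r \<le> n div 2"
  shows "radnum r = of_nat (CARD('a) ^ (n mod 2)) *
    ((of_nat (CARD('a)\<^sup>2) - 1) * qint (of_nat (CARD('a)\<^sup>2)) (n div 2 - r) + 1)"
proof -
  have e: "n - 2 * r = n mod 2 + 2 * (n div 2 - r)" using assms by presburger
  have "radnum r = of_nat (CARD('a) ^ (n mod 2)) * of_nat (CARD('a)\<^sup>2) ^ (n div 2 - r)"
    unfolding radnum_def e power_add power_mult by simp
  moreover have "of_nat (CARD('a)\<^sup>2) ^ (n div 2 - r) =
      (of_nat (CARD('a)\<^sup>2) - 1) * qint (of_nat (CARD('a)\<^sup>2)) (n div 2 - r) + 1"
    unfolding qint_def power_diff_1_eq[symmetric] by simp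
  ultimately show ?thesis by (simp only:)
qed

text \<open>The three-term recurrence of the \<open>Q\<close>-polynomial structure, rewritten with the size of the
  radical, on which the dual eigenvalues depend affinely.\<close>

lemma recurrence:
  assumes E: "standard_Q_polynomial X R (of_nat (CARD('a)\<^sup>2)) E"
  obtains k :: "nat \<Rightarrow> nat \<Rightarrow> complex" and \<beta> \<alpha> \<gamma> \<kappa> where
    "\<And>i. i \<le> n div 2 \<Longrightarrow> has_coeffs (E i) (k i)"
    "\<kappa> \<noteq> 0" "\<And>D. D \<in> altf \<Longrightarrow> k 0 (rho D) = \<kappa>"
    "\<And>i. i < n div 2 \<Longrightarrow> \<gamma> i \<noteq> 0"
    "\<And>i D. i \<le> n div 2 \<Longrightarrow> D \<in> altf \<Longrightarrow> radnum (rho D) * k i (rho D) =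
      \<beta> i * k (i - 1) (rho D) + \<alpha> i * k i (rho D) + \<gamma> i * k (min (i + 1) (n div 2)) (rho D)"
proof -
  let ?d = "n div 2"
  let ?N = "of_nat (card X) :: complex"
  let ?q = "of_nat (CARD('a)\<^sup>2) :: complex"
  have N: "?N \<noteq> 0" using x0 by (auto simp: card_eq_0_iff)
  note dd = diam_Alt
  have Q: "Q_polynomial X R E" using E by (simp add: standard_Q_polynomial_def)
  then have io: "idempotent_ordering X R E" by (simp add: Q_polynomial_def)
  from Q obtain a b c where bc: "\<forall>i\<in>{1..?d}. b (i - 1) * c i \<noteq> 0"
    and rec: "\<forall>i\<le>?d. E 1 * E i = smat (1 / ?N)
      ((if i = 0 then 0 else smat (b (i - 1)) (E (i - 1))) + smat (a i) (E i) +
       (if i = ?d then 0 else smat (c (i + 1)) (E (i + 1))))"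
    unfolding Q_polynomial_def dd by blast
  from E obtain \<theta> \<xi> \<zeta> where th: "smat ?N (E 1) = (\<Sum>i\<le>diam X R. smat (\<theta> i) (dist_matrix X R i))"
    "\<xi> \<noteq> 0" "\<forall>i\<le>?d. \<theta> i = \<xi> * qint ?q (?d - i) + \<zeta>"
    unfolding standard_Q_polynomial_def dd by blast
  have "\<forall>i. \<exists>c. i \<le> ?d \<longrightarrow> has_coeffs (E i) c" using idempotent_coeffs(1)[OF io] dd by metis
  then obtain k where k: "\<And>i. i \<le> ?d \<Longrightarrow> has_coeffs (E i) (k i)" by metis
  have entry: "E i $ gr D $ gr 0 = k i (rho D)" if "i \<le> ?d" "D \<in> altf" for i D
    using coeffs_gr[OF k[OF that(1)] that(2) altf_0] by simp
  have k0: "k 0 (rho D) = 1 / ?N" if D: "D \<in> altf" for D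
  proof -
    have "E 0 = smat (1 / ?N) (all_ones X)" using io by (simp add: idempotent_ordering_def)
    then have "E 0 $ gr D $ gr 0 = 1 / ?N" using gr_X[OF D] gr_X[OF altf_0] by (simp add: all_ones_def)
    then show ?thesis using entry[of 0 D] D by simp
  qed
  have d1: "1 \<le> ?d" using n2 by simp
  have k1: "?N * k 1 (rho D) = \<theta> (rho D)" if D: "D \<in> altf" for D
  proof -
    have "has_coeffs (smat ?N (E 1)) \<theta>" unfolding th(1) by (rule has_coeffs_sum)
    then have "smat ?N (E 1) $ gr D $ gr 0 = \<theta> (rho (D - 0))" by (rule coeffs_gr[OF _ D altf_0])
    then show ?thesis using entry[OF d1 D] by simp
  qed
  define L where "L = (of_nat (CARD('a) ^ (n mod 2)) :: complex)"
  define K where "K = L * (?q - 1) / \<xi>"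
  define K' where "K' = L - K * \<zeta>"
  have "(CARD('a))\<^sup>2 \<noteq> 1" using card_a by simp
  then have "?q \<noteq> 1" by (metis of_nat_1 of_nat_eq_iff)
  then have K: "K \<noteq> 0" using th(2) by (simp add: K_def L_def)
  have aff: "radnum (rho D) = K * \<theta> (rho D) + K'" for D
  proof -
    let ?x = "qint ?q (?d - rho D)"
    have "radnum (rho D) = L * ((?q - 1) * ?x + 1)" unfolding L_def by (rule radnum_affine[OF rho_le])
    also have "\<dots> = (L * (?q - 1)) * ?x + L" by (simp only: distrib_left mult.assoc mult_1_right)
    also have "L * (?q - 1) = K * \<xi>" using th(2) by (simp only: K_def) simp
    also have "K * \<xi> * ?x + L = K * (\<xi> * ?x + \<zeta>) + K'" unfolding K'_def by (simp add: algebra_simps)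
    also have "\<xi> * ?x + \<zeta> = \<theta> (rho D)" using th(3) rho_le[of D] by simp
    finally show ?thesis .
  qed
  \<comment> \<open>\<open>\<beta> 0\<close> and \<open>\<gamma> ?d\<close> are 0, so the indices
    \<open>i - 1\<close> at \<open>i = 0\<close> and \<open>min (i + 1) ?d\<close> at
    \<open>i = ?d\<close> only have to stay in the range.\<close>
  define \<beta> where "\<beta> = (\<lambda>i. if i = 0 then 0 else K * b (i - 1))"
  define \<alpha> where "\<alpha> = (\<lambda>i. K * a i + K')"
  define \<gamma> where "\<gamma> = (\<lambda>i. if i = ?d then 0 else K * c (i + 1))"
  have "radnum (rho D) * k i (rho D) =
      \<beta> i * k (i - 1) (rho D) + \<alpha> i * k i (rho D) + \<gamma> i * k (min (i + 1) ?d) (rho D)"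
    if i: "i \<le> ?d" and D: "D \<in> altf" for i D
  proof -
    define T where "T = (if i = 0 then 0 else b (i - 1) * k (i - 1) (rho D)) +
      a i * k i (rho D) + (if i = ?d then 0 else c (i + 1) * k (i + 1) (rho D))"
    have "(E 1 * E i) $ gr D $ gr 0 = k 1 (rho D) * k i (rho D)"
      by (simp only: vector_mult_component entry[OF d1 D] entry[OF i D])
    moreover have "(E 1 * E i) $ gr D $ gr 0 = 1 / ?N * T"
      using i D entry[of "i - 1" D] entry[of "i + 1" D] entry[of i D] unfolding T_def
      by (subst rec[rule_format, OF i]) auto
    ultimately have "k 1 (rho D) * k i (rho D) = 1 / ?N * T" by (simp only:)
    then have "?N * k 1 (rho D) * k i (rho D) = ?N * (1 / ?N * T)" by (simp only: mult.assoc)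
    also have "\<dots> = T" using N by simp
    finally have t: "\<theta> (rho D) * k i (rho D) = T" by (simp only: k1[OF D])
    have "radnum (rho D) * k i (rho D) = K * (\<theta> (rho D) * k i (rho D)) + K' * k i (rho D)"
      by (simp add: aff algebra_simps)
    moreover have "(if i = ?d then 0 else c (i + 1) * k (i + 1) (rho D)) =
        (if i = ?d then 0 else c (i + 1)) * k (min (i + 1) ?d) (rho D)" using i by (auto simp: min_def)
    ultimately show ?thesis unfolding t T_def by (simp add: \<alpha>_def \<beta>_def \<gamma>_def algebra_simps)
  qed
  moreover have "\<gamma> i \<noteq> 0" if "i < ?d" for i
    using bc[rule_format, of "i + 1"] that K by (auto simp: \<gamma>_def)
  moreover have "1 / ?N \<noteq> 0" using N by simp
  ultimately show ?thesis using that[OF k _ k0] by blast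
qed

text \<open>Idempotents with index below \<open>length P\<close> have coefficient 0 by degree, so it
  remains to see that not all coefficients at \<open>P\<close> vanish. If they did, the recurrence
  would extend this to all products of some \<open>k i\<close> with a polynomial in
  \<open>radnum\<close>. But \<open>k 0\<close> times the product of
  \<open>radnum - radnum r\<close> over \<open>r \<ge> 1\<close> lives on the forms vanishing on
  \<open>x0\<close>, where the character is 1, and its sum is nonzero.\<close>

lemma standard_FT:
  assumes E: "standard_Q_polynomial X R (of_nat (CARD('a)\<^sup>2)) E" and P: "ind P" "sv P \<subseteq> x0"
  shows "\<exists>i\<le>n div 2. length P \<le> i \<and> (\<exists>c. has_coeffs (E i) c \<and> FT (c \<circ> rho) P \<noteq> 0)"
proof -
  let ?d = "n div 2"
  obtain k \<beta> \<alpha> \<gamma> \<kappa> where k: "\<And>i. i \<le> ?d \<Longrightarrow> has_coeffs (E i) (k i)"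
    and \<kappa>: "\<kappa> \<noteq> 0" "\<And>D. D \<in> altf \<Longrightarrow> k 0 (rho D) = \<kappa>" and \<gamma>: "\<And>i. i < ?d \<Longrightarrow> \<gamma> i \<noteq> 0"
    and rec: "\<And>i D. i \<le> ?d \<Longrightarrow> D \<in> altf \<Longrightarrow> radnum (rho D) * k i (rho D) =
      \<beta> i * k (i - 1) (rho D) + \<alpha> i * k i (rho D) + \<gamma> i * k (min (i + 1) ?d) (rho D)"
    by (rule recurrence[OF E]) blast
  have cong: "FT f P = FT g P" if "\<And>D. D \<in> altf \<Longrightarrow> f D = g D" for f g
    using that by (simp add: FT_def)
  \<comment> \<open>The weight \<open>i + j\<close> bounds the degree in \<open>radnum\<close>: the
    recurrence trades one step in \<open>i\<close> for one factor \<open>radnum\<close>.\<close>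
  have low: "FT (\<lambda>D. k i (rho D) * radnum (rho D) ^ j) P = 0" if "i \<le> ?d" "i + j < length P" for i j
    using that
  proof (induction i arbitrary: j rule: less_induct)
    case (less i)
    show ?case
    proof (cases i)
      case 0
      have "FT (\<lambda>D. k i (rho D) * radnum (rho D) ^ j) P = FT (\<lambda>D. \<kappa> * of_nat (card (rad x0 D) ^ j)) P"
        by (rule cong) (simp add: 0 \<kappa> radnum_rho)
      then show ?thesis using FT_card_rad_power[OF P(1), of j x0] less(3) by (simp add: FT_lin)
    next
      case (Suc i')
      have i': "i' < ?d" "min (i' + 1) ?d = i" using less(2) Suc by auto
      let ?F = "\<lambda>i j D. k i (rho D) * radnum (rho D) ^ j"
      have "FT (?F i j) P = FT (\<lambda>D. (1 / \<gamma> i') * (?F i' (j + 1) D + ((- \<alpha> i') * ?F i' j D + (- \<beta> i') * ?F (i' - 1) j D))) P"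
      proof (rule cong)
        fix D :: "'a^'m \<Rightarrow> 'a^'m \<Rightarrow> 'a" assume D: "D \<in> altf"
        have r: "\<gamma> i' * k i (rho D) = radnum (rho D) * k i' (rho D) - \<alpha> i' * k i' (rho D) - \<beta> i' * k (i' - 1) (rho D)"
          using rec[OF _ D, of i'] i' by simp
        have "\<gamma> i' * ?F i j D = (\<gamma> i' * k i (rho D)) * radnum (rho D) ^ j" by simp
        also have "\<dots> = ?F i' (j + 1) D + ((- \<alpha> i') * ?F i' j D + (- \<beta> i') * ?F (i' - 1) j D)"
          unfolding r by (simp add: algebra_simps)
        finally show "?F i j D = (1 / \<gamma> i') * (?F i' (j + 1) D + ((- \<alpha> i') * ?F i' j D + (- \<beta> i') * ?F (i' - 1) j D))"
          using \<gamma>[OF i'(1)] by (simp add: nonzero_eq_divide_eq mult.commute)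
      qed
      also have "\<dots> = (1 / \<gamma> i') * (FT (?F i' (j + 1)) P + ((- \<alpha> i') * FT (?F i' j) P + (- \<beta> i') * FT (?F (i' - 1) j) P))"
        by (simp only: FT_lin)
      also have "\<dots> = 0"
      proof -
        have "FT (?F i' (j + 1)) P = 0" "FT (?F i' j) P = 0" "FT (?F (i' - 1) j) P = 0"
          by (rule less.IH; use less.prems Suc in simp)+
        then show ?thesis by (simp only: mult_zero_right add_0_right)
      qed
      finally show ?thesis .
    qed
  qed
  have "\<exists>i\<le>?d. FT (k i \<circ> rho) P \<noteq> 0"
  proof (rule ccontr)
    assume "\<not> ?thesis"
    then have z: "FT (\<lambda>D. k i (rho D) * 1) P = 0" if "i \<le> ?d" for i using that by (auto simp: comp_def)
    let ?g = "\<lambda>S D. \<Prod>r\<in>S. (radnum (rho D) - radnum r)"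
    have prod: "\<forall>i\<le>?d. FT (\<lambda>D. k i (rho D) * ?g S D) P = 0" if "finite S" for S
      using that
    proof induction
      case empty
      then show ?case using z by simp
    next
      case (insert r S)
      show ?case
      proof (intro allI impI)
        fix i assume i: "i \<le> ?d"
        let ?F = "\<lambda>i D. k i (rho D) * ?g S D"
        let ?h = "min (i + 1) ?d"
        have "FT (\<lambda>D. k i (rho D) * ?g (insert r S) D) P =
            FT (\<lambda>D. \<beta> i * ?F (i - 1) D + ((\<alpha> i - radnum r) * ?F i D + \<gamma> i * ?F ?h D)) P"
        proof (rule cong)
          fix D :: "'a^'m \<Rightarrow> 'a^'m \<Rightarrow> 'a" assume D: "D \<in> altf"
          have "k i (rho D) * ?g (insert r S) D = (radnum (rho D) * k i (rho D) - radnum r * k i (rho D)) * ?g S D"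
            using insert by (simp add: algebra_simps)
          then show "k i (rho D) * ?g (insert r S) D =
              \<beta> i * ?F (i - 1) D + ((\<alpha> i - radnum r) * ?F i D + \<gamma> i * ?F ?h D)"
            unfolding rec[OF i D] by (simp add: algebra_simps)
        qed
        also have "\<dots> = \<beta> i * FT (?F (i - 1)) P + ((\<alpha> i - radnum r) * FT (?F i) P + \<gamma> i * FT (?F ?h) P)"
          by (simp only: FT_lin)
        also have "\<dots> = 0" using insert.IH i by simp
        finally show "FT (\<lambda>D. k i (rho D) * ?g (insert r S) D) P = 0" .
      qed
    qed
    let ?G = "?g {1..?d}"
    let ?c = "\<kappa> * (\<Prod>r\<in>{1..?d}. (radnum 0 - radnum r))"
    have "FT (\<lambda>D. k 0 (rho D) * ?G D) P = (\<Sum>D\<in>altf. if eqon x0 0 D then ?c else 0)"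
      unfolding FT_def
    proof (intro sum.cong refl)
      fix D :: "'a^'m \<Rightarrow> 'a^'m \<Rightarrow> 'a" assume D: "D \<in> altf"
      show "k 0 (rho D) * ?G D * addchar (ev D P) = (if eqon x0 0 D then ?c else 0)"
      proof (cases "eqon x0 0 D")
        case True
        then have "rho D = 0" using rho_eq_0[OF D] eqon_sym by blast
        moreover have "ev D P = 0" using ev_cong[OF True P(2)] by simp
        ultimately show ?thesis using True \<kappa>(2)[OF D] by simp
      next
        case False
        then have "rho D \<noteq> 0" using rho_eq_0[OF D] eqon_sym by blast
        then have "rho D \<in> {1..?d}" using rho_le[of D] by simp
        then have "?G D = 0" by (intro prod_zero) auto
        then show ?thesis using False by simp
      qed
    qed
    also have "\<dots> = of_nat (fibre x0) * ?c"
      using card_fibre[OF altf_0, of x0] by (simp add: sum.If_cases Int_def)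
    finally have "of_nat (fibre x0) * ?c = 0" using prod[of "{1..?d}"] by simp
    then show False using fibre_nz[of x0] \<kappa>(1) radnum_inj by (auto simp: prod_zero_iff)
  qed
  then obtain i where i: "i \<le> ?d" "FT (k i \<circ> rho) P \<noteq> 0" by blast
  moreover have "length P \<le> i"
  proof (rule ccontr)
    assume "\<not> length P \<le> i"
    then show False using low[of i 0] i by (simp add: comp_def)
  qed
  ultimately show ?thesis using k by blast
qed

lemma dual_width_FT:
  assumes E: "standard_Q_polynomial X R (of_nat (CARD('a)\<^sup>2)) E" and Y: "Y \<subseteq> X"
    and f_def: "f = (\<lambda>B. if gr B \<in> Y then 1 else 0)"
    and P: "ind P" "sv P \<subseteq> x0" "dual_width X R E Y < length P"
  shows "FT f P = 0"
proof -
  obtain i c where i: "i \<le> n div 2" "length P \<le> i" "has_coeffs (E i) c" "FT (c \<circ> rho) P \<noteq> 0"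
    using standard_FT[OF E P(1,2)] by blast
  have io: "idempotent_ordering X R E" using E by (simp add: standard_Q_polynomial_def Q_polynomial_def)
  have "scalar_product (charvec Y) (E i *v charvec Y) = 0"
  proof (rule ccontr)
    assume "\<not> ?thesis"
    then have "i \<le> dual_width X R E Y" unfolding dual_width_def
      using i(1) by (intro Max_ge) (auto simp: diam_Alt)
    then show False using P(3) i(2) by simp
  qed
  then show ?thesis
    using idempotent_FT_vanish[OF i(3) _ Y _ f_def P(2) i(4)] idempotent_coeffs(2)[OF io] i(1) by (simp add: diam_Alt)
qed

section \<open>Width, and the return from forms to vertex sets\<close>

lemma gdist_le_width:
  assumes Y: "Y \<subseteq> X" and xy: "x \<in> Y" "y \<in> Y"
  shows "gdist R x y \<le> width X R Y"
proof -
  let ?i = "gdist R x y"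
  let ?S = "{(u, v). u \<in> Y \<and> v \<in> Y \<and> gdist R u v = ?i}"
  have "scalar_product (charvec Y) (dist_matrix X R ?i *v charvec Y) =
      (\<Sum>u\<in>UNIV. \<Sum>v\<in>UNIV. if (u, v) \<in> ?S then 1 else 0)"
    unfolding scalar_product_def matrix_vector_mult_def charvec_def dist_matrix_def
    using Y by (auto simp: sum_distrib_left intro!: sum.cong)
  also have "\<dots> = (\<Sum>p\<in>UNIV. if p \<in> ?S then 1 else 0)"
    by (simp only: sum.cartesian_product UNIV_Times_UNIV) (intro sum.cong refl, simp only: split_paired_all prod.case)
  also have "\<dots> = of_nat (card ?S)" by (simp add: sum.If_cases Int_def)
  finally have "scalar_product (charvec Y) (dist_matrix X R ?i *v charvec Y) = of_nat (card ?S)" .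
  moreover have "(x, y) \<in> ?S" using xy by simp
  then have "card ?S \<noteq> 0" using finite[of ?S] unfolding card_eq_0_iff by blast
  moreover have "?i \<le> diam X R" using gdist_Alt[of x y] xy Y diam_Alt by (simp add: subset_iff div_le_mono)
  ultimately show ?thesis unfolding width_def by (intro Max_ge) auto
qed

lemma mem_gr_x0: "a \<in> x0 \<Longrightarrow> a \<in> gr B \<longleftrightarrow> (\<forall>b\<in>x0. B a b = 0)"
  using gr_iff[of a 0 B] vec.subspace_0[OF zD(1)] by (auto simp: bf_0)

text \<open>With \<open>rad x0 B = x0 \<inter> gr B\<close>, the right-hand side is membership in
  \<open>C_set\<close>. If \<open>B\<close> vanishes on \<open>A\<close>, a radical vector outside
  \<open>A\<close> would make \<open>B\<close> zero; so for nonzero \<open>B\<close> the radical is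
  the kernel in \<open>A\<close> of one contraction and has codimension two. Conversely
  \<open>A\<close> is spanned by the radical and one vector \<open>e\<close>, and
  \<open>B e e = 0\<close>.\<close>

lemma vanishes_on_hyperplane_iff:
  assumes B: "B \<in> altf" and A: "sp A" "A \<subseteq> x0" "vec.dim A + 1 = n"
  shows "eqon A B 0 \<longleftrightarrow> eqon x0 B 0 \<or> vec.dim (rad x0 B) + 2 = n \<and> rad x0 B \<subseteq> A"
proof -
  note sx0 = XD(3)[OF x0] and sr = sp_rad[OF XD(3)[OF x0] B]
  have full: "vec.span (insert e A) = x0" if e: "e \<in> x0" "e \<notin> A" for e
  proof (rule sp_eqI[OF vec.subspace_span sx0])
    show "vec.span (insert e A) \<subseteq> x0" using e A by (intro vec.span_minimal sx0) auto
    have "e \<notin> vec.span A" using e(2) unfolding span_eq_subspace[OF A(1)] .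
    then show "vec.dim x0 \<le> vec.dim (vec.span (insert e A))"
      using A(3) XD(4)[OF x0] by (simp add: vec.dim_insert)
  qed
  have zero_full: "B v y = 0" if "e \<in> x0" "e \<notin> A" "\<forall>a\<in>A. B v a = 0" "B v e = 0" "y \<in> x0" for v e y
  proof -
    have "y \<in> vec.span (insert e A)" using full that by simp
    then obtain c a where "a \<in> vec.span A" "y = c *s e + a" by (rule in_span_insertE)
    moreover from this(1) have "a \<in> A" unfolding span_eq_subspace[OF A(1)] .
    ultimately show ?thesis using that(3,4) by (simp add: altf_simps[OF B])
  qed
  show ?thesis
  proof
    assume e0: "eqon A B 0"
    show "eqon x0 B 0 \<or> vec.dim (rad x0 B) + 2 = n \<and> rad x0 B \<subseteq> A"
    proof (cases "eqon x0 B 0")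
      case False
      have "\<not> x0 \<subseteq> A" using e0 False eqon_subset by blast
      then obtain e where e: "e \<in> x0" "e \<notin> A" by blast
      have sub: "rad x0 B \<subseteq> A"
      proof
        fix v assume v: "v \<in> rad x0 B"
        show "v \<in> A"
        proof (rule ccontr)
          assume vA: "v \<notin> A"
          have vx: "v \<in> x0" and vr: "\<And>y. y \<in> x0 \<Longrightarrow> B y v = 0"
            using v altf_skew[OF B, of _ v] by (auto simp: rad_def)
          have a0: "B a y = 0" if a: "a \<in> A" and y: "y \<in> x0" for a y
            by (rule zero_full[OF vx vA _ _ y]) (use a e0 vr A(2) in \<open>auto simp: eqon_def\<close>)
          have "B y y' = 0" if y: "y \<in> x0" "y' \<in> x0" for y y'
          proof (rule zero_full[OF vx vA _ vr[OF y(1)] y(2)], rule ballI)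
            show "B y a = 0" if "a \<in> A" for a using a0[OF that y(1)] altf_skew[OF B, of y a] by simp
          qed
          then show False using False by (simp add: eqon_def)
        qed
      qed
      have "rad x0 B = {a \<in> A. B e a = 0}"
      proof
        show "rad x0 B \<subseteq> {a \<in> A. B e a = 0}" using sub e altf_skew[OF B, of e] by (auto simp: rad_def)
        show "{a \<in> A. B e a = 0} \<subseteq> rad x0 B"
          using zero_full[OF e] e0 A(2) altf_skew[OF B, of _ e] by (auto simp: rad_def eqon_def)
      qed
      then have "vec.dim A \<le> vec.dim (rad x0 B) + 1"
        using dim_kernel(2)[where h = "B e" and W = A] A(1) altf_simps[OF B] by simp
      moreover have "rho B \<noteq> 0" using False rho_eq_0[OF B] by simp
      ultimately have "vec.dim (rad x0 B) + 2 = n" using dim_rad[OF B] A(3) by linarith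
      then show ?thesis using sub by simp
    qed simp
  next
    assume "eqon x0 B 0 \<or> vec.dim (rad x0 B) + 2 = n \<and> rad x0 B \<subseteq> A"
    then show "eqon A B 0"
    proof
      assume "eqon x0 B 0"
      then show ?thesis using A(2) eqon_subset by blast
    next
      assume r: "vec.dim (rad x0 B) + 2 = n \<and> rad x0 B \<subseteq> A"
      have "\<not> A \<subseteq> rad x0 B"
      proof
        assume "A \<subseteq> rad x0 B"
        then have "vec.dim A \<le> vec.dim (rad x0 B)" by (rule vec.dim_subset)
        then show False using r A(3) by linarith
      qed
      then obtain e where e: "e \<in> A" "e \<notin> rad x0 B" by blast
      have A_eq: "vec.span (insert e (rad x0 B)) = A"
      proof (rule sp_eqI[OF vec.subspace_span A(1)])
        show "vec.span (insert e (rad x0 B)) \<subseteq> A" using e r by (intro vec.span_minimal A(1)) auto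
        have "e \<notin> vec.span (rad x0 B)" using e(2) unfolding span_eq_subspace[OF sr] .
        then show "vec.dim A \<le> vec.dim (vec.span (insert e (rad x0 B)))"
          using A(3) r by (simp add: vec.dim_insert)
      qed
      have "B v y = 0" if vy: "v \<in> A" "y \<in> A" for v y
      proof -
        obtain c a where a: "a \<in> vec.span (rad x0 B)" "v = c *s e + a"
          using vy(1) unfolding A_eq[symmetric] by (rule in_span_insertE)
        obtain c' a' where a': "a' \<in> vec.span (rad x0 B)" "y = c' *s e + a'"
          using vy(2) unfolding A_eq[symmetric] by (rule in_span_insertE)
        have "a \<in> rad x0 B" "a' \<in> rad x0 B" using a(1) a'(1) unfolding span_eq_subspace[OF sr] .
        moreover have "e \<in> x0" using e A(2) by blast
        ultimately have "B a e = 0" "B a a' = 0" "B e a' = 0"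
          using altf_skew[OF B, of e a'] by (auto simp: rad_def)
        then show ?thesis by (simp add: a(2) a'(2) altf_simps[OF B])
      qed
      then show ?thesis by (simp add: eqon_def)
    qed
  qed
qed

lemma descendant_forms_Y:
  assumes d: "3 \<le> d" "n = 2 * d \<or> n = 2 * d + 1"
    and E: "standard_Q_polynomial X R (of_nat (CARD('a)\<^sup>2)) E"
    and Y: "nontrivial_descendent X R E Y" "x0 \<in> Y"
  shows "descendant_forms x0 (\<lambda>B. if gr B \<in> Y then 1 else 0) d (width X R Y)"
proof
  let ?w = "width X R Y"
  have YX: "Y \<subseteq> X" and w: "?w + dual_width X R E Y = d" "?w \<noteq> 0" "?w \<noteq> d"
    using Y(1) d(2) diam_Alt by (auto simp: nontrivial_descendent_def descendent_def)
  show "sp x0" by (rule XD(3)[OF x0])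
  show "vec.dim x0 = 2 * d \<or> vec.dim x0 = 2 * d + 1" using d(2) XD(4)[OF x0] by simp
  show "3 \<le> d" "0 < ?w" "?w < d" using d w by auto
  show "dep x0 (\<lambda>B. if gr B \<in> Y then 1 else 0)"
    unfolding dep_def
  proof (intro ballI impI)
    fix B D assume "B \<in> altf" "D \<in> altf" "eqon x0 B D"
    then have "gr B = gr D" by (simp only: gr_eq_iff)
    then show "(if gr B \<in> Y then 1 else 0) = (if gr D \<in> Y then 1 else (0::complex))" by (simp only:)
  qed
  show "(if gr B \<in> Y then 1 else 0) = (0::complex) \<or> (if gr B \<in> Y then 1 else 0) = (1::complex)" for B by simp
  show "(if gr 0 \<in> Y then 1 else 0) = (1::complex)" using Y(2) gr_0 by simp
  show "\<not> nonsing M (B - D)"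
    if B: "B \<in> altf" "(if gr B \<in> Y then 1 else 0) \<noteq> (0::complex)"
      and D: "D \<in> altf" "(if gr D \<in> Y then 1 else 0) \<noteq> (0::complex)"
      and M: "sp M" "M \<subseteq> x0" "vec.dim M = 2 * ?w + 2" for B D M
  proof
    assume ns: "nonsing M (B - D)"
    have BD: "B - D \<in> altf" by (rule altf_diff[OF B(1) D(1)])
    note sx0 = XD(3)[OF x0]
    have "gr B \<in> Y" "gr D \<in> Y" using B(2) D(2) by (auto split: if_splits)
    \<comment> \<open>Rank at most \<open>2 * ?w\<close> leaves a radical of codimension at most
      \<open>2 * ?w\<close> in \<open>x0\<close>, which must meet the space \<open>M\<close> of
      dimension \<open>2 * ?w + 2\<close>.\<close>
    then have "rho (B - D) \<le> ?w" using gdist_le_width[OF YX] gdist_gr[OF B(1) D(1)] by metis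
    moreover have "vec.dim M + vec.dim (rad x0 (B - D)) \<le> vec.dim (M \<inter> rad x0 (B - D)) + vec.dim x0"
      by (rule dim_Int_ge[OF M(1) sp_rad[OF sx0 BD] sx0 M(2) rad_subset])
    ultimately have "vec.dim (M \<inter> rad x0 (B - D)) \<noteq> 0"
      using dim_rad[OF BD] M(3) XD(4)[OF x0] by linarith
    then have "\<not> M \<inter> rad x0 (B - D) \<subseteq> {0}" by simp
    then obtain v where v: "v \<in> M" "v \<in> rad x0 (B - D)" "v \<noteq> 0" by blast
    have "\<forall>y\<in>M. (B - D) v y = 0" using v(2) M(2) by (auto simp: rad_def)
    then show False using ns v(1,3) unfolding nonsing_def by blast
  qed
  show "FT (\<lambda>B. if gr B \<in> Y then 1 else 0) P = 0"
    if "ind P" "sv P \<subseteq> x0" "d - ?w < length P" for P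
    by (rule dual_width_FT[OF E YX refl]) (use that w(1) in auto)
qed

lemma classification_Y:
  assumes d: "3 \<le> d" "n = 2 * d \<or> n = 2 * d + 1"
    and E: "standard_Q_polynomial X R (of_nat (CARD('a)\<^sup>2)) E"
    and Y: "nontrivial_descendent X R E Y" "x0 \<in> Y"
  shows "n = 2 * d \<and>
    ((width X R Y = 1 \<and> (\<exists>x\<in>X. \<exists>v. vec.subspace v \<and> v \<subseteq> x \<and> vec.dim v = n - 1 \<and> Y = C_set R x v)) \<or>
     (width X R Y = d - 1 \<and> (\<exists>u. isotropic Q u \<and> vec.dim u = 1 \<and> z \<inter> u = {0} \<and> Y = I_set X u)))"
proof -
  interpret D: descendant_forms x0 "\<lambda>B. if gr B \<in> Y then 1 else 0" d "width X R Y"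
    by (rule descendant_forms_Y[OF assms])
  have YX: "Y \<subseteq> X" using Y(1) by (simp add: nontrivial_descendent_def descendent_def)
  have mem: "(if gr B \<in> Y then 1 else 0) \<noteq> (0::complex) \<longleftrightarrow> gr B \<in> Y" for B by simp
  note cl = D.classification[unfolded mem XD(4)[OF x0]]
  have n: "n = 2 * d" using cl by blast
  have Y_eqI: "Y = S" if S: "S \<subseteq> X" "\<And>B. B \<in> altf \<Longrightarrow> gr B \<in> Y \<longleftrightarrow> gr B \<in> S" for S
    using YX S gr_surj by blast
  from cl consider
      A where "width X R Y = 1" "sp A" "A \<subseteq> x0" "vec.dim A + 1 = n" "\<forall>B\<in>altf. gr B \<in> Y \<longleftrightarrow> eqon A B 0"
    | u where "width X R Y = d - 1" "u \<in> x0" "u \<noteq> 0" "\<forall>B\<in>altf. gr B \<in> Y \<longleftrightarrow> (\<forall>y\<in>x0. B u y = 0)"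
    by blast
  then show ?thesis
  proof cases
    case (1 A)
    have "Y = C_set R x0 A"
    proof (rule Y_eqI)
      show "C_set R x0 A \<subseteq> X" using x0 Alt_adj_iff[OF z] by (auto simp: C_set_def nbrs_def)
      fix B :: "'a^'m \<Rightarrow> 'a^'m \<Rightarrow> 'a" assume B: "B \<in> altf"
      have int: "x0 \<inter> gr B = rad x0 B" using mem_gr_x0 by (auto simp: rad_def)
      have "gr B = x0 \<longleftrightarrow> eqon x0 B 0" using gr_eq_iff[OF B altf_0] gr_0 by simp
      then show "gr B \<in> Y \<longleftrightarrow> gr B \<in> C_set R x0 A"
        using 1(5) B vanishes_on_hyperplane_iff[OF B 1(2-4)] x0 gr_X[OF B] Alt_adj_iff[OF z, of x0 "gr B"]
        by (simp add: C_set_def nbrs_def int)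
    qed
    moreover have "vec.dim A = n - 1" using 1(4) by simp
    ultimately show ?thesis using n 1 x0 by blast
  next
    case (2 u)
    let ?U = "vec.span {u}"
    have U: "?U \<subseteq> x0" using 2(2) by (intro vec.span_minimal XD(3)[OF x0]) simp
    have "Y = I_set X ?U"
    proof (rule Y_eqI)
      show "I_set X ?U \<subseteq> X" by (auto simp: I_set_def)
      fix B :: "'a^'m \<Rightarrow> 'a^'m \<Rightarrow> 'a" assume B: "B \<in> altf"
      have "?U \<subseteq> gr B \<longleftrightarrow> u \<in> gr B"
        using vec.span_minimal[OF _ gr_sp[OF B], of "{u}"] vec.span_base[of u "{u}"] by blast
      then show "gr B \<in> Y \<longleftrightarrow> gr B \<in> I_set X ?U"
        using 2(4) B mem_gr_x0[OF 2(2)] gr_X[OF B] by (simp add: I_set_def)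
    qed
    moreover have "isotropic Q ?U" using U isotropicD(2)[OF XD(5)[OF x0]] by (auto simp: isotropic_def)
    moreover have "vec.dim ?U = 1" using 2(3) by (simp add: vec.dim_insert)
    moreover have "z \<inter> ?U = {0}" using U XD(2)[OF x0] vec.span_zero vec.subspace_0[OF zD(1)] by blast
    ultimately show ?thesis using n 2(1) by blast
  qed
qed

end

theorem mainTheorem14:
  fixes Q :: "('a::{field,finite})^('m::finite) \<Rightarrow> 'a"
    and d n l w :: nat
    and z :: "('a^'m) set"
    and X :: "('a^'m) set set"
    and R :: "(('a^'m) set) rel"
    and E :: "nat \<Rightarrow> complex^(('a^'m) set)^(('a^'m) set)"
    and Y :: "('a^'m) set set"
  assumes "d \<ge> 3"
    and "n = 2 * d \<or> n = 2 * d + 1"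
    and "CARD('a) = l"
    and "CARD('m) = 2 * n"
    and "quadratic_form Q" and "nondegenerate Q" and "witt_index Q = n"
    and "z \<in> dual_polar_vertices Q"
    and "X = Alt_vertices Q n z"
    and "R = Alt_adj Q n z"
    and "standard_Q_polynomial X R (of_nat (l\<^sup>2)) E"
    and "nontrivial_descendent X R E Y"
    and "w = width X R Y"
  shows "n = 2 * d \<and>
    ((w = 1 \<and> (\<exists>x\<in>X. \<exists>v. vec.subspace v \<and> v \<subseteq> x \<and> vec.dim v = n - 1 \<and> Y = C_set R x v)) \<or>
     (w = d - 1 \<and> (\<exists>u. isotropic Q u \<and> vec.dim u = 1 \<and> z \<inter> u = {0} \<and> Y = I_set X u)))"
proof -
  \<comment> \<open>Basing the forms at a vertex of \<open>Y\<close> makes 0 a member of the set of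
    forms.\<close>
  obtain x0 where x0Y: "x0 \<in> Y" "x0 \<in> Alt_vertices Q n z"
    using assms(9,12) by (auto simp: nontrivial_descendent_def descendent_def)
  interpret alt_graph Q n z x0
    by unfold_locales (use assms x0Y in auto)
  show ?thesis
    using classification_Y[OF assms(1,2) _ _ x0Y(1), of E] assms(11,12)
    unfolding assms(3)[symmetric] assms(9,10,13) by blast
qed

end
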